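(* Let $m\ge0$ and $\theta\in(-\frac{\pi}{2},\frac{\pi}{2})$. Given any $\delta>0$, there exist $C_1,C_2>0$ such that, for all $\varepsilon>0$, $$\Big\{z\in\mathbb{C}:\ |z^2-m^2|\ge C_1\ \land\ |\arg(z^2-m^2)|\le\theta-\delta\ \land\ |z^2-m^2|>C_2\log\frac{1}{\varepsilon^2}\Big\}\subset\sigma_\varepsilon(H_\theta)$$ and $$\sigma_\varepsilon(H_\theta)\subset\Big\{z\in\mathbb{C}:\ \big(1-|\tan\tfrac{\theta}{2}|\big)\,|\mathrm{Im}\,z|\le(|\mathrm{Re}\,z|+m)\,|\tan\tfrac{\theta}{2}|+\varepsilon\Big\}.$$
   Context: Pauli matrices: $\sigma_1=\begin{pmatrix}0&1\\1&0\end{pmatrix}$, $\sigma_2=\begin{pmatrix}0&-i\\i&0\end{pmatrix}$, $\sigma_3=\begin{pmatrix}1&0\\0&-1\end{pmatrix}$; Dirac matrices $\alpha_k=\begin{pmatrix}0&\sigma_k\\\sigma_k&0\end{pmatrix}$, $k=1,2,3$. For $m\ge0$ and $|\theta|<\frac{\pi}{2}$, the operator $H_\theta$ acts in $L^2(\mathbb{R})^4=L^2(\mathbb{R};\mathbb{C}^4)$ by $$H_\theta=-i\alpha_1e^{-i\theta/2}\partial_x-\alpha_2e^{i\theta/2}x+m\alpha_3,\qquad \mathsf{D}(H_\theta)=\mathcal{D}^4,\quad \mathcal{D}=H^1(\mathbb{R})\cap L^2(\mathbb{R},x^2\,dx);$$ it is a closed operator. For $\varepsilon>0$ the $\varepsilon$-pseudospectrum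 is $\sigma_\varepsilon(H_\theta)=\sigma(H_\theta)\cup\{z\notin\sigma(H_\theta):\ \|(H_\theta-z)^{-1}\|>\frac1\varepsilon\}$. Here $\arg$ is the principal argument with values in $(-\pi,\pi]$. *)

theory Defs
  imports "HOL-Analysis.Analysis"
begin

text \<open>
  Elements of $L^2$ are handled through Borel-measurable representatives; equality in $L^2$ is
  equality almost everywhere.
\<close>

definition L2 :: "(real \<Rightarrow> 'a::euclidean_space) set" where
  "L2 = {f \<in> borel_measurable lborel. integrable lborel (\<lambda>x. (norm (f x))\<^sup>2)}"

definition L2_norm :: "(real \<Rightarrow> 'a::euclidean_space) \<Rightarrow> real" where
  "L2_norm f = sqrt (LINT x|lborel. (norm (f x))\<^sup>2)"

definition L2_eq :: "(real \<Rightarrow> 'a) \<Rightarrow> (real \<Rightarrow> 'a) \<Rightarrow> bool" where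
  "L2_eq f g \<longleftrightarrow> (AE x in lborel. f x = g x)"

definition test_functions :: "(real \<Rightarrow> real) set" where
  "test_functions = {\<phi>. (\<forall>n x. (deriv ^^ n) \<phi> differentiable (at x)) \<and>
                         compact (closure {x. \<phi> x \<noteq> 0})}"

text \<open>
  Real-valued test functions suffice: the identity for complex-valued ones follows by linearity.
  Both integrands are integrable because \<open>u\<close> and \<open>g\<close> are in $L^2$.
\<close>

definition has_weak_L2_derivative :: "(real \<Rightarrow> complex) \<Rightarrow> (real \<Rightarrow> complex) \<Rightarrow> bool" where
  "has_weak_L2_derivative u g \<longleftrightarrow> u \<in> L2 \<and> g \<in> L2 \<and>
     (\<forall>\<phi>\<in>test_functions.
        (LINT x|lborel. deriv \<phi> x *\<^sub>R u x) = - (LINT x|lborel. \<phi> x *\<^sub>R g x))"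

definition H1 :: "(real \<Rightarrow> complex) set" where
  "H1 = {u. \<exists>g. has_weak_L2_derivative u g}"

definition weak_deriv :: "(real \<Rightarrow> complex) \<Rightarrow> real \<Rightarrow> complex" where
  "weak_deriv u = (SOME g. has_weak_L2_derivative u g)"

definition weighted_L2 :: "(real \<Rightarrow> complex) set" where
  "weighted_L2 = {f \<in> borel_measurable lborel. integrable lborel (\<lambda>x. (norm (f x))\<^sup>2 * x\<^sup>2)}"

text \<open>
  An operator in $L^2(\mathbb{R};\mathbb{C}^n)$ is given by its domain \<open>D\<close> (a set of
  representatives) and its action \<open>T\<close> on representatives.
\<close>

definition shift_op ::
  "((real \<Rightarrow> complex ^ 'n) \<Rightarrow> real \<Rightarrow> complex ^ 'n) \<Rightarrow> complex \<Rightarrow>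
   (real \<Rightarrow> complex ^ 'n) \<Rightarrow> real \<Rightarrow> complex ^ 'n" where
  "shift_op T z u = (\<lambda>x. T u x - z *s u x)"

definition resolvent ::
  "(real \<Rightarrow> complex ^ 'n) set \<Rightarrow> ((real \<Rightarrow> complex ^ 'n) \<Rightarrow> real \<Rightarrow> complex ^ 'n) \<Rightarrow>
   complex \<Rightarrow> (real \<Rightarrow> complex ^ 'n) \<Rightarrow> real \<Rightarrow> complex ^ 'n" where
  "resolvent D T z f = (SOME u. u \<in> D \<and> L2_eq (shift_op T z u) f)"

text \<open>
  \<open>T - z\<close> is a bijection from \<open>D\<close> onto $L^2$ (modulo equality almost everywhere) with bounded
  inverse.
\<close>

definition resolvent_set ::
  "(real \<Rightarrow> complex ^ 'n) set \<Rightarrow> ((real \<Rightarrow> complex ^ 'n) \<Rightarrow> real \<Rightarrow> complex ^ 'n) \<Rightarrow>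
   complex set" where
  "resolvent_set D T = {z.
     (\<forall>u\<in>D. \<forall>v\<in>D. L2_eq (shift_op T z u) (shift_op T z v) \<longrightarrow> L2_eq u v) \<and>
     (\<forall>f\<in>L2. \<exists>u\<in>D. L2_eq (shift_op T z u) f) \<and>
     (\<exists>C. \<forall>f\<in>L2. L2_norm (resolvent D T z f) \<le> C * L2_norm f)}"

definition spectrum ::
  "(real \<Rightarrow> complex ^ 'n) set \<Rightarrow> ((real \<Rightarrow> complex ^ 'n) \<Rightarrow> real \<Rightarrow> complex ^ 'n) \<Rightarrow>
   complex set" where
  "spectrum D T = - resolvent_set D T"

text \<open>The real-valued supremum is meaningful only when the resolvent is bounded, i.e. on the
  resolvent set, which is the only place it is used.\<close>

definition resolvent_norm ::
  "(real \<Rightarrow> complex ^ 'n) set \<Rightarrow> ((real \<Rightarrow> complex ^ 'n) \<Rightarrow> real \<Rightarrow> complex ^ 'n) \<Rightarrow>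
   complex \<Rightarrow> real" where
  "resolvent_norm D T z = (SUP f\<in>{f \<in> L2. L2_norm f \<le> 1}. L2_norm (resolvent D T z f))"

definition pseudospectrum ::
  "(real \<Rightarrow> complex ^ 'n) set \<Rightarrow> ((real \<Rightarrow> complex ^ 'n) \<Rightarrow> real \<Rightarrow> complex ^ 'n) \<Rightarrow>
   real \<Rightarrow> complex set" where
  "pseudospectrum D T \<epsilon> =
     spectrum D T \<union> {z. z \<notin> spectrum D T \<and> resolvent_norm D T z > 1 / \<epsilon>}"

definition pauli1 :: "complex ^ 2 ^ 2" where
  "pauli1 = vector [vector [0, 1], vector [1, 0]]"

definition pauli2 :: "complex ^ 2 ^ 2" where
  "pauli2 = vector [vector [0, - \<i>], vector [\<i>, 0]]"

definition pauli3 :: "complex ^ 2 ^ 2" where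
  "pauli3 = vector [vector [1, 0], vector [0, - 1]]"

definition off_diagonal_block :: "complex ^ 2 ^ 2 \<Rightarrow> complex ^ 4 ^ 4" where
  "off_diagonal_block s = vector
     [vector [0, 0, s $ 1 $ 1, s $ 1 $ 2],
      vector [0, 0, s $ 2 $ 1, s $ 2 $ 2],
      vector [s $ 1 $ 1, s $ 1 $ 2, 0, 0],
      vector [s $ 2 $ 1, s $ 2 $ 2, 0, 0]]"

definition dirac1 :: "complex ^ 4 ^ 4" where "dirac1 = off_diagonal_block pauli1"
definition dirac2 :: "complex ^ 4 ^ 4" where "dirac2 = off_diagonal_block pauli2"
definition dirac3 :: "complex ^ 4 ^ 4" where "dirac3 = off_diagonal_block pauli3"

definition H_dom :: "(real \<Rightarrow> complex ^ 4) set" where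
  "H_dom = {u. \<forall>k. (\<lambda>x. u x $ k) \<in> H1 \<inter> weighted_L2}"

definition H_op ::
  "real \<Rightarrow> real \<Rightarrow> (real \<Rightarrow> complex ^ 4) \<Rightarrow> real \<Rightarrow> complex ^ 4" where
  "H_op m \<theta> u = (\<lambda>x.
       (- \<i> * exp (- \<i> * of_real \<theta> / 2)) *s (dirac1 *v (\<chi> k. weak_deriv (\<lambda>y. u y $ k) x))
     - (exp (\<i> * of_real \<theta> / 2) * of_real x) *s (dirac2 *v u x)
     + of_real m *s (dirac3 *v u x))"

end

theory Submission
  imports Defs "HOL-Probability.Probability" "HOL-Real_Asymp.Real_Asymp"
begin

text \<open>
  Up to the exchange of the two halves of a spinor, \<open>H\<close> acts as the matrix \<open>T\<close> with rows \<open>(m, A\<^sup>+)\<close> and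
  \<open>(A, - m)\<close>, where \<open>A\<close> and \<open>A\<^sup>+\<close> are rotated ladder operators.

  Outer inclusion. Put \<open>t = \<bar>tan (\<theta> / 2)\<bar>\<close> and \<open>\<kappa> = (1 - t) * \<bar>Im z\<bar> - t * (\<bar>Re z\<bar> + m)\<close>. If \<open>\<kappa> > 0\<close>, then
  \<open>H - z\<close> is bounded below by \<open>\<kappa>\<close>: for part of the parameters by completing squares, for the rest by comparison
  with the self-adjoint case \<open>\<theta> = 0\<close>. The bound makes the range closed, and an element of its orthogonal
  complement is, up to conjugation and signs, a weak solution of the same equation, hence zero by
  the same bound applied to its cut-offs.

  Inner inclusion. Put \<open>\<Lambda> = z\<^sup>2 - m\<^sup>2\<close>. The problem \<open>(H - z) u = 0\<close> reduces to \<open>A\<^sup>+ A g = \<Lambda> g\<close>. Let \<open>g\<close> be the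
  integral over \<open>-r \<le> s \<le> r\<close> of coherent states with centre \<open>w exp (\<eta> s)\<close> and weight \<open>exp (- \<Lambda> \<eta> s / 2)\<close>.
  Then \<open>A\<^sup>+ A g - \<Lambda> g\<close> is the integral of an exact derivative, so only the end packets remain. Overlaps of packets
  are explicit Gaussian integrals: choosing \<open>w\<close> at a saddle point and \<open>\<eta>\<close> as the direction of steepest
  descent, \<open>g\<close> is bounded below by Laplace's argument, whereas the end packets are exponentially smaller,
  with a uniform rate, exactly because \<open>\<bar>Arg \<Lambda>\<bar>\<close> stays away from \<open>\<theta>\<close>.
\<close>

section \<open>Square integrable functions\<close>

text \<open>The form of \<open>\<kappa>\<close>: the operator is \<open>cos (\<theta> / 2)\<close>
  times its self-adjoint model minus \<open>\<i> * sin (\<theta> / 2)\<close> times a partner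
  \<open>M\<close>. Were \<open>cos (\<theta> / 2) * norm M\<close> at most
  \<open>1 + (\<bar>Re z\<bar> + m) / \<bar>Im z\<bar>\<close> times the shifted model, the triangle
  inequality would give exactly \<open>\<kappa>\<close>. The obstacle is a commutator: it adds twice
  the difference of the squared norms of the two components to the square of \<open>norm M\<close>,
  and this can be positive. The sign of one quadratic polynomial in \<open>Re z\<close> and
  \<open>m\<close> decides whether this comparison or the completion of squares is used. A single
  packet is only a rough approximate solution. The family \<open>w exp (\<eta> * s)\<close> is the
  flow of the first order operator in \<open>w\<close> by which \<open>A\<^sup>+ A\<close> acts on
  packets, so a superposition along it can cancel all errors except those at its ends. These are
  exponentially small in the modulus of \<open>\<Lambda>\<close>, hence the logarithm of
  \<open>\<epsilon>\<close>. Along the beam, norms of packets exceed overlaps by a quadratic term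
  with coefficient \<open>1\<close>; the descent rate must beat it, and this is the angular
  condition.\<close>

lemma L2_measurable [measurable_dest]: "f \<in> L2 \<Longrightarrow> f \<in> borel_measurable borel"
  by (simp add: L2_def)

lemma L2_integrable: "f \<in> L2 \<Longrightarrow> integrable lborel (\<lambda>x. (norm (f x))\<^sup>2)"
  by (simp add: L2_def)

lemma L2_boundI:
  fixes f :: "real \<Rightarrow> 'a::euclidean_space" and g :: "real \<Rightarrow> 'b::euclidean_space"
    and h :: "real \<Rightarrow> 'c::euclidean_space"
  assumes "f \<in> L2" "g \<in> L2" "h \<in> borel_measurable borel"
    and "\<And>x. norm (h x) \<le> K * norm (f x) + M * norm (g x)"
  shows "h \<in> L2"
proof -
  have "integrable lborel (\<lambda>x. (norm (h x))\<^sup>2)"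
  proof (rule Bochner_Integration.integrable_bound)
    show "integrable lborel (\<lambda>x. 2 * K\<^sup>2 * (norm (f x))\<^sup>2 + 2 * M\<^sup>2 * (norm (g x))\<^sup>2)"
      using L2_integrable[OF assms(1)] L2_integrable[OF assms(2)] by auto
    show "(\<lambda>x. (norm (h x))\<^sup>2) \<in> borel_measurable lborel" using assms(3) by simp
    have "(norm (h x))\<^sup>2 \<le> 2 * K\<^sup>2 * (norm (f x))\<^sup>2 + 2 * M\<^sup>2 * (norm (g x))\<^sup>2" for x
    proof -
      have "(norm (h x))\<^sup>2 \<le> (K * norm (f x) + M * norm (g x))\<^sup>2"
        using assms(4) by (intro power_mono) auto
      also have "\<dots> \<le> 2 * K\<^sup>2 * (norm (f x))\<^sup>2 + 2 * M\<^sup>2 * (norm (g x))\<^sup>2"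
        using sum_squares_bound[of "K * norm (f x)" "M * norm (g x)"]
        by (simp add: power2_sum power_mult_distrib)
      finally show ?thesis .
    qed
    then show "AE x in lborel. norm ((norm (h x))\<^sup>2) \<le>
        norm (2 * K\<^sup>2 * (norm (f x))\<^sup>2 + 2 * M\<^sup>2 * (norm (g x))\<^sup>2)"
      by (intro AE_I2) (auto intro: order_trans)
  qed
  then show ?thesis using assms(3) by (simp add: L2_def)
qed

lemma L2_zero [simp]: "(\<lambda>x. 0) \<in> L2" by (simp add: L2_def)

lemma L2_bound1I:
  fixes f :: "real \<Rightarrow> 'a::euclidean_space" and h :: "real \<Rightarrow> 'c::euclidean_space"
  assumes "f \<in> L2" "h \<in> borel_measurable borel" "\<And>x. norm (h x) \<le> K * norm (f x)"
  shows "h \<in> L2"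
  by (rule L2_boundI[OF assms(1) L2_zero[where 'a=real] assms(2), of K 0]) (use assms(3) in auto)

lemma L2_add: "f \<in> L2 \<Longrightarrow> g \<in> L2 \<Longrightarrow> (\<lambda>x. f x + g x) \<in> L2"
  by (rule L2_boundI[where f=f and g=g and K=1 and M=1]) (auto simp: norm_triangle_ineq L2_measurable intro!: borel_measurable_add)

lemma L2_diff: "f \<in> L2 \<Longrightarrow> g \<in> L2 \<Longrightarrow> (\<lambda>x. f x - g x) \<in> L2"
  by (rule L2_boundI[where f=f and g=g and K=1 and M=1]) (auto simp: norm_triangle_ineq4 L2_measurable intro!: borel_measurable_diff)

lemma L2_linear:
  fixes f :: "real \<Rightarrow> 'a::euclidean_space" and T :: "'a \<Rightarrow> 'b::euclidean_space"
  assumes "bounded_linear T" "f \<in> L2" shows "(\<lambda>x. T (f x)) \<in> L2"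
proof -
  obtain K where K: "\<And>x. norm (T x) \<le> norm x * K" using bounded_linear.bounded[OF assms(1)] by blast
  have "T \<in> borel_measurable borel"
    by (intro borel_measurable_continuous_onI linear_continuous_on assms(1))
  then have "(\<lambda>x. T (f x)) \<in> borel_measurable borel"
    using L2_measurable[OF assms(2)] by (rule measurable_compose_rev)
  then show ?thesis using K by (intro L2_bound1I[OF assms(2), of _ K]) (auto simp: mult.commute)
qed

lemma L2_scaleR: "f \<in> L2 \<Longrightarrow> (\<lambda>x. c *\<^sub>R f x) \<in> L2"
  by (rule L2_linear[OF bounded_linear_scaleR_right])

lemma L2_mult_const: "f \<in> L2 \<Longrightarrow> (\<lambda>x. (c::complex) * f x) \<in> L2"
  by (rule L2_linear[OF bounded_linear_mult_right])

lemma L2_cnj: "f \<in> L2 \<Longrightarrow> (\<lambda>x. cnj (f x)) \<in> L2"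
  by (rule L2_linear[OF bounded_linear_cnj])

lemma L2_minus: "f \<in> L2 \<Longrightarrow> (\<lambda>x. - f x) \<in> L2"
  by (rule L2_linear[OF bounded_linear_minus[OF bounded_linear_ident]])

lemma L2_sum: "(\<And>i. i \<in> I \<Longrightarrow> f i \<in> L2) \<Longrightarrow> (\<lambda>x. \<Sum>i\<in>I. f i x) \<in> L2"
  by (induction I rule: infinite_finite_induct) (auto intro: L2_add)

lemma L2_bilinear_integrable:
  fixes f :: "real \<Rightarrow> 'a::euclidean_space" and g :: "real \<Rightarrow> 'b::euclidean_space"
    and h :: "real \<Rightarrow> 'c::euclidean_space"
  assumes "f \<in> L2" "g \<in> L2" "h \<in> borel_measurable borel"
    and "\<And>x. norm (h x) \<le> norm (f x) * norm (g x)"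
  shows "integrable lborel h"
proof (rule Bochner_Integration.integrable_bound)
  show "integrable lborel (\<lambda>x. (norm (f x))\<^sup>2 + (norm (g x))\<^sup>2)"
    using L2_integrable[OF assms(1)] L2_integrable[OF assms(2)] by auto
  show "h \<in> borel_measurable lborel" using assms(3) by simp
  have "norm (h x) \<le> (norm (f x))\<^sup>2 + (norm (g x))\<^sup>2" for x
  proof -
    have "0 \<le> norm (f x) * norm (g x)" by simp
    then show ?thesis
      using assms(4)[of x] sum_squares_bound[of "norm (f x)" "norm (g x)"] by linarith
  qed
  then show "AE x in lborel. norm (h x) \<le> norm ((norm (f x))\<^sup>2 + (norm (g x))\<^sup>2)"
    by (intro AE_I2) (auto intro: order_trans)
qed

lemma L2_inner_integrable: "f \<in> L2 \<Longrightarrow> g \<in> L2 \<Longrightarrow> integrable lborel (\<lambda>x. inner (f x) (g x))"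
  by (rule L2_bilinear_integrable[where f=f and g=g])
     (auto simp: Cauchy_Schwarz_ineq2 L2_measurable intro!: borel_measurable_inner)

lemma L2_mult_integrable: "f \<in> L2 \<Longrightarrow> g \<in> L2 \<Longrightarrow> integrable lborel (\<lambda>x. f x * (g x :: complex))"
  by (rule L2_bilinear_integrable[where f=f and g=g]) (auto simp: norm_mult L2_measurable intro!: borel_measurable_times)

lemma L2_norm_nonneg [simp]: "0 \<le> L2_norm f" by (simp add: L2_norm_def)

lemma L2_norm_power2: "(L2_norm f)\<^sup>2 = (LINT x|lborel. (norm (f x))\<^sup>2)"
  by (simp add: L2_norm_def)

lemma L2_norm_add_power2:
  assumes "f \<in> L2" "g \<in> L2"
  shows "(L2_norm (\<lambda>x. f x + g x))\<^sup>2 =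
    (L2_norm f)\<^sup>2 + 2 * (LINT x|lborel. inner (f x) (g x)) + (L2_norm g)\<^sup>2"
proof -
  have "(LINT x|lborel. (norm (f x + g x))\<^sup>2) =
      (LINT x|lborel. (norm (f x))\<^sup>2 + 2 * inner (f x) (g x) + (norm (g x))\<^sup>2)"
    by (intro Bochner_Integration.integral_cong)
       (auto simp: power2_norm_eq_inner inner_add_left inner_add_right inner_commute)
  also have "\<dots> = (LINT x|lborel. (norm (f x))\<^sup>2) + 2 * (LINT x|lborel. inner (f x) (g x)) +
      (LINT x|lborel. (norm (g x))\<^sup>2)"
    using assms by (simp add: L2_integrable L2_inner_integrable)
  finally show ?thesis by (simp add: L2_norm_power2)
qed

lemma L2_norm_scaleR: "L2_norm (\<lambda>x. c *\<^sub>R f x) = \<bar>c\<bar> * L2_norm f"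
  by (simp add: L2_norm_def power_mult_distrib real_sqrt_mult)

lemma L2_norm_minus: "L2_norm (\<lambda>x. - f x) = L2_norm f"
  by (simp add: L2_norm_def)

lemma L2_norm_minus_commute: "L2_norm (\<lambda>x. f x - g x) = L2_norm (\<lambda>x. g x - f x)"
  by (simp add: L2_norm_def norm_minus_commute)

lemma L2_norm_zero [simp]: "L2_norm (\<lambda>x. 0) = 0" by (simp add: L2_norm_def)

lemma L2_norm_cong_AE:
  assumes "AE x in lborel. f x = g x" "f \<in> borel_measurable borel" "g \<in> borel_measurable borel"
  shows "L2_norm f = L2_norm g"
  unfolding L2_norm_def by (subst integral_cong_AE[of _ lborel "\<lambda>x. (norm (g x))\<^sup>2"]) (use assms in auto)

lemma L2_norm_eq_0_iff:
  assumes "f \<in> L2" shows "L2_norm f = 0 \<longleftrightarrow> (AE x in lborel. f x = 0)"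
  using integral_nonneg_eq_0_iff_AE[OF L2_integrable[OF assms]]
  by (simp add: L2_norm_def)

lemma quadratic_nonneg_discriminant:
  fixes a b c :: real
  assumes "\<And>t. 0 \<le> a + 2 * t * b + t\<^sup>2 * c" "0 \<le> a" "0 \<le> c"
  shows "b\<^sup>2 \<le> a * c"
proof (cases "c = 0")
  case True
  have "b = 0"
  proof (rule ccontr)
    assume "b \<noteq> 0"
    \<comment> \<open>This \<open>t\<close> gives \<open>a + 2 * t * b = - 1\<close>.\<close>
    then show False using assms(1)[of "- (a + 1) / (2 * b)"] True assms(2) by (simp add: field_simps)
  qed
  then show ?thesis by (simp add: True)
next
  case False
  then have "0 < c" using assms(3) by simp
  then show ?thesis using assms(1)[of "- b / c"]
    by (simp add: field_simps power2_eq_square)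
qed

lemma L2_Cauchy_Schwarz:
  assumes "f \<in> L2" "g \<in> L2"
  shows "\<bar>LINT x|lborel. inner (f x) (g x)\<bar> \<le> L2_norm f * L2_norm g"
proof -
  have "0 \<le> (L2_norm f)\<^sup>2 + 2 * t * (LINT x|lborel. inner (f x) (g x)) + t\<^sup>2 * (L2_norm g)\<^sup>2" for t
  proof -
    have "0 \<le> (L2_norm (\<lambda>x. f x + t *\<^sub>R g x))\<^sup>2" by simp
    also have "\<dots> = (L2_norm f)\<^sup>2 + 2 * t * (LINT x|lborel. inner (f x) (g x)) + t\<^sup>2 * (L2_norm g)\<^sup>2"
      by (subst L2_norm_add_power2[OF assms(1) L2_scaleR[OF assms(2)]])
         (simp add: L2_norm_scaleR power_mult_distrib)
    finally show ?thesis .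
  qed
  from quadratic_nonneg_discriminant[OF this]
  have "(LINT x|lborel. inner (f x) (g x))\<^sup>2 \<le> (L2_norm f * L2_norm g)\<^sup>2"
    by (simp add: power_mult_distrib)
  then show ?thesis by (metis L2_norm_nonneg abs_le_square_iff abs_of_nonneg mult_nonneg_nonneg)
qed

lemma L2_norm_triangle:
  assumes "f \<in> L2" "g \<in> L2"
  shows "L2_norm (\<lambda>x. f x + g x) \<le> L2_norm f + L2_norm g"
proof (rule power2_le_imp_le)
  show "(L2_norm (\<lambda>x. f x + g x))\<^sup>2 \<le> (L2_norm f + L2_norm g)\<^sup>2"
    using L2_Cauchy_Schwarz[OF assms] by (simp add: L2_norm_add_power2[OF assms] power2_sum)
qed simp

lemma L2_norm_triangle_diff:
  assumes "f \<in> L2" "g \<in> L2" "h \<in> L2"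
  shows "L2_norm (\<lambda>x. f x - h x) \<le> L2_norm (\<lambda>x. f x - g x) + L2_norm (\<lambda>x. g x - h x)"
  using L2_norm_triangle[OF L2_diff[OF assms(1,2)] L2_diff[OF assms(2,3)]] by simp

lemma L2_norm_mono:
  fixes f :: "real \<Rightarrow> 'a::euclidean_space" and g :: "real \<Rightarrow> 'b::euclidean_space"
  assumes "g \<in> L2" "f \<in> L2" "AE x in lborel. norm (f x) \<le> norm (g x)"
  shows "L2_norm f \<le> L2_norm g"
  unfolding L2_norm_def
proof (intro real_sqrt_le_mono integral_mono_AE L2_integrable assms)
  show "AE x in lborel. (norm (f x))\<^sup>2 \<le> (norm (g x))\<^sup>2"
    using assms(3) by eventually_elim (auto intro: power_mono)
qed

section \<open>Completeness and orthogonal projection\<close>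

definition L2_Cauchy :: "(nat \<Rightarrow> real \<Rightarrow> 'a::euclidean_space) \<Rightarrow> bool" where
  "L2_Cauchy F \<longleftrightarrow> (\<forall>e>0. \<exists>N. \<forall>m\<ge>N. \<forall>n\<ge>N. L2_norm (\<lambda>x. F m x - F n x) < e)"

text \<open>A subsequence with increments of norm below \<open>(1/4)^k\<close> converges almost
  everywhere: weighting the squares by \<open>2^k\<close> keeps the sum of their integrals finite,
  so at almost every point they have a common finite bound \<open>B\<close>, and the increments are
  dominated by a geometric series of ratio \<open>1 / sqrt 2\<close>. Fatou's lemma carries the
  pointwise limit back to the norm, for the whole sequence and not only for the subsequence.\<close>

theorem L2_complete:
  fixes F :: "nat \<Rightarrow> real \<Rightarrow> 'a::euclidean_space"
  assumes F: "\<And>n. F n \<in> L2" and C: "L2_Cauchy F"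
  obtains f where "f \<in> L2" "(\<lambda>n. L2_norm (\<lambda>x. F n x - f x)) \<longlonglongrightarrow> 0"
proof -
  have [measurable]: "F n \<in> borel_measurable borel" for n using F by (rule L2_measurable)
  have "\<exists>N. \<forall>m\<ge>N. \<forall>n\<ge>N. L2_norm (\<lambda>x. F m x - F n x) < (1/4)^k" for k :: nat
    using C unfolding L2_Cauchy_def by simp
  then obtain N where N: "\<And>k m n. N k \<le> m \<Longrightarrow> N k \<le> n \<Longrightarrow> L2_norm (\<lambda>x. F m x - F n x) < (1/4)^k"
    by metis
  \<comment> \<open>Summing the thresholds gives \<open>N k \<le> r j\<close> whenever
    \<open>k \<le> j\<close>, so \<open>r k\<close> and \<open>r (Suc k)\<close> both lie in the
    \<open>k\<close>-th tail.\<close>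
  define r where "r k = (\<Sum>i\<le>k. N i)" for k
  have rN: "N k \<le> r j" if "k \<le> j" for k j
    unfolding r_def using that by (intro member_le_sum) auto
  define d where "d k x = F (r (Suc k)) x - F (r k) x" for k x
  have [measurable]: "d k \<in> borel_measurable borel" for k unfolding d_def by simp
  have dL2: "d k \<in> L2" for k unfolding d_def by (intro L2_diff F)
  have dn: "L2_norm (d k) < (1/4)^k" for k
    unfolding d_def using N[of k "r (Suc k)" "r k"] rN by simp
  have nn: "(\<integral>\<^sup>+x. ennreal (2^k * (norm (d k x))\<^sup>2) \<partial>lborel) \<le> ennreal ((1/8)^k)" for k
  proof -
    have "(\<integral>\<^sup>+x. ennreal (2^k * (norm (d k x))\<^sup>2) \<partial>lborel) = ennreal (2^k * (L2_norm (d k))\<^sup>2)"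
      using L2_integrable[OF dL2] by (subst nn_integral_eq_integral) (auto simp: L2_norm_power2)
    also have "\<dots> \<le> ennreal (2^k * ((1/4)^k)\<^sup>2)"
      using dn[of k] by (intro ennreal_leI mult_left_mono power_mono) auto
    also have "2^k * ((1/4)^k)\<^sup>2 = (1/8 :: real)^k"
      by (simp add: power2_eq_square flip: power_mult_distrib)
    finally show ?thesis .
  qed
  have "(\<integral>\<^sup>+x. (\<Sum>k. ennreal (2^k * (norm (d k x))\<^sup>2)) \<partial>lborel) =
      (\<Sum>k. \<integral>\<^sup>+x. ennreal (2^k * (norm (d k x))\<^sup>2) \<partial>lborel)"
    by (intro nn_integral_suminf) auto
  also have "\<dots> \<le> (\<Sum>k. ennreal ((1/8)^k))" by (intro suminf_le nn) auto
  also have "\<dots> = ennreal (\<Sum>k. (1/8)^k)" by (intro suminf_ennreal2) (auto simp: summable_geometric)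
  finally have fin: "(\<integral>\<^sup>+x. (\<Sum>k. ennreal (2^k * (norm (d k x))\<^sup>2)) \<partial>lborel) < \<infinity>"
    by (rule le_less_trans) simp
  have meas: "(\<lambda>x. \<Sum>k. ennreal (2^k * (norm (d k x))\<^sup>2)) \<in> borel_measurable lborel"
    by measurable
  have "AE x in lborel. (\<Sum>k. ennreal (2^k * (norm (d k x))\<^sup>2)) \<noteq> \<infinity>"
    by (rule nn_integral_PInf_AE[OF meas less_imp_neq[OF fin]])
  then have conv: "AE x in lborel. convergent (\<lambda>k. F (r k) x)"
  proof eventually_elim
    case (elim x)
    define B where "B = enn2real (\<Sum>k. ennreal (2^k * (norm (d k x))\<^sup>2))"
    have le: "2^k * (norm (d k x))\<^sup>2 \<le> B" for k
    proof -
      have "ennreal (2^k * (norm (d k x))\<^sup>2) \<le> (\<Sum>k. ennreal (2^k * (norm (d k x))\<^sup>2))"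
      proof -
        have "(\<Sum>j\<in>{k}. ennreal (2^j * (norm (d j x))\<^sup>2)) \<le> (\<Sum>k. ennreal (2^k * (norm (d k x))\<^sup>2))"
          by (intro sum_le_suminf) auto
        then show ?thesis by (simp only: sum.insert finite.emptyI empty_iff not_False_eq_True sum.empty add_0_right)
      qed
      also have "\<dots> = ennreal B" using elim unfolding B_def by (intro ennreal_enn2real[symmetric]) (simp only: less_top infinity_ennreal_def)
      finally have "ennreal (2^k * (norm (d k x))\<^sup>2) \<le> ennreal B" .
      moreover have "0 \<le> B" unfolding B_def by (rule enn2real_nonneg)
      ultimately show ?thesis by (simp only: ennreal_le_iff)
    qed
    have "norm (d k x) \<le> sqrt B * (1 / sqrt 2)^k" for k
    proof -
      have "(norm (d k x))\<^sup>2 \<le> B / 2^k" using le[of k] by (simp add: field_simps)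
      then have "norm (d k x) \<le> sqrt (B / 2^k)" by (rule real_le_rsqrt)
      also have "\<dots> = sqrt B * (1 / sqrt 2)^k"
        by (simp add: real_sqrt_divide real_sqrt_power power_divide)
      finally show ?thesis .
    qed
    moreover have "summable (\<lambda>k. sqrt B * (1 / sqrt 2)^k)"
      by (intro summable_mult summable_geometric) simp
    ultimately have "summable (\<lambda>k. d k x)" by (blast intro: summable_comparison_test')
    then have "convergent (\<lambda>n. \<Sum>k<n. d k x)" by (simp add: summable_iff_convergent)
    moreover have "(\<Sum>k<n. d k x) = F (r n) x - F (r 0) x" for n
      unfolding d_def by (rule sum_lessThan_telescope)
    ultimately have "convergent (\<lambda>n. (F (r n) x - F (r 0) x) + F (r 0) x)"
      by (intro convergent_add convergent_const) simp
    then show ?case by simp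
  qed
  define f where "f x = lim (\<lambda>k. F (r k) x)" for x
  have [measurable]: "f \<in> borel_measurable borel"
    unfolding f_def by (rule borel_measurable_lim_metric) simp
  have lim: "AE x in lborel. (\<lambda>k. F (r k) x) \<longlonglongrightarrow> f x"
    using conv by eventually_elim (simp add: f_def convergent_LIMSEQ_iff)
  \<comment> \<open>Fatou with \<open>n\<close> fixed and the index of the subsequence tending to
    infinity.\<close>
  have key: "(\<integral>\<^sup>+x. ennreal ((norm (F n x - f x))\<^sup>2) \<partial>lborel) \<le> ennreal (((1/4)^k)\<^sup>2)" if n: "N k \<le> n" for n k
  proof -
    have "(\<integral>\<^sup>+x. ennreal ((norm (F n x - f x))\<^sup>2) \<partial>lborel) =
        (\<integral>\<^sup>+x. liminf (\<lambda>j. ennreal ((norm (F n x - F (r j) x))\<^sup>2)) \<partial>lborel)"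
    proof (rule nn_integral_cong_AE)
      show "AE x in lborel. ennreal ((norm (F n x - f x))\<^sup>2) =
          liminf (\<lambda>j. ennreal ((norm (F n x - F (r j) x))\<^sup>2))"
        using lim
      proof eventually_elim
        case (elim x)
        have "(\<lambda>j. ennreal ((norm (F n x - F (r j) x))\<^sup>2)) \<longlonglongrightarrow> ennreal ((norm (F n x - f x))\<^sup>2)"
          by (intro tendsto_ennrealI tendsto_intros elim)
        then show ?case by (rule lim_imp_Liminf[OF sequentially_bot, symmetric])
      qed
    qed
    also have "\<dots> \<le> liminf (\<lambda>j. \<integral>\<^sup>+x. ennreal ((norm (F n x - F (r j) x))\<^sup>2) \<partial>lborel)"
      by (rule nn_integral_liminf) simp
    also have "\<dots> \<le> ennreal (((1/4)^k)\<^sup>2)"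
    proof (rule Liminf_le)
      show "eventually (\<lambda>j. (\<integral>\<^sup>+x. ennreal ((norm (F n x - F (r j) x))\<^sup>2) \<partial>lborel) \<le> ennreal (((1/4)^k)\<^sup>2)) sequentially"
        using eventually_ge_at_top[of k]
      proof eventually_elim
        case (elim j)
        have "(\<integral>\<^sup>+x. ennreal ((norm (F n x - F (r j) x))\<^sup>2) \<partial>lborel) = ennreal ((L2_norm (\<lambda>x. F n x - F (r j) x))\<^sup>2)"
          using L2_integrable[OF L2_diff[OF F F]] by (subst nn_integral_eq_integral) (auto simp: L2_norm_power2)
        also have "\<dots> \<le> ennreal (((1/4)^k)\<^sup>2)"
          using N[OF n, of "r j"] rN[OF elim] by (intro ennreal_leI power_mono) auto
        finally show ?case .
      qed
    qed simp
    finally show ?thesis .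
  qed
  have dif: "(\<lambda>x. F n x - f x) \<in> L2 \<and> L2_norm (\<lambda>x. F n x - f x) \<le> (1/4)^k" if n: "N k \<le> n" for n k
  proof -
    have i: "integrable lborel (\<lambda>x. (norm (F n x - f x))\<^sup>2)"
      using key[OF n] by (intro integrableI_bounded) (auto intro: le_less_trans)
    then have "ennreal (LINT x|lborel. (norm (F n x - f x))\<^sup>2) \<le> ennreal (((1/4)^k)\<^sup>2)"
      using key[OF n] by (subst nn_integral_eq_integral[symmetric]) auto
    then have "(L2_norm (\<lambda>x. F n x - f x))\<^sup>2 \<le> ((1/4)^k)\<^sup>2" by (simp add: L2_norm_power2)
    then have "L2_norm (\<lambda>x. F n x - f x) \<le> (1/4)^k" by (rule power2_le_imp_le) simp
    with i show ?thesis by (simp add: L2_def)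
  qed
  have "f \<in> L2"
    using L2_diff[OF F[of "N 0"] conjunct1[OF dif[of 0 "N 0"]]] by simp
  moreover have "(\<lambda>n. L2_norm (\<lambda>x. F n x - f x)) \<longlonglongrightarrow> 0"
  proof (rule LIMSEQ_I)
    fix e :: real assume "0 < e"
    then obtain k :: nat where k: "(1/4)^k < e" using real_arch_pow_inv[of e "1/4"] by auto
    show "\<exists>no. \<forall>n\<ge>no. norm (L2_norm (\<lambda>x. F n x - f x) - 0) < e"
      using dif k by (intro exI[of _ "N k"]) (auto intro: le_less_trans)
  qed
  ultimately show ?thesis by (rule that)
qed

lemma L2_parallelogram:
  assumes "f \<in> L2" "g \<in> L2"
  shows "(L2_norm (\<lambda>x. f x - g x))\<^sup>2 + (L2_norm (\<lambda>x. f x + g x))\<^sup>2 = 2 * (L2_norm f)\<^sup>2 + 2 * (L2_norm g)\<^sup>2"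
  using L2_norm_add_power2[OF assms] L2_norm_add_power2[OF assms(1) L2_minus[OF assms(2)]]
  by (simp add: L2_norm_minus)

text \<open>Nearest-point argument: a minimising sequence is Cauchy by the parallelogram law,
  because midpoints stay in \<open>V\<close>, and at the minimiser the first variation vanishes.
  Everything is over the reals; complex orthogonality is recovered later by varying the scalar of
  the test vector.\<close>

theorem L2_projection:
  fixes V :: "(real \<Rightarrow> 'a::euclidean_space) set"
  assumes V: "V \<subseteq> L2" "V \<noteq> {}"
    and add: "\<And>u v. u \<in> V \<Longrightarrow> v \<in> V \<Longrightarrow> (\<lambda>x. u x + v x) \<in> V"
    and scale: "\<And>c u. u \<in> V \<Longrightarrow> (\<lambda>x. c *\<^sub>R u x) \<in> V"
    and closed: "\<And>F g. (\<And>n. F n \<in> V) \<Longrightarrow> g \<in> L2 \<Longrightarrow> (\<lambda>n. L2_norm (\<lambda>x. F n x - g x)) \<longlonglongrightarrow> 0 \<Longrightarrow> g \<in> V"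
    and f: "f \<in> L2"
  obtains h where "h \<in> V" "\<And>v. v \<in> V \<Longrightarrow> (LINT x|lborel. inner (f x - h x) (v x)) = 0"
proof -
  define A where "A = (\<lambda>v. L2_norm (\<lambda>x. f x - v x)) ` V"
  define d where "d = Inf A"
  have A: "A \<noteq> {}" "bdd_below A" using V by (auto simp: A_def intro!: bdd_belowI[of _ 0])
  have d_le: "d \<le> L2_norm (\<lambda>x. f x - v x)" if "v \<in> V" for v
    unfolding d_def A_def using that A by (intro cInf_lower) (auto simp: A_def)
  have d0: "0 \<le> d" unfolding d_def using A by (intro cInf_greatest) (auto simp: A_def)
  have "\<exists>v\<in>V. L2_norm (\<lambda>x. f x - v x) < d + 1 / (Suc n)" for n
  proof -
    have "Inf A < d + 1 / (Suc n)" by (simp add: d_def)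
    then show ?thesis using cInf_lessD[OF A(1)] by (auto simp: A_def)
  qed
  then obtain F where FV: "\<And>n. F n \<in> V" and Fd: "\<And>n. L2_norm (\<lambda>x. f x - F n x) < d + 1 / (Suc n)"
    by metis
  have FL: "F n \<in> L2" for n using FV V by auto
  have bound: "(L2_norm (\<lambda>x. F m x - F n x))\<^sup>2 \<le> 2 * (d + 1 / Suc m)\<^sup>2 + 2 * (d + 1 / Suc n)\<^sup>2 - 4 * d\<^sup>2" for m n
  proof -
    have mid: "(\<lambda>x. (1/2) *\<^sub>R (F m x + F n x)) \<in> V" by (intro scale add FV)
    have "(L2_norm (\<lambda>x. (f x - F n x) - (f x - F m x)))\<^sup>2 + (L2_norm (\<lambda>x. (f x - F n x) + (f x - F m x)))\<^sup>2
        = 2 * (L2_norm (\<lambda>x. f x - F n x))\<^sup>2 + 2 * (L2_norm (\<lambda>x. f x - F m x))\<^sup>2"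
      by (intro L2_parallelogram L2_diff f FL)
    moreover have "(\<lambda>x. (f x - F n x) + (f x - F m x)) = (\<lambda>x. 2 *\<^sub>R (f x - (1/2) *\<^sub>R (F m x + F n x)))"
      by (auto simp: algebra_simps scaleR_2)
    then have "L2_norm (\<lambda>x. (f x - F n x) + (f x - F m x)) = 2 * L2_norm (\<lambda>x. f x - (1/2) *\<^sub>R (F m x + F n x))"
      by (simp only: L2_norm_scaleR)
    moreover have "d\<^sup>2 \<le> (L2_norm (\<lambda>x. f x - (1/2) *\<^sub>R (F m x + F n x)))\<^sup>2"
      using d_le[OF mid] d0 by (intro power_mono)
    moreover have "(L2_norm (\<lambda>x. f x - F k x))\<^sup>2 \<le> (d + 1 / Suc k)\<^sup>2" for k
      using Fd[of k] by (intro power_mono) auto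
    note this[of m] this[of n]
    ultimately show ?thesis by (simp add: power_mult_distrib)
  qed
  have "L2_Cauchy F"
    unfolding L2_Cauchy_def
  proof (intro allI impI)
    fix e :: real assume "0 < e"
    have "(\<lambda>n. (d + 1 / real (Suc n))\<^sup>2) \<longlonglongrightarrow> (d + 0)\<^sup>2"
      by (intro tendsto_intros LIMSEQ_Suc[OF lim_1_over_n])
    then have "eventually (\<lambda>n. (d + 1 / real (Suc n))\<^sup>2 < d\<^sup>2 + e\<^sup>2 / 4) sequentially"
      by (rule order_tendstoD) (use \<open>0 < e\<close> in auto)
    then obtain N where N: "\<And>n. n \<ge> N \<Longrightarrow> (d + 1 / real (Suc n))\<^sup>2 < d\<^sup>2 + e\<^sup>2 / 4"
      unfolding eventually_sequentially by blast
    show "\<exists>N. \<forall>m\<ge>N. \<forall>n\<ge>N. L2_norm (\<lambda>x. F m x - F n x) < e"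
    proof (intro exI allI impI)
      fix m n assume "N \<le> m" "N \<le> n"
      then have "(L2_norm (\<lambda>x. F m x - F n x))\<^sup>2 < e\<^sup>2"
        using order_le_less_trans[OF bound[of m n], of "e\<^sup>2"] N[OF \<open>N \<le> m\<close>] N[OF \<open>N \<le> n\<close>]
        unfolding atomize_imp by argo
      then show "L2_norm (\<lambda>x. F m x - F n x) < e"
        by (rule power2_less_imp_less) (use \<open>0 < e\<close> in simp)
    qed
  qed
  from L2_complete[OF FL this] obtain h where h: "h \<in> L2" and lim: "(\<lambda>n. L2_norm (\<lambda>x. F n x - h x)) \<longlonglongrightarrow> 0"
    by blast
  have hV: "h \<in> V" by (rule closed[OF FV h lim])
  have hd: "L2_norm (\<lambda>x. f x - h x) \<le> d"
  proof (rule LIMSEQ_le_const)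
    have "(\<lambda>n. (d + 1 / real (Suc n)) + L2_norm (\<lambda>x. F n x - h x)) \<longlonglongrightarrow> (d + 0) + 0"
      by (intro tendsto_intros LIMSEQ_Suc[OF lim_1_over_n] lim)
    then show "(\<lambda>n. (d + 1 / real (Suc n)) + L2_norm (\<lambda>x. F n x - h x)) \<longlonglongrightarrow> d" by simp
    show "\<exists>N. \<forall>n\<ge>N. L2_norm (\<lambda>x. f x - h x) \<le> (d + 1 / real (Suc n)) + L2_norm (\<lambda>x. F n x - h x)"
    proof (intro exI allI impI)
      fix n
      show "L2_norm (\<lambda>x. f x - h x) \<le> (d + 1 / real (Suc n)) + L2_norm (\<lambda>x. F n x - h x)"
        using L2_norm_triangle_diff[OF f FL[of n] h] Fd[of n] by linarith
    qed
  qed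
  show ?thesis
  proof (rule that[OF hV])
    fix v assume v: "v \<in> V"
    then have vL: "v \<in> L2" using V by auto
    define I where "I = (LINT x|lborel. inner (f x - h x) (v x))"
    \<comment> \<open>The vanishing constant term makes the discriminant bound read
      \<open>I\<^sup>2 \<le> 0\<close>.\<close>
    have "0 \<le> 0 + 2 * t * I + t\<^sup>2 * (L2_norm v)\<^sup>2" for t
    proof -
      have "(\<lambda>x. h x + (- t) *\<^sub>R v x) \<in> V" by (intro add scale hV v)
      from d_le[OF this] have "d \<le> L2_norm (\<lambda>x. (f x - h x) + t *\<^sub>R v x)" by (simp add: algebra_simps)
      with hd have "L2_norm (\<lambda>x. f x - h x) \<le> L2_norm (\<lambda>x. (f x - h x) + t *\<^sub>R v x)" by linarith
      then have "(L2_norm (\<lambda>x. f x - h x))\<^sup>2 \<le> (L2_norm (\<lambda>x. (f x - h x) + t *\<^sub>R v x))\<^sup>2"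
        by (intro power_mono) auto
      then show ?thesis
        by (subst (asm) L2_norm_add_power2[OF L2_diff[OF f h] L2_scaleR[OF vL]])
           (simp add: L2_norm_scaleR power_mult_distrib I_def)
    qed
    from quadratic_nonneg_discriminant[OF this] show "(LINT x|lborel. inner (f x - h x) (v x)) = 0"
      by (simp add: I_def)
  qed
qed

section \<open>Test functions\<close>

text \<open>The recursion takes one derivative off the front, so that closure under sums, products
  and affine substitutions follows by plain induction on the order.\<close>

primrec diff_times :: "nat \<Rightarrow> (real \<Rightarrow> real) \<Rightarrow> bool" where
  "diff_times 0 f \<longleftrightarrow> (\<forall>x. f differentiable (at x))"
| "diff_times (Suc n) f \<longleftrightarrow> (\<forall>x. f differentiable (at x)) \<and> diff_times n (deriv f)"

lemma diff_times_iff: "diff_times n f \<longleftrightarrow> (\<forall>k\<le>n. \<forall>x. (deriv ^^ k) f differentiable (at x))"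
proof (induction n arbitrary: f)
  case (Suc n)
  have "(\<forall>k\<le>Suc n. P k) \<longleftrightarrow> P 0 \<and> (\<forall>k\<le>n. P (Suc k))" for P
    by (metis Suc_le_mono le0 not0_implies_Suc)
  then show ?case by (simp add: Suc funpow_Suc_right del: funpow.simps(2))
qed simp

lemma test_functions_iff:
  "\<phi> \<in> test_functions \<longleftrightarrow> (\<forall>n. diff_times n \<phi>) \<and> compact (closure {x. \<phi> x \<noteq> 0})"
  unfolding test_functions_def diff_times_iff by blast

lemma diff_times_differentiable: "diff_times n f \<Longrightarrow> f differentiable (at x)"
  by (cases n) auto

lemma diff_times_DERIV: "diff_times n f \<Longrightarrow> DERIV f x :> deriv f x"
  using diff_times_differentiable DERIV_deriv_iff_real_differentiable by blast

lemma diff_times_SucI: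
  assumes "\<And>x. DERIV f x :> g x" "diff_times n g" shows "diff_times (Suc n) f"
proof -
  have "deriv f = g" using assms(1) by (auto intro: DERIV_imp_deriv)
  then show ?thesis using assms real_differentiable_def by auto
qed

lemma diff_times_SucD: "diff_times (Suc n) f \<Longrightarrow> diff_times n f"
  by (induction n arbitrary: f) auto

lemma diff_times_add: "diff_times n f \<Longrightarrow> diff_times n g \<Longrightarrow> diff_times n (\<lambda>x. f x + g x)"
proof (induction n arbitrary: f g)
  case (Suc n)
  show ?case
    by (rule diff_times_SucI[where g="\<lambda>x. deriv f x + deriv g x"])
       (use Suc in \<open>auto intro!: DERIV_add simp: DERIV_deriv_iff_real_differentiable\<close>)
qed auto

lemma diff_times_mult: "diff_times n f \<Longrightarrow> diff_times n g \<Longrightarrow> diff_times n (\<lambda>x. f x * g x)"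
proof (induction n arbitrary: f g)
  case (Suc n)
  show ?case
  proof (rule diff_times_SucI[where g="\<lambda>x. deriv f x * g x + deriv g x * f x"])
    show "DERIV (\<lambda>x. f x * g x) x :> deriv f x * g x + deriv g x * f x" for x
      using Suc.prems by (intro DERIV_mult) (auto simp: DERIV_deriv_iff_real_differentiable)
    show "diff_times n (\<lambda>x. deriv f x * g x + deriv g x * f x)"
      using Suc.prems diff_times_SucD by (intro diff_times_add Suc.IH) auto
  qed
qed auto

lemma diff_times_const: "diff_times n (\<lambda>x. c)"
proof (induction n arbitrary: c)
  case (Suc n)
  show ?case by (rule diff_times_SucI[OF DERIV_const Suc])
qed simp

lemma diff_times_affine: "diff_times n f \<Longrightarrow> diff_times n (\<lambda>x. f (a * x + b))"
proof (induction n arbitrary: f)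
  case 0
  have "DERIV (\<lambda>x. f (a * x + b)) x :> deriv f (a * x + b) * a" for x
    by (rule DERIV_chain2[OF diff_times_DERIV[OF 0]]) (auto intro!: derivative_eq_intros)
  then show ?case using real_differentiable_def by auto
next
  case (Suc n)
  show ?case
  proof (rule diff_times_SucI[where g="\<lambda>x. deriv f (a * x + b) * a"])
    show "DERIV (\<lambda>x. f (a * x + b)) x :> deriv f (a * x + b) * a" for x
      by (rule DERIV_chain2[OF diff_times_DERIV[OF Suc.prems]]) (auto intro!: derivative_eq_intros)
    show "diff_times n (\<lambda>x. deriv f (a * x + b) * a)"
      by (rule diff_times_mult[OF Suc.IH diff_times_const]) (use Suc.prems in auto)
  qed
qed

text \<open>The functions \<open>p (1 / x) * exp (- 1 / x)\<close> on the positive half-line, extended by zero, are closed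
  under differentiation; this yields smoothness of the standard bump.\<close>

definition exp_poly :: "real poly \<Rightarrow> real \<Rightarrow> real" where
  "exp_poly p x = (if 0 < x then poly p (1 / x) * exp (- (1 / x)) else 0)"

lemma poly_over_exp_tendsto_0: "((\<lambda>y::real. poly p y * exp (- y)) \<longlongrightarrow> 0) at_top"
proof -
  \<comment> \<open>The extra factor \<open>y ^ k\<close> absorbs the power of \<open>y\<close> that
    is split off with each coefficient.\<close>
  have "((\<lambda>y::real. y ^ k * poly p y / exp y) \<longlongrightarrow> 0) at_top" for k
  proof (induction p arbitrary: k)
    case (pCons a p)
    have "((\<lambda>y::real. a * (y ^ k / exp y) + y ^ Suc k * poly p y / exp y) \<longlongrightarrow> a * 0 + 0) at_top"
      by (intro tendsto_intros tendsto_power_div_exp_0 pCons.IH)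
    then show ?case by (simp add: field_simps)
  qed simp
  from this[of 0] show ?thesis by (simp add: exp_minus divide_inverse)
qed

text \<open>In terms of \<open>y = 1 / x\<close> the derivative is \<open>- y\<^sup>2\<close> times
  the one in \<open>y\<close>, which sends \<open>p y * exp (- y)\<close> to
  \<open>y\<^sup>2 * (p y - p' y) * exp (- y)\<close>. At the origin the difference quotient is of
  the same class, with \<open>y * p y\<close> in place of \<open>p y\<close>, and tends to
  zero.\<close>

lemma DERIV_exp_poly: "DERIV (exp_poly p) x :> exp_poly ([:0, 0, 1:] * (p - pderiv p)) x"
proof -
  consider "x < 0" | "x > 0" | "x = 0" by linarith
  then show ?thesis
  proof cases
    case 1
    have "DERIV (\<lambda>x. 0) x :> exp_poly ([:0, 0, 1:] * (p - pderiv p)) x"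
      using 1 by (simp add: exp_poly_def)
    moreover have "eventually (\<lambda>y. exp_poly p y = 0) (nhds x)"
      using eventually_nhds_in_open[of "{..<0}" x] 1 by (auto elim!: eventually_mono simp: exp_poly_def)
    ultimately show ?thesis by (subst DERIV_cong_ev) auto
  next
    case 2
    have "DERIV (\<lambda>x. poly p (1 / x) * exp (- (1 / x))) x :>
        (poly (pderiv p) (1 / x) * (- (1 / x^2))) * exp (- (1 / x)) + exp (- (1 / x)) * (1 / x^2) * poly p (1 / x)"
      using 2 by (auto intro!: derivative_eq_intros DERIV_chain'[OF _ poly_DERIV] simp: power2_eq_square field_simps)
    then have "DERIV (\<lambda>x. poly p (1 / x) * exp (- (1 / x))) x :> exp_poly ([:0, 0, 1:] * (p - pderiv p)) x"
      using 2 by (auto elim!: DERIV_cong simp: exp_poly_def field_simps power2_eq_square)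
    moreover have "eventually (\<lambda>y. exp_poly p y = poly p (1 / y) * exp (- (1 / y))) (nhds x)"
      using eventually_nhds_in_open[of "{0<..}" x] 2 by (auto elim!: eventually_mono simp: exp_poly_def)
    ultimately show ?thesis by (subst DERIV_cong_ev) auto
  next
    case 3
    have "((\<lambda>h. poly (pCons 0 p) (inverse h) * exp (- inverse h)) \<longlongrightarrow> 0) (at_right 0)"
      by (rule filterlim_compose[OF poly_over_exp_tendsto_0 filterlim_inverse_at_top_right])
    then have "((\<lambda>h. exp_poly p h / h) \<longlongrightarrow> 0) (at_right 0)"
      by (rule Lim_transform_eventually)
         (auto simp: eventually_at_right_field exp_poly_def field_simps intro!: exI[of _ 1])
    moreover have "((\<lambda>h. exp_poly p h / h) \<longlongrightarrow> 0) (at_left 0)"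
      by (rule Lim_transform_eventually[of "\<lambda>_. 0"])
         (auto simp: eventually_at_left_field exp_poly_def intro!: exI[of _ "-1"])
    ultimately have "((\<lambda>h. exp_poly p h / h) \<longlongrightarrow> 0) (at 0)" by (simp add: filterlim_split_at)
    then show ?thesis using 3 by (simp add: has_field_derivative_iff exp_poly_def)
  qed
qed

lemma diff_times_exp_poly: "diff_times n (exp_poly p)"
proof (induction n arbitrary: p)
  case 0
  show ?case using DERIV_exp_poly real_differentiable_def by auto
next
  case (Suc n)
  show ?case by (rule diff_times_SucI[OF DERIV_exp_poly Suc])
qed

definition bump :: "real \<Rightarrow> real" where "bump x = exp_poly 1 x"

lemma bump_simps: "x \<le> 0 \<Longrightarrow> bump x = 0" "0 < x \<Longrightarrow> bump x = exp (- (1 / x))"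
  by (auto simp: bump_def exp_poly_def)

lemma bump_range: "0 \<le> bump x" "bump x \<le> 1" "0 < x \<Longrightarrow> 0 < bump x"
  by (auto simp: bump_def exp_poly_def)

lemma test_functionI:
  assumes "\<And>n. diff_times n \<phi>" "\<And>x. \<phi> x \<noteq> 0 \<Longrightarrow> a \<le> x \<and> x \<le> b"
  shows "\<phi> \<in> test_functions"
proof -
  have "{x. \<phi> x \<noteq> 0} \<subseteq> {a..b}" using assms(2) by auto
  then have "compact (closure {x. \<phi> x \<noteq> 0})"
    by (metis bounded_subset bounded_closed_interval compact_closure)
  then show ?thesis using assms(1) by (simp add: test_functions_iff)
qed

lemma test_function_support:
  assumes "\<phi> \<in> test_functions" obtains R where "0 < R" "\<And>x. R \<le> \<bar>x\<bar> \<Longrightarrow> \<phi> x = 0"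
proof -
  have "bounded {x. \<phi> x \<noteq> 0}" using assms by (simp add: test_functions_iff)
  then obtain R where "\<And>x. \<phi> x \<noteq> 0 \<Longrightarrow> \<bar>x\<bar> \<le> R" by (auto simp: bounded_iff)
  then have "\<phi> x = 0" if "\<bar>R\<bar> + 1 \<le> \<bar>x\<bar>" for x using that by (smt (verit, ccfv_threshold))
  then show ?thesis by (intro that[of "\<bar>R\<bar> + 1"]) auto
qed

lemma test_function_DERIV: "\<phi> \<in> test_functions \<Longrightarrow> DERIV \<phi> x :> deriv \<phi> x"
  unfolding test_functions_iff using diff_times_DERIV by blast

lemma test_function_continuous: "\<phi> \<in> test_functions \<Longrightarrow> continuous_on A \<phi>"
  using test_function_DERIV DERIV_continuous_on DERIV_subset by (metis UNIV_I subset_UNIV)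

lemma test_function_measurable: "\<phi> \<in> test_functions \<Longrightarrow> \<phi> \<in> borel_measurable borel"
  by (simp add: borel_measurable_continuous_onI test_function_continuous)

lemma test_function_deriv: assumes "\<phi> \<in> test_functions" shows "deriv \<phi> \<in> test_functions"
proof -
  obtain R where R: "0 < R" "\<And>x. R \<le> \<bar>x\<bar> \<Longrightarrow> \<phi> x = 0" using test_function_support[OF assms] by blast
  have "deriv \<phi> x = 0" if "R < \<bar>x\<bar>" for x
  proof -
    have "open {y. R < \<bar>y\<bar>}" by (intro open_Collect_less continuous_intros)
    from eventually_nhds_in_open[OF this, of x] have "eventually (\<lambda>y. \<phi> y = 0) (nhds x)"
      using that R by (auto elim!: eventually_mono)
    then have "DERIV \<phi> x :> 0" by (subst DERIV_cong_ev[of x x \<phi> "\<lambda>_. 0"]) auto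
    then show ?thesis by (rule DERIV_imp_deriv)
  qed
  moreover have "diff_times n (deriv \<phi>)" for n
    using assms diff_times.simps(2) test_functions_iff by blast
  moreover have "- R \<le> x \<and> x \<le> R" if "\<not> R < \<bar>x\<bar>" for x using that by auto
  ultimately show ?thesis by (intro test_functionI[of _ "-R" R]) blast+
qed

lemma test_function_mult: "\<phi> \<in> test_functions \<Longrightarrow> \<psi> \<in> test_functions \<Longrightarrow> (\<lambda>x. \<phi> x * \<psi> x) \<in> test_functions"
proof -
  assume \<phi>: "\<phi> \<in> test_functions" and \<psi>: "\<psi> \<in> test_functions"
  obtain R where R: "\<And>x. R \<le> \<bar>x\<bar> \<Longrightarrow> \<phi> x = 0" using test_function_support[OF \<phi>] by metis
  show ?thesis
  proof (rule test_functionI[of _ "-R" R])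
    show "diff_times n (\<lambda>x. \<phi> x * \<psi> x)" for n
      using \<phi> \<psi> by (intro diff_times_mult) (auto simp: test_functions_iff)
    show "- R \<le> x \<and> x \<le> R" if "\<phi> x * \<psi> x \<noteq> 0" for x
      using R[of x] that by (cases "R \<le> \<bar>x\<bar>") auto
  qed
qed

lemma test_function_lincomb:
  "\<phi> \<in> test_functions \<Longrightarrow> \<psi> \<in> test_functions \<Longrightarrow> (\<lambda>x. \<phi> x + c * \<psi> x) \<in> test_functions"
proof -
  assume \<phi>: "\<phi> \<in> test_functions" and \<psi>: "\<psi> \<in> test_functions"
  obtain R where R: "\<And>x. R \<le> \<bar>x\<bar> \<Longrightarrow> \<phi> x = 0" using test_function_support[OF \<phi>] by metis
  obtain R' where R': "\<And>x. R' \<le> \<bar>x\<bar> \<Longrightarrow> \<psi> x = 0" using test_function_support[OF \<psi>] by metis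
  show ?thesis
  proof (rule test_functionI[of _ "- max R R'" "max R R'"])
    show "diff_times n (\<lambda>x. \<phi> x + c * \<psi> x)" for n
      using \<phi> \<psi> by (intro diff_times_add diff_times_mult diff_times_const) (auto simp: test_functions_iff)
    show "- max R R' \<le> x \<and> x \<le> max R R'" if "\<phi> x + c * \<psi> x \<noteq> 0" for x
    proof (rule ccontr)
      assume "\<not> ?thesis"
      then have "R \<le> \<bar>x\<bar>" "R' \<le> \<bar>x\<bar>" by auto
      then show False using R R' that by simp
    qed
  qed
qed

lemma test_function_bounded:
  assumes "\<phi> \<in> test_functions" obtains B where "0 < B" "\<And>x. \<bar>\<phi> x\<bar> \<le> B"
proof -
  obtain R where R: "0 < R" "\<And>x. R \<le> \<bar>x\<bar> \<Longrightarrow> \<phi> x = 0" using test_function_support[OF assms] by blast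
  have "compact (\<phi> ` {-R..R})" by (intro compact_continuous_image test_function_continuous assms) simp
  then obtain B where B: "\<And>x. x \<in> {-R..R} \<Longrightarrow> \<bar>\<phi> x\<bar> \<le> B"
    using compact_imp_bounded by (metis (no_types) bounded_iff image_eqI real_norm_def)
  have "\<bar>\<phi> x\<bar> \<le> \<bar>B\<bar> + 1" for x
  proof (cases "R \<le> \<bar>x\<bar>")
    case False
    then have "\<bar>\<phi> x\<bar> \<le> B" by (intro B) auto
    then show ?thesis by linarith
  qed (simp add: R(2))
  then show ?thesis by (intro that[of "\<bar>B\<bar> + 1"]) auto
qed

text \<open>The parameter \<open>k\<close> steepens both flanks; as it grows, the indicator of the
  open interval is reached without any mollification.\<close>

definition interval_bump :: "real \<Rightarrow> real \<Rightarrow> real \<Rightarrow> real \<Rightarrow> real" where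
  "interval_bump k a b x = bump (k * (x - a)) * bump (k * (b - x))"

lemma interval_bump_test:
  assumes "0 < k" shows "interval_bump k a b \<in> test_functions"
proof (rule test_functionI[of _ a b])
  show "diff_times n (interval_bump k a b)" for n
    using diff_times_mult[OF diff_times_affine[OF diff_times_exp_poly[of n 1], of k "- k * a"]
        diff_times_affine[OF diff_times_exp_poly[of n 1], of "- k" "k * b"]]
    by (simp add: interval_bump_def[abs_def] bump_def algebra_simps)
  show "a \<le> x \<and> x \<le> b" if "interval_bump k a b x \<noteq> 0" for x
  proof -
    have "\<not> k * (x - a) \<le> 0" "\<not> k * (b - x) \<le> 0"
      using that bump_simps(1) by (auto simp: interval_bump_def)
    then show ?thesis using assms by (auto simp: mult_le_0_iff)
  qed
qed

lemma interval_bump_range: "0 \<le> interval_bump k a b x" "interval_bump k a b x \<le> 1"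
  using bump_range by (auto simp: interval_bump_def intro!: mult_le_one)

lemma interval_bump_tendsto:
  "(\<lambda>n. interval_bump (real (Suc n)) a b x) \<longlonglongrightarrow> indicator {a<..<b} x"
proof (cases "a < x \<and> x < b")
  case True
  have *: "(\<lambda>n. bump (real (Suc n) * y)) \<longlonglongrightarrow> 1" if "0 < y" for y
  proof -
    have "(\<lambda>n. exp (- (1 / (real (Suc n) * y)))) \<longlonglongrightarrow> 1" using that by real_asymp
    then show ?thesis using that by (simp add: bump_simps del: of_nat_Suc)
  qed
  have "(\<lambda>n. interval_bump (real (Suc n)) a b x) \<longlonglongrightarrow> 1 * 1"
    unfolding interval_bump_def by (intro tendsto_mult *) (use True in auto)
  then show ?thesis using True by simp
next
  case False
  have "interval_bump (real (Suc n)) a b x = 0" for n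
    using False by (auto simp: interval_bump_def bump_simps mult_le_0_iff not_less)
  then show ?thesis using False by simp
qed

section \<open>Local integrability and the fundamental lemma of the calculus of variations\<close>

definition locally_integrable :: "(real \<Rightarrow> 'a::euclidean_space) \<Rightarrow> bool" where
  "locally_integrable f \<longleftrightarrow> (\<forall>a b. integrable lborel (\<lambda>x. indicator {a..b} x *\<^sub>R f x))"

lemma locally_integrableD: "locally_integrable f \<Longrightarrow> integrable lborel (\<lambda>x. indicator {a..b} x *\<^sub>R f x)"
  by (simp add: locally_integrable_def)

lemma locally_integrable_measurable:
  fixes f :: "real \<Rightarrow> 'a::euclidean_space"
  assumes "locally_integrable f" shows "f \<in> borel_measurable borel"
proof -
  have "(\<lambda>x. indicator {- real n..real n} x *\<^sub>R f x) \<in> borel_measurable borel" for n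
    using borel_measurable_integrable[OF locally_integrableD[OF assms]] by simp
  moreover have "(\<lambda>n. indicator {- real n..real n} x *\<^sub>R f x) \<longlonglongrightarrow> f x" for x
  proof (rule tendsto_eventually)
    obtain N :: nat where "\<bar>x\<bar> \<le> real N" using real_arch_simple by blast
    then show "eventually (\<lambda>n. indicator {- real n..real n} x *\<^sub>R f x = f x) sequentially"
      by (auto simp: eventually_sequentially indicator_def intro!: exI[of _ N])
  qed
  ultimately show ?thesis by (rule borel_measurable_LIMSEQ_metric)
qed

lemma locally_integrable_bounded_mult:
  fixes f :: "real \<Rightarrow> 'a::euclidean_space"
  assumes f: "locally_integrable f" and h: "h \<in> borel_measurable borel"
    and "\<And>x. norm (h x) \<le> B * norm (f x)" "\<And>x. R \<le> \<bar>x\<bar> \<Longrightarrow> h x = 0"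
  shows "integrable lborel (h :: real \<Rightarrow> 'b::euclidean_space)"
proof (rule Bochner_Integration.integrable_bound)
  show "integrable lborel (\<lambda>x. B * norm (indicator {-R..R} x *\<^sub>R f x))"
    by (intro integrable_mult_right integrable_norm locally_integrableD f)
  have "norm (h x) \<le> norm (B * norm (indicator {-R..R} x *\<^sub>R f x))" for x
    using assms(3)[of x] assms(4)[of x] by (auto simp: indicator_def abs_mult split: if_splits)
      (smt (verit) abs_ge_self mult_right_mono norm_ge_zero)
  then show "AE x in lborel. norm (h x) \<le> norm (B * norm (indicator {-R..R} x *\<^sub>R f x))" by simp
qed (use h in auto)

lemma test_function_integrable:
  fixes g :: "real \<Rightarrow> 'a::euclidean_space"
  assumes "\<phi> \<in> test_functions" "locally_integrable g"
  shows "integrable lborel (\<lambda>x. \<phi> x *\<^sub>R g x)"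
proof -
  obtain R where R: "0 < R" "\<And>x. R \<le> \<bar>x\<bar> \<Longrightarrow> \<phi> x = 0" using test_function_support[OF assms(1)] by blast
  obtain B where B: "0 < B" "\<And>x. \<bar>\<phi> x\<bar> \<le> B" using test_function_bounded[OF assms(1)] by blast
  show ?thesis
  proof (rule locally_integrable_bounded_mult[OF assms(2), of _ B R])
    show "(\<lambda>x. \<phi> x *\<^sub>R g x) \<in> borel_measurable borel"
      using test_function_measurable[OF assms(1)] locally_integrable_measurable[OF assms(2)] by simp
  qed (use R B in \<open>auto intro!: mult_right_mono\<close>)
qed

lemma L2_locally_integrable:
  fixes f :: "real \<Rightarrow> 'a::euclidean_space"
  assumes "f \<in> L2" shows "locally_integrable f"
  unfolding locally_integrable_def
proof (intro allI)
  fix a b :: real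
  have i: "(\<lambda>x. indicator {a..b} x :: real) \<in> L2"
    using integrable_real_indicator[of "{a..b}" lborel]
    by (simp add: L2_def power2_eq_square emeasure_lborel_Icc_eq flip: indicator_inter_arith)
  show "integrable lborel (\<lambda>x. indicator {a..b} x *\<^sub>R f x)"
    by (rule L2_bilinear_integrable[OF i assms]) (use L2_measurable[OF assms] in auto)
qed

text \<open>Sharpening bumps shows that the integral of \<open>g\<close> over every bounded open
  interval vanishes. These intervals are stable under intersection and generate the Borel sets, so
  an induction over the generated sigma-algebra reaches every Borel set, and a density all of whose
  integrals vanish is zero almost everywhere.\<close>

theorem AE_zero_if_orthogonal_to_test_functions:
  fixes g :: "real \<Rightarrow> complex"
  assumes g: "locally_integrable g"
    and orth: "\<And>\<phi>. \<phi> \<in> test_functions \<Longrightarrow> (LINT x|lborel. \<phi> x *\<^sub>R g x) = 0"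
  shows "AE x in lborel. g x = 0"
proof -
  note [measurable] = locally_integrable_measurable[OF g]
  have open_interval: "(LINT x|lborel. indicator {a<..<b} x *\<^sub>R g x) = 0" for a b :: real
  proof -
    have "(\<lambda>n. LINT x|lborel. interval_bump (real (Suc n)) a b x *\<^sub>R g x)
        \<longlonglongrightarrow> (LINT x|lborel. indicator {a<..<b} x *\<^sub>R g x)"
    proof (rule integral_dominated_convergence)
      show "integrable lborel (\<lambda>x. norm (indicator {a..b} x *\<^sub>R g x))"
        by (intro integrable_norm locally_integrableD g)
      show "(\<lambda>x. interval_bump (real (Suc n)) a b x *\<^sub>R g x) \<in> borel_measurable lborel" for n
        using test_function_measurable[OF interval_bump_test[of "real (Suc n)" a b]] by simp
      show "AE x in lborel. (\<lambda>n. interval_bump (real (Suc n)) a b x *\<^sub>R g x) \<longlonglongrightarrow> indicator {a<..<b} x *\<^sub>R g x"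
        by (intro AE_I2 tendsto_scaleR interval_bump_tendsto tendsto_const)
      have "norm (interval_bump (real (Suc n)) a b x *\<^sub>R g x) \<le> norm (indicator {a..b} x *\<^sub>R g x)" for n x
      proof (cases "a \<le> x \<and> x \<le> b")
        case True
        then show ?thesis
          using interval_bump_range[of "real (Suc n)" a b x] by (simp add: mult_left_le_one_le)
      next
        case False
        then have "interval_bump (real (Suc n)) a b x = 0"
          by (auto simp: interval_bump_def bump_simps mult_le_0_iff not_le)
        then show ?thesis by simp
      qed
      then show "AE x in lborel. norm (interval_bump (real (Suc n)) a b x *\<^sub>R g x) \<le> norm (indicator {a..b} x *\<^sub>R g x)" for n
        by simp
    qed simp
    moreover have "(LINT x|lborel. interval_bump (real (Suc n)) a b x *\<^sub>R g x) = 0" for n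
      by (intro orth interval_bump_test) simp
    ultimately show ?thesis by (simp add: LIMSEQ_const_iff)
  qed
  have sets_eq: "sets lborel = sigma_sets UNIV (range (\<lambda>(a, b). {a<..<b :: real}))"
  proof -
    have "sets (borel :: real measure) = sets (sigma UNIV (range (\<lambda>(a, b). {a<..<b :: real})))"
    proof -
      have "(\<lambda>(a, b). box a b) = (\<lambda>(a, b). {a<..<b :: real})" by (auto simp: box_real)
      then show ?thesis by (simp only: borel_eq_box)
    qed
    then show ?thesis by simp
  qed
  \<comment> \<open>Truncation supplies the global integrability that \<open>density_zero\<close>
    and the step for complements need.\<close>
  have "AE x in lborel. indicator {- real N<..<real N} x *\<^sub>R g x = 0" for N :: nat
  proof (rule sigma_finite_measure.density_zero[OF lborel.sigma_finite_measure_axioms])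
    let ?h = "\<lambda>x. indicator {- real N<..<real N} x *\<^sub>R g x"
    have h: "integrable lborel ?h"
      by (rule locally_integrable_bounded_mult[OF g, of _ 1 "real N"]) (auto simp: indicator_def)
    then show "integrable lborel ?h" .
    fix A :: "real set" assume "A \<in> sets lborel"
    then have A: "A \<in> sigma_sets UNIV (range (\<lambda>(a, b). {a<..<b}))" by (simp only: sets_eq)
    have inter: "{a<..<b} \<inter> {c<..<d} \<in> range (\<lambda>(a, b). {a<..<b :: real})" for a b c d :: real
    proof -
      have "{a<..<b} \<inter> {c<..<d} = (case (max a c, min b d) of (a, b) \<Rightarrow> {a<..<b})" by auto
      then show ?thesis by (rule range_eqI)
    qed
    have stable: "Int_stable (range (\<lambda>(a, b). {a<..<b :: real}))"
    proof (rule Int_stableI)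
      fix A B assume A: "A \<in> range (\<lambda>(a, b). {a<..<b :: real})" and B: "B \<in> range (\<lambda>(a, b). {a<..<b :: real})"
      from A obtain a b where "A = {a<..<b}" by auto
      moreover from B obtain c d where "B = {c<..<d}" by auto
      ultimately show "A \<inter> B \<in> range (\<lambda>(a, b). {a<..<b :: real})" by (simp only: inter)
    qed
    show "set_lebesgue_integral lborel A ?h = 0"
      using stable subset_UNIV[of "range (\<lambda>(a, b). {a<..<b :: real})", folded Pow_UNIV] A
    proof (induction rule: sigma_sets_induct_disjoint)
      case (basic A)
      then obtain a b where A: "A = {a<..<b}" by auto
      have "{a<..<b} \<inter> {- real N<..<real N} = {max a (- real N)<..<min b (real N)}" by auto
      then have "indicator A x *\<^sub>R ?h x = indicator {max a (- real N)<..<min b (real N)} x *\<^sub>R g x" for x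
        unfolding A scaleR_scaleR indicator_inter_arith[symmetric] by simp
      then show ?case unfolding set_lebesgue_integral_def by (simp only: open_interval)
    next
      case (compl A)
      then have A: "A \<in> sets lborel" by (simp only: sets_eq)
      have "(LINT x|lborel. indicator (UNIV - A) x *\<^sub>R ?h x) = (LINT x|lborel. ?h x - indicator A x *\<^sub>R ?h x)"
        by (intro Bochner_Integration.integral_cong) (auto simp: indicator_def)
      also have "\<dots> = (LINT x|lborel. ?h x) - (LINT x|lborel. indicator A x *\<^sub>R ?h x)"
        by (intro Bochner_Integration.integral_diff h integrable_mult_indicator A)
      finally show ?case using compl open_interval by (simp add: set_lebesgue_integral_def)
    next
      case (union A)
      have A: "A i \<in> sets lborel" for i
        using union(2) unfolding sets_eq by blast
      have "set_lebesgue_integral lborel (\<Union>i. A i) ?h = (\<Sum>i. set_lebesgue_integral lborel (A i) ?h)"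
      proof (rule lebesgue_integral_countable_add[OF A])
        show "A i \<inter> A j = {}" if "i \<noteq> j" for i j using union(1) that by (auto simp: disjoint_family_on_def)
        show "set_integrable lborel (\<Union>i. A i) ?h"
          unfolding set_integrable_def by (intro integrable_mult_indicator h sets.countable_UN) (use A in auto)
      qed
      then show ?case using union(3) by simp
    next
      case empty
      show ?case by (simp add: set_lebesgue_integral_def)
    qed
  qed
  then have "AE x in lborel. \<forall>N::nat. indicator {- real N<..<real N} x *\<^sub>R g x = 0"
    by (intro AE_all_countable[THEN iffD2] allI)
  then show ?thesis
  proof eventually_elim
    case (elim x)
    obtain N :: nat where "\<bar>x\<bar> < real N" using reals_Archimedean2 by blast
    then show ?case using elim[rule_format, of N] by (simp add: indicator_def split: if_splits)
  qed
qed

section \<open>Primitives of locally integrable functions\<close>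

definition interval_int :: "(real \<Rightarrow> complex) \<Rightarrow> real \<Rightarrow> real \<Rightarrow> complex" where
  "interval_int f a b = (LINT x|lborel. indicator {a..b} x *\<^sub>R f x)"

text \<open>Local absolute continuity, encoded by its integral identity, so that pointwise
  derivatives need not be discussed.\<close>

definition primitive_of :: "(real \<Rightarrow> complex) \<Rightarrow> (real \<Rightarrow> complex) \<Rightarrow> bool" where
  "primitive_of F f \<longleftrightarrow> locally_integrable f \<and> (\<forall>a b. a \<le> b \<longrightarrow> F b - F a = interval_int f a b)"

lemma interval_int_split:
  assumes f: "locally_integrable f" and "a \<le> b" "b \<le> c"
  shows "interval_int f a c = interval_int f a b + interval_int f b c"
proof -
  note [measurable] = locally_integrable_measurable[OF f]
  have "interval_int f a c =
      (LINT x|lborel. indicator {a..b} x *\<^sub>R f x + indicator {b..c} x *\<^sub>R f x)"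
    unfolding interval_int_def
  proof (intro integral_cong_AE)
    show "AE x in lborel. indicator {a..c} x *\<^sub>R f x = indicator {a..b} x *\<^sub>R f x + indicator {b..c} x *\<^sub>R f x"
      using AE_lborel_singleton[of b]
      by eventually_elim (use assms(2,3) in \<open>auto simp: indicator_def\<close>)
  qed measurable
  then show ?thesis
    unfolding interval_int_def by (simp add: locally_integrableD[OF f])
qed

lemma primitive_exists:
  assumes f: "locally_integrable f" obtains F where "primitive_of F f"
proof
  define F where "F x = (if 0 \<le> x then interval_int f 0 x else - interval_int f x 0)" for x
  have "F b - F a = interval_int f a b" if "a \<le> b" for a b
  proof -
    consider "0 \<le> a" | "a < 0" "0 \<le> b" | "b < 0" by linarith
    then show ?thesis
    proof cases
      case 1
      then show ?thesis using that interval_int_split[OF f, of 0 a b] by (simp add: F_def)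
    next
      case 2
      then show ?thesis using that interval_int_split[OF f, of a 0 b] by (simp add: F_def)
    next
      case 3
      then show ?thesis using that interval_int_split[OF f, of a b 0] by (simp add: F_def)
    qed
  qed
  then show "primitive_of F f" using f by (simp add: primitive_of_def)
qed

lemma primitive_of_diff: "primitive_of F f \<Longrightarrow> a \<le> b \<Longrightarrow> F b - F a = interval_int f a b"
  by (simp add: primitive_of_def)

lemma primitive_of_locally_integrable: "primitive_of F f \<Longrightarrow> locally_integrable f"
  by (simp add: primitive_of_def)

lemma primitive_of_isCont:
  assumes F: "primitive_of F f" shows "isCont F x"
proof -
  have f: "locally_integrable f" using F by (rule primitive_of_locally_integrable)
  have si: "set_integrable lborel {a..b} f" for a b
    using locally_integrableD[OF f] by (simp add: set_integrable_def)
  have eq: "F y = F (x - 1) + integral {x - 1..y} f" if "y \<in> {x - 1..x + 1}" for y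
  proof -
    have "interval_int f (x - 1) y = integral {x - 1..y} f"
      using set_borel_integral_eq_integral(2)[OF si] by (simp add: interval_int_def set_lebesgue_integral_def)
    then show ?thesis using primitive_of_diff[OF F, of "x - 1" y] that by (simp add: algebra_simps)
  qed
  have "continuous_on {x - 1..x + 1} (\<lambda>y. F (x - 1) + integral {x - 1..y} f)"
    by (intro continuous_intros indefinite_integral_continuous_1 set_borel_integral_eq_integral(1)[OF si])
  then have "continuous_on {x - 1..x + 1} F" by (rule continuous_on_eq) (rule eq[symmetric])
  then show ?thesis by (intro continuous_on_interior) auto
qed

lemma primitive_of_measurable: "primitive_of F f \<Longrightarrow> F \<in> borel_measurable borel"
  by (intro borel_measurable_continuous_onI continuous_at_imp_continuous_on ballI primitive_of_isCont)

lemma locally_integrable_mult_continuous: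
  fixes f G :: "real \<Rightarrow> complex"
  assumes f: "locally_integrable f" and G: "\<And>x. isCont G x"
  shows "locally_integrable (\<lambda>x. f x * G x)"
  unfolding locally_integrable_def
proof (intro allI)
  fix a b :: real
  note [measurable] = locally_integrable_measurable[OF f]
  have [measurable]: "G \<in> borel_measurable borel"
    by (intro borel_measurable_continuous_onI continuous_at_imp_continuous_on ballI G)
  have "compact (G ` {a..b})"
    by (intro compact_continuous_image continuous_at_imp_continuous_on ballI G) simp
  then obtain B where B: "\<And>x. x \<in> {a..b} \<Longrightarrow> norm (G x) \<le> B"
    using compact_imp_bounded by (metis (no_types) bounded_iff image_eqI)
  show "integrable lborel (\<lambda>x. indicator {a..b} x *\<^sub>R (f x * G x))"
  proof (rule Bochner_Integration.integrable_bound)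
    show "integrable lborel (\<lambda>x. B * norm (indicator {a..b} x *\<^sub>R f x))"
      by (intro integrable_mult_right integrable_norm locally_integrableD f)
    show "AE x in lborel. norm (indicator {a..b} x *\<^sub>R (f x * G x)) \<le> norm (B * norm (indicator {a..b} x *\<^sub>R f x))"
    proof (intro AE_I2)
      fix x
      show "norm (indicator {a..b} x *\<^sub>R (f x * G x)) \<le> norm (B * norm (indicator {a..b} x *\<^sub>R f x))"
      proof (cases "x \<in> {a..b}")
        case True
        then have "norm (f x) * norm (G x) \<le> norm (f x) * \<bar>B\<bar>" using B[OF True] by (intro mult_left_mono) auto
        then show ?thesis using True by (simp add: norm_mult abs_mult mult.commute)
      qed simp
    qed
  qed simp
qed

lemma locally_integrable_add:
  fixes f g :: "real \<Rightarrow> 'a::euclidean_space"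
  shows "locally_integrable f \<Longrightarrow> locally_integrable g \<Longrightarrow> locally_integrable (\<lambda>x. f x + g x)"
  unfolding locally_integrable_def by (simp add: scaleR_add_right)

lemma integrable_lborel_mult_pair:
  fixes p q :: "real \<Rightarrow> complex"
  assumes p: "integrable lborel p" and q: "integrable lborel q"
  shows "integrable (lborel \<Otimes>\<^sub>M lborel) (\<lambda>(x, y). p x * q y)"
proof (rule lborel_pair.Fubini_integrable)
  note [measurable] = borel_measurable_integrable[OF p] borel_measurable_integrable[OF q]
  show "(\<lambda>(x, y). p x * q y) \<in> borel_measurable (lborel \<Otimes>\<^sub>M lborel)" by measurable
  show "integrable lborel (\<lambda>x. LINT y|lborel. norm (case (x, y) of (x, y) \<Rightarrow> p x * q y))"
    using p q by (simp add: norm_mult)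
  show "AE x in lborel. integrable lborel (\<lambda>y. case (x, y) of (x, y) \<Rightarrow> p x * q y)" using q by simp
qed

text \<open>Product rule for absolutely continuous functions. Inserting the two indefinite integrals
  produces double integrals of \<open>f1 x * g1 y\<close> over the two triangles of a square; by
  Fubini they add up to the product of the increments, since the diagonal is null.\<close>

theorem primitive_of_mult:
  assumes F: "primitive_of F f" and G: "primitive_of G g"
  shows "primitive_of (\<lambda>x. F x * G x) (\<lambda>x. f x * G x + F x * g x)"
proof -
  note f = primitive_of_locally_integrable[OF F] and g = primitive_of_locally_integrable[OF G]
  have fG: "locally_integrable (\<lambda>x. f x * G x)"
    by (intro locally_integrable_mult_continuous f primitive_of_isCont[OF G])
  have "locally_integrable (\<lambda>x. g x * F x)"
    by (intro locally_integrable_mult_continuous g primitive_of_isCont[OF F])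
  then have Fg: "locally_integrable (\<lambda>x. F x * g x)" by (simp add: mult.commute)
  have "F b * G b - F a * G a = interval_int (\<lambda>x. f x * G x + F x * g x) a b" if "a \<le> b" for a b
  proof -
    define f1 where "f1 x = indicator {a..b} x *\<^sub>R f x" for x
    define g1 where "g1 x = indicator {a..b} x *\<^sub>R g x" for x
    have i: "integrable lborel f1" "integrable lborel g1"
      unfolding f1_def[abs_def] g1_def[abs_def] by (intro locally_integrableD f g)+
    note [measurable] = borel_measurable_integrable[OF i(1)] borel_measurable_integrable[OF i(2)]
    have F1: "indicator {a..b} x *\<^sub>R F x = indicator {a..b} x *\<^sub>R (F a + (LINT y|lborel. indicator {..x} y *\<^sub>R f1 y))" for x
    proof (cases "x \<in> {a..b}")
      case True
      have "interval_int f a x = (LINT y|lborel. indicator {..x} y *\<^sub>R f1 y)"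
        unfolding interval_int_def f1_def
        by (intro Bochner_Integration.integral_cong) (use True in \<open>auto simp: indicator_def\<close>)
      then show ?thesis using primitive_of_diff[OF F, of a x] True by (simp add: algebra_simps)
    qed simp
    have G1: "indicator {a..b} x *\<^sub>R G x = indicator {a..b} x *\<^sub>R (G a + (LINT y|lborel. indicator {..x} y *\<^sub>R g1 y))" for x
    proof (cases "x \<in> {a..b}")
      case True
      have "interval_int g a x = (LINT y|lborel. indicator {..x} y *\<^sub>R g1 y)"
        unfolding interval_int_def g1_def
        by (intro Bochner_Integration.integral_cong) (use True in \<open>auto simp: indicator_def\<close>)
      then show ?thesis using primitive_of_diff[OF G, of a x] True by (simp add: algebra_simps)
    qed simp
    have ind: "indicator {a..b} x *\<^sub>R (u * v) = (indicator {a..b} x *\<^sub>R u) * (indicator {a..b} x *\<^sub>R v)"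
      for x and u v :: complex by (simp add: indicator_def)
    \<comment> \<open>The integrand on one triangle, as a function on the plane, so that Fubini can
      exchange the roles of the variables.\<close>
    define k where "k p q x y = indicator {(x, y). y \<le> x} (x, y) *\<^sub>R (p x * q y)"
      for p q :: "real \<Rightarrow> complex" and x y :: real
    have kint: "integrable (lborel \<Otimes>\<^sub>M lborel) (case_prod (k p q))"
      if "integrable lborel p" "integrable lborel q" for p q :: "real \<Rightarrow> complex"
    proof -
      have "closed {p :: real \<times> real. snd p \<le> fst p}" by (intro closed_Collect_le continuous_intros)
      then have "{(x, y). y \<le> (x::real)} \<in> sets (lborel \<Otimes>\<^sub>M lborel)"
        unfolding lborel_prod sets_lborel split_def by (rule borel_closed)
      from integrable_mult_indicator[OF this integrable_lborel_mult_pair[OF that]] show ?thesis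
        by (rule Bochner_Integration.integrable_cong[THEN iffD1, rotated 2]) (auto simp: k_def)
    qed
    have ki: "integrable lborel (\<lambda>x. LINT y|lborel. k p q x y)"
      if "integrable lborel p" "integrable lborel q" for p q :: "real \<Rightarrow> complex"
      using lborel_pair.integrable_fst[OF kint[OF that]] by simp
    have keq: "(LINT y|lborel. k p q x y) = p x * (LINT y|lborel. indicator {..x} y *\<^sub>R q y)"
      for p q :: "real \<Rightarrow> complex" and x
    proof -
      have "(LINT y|lborel. k p q x y) = (LINT y|lborel. p x * (indicator {..x} y *\<^sub>R q y))"
        by (intro Bochner_Integration.integral_cong) (auto simp: k_def indicator_def)
      then show ?thesis by (simp only: integral_mult_right_zero)
    qed
    have "interval_int (\<lambda>x. f x * G x + F x * g x) a b =
        (LINT x|lborel. (G a * f1 x + (LINT y|lborel. k f1 g1 x y)) + (F a * g1 x + (LINT y|lborel. k g1 f1 x y)))"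
      unfolding interval_int_def
    proof (intro Bochner_Integration.integral_cong refl)
      fix x
      show "indicator {a..b} x *\<^sub>R (f x * G x + F x * g x) =
          (G a * f1 x + (LINT y|lborel. k f1 g1 x y)) + (F a * g1 x + (LINT y|lborel. k g1 f1 x y))"
        unfolding scaleR_add_right ind F1 G1 keq
        by (cases "x \<in> {a..b}") (simp_all add: f1_def g1_def algebra_simps)
    qed
    also have "\<dots> = G a * (LINT x|lborel. f1 x) + F a * (LINT x|lborel. g1 x)
        + ((LINT x|lborel. LINT y|lborel. k f1 g1 x y) + (LINT x|lborel. LINT y|lborel. k g1 f1 x y))"
      using i by (simp add: ki)
    also have "(LINT x|lborel. LINT y|lborel. k g1 f1 x y) = (LINT y|lborel. LINT x|lborel. k g1 f1 x y)"
      using lborel_pair.Fubini_integral[OF kint[OF i(2,1)]] by simp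
    also have "(LINT x|lborel. LINT y|lborel. k f1 g1 x y) + (LINT y|lborel. LINT x|lborel. k g1 f1 x y)
        = (LINT x|lborel. (LINT y|lborel. k f1 g1 x y) + (LINT y|lborel. k g1 f1 y x))"
      using ki[OF i] lborel_pair.integrable_snd[OF kint[OF i(2,1)]]
      by (intro Bochner_Integration.integral_add[symmetric]) auto
    also have "\<dots> = (LINT x|lborel. f1 x * (LINT y|lborel. g1 y))"
    proof (intro Bochner_Integration.integral_cong refl)
      fix x
      have j: "integrable lborel (\<lambda>y. indicator A y *\<^sub>R (f1 x * g1 y))" if "A \<in> sets borel" for A
        using i(2) that by (intro integrable_mult_indicator) auto
      have "(LINT y|lborel. k f1 g1 x y) + (LINT y|lborel. k g1 f1 y x)
          = (LINT y|lborel. indicator {..x} y *\<^sub>R (f1 x * g1 y)) + (LINT y|lborel. indicator {x..} y *\<^sub>R (f1 x * g1 y))"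
        by (intro arg_cong2[where f="(+)"] Bochner_Integration.integral_cong) (auto simp: k_def indicator_def)
      also have "\<dots> = (LINT y|lborel. indicator {..x} y *\<^sub>R (f1 x * g1 y) + indicator {x..} y *\<^sub>R (f1 x * g1 y))"
        by (intro Bochner_Integration.integral_add[symmetric] j) auto
      also have "\<dots> = (LINT y|lborel. f1 x * g1 y)"
      proof (intro integral_cong_AE)
        \<comment> \<open>The two half-lines overlap in the single point \<open>x\<close>.\<close>
        show "AE y in lborel. indicator {..x} y *\<^sub>R (f1 x * g1 y) + indicator {x..} y *\<^sub>R (f1 x * g1 y) = f1 x * g1 y"
          using AE_lborel_singleton[of x] by eventually_elim (auto simp: indicator_def)
      qed measurable
      finally show "(LINT y|lborel. k f1 g1 x y) + (LINT y|lborel. k g1 f1 y x) = f1 x * (LINT y|lborel. g1 y)"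
        by simp
    qed
    also have "G a * (LINT x|lborel. f1 x) + F a * (LINT x|lborel. g1 x) + (LINT x|lborel. f1 x * (LINT y|lborel. g1 y))
        = G a * (F b - F a) + F a * (G b - G a) + (F b - F a) * (G b - G a)"
    proof -
      have "(LINT x|lborel. f1 x) = F b - F a" "(LINT x|lborel. g1 x) = G b - G a"
        using primitive_of_diff[OF F that] primitive_of_diff[OF G that]
        by (simp_all add: interval_int_def f1_def[abs_def] g1_def[abs_def])
      then show ?thesis by (simp only: integral_mult_left_zero)
    qed
    finally show ?thesis by (simp add: algebra_simps)
  qed
  then show ?thesis using locally_integrable_add[OF fG Fg] by (simp add: primitive_of_def)
qed

lemma primitive_of_C1:
  assumes "\<And>x. (F has_vector_derivative f x) (at x)" "continuous_on UNIV f"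
  shows "primitive_of F f"
  unfolding primitive_of_def
proof (intro conjI allI impI)
  have [measurable]: "f \<in> borel_measurable borel" using assms(2) by (rule borel_measurable_continuous_onI)
  show "locally_integrable f"
    unfolding locally_integrable_def
    using borel_integrable_atLeastAtMost'[OF continuous_on_subset[OF assms(2) subset_UNIV]]
    by (simp add: set_integrable_def)
  fix a b :: real assume "a \<le> b"
  have "(LINT x|lborel. indicator {a..b} x *\<^sub>R f x) = F b - F a"
  proof (rule integral_FTC_atLeastAtMost[OF \<open>a \<le> b\<close>])
    show "(F has_vector_derivative f x) (at x within {a..b})" for x
      using assms(1) has_vector_derivative_at_within by blast
    show "continuous_on {a..b} f" using assms(2) continuous_on_subset by blast
  qed
  then show "F b - F a = interval_int f a b" by (simp add: interval_int_def)
qed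

lemma primitive_of_const_add: "primitive_of F f \<Longrightarrow> primitive_of (\<lambda>x. c + F x) f"
  by (simp add: primitive_of_def)

section \<open>Boundary terms at infinity\<close>

lemma interval_int_tendsto:
  assumes "integrable lborel f"
  shows "((\<lambda>y. interval_int f (- y) y) \<longlongrightarrow> (LINT x|lborel. f x)) at_top"
proof (rule tendsto_at_topI_sequentially)
  fix X :: "nat \<Rightarrow> real" assume X: "filterlim X at_top sequentially"
  have [measurable]: "f \<in> borel_measurable borel" using assms by auto
  show "(\<lambda>n. interval_int f (- X n) (X n)) \<longlonglongrightarrow> (LINT x|lborel. f x)"
    unfolding interval_int_def
  proof (rule integral_dominated_convergence[where w="\<lambda>x. norm (f x)"])
    show "AE x in lborel. (\<lambda>n. indicator {- X n..X n} x *\<^sub>R f x) \<longlonglongrightarrow> f x"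
    proof (intro AE_I2 tendsto_eventually)
      fix x
      show "eventually (\<lambda>n. indicator {- X n..X n} x *\<^sub>R f x = f x) sequentially"
        using filterlim_at_top[THEN iffD1, OF X, rule_format, of "\<bar>x\<bar>"]
        by eventually_elim (auto simp: indicator_def)
    qed
  qed (use assms in \<open>auto simp: indicator_def\<close>)
qed

text \<open>Otherwise the norm of \<open>F\<close> exceeds half that of \<open>L\<close> on a
  half-line, which has infinite measure.\<close>

lemma integrable_tendsto_at_top_zero:
  fixes F :: "real \<Rightarrow> complex"
  assumes F: "integrable lborel F" and lim: "(F \<longlongrightarrow> L) at_top"
  shows "L = 0"
proof (rule ccontr)
  assume "L \<noteq> 0"
  have "((\<lambda>x. norm (F x)) \<longlongrightarrow> norm L) at_top" using lim by (rule tendsto_norm)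
  then have "eventually (\<lambda>x. norm L / 2 < norm (F x)) at_top"
    by (rule order_tendstoD) (use \<open>L \<noteq> 0\<close> in simp)
  then obtain B where B: "\<And>x. B \<le> x \<Longrightarrow> norm L / 2 < norm (F x)"
    unfolding eventually_at_top_linorder by blast
  have "integrable lborel (\<lambda>x. indicator {B..} x * (norm L / 2))"
  proof (rule Bochner_Integration.integrable_bound[OF F])
    show "AE x in lborel. norm (indicator {B..} x * (norm L / 2)) \<le> norm (F x)"
      by (intro AE_I2) (auto simp: indicator_def dest!: B)
  qed simp
  from integrable_mult_right[OF this, of "2 / norm L"]
  have "integrable lborel (indicator {B..} :: real \<Rightarrow> real)" using \<open>L \<noteq> 0\<close> by simp
  then have "emeasure lborel {B..} < \<infinity>" by (simp add: integrable_indicator_iff)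
  moreover have "emeasure lborel {B..B + real n} \<le> emeasure lborel {B..}" for n
    by (intro emeasure_mono) auto
  then have "of_nat n \<le> emeasure lborel {B..}" for n by (simp add: ennreal_of_nat_eq_real_of_nat)
  ultimately show False
    using ennreal_Ex_less_of_nat by (metis infinity_ennreal_def leD)
qed

text \<open>The integral is the limit of the increments \<open>F y - F (- y)\<close>. These form an
  integrable function of \<open>y\<close>, and a limit of an integrable function at infinity can
  only be zero.\<close>

theorem integral_derivative_zero:
  assumes F: "primitive_of F f" and "integrable lborel F" "integrable lborel f"
  shows "(LINT x|lborel. f x) = 0"
proof (rule integrable_tendsto_at_top_zero)
  show "integrable lborel (\<lambda>x. F x - F (- x))"
    using assms(2) lborel_integrable_real_affine[of F "- 1" 0] by (intro Bochner_Integration.integrable_diff) auto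
  have "eventually (\<lambda>y. interval_int f (- y) y = F y - F (- y)) at_top"
    using eventually_ge_at_top[of 0] by eventually_elim (simp add: primitive_of_diff[OF F])
  with interval_int_tendsto[OF assms(3)] show "((\<lambda>x. F x - F (- x)) \<longlongrightarrow> (LINT x|lborel. f x)) at_top"
    by (rule Lim_transform_eventually)
qed

section \<open>Weak derivatives\<close>

text \<open>A local version of the weak derivative is needed because weak solutions of the adjoint
  equation lie in \<open>L2\<close>, but their derivatives contain \<open>x\<close> times the
  solution and are a priori only locally integrable.\<close>

definition weakly_diff :: "(real \<Rightarrow> complex) \<Rightarrow> (real \<Rightarrow> complex) \<Rightarrow> bool" where
  "weakly_diff u g \<longleftrightarrow> locally_integrable u \<and> locally_integrable g \<and>
     (\<forall>\<phi>\<in>test_functions. (LINT x|lborel. deriv \<phi> x *\<^sub>R u x) = - (LINT x|lborel. \<phi> x *\<^sub>R g x))"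

lemma has_weak_L2_derivative_iff:
  "has_weak_L2_derivative u g \<longleftrightarrow> u \<in> L2 \<and> g \<in> L2 \<and> weakly_diff u g"
  by (auto simp: has_weak_L2_derivative_def weakly_diff_def L2_locally_integrable)

lemma locally_integrable_continuous:
  fixes f :: "real \<Rightarrow> 'a::euclidean_space"
  assumes "continuous_on UNIV f" shows "locally_integrable f"
  unfolding locally_integrable_def
  using borel_integrable_atLeastAtMost'[OF continuous_on_subset[OF assms subset_UNIV]]
  by (simp add: set_integrable_def)

lemma test_function_L2: assumes "\<phi> \<in> test_functions" shows "\<phi> \<in> L2"
  using test_function_integrable[OF assms locally_integrable_continuous[OF test_function_continuous[OF assms]]]
    test_function_measurable[OF assms]
  by (simp add: L2_def power2_eq_square)

lemma test_function_lborel_integrable: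
  assumes "\<phi> \<in> test_functions" shows "integrable lborel \<phi>"
  using test_function_integrable[OF assms locally_integrable_continuous[of "\<lambda>_. 1 :: real"]] by simp

lemma weakly_diff_primitive:
  assumes U: "primitive_of U g" shows "weakly_diff U g"
  unfolding weakly_diff_def
proof (intro conjI ballI)
  note g = primitive_of_locally_integrable[OF U]
  show "locally_integrable g" by (rule g)
  have "continuous_on UNIV U" by (intro continuous_at_imp_continuous_on ballI primitive_of_isCont[OF U])
  then show lU: "locally_integrable U" by (rule locally_integrable_continuous)
  fix \<phi> assume \<phi>: "\<phi> \<in> test_functions"
  note \<phi>' = test_function_deriv[OF \<phi>]
  obtain R where R: "0 < R" "\<And>x. R \<le> \<bar>x\<bar> \<Longrightarrow> \<phi> x = 0" using test_function_support[OF \<phi>] by blast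
  obtain R' where R': "0 < R'" "\<And>x. R' \<le> \<bar>x\<bar> \<Longrightarrow> deriv \<phi> x = 0" using test_function_support[OF \<phi>'] by blast
  define M where "M = max R R'"
  have M: "0 < M" "\<And>x. M \<le> \<bar>x\<bar> \<Longrightarrow> \<phi> x = 0" "\<And>x. M \<le> \<bar>x\<bar> \<Longrightarrow> deriv \<phi> x = 0"
    using R R' by (auto simp: M_def)
  have "primitive_of (\<lambda>x. of_real (\<phi> x)) (\<lambda>x. of_real (deriv \<phi> x))"
  proof (rule primitive_of_C1)
    show "((\<lambda>x. of_real (\<phi> x)) has_vector_derivative complex_of_real (deriv \<phi> x)) (at x)" for x
      using test_function_DERIV[OF \<phi>]
      by (intro has_vector_derivative_of_real) (simp add: has_real_derivative_iff_has_vector_derivative)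
    show "continuous_on UNIV (\<lambda>x. complex_of_real (deriv \<phi> x))"
      by (intro continuous_intros test_function_continuous \<phi>')
  qed
  from primitive_of_diff[OF primitive_of_mult[OF this U], of "- M" M]
  have "0 = interval_int (\<lambda>x. of_real (deriv \<phi> x) * U x + of_real (\<phi> x) * g x) (- M) M"
    using M by simp
  also have "\<dots> = (LINT x|lborel. deriv \<phi> x *\<^sub>R U x + \<phi> x *\<^sub>R g x)"
    unfolding interval_int_def
  proof (intro Bochner_Integration.integral_cong refl)
    fix x
    show "indicator {- M..M} x *\<^sub>R (of_real (deriv \<phi> x) * U x + of_real (\<phi> x) * g x) = deriv \<phi> x *\<^sub>R U x + \<phi> x *\<^sub>R g x"
      using M(2,3)[of x] by (cases "x \<in> {-M..M}") (auto simp: scaleR_conv_of_real indicator_def)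
  qed
  also have "\<dots> = (LINT x|lborel. deriv \<phi> x *\<^sub>R U x) + (LINT x|lborel. \<phi> x *\<^sub>R g x)"
    by (intro Bochner_Integration.integral_add test_function_integrable \<phi> \<phi>' lU g)
  finally show "(LINT x|lborel. deriv \<phi> x *\<^sub>R U x) = - (LINT x|lborel. \<phi> x *\<^sub>R g x)"
    by (simp add: eq_neg_iff_add_eq_0)
qed

section \<open>Absolutely continuous representatives\<close>

lemma normalised_test_function:
  obtains \<omega> where "\<omega> \<in> test_functions" "(LINT x|lborel. \<omega> x) = 1"
proof -
  define b where "b = interval_bump 1 (-1) 1"
  have b: "b \<in> test_functions" unfolding b_def by (rule interval_bump_test) simp
  have nonneg: "AE x in lborel. 0 \<le> b x" by (simp add: b_def interval_bump_range)
  have "(LINT x|lborel. b x) \<noteq> 0"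
  proof
    assume "(LINT x|lborel. b x) = 0"
    then have "AE x in lborel. b x = 0"
      using integral_nonneg_eq_0_iff_AE[OF test_function_lborel_integrable[OF b] nonneg] by simp
    then have "AE x in lborel. x \<notin> {-1<..<1::real}"
    proof eventually_elim
      case (elim x)
      then show ?case using bump_range(3)[of "x + 1"] bump_range(3)[of "1 - x"]
        by (auto simp: b_def interval_bump_def)
    qed
    then have "emeasure lborel {-1<..<1::real} = 0"
      by (subst (asm) AE_iff_measurable[of "{-1<..<1::real}"]) auto
    then show False by simp
  qed
  then show ?thesis
    \<comment> \<open>This is \<open>b\<close> divided by its integral, written in the form covered
      by the closure rule for combinations.\<close>
    using test_function_lincomb[OF b b, of "1 / (LINT x|lborel. b x) - 1"]
    by (intro that[of "\<lambda>x. b x + (1 / (LINT x|lborel. b x) - 1) * b x"])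
       (auto simp: algebra_simps test_function_lborel_integrable[OF b])
qed

text \<open>Vanishing mean is what makes the primitive zero to the right of the support; to the
  left, the choice of the base point does.\<close>

lemma test_function_antiderivative:
  assumes k: "k \<in> test_functions" and k0: "(LINT x|lborel. k x) = 0"
  obtains \<phi> where "\<phi> \<in> test_functions" "deriv \<phi> = k"
proof -
  obtain S where S: "0 < S" "\<And>x. S \<le> \<bar>x\<bar> \<Longrightarrow> k x = 0" using test_function_support[OF k] by blast
  \<comment> \<open>The base point lies strictly to the left of the support, so every point from
    \<open>- S\<close> on is interior to the interval of integration used for the
    derivative.\<close>
  define R where "R = S + 1"
  define \<phi> where "\<phi> x = integral {- R..x} k" for x
  have zero_left: "\<phi> x = 0" if "x < - S" for x
  proof -
    have "integral {- R..x} k = integral {- R..x} (\<lambda>_. 0)"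
      by (intro integral_cong S) (use that in auto)
    then show ?thesis by (simp add: \<phi>_def)
  qed
  have zero_right: "\<phi> x = 0" if "S < x" for x
  proof -
    have "set_integrable lborel {- R..x} k"
      by (intro borel_integrable_atLeastAtMost' test_function_continuous k)
    from set_borel_integral_eq_integral(2)[OF this]
    have "\<phi> x = (LINT y|lborel. indicator {- R..x} y *\<^sub>R k y)" by (simp add: \<phi>_def set_lebesgue_integral_def)
    also have "\<dots> = (LINT y|lborel. k y)"
    proof (intro Bochner_Integration.integral_cong refl)
      fix y show "indicator {- R..x} y *\<^sub>R k y = k y"
        using S(2)[of y] that by (cases "S \<le> \<bar>y\<bar>") (auto simp: R_def indicator_def)
    qed
    finally show ?thesis using k0 by simp
  qed
  have D: "DERIV \<phi> x :> k x" for x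
  proof (cases "x < - S")
    case True
    have "eventually (\<lambda>y. \<phi> y = 0) (nhds x)"
      using eventually_nhds_in_open[of "{..<- S}" x] True by (auto elim!: eventually_mono simp: zero_left)
    then have "DERIV \<phi> x :> 0" by (subst DERIV_cong_ev[of x x \<phi> "\<lambda>_. 0"]) auto
    then show ?thesis using S(2)[of x] S(1) True by auto
  next
    case False
    have "(\<phi> has_vector_derivative k x) (at x within {- R..x + 1})"
      unfolding \<phi>_def[abs_def]
      by (rule integral_has_vector_derivative) (use False test_function_continuous[OF k] in \<open>auto simp: R_def\<close>)
    then have "(\<phi> has_vector_derivative k x) (at x)"
      by (subst (asm) at_within_interior) (use False in \<open>auto simp: R_def\<close>)
    then show ?thesis by (simp add: has_real_derivative_iff_has_vector_derivative)
  qed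
  have dk: "deriv \<phi> = k" using D by (auto intro: DERIV_imp_deriv)
  have "\<phi> \<in> test_functions"
  proof (rule test_functionI[of _ "- S" S])
    have "diff_times n k" for n using k by (simp add: test_functions_iff)
    then have "diff_times (Suc n) \<phi>" for n using D by (rule diff_times_SucI[rotated])
    then show "diff_times n \<phi>" for n by (rule diff_times_SucD)
    show "- S \<le> x \<and> x \<le> S" if "\<phi> x \<noteq> 0" for x
      using that zero_left[of x] zero_right[of x] by (meson not_le)
  qed
  then show ?thesis using dk by (rule that)
qed

text \<open>The argument of du Bois-Reymond. The difference of \<open>u\<close> and a primitive of
  \<open>g\<close> annihilates all derivatives of test functions; every test function is such a
  derivative plus its mean times a fixed normalised one, so the difference is the constant
  \<open>c\<close>.\<close>

theorem weakly_diff_representative: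
  assumes ug: "weakly_diff u g"
  obtains U where "primitive_of U g" "AE x in lborel. u x = U x"
proof -
  have u: "locally_integrable u" and g: "locally_integrable g"
    and w: "\<And>\<phi>. \<phi> \<in> test_functions \<Longrightarrow> (LINT x|lborel. deriv \<phi> x *\<^sub>R u x) = - (LINT x|lborel. \<phi> x *\<^sub>R g x)"
    using ug by (auto simp: weakly_diff_def)
  obtain G where G: "primitive_of G g" using primitive_exists[OF g] by blast
  have wG: "weakly_diff G g" by (rule weakly_diff_primitive[OF G])
  then have lG: "locally_integrable G" by (simp add: weakly_diff_def)
  obtain \<omega> where \<omega>: "\<omega> \<in> test_functions" "(LINT x|lborel. \<omega> x) = 1" by (rule normalised_test_function)
  define h where "h x = u x - G x" for x
  have lh: "locally_integrable h"
    using u lG unfolding locally_integrable_def h_def by (simp add: scaleR_diff_right)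
  have h0: "(LINT x|lborel. deriv \<phi> x *\<^sub>R h x) = 0" if "\<phi> \<in> test_functions" for \<phi>
  proof -
    have "(LINT x|lborel. deriv \<phi> x *\<^sub>R h x) = (LINT x|lborel. deriv \<phi> x *\<^sub>R u x) - (LINT x|lborel. deriv \<phi> x *\<^sub>R G x)"
      unfolding h_def scaleR_diff_right
      by (intro Bochner_Integration.integral_diff test_function_integrable test_function_deriv that u lG)
    then show ?thesis using w[OF that] wG that by (simp add: weakly_diff_def)
  qed
  define c where "c = (LINT x|lborel. \<omega> x *\<^sub>R h x)"
  have lc: "locally_integrable (\<lambda>x. h x - c)"
    using lh locally_integrable_continuous[of "\<lambda>_. c"] unfolding locally_integrable_def
    by (simp add: scaleR_diff_right)
  have "AE x in lborel. h x - c = 0"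
  proof (rule AE_zero_if_orthogonal_to_test_functions[OF lc])
    fix \<psi> assume \<psi>: "\<psi> \<in> test_functions"
    define I where "I = (LINT x|lborel. \<psi> x)"
    define k where "k x = \<psi> x + (- I) * \<omega> x" for x
    have k: "k \<in> test_functions" unfolding k_def[abs_def] by (rule test_function_lincomb[OF \<psi> \<omega>(1)])
    have "(LINT x|lborel. k x) = 0"
      unfolding k_def using \<omega>(2) by (simp add: test_function_lborel_integrable \<psi> \<omega>(1) I_def)
    then obtain \<phi> where \<phi>: "\<phi> \<in> test_functions" "deriv \<phi> = k" using test_function_antiderivative[OF k] by blast
    have "0 = (LINT x|lborel. k x *\<^sub>R h x)" using h0[OF \<phi>(1)] \<phi>(2) by simp
    also have "\<dots> = (LINT x|lborel. \<psi> x *\<^sub>R h x) - I *\<^sub>R c"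
      unfolding k_def c_def by (simp add: scaleR_add_left scaleR_diff_left test_function_integrable \<psi> \<omega>(1) lh flip: scaleR_scaleR)
    finally have "(LINT x|lborel. \<psi> x *\<^sub>R h x) = I *\<^sub>R c" by simp
    moreover have "(LINT x|lborel. \<psi> x *\<^sub>R c) = I *\<^sub>R c"
      unfolding I_def using test_function_lborel_integrable[OF \<psi>] by simp
    ultimately show "(LINT x|lborel. \<psi> x *\<^sub>R (h x - c)) = 0"
      using test_function_integrable[OF \<psi> lh] test_function_integrable[OF \<psi> locally_integrable_continuous[of "\<lambda>_. c"]]
      by (simp add: scaleR_diff_right)
  qed
  then have "AE x in lborel. u x = c + G x" by eventually_elim (simp add: h_def algebra_simps)
  with primitive_of_const_add[OF G] show ?thesis by (rule that)
qed

lemma weakly_diff_unique: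
  assumes "weakly_diff u g" "weakly_diff u g'" shows "AE x in lborel. g x = g' x"
proof -
  have "AE x in lborel. g x - g' x = 0"
  proof (rule AE_zero_if_orthogonal_to_test_functions)
    show "locally_integrable (\<lambda>x. g x - g' x)"
      using assms by (simp add: weakly_diff_def locally_integrable_def scaleR_diff_right)
    fix \<phi> assume "\<phi> \<in> test_functions"
    then show "(LINT x|lborel. \<phi> x *\<^sub>R (g x - g' x)) = 0"
      using assms test_function_integrable[of \<phi> g] test_function_integrable[of \<phi> g']
      by (simp add: weakly_diff_def scaleR_diff_right)
  qed
  then show ?thesis by eventually_elim simp
qed

lemma weak_deriv_weak: "u \<in> H1 \<Longrightarrow> has_weak_L2_derivative u (weak_deriv u)"
  unfolding H1_def weak_deriv_def by (auto intro: someI[of "has_weak_L2_derivative u"])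

lemma weak_deriv_eq:
  assumes "has_weak_L2_derivative u g" shows "AE x in lborel. weak_deriv u x = g x"
  using weak_deriv_weak[of u] assms weakly_diff_unique
  by (auto simp: H1_def has_weak_L2_derivative_iff)

lemma has_weak_L2_derivative_C1:
  assumes "\<And>x. (u has_vector_derivative g x) (at x)" "continuous_on UNIV g" "u \<in> L2" "g \<in> L2"
  shows "has_weak_L2_derivative u g"
  using weakly_diff_primitive[OF primitive_of_C1[OF assms(1,2)]] assms(3,4)
  by (simp add: has_weak_L2_derivative_iff)

lemma has_weak_L2_derivative_linear:
  assumes u: "has_weak_L2_derivative u g" and T: "bounded_linear T"
  shows "has_weak_L2_derivative (\<lambda>x. T (u x)) (\<lambda>x. T (g x))"
proof -
  have uL: "u \<in> L2" "g \<in> L2" and w: "weakly_diff u g" using u by (auto simp: has_weak_L2_derivative_iff)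
  have int: "integrable lborel (\<lambda>x. \<phi> x *\<^sub>R f x)" if "\<phi> \<in> test_functions" "f \<in> L2" for \<phi> and f :: "real \<Rightarrow> complex"
    using that by (intro test_function_integrable L2_locally_integrable)
  have "(LINT x|lborel. deriv \<phi> x *\<^sub>R T (u x)) = - (LINT x|lborel. \<phi> x *\<^sub>R T (g x))" if \<phi>: "\<phi> \<in> test_functions" for \<phi>
  proof -
    have eq: "(LINT x|lborel. \<psi> x *\<^sub>R T (f x)) = T (LINT x|lborel. \<psi> x *\<^sub>R f x)"
      if "\<psi> \<in> test_functions" "f \<in> L2" for \<psi> and f :: "real \<Rightarrow> complex"
      using integral_bounded_linear[OF T int[OF that]] linear_simps(5)[OF T] by simp
    show ?thesis
      using w \<phi> eq[OF test_function_deriv[OF \<phi>] uL(1)] eq[OF \<phi> uL(2)] bounded_linear.linear[OF T, THEN linear_neg]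
      by (simp add: weakly_diff_def)
  qed
  then show ?thesis using uL L2_linear[OF T] by (simp add: has_weak_L2_derivative_def)
qed

lemma has_weak_L2_derivative_add:
  assumes u: "has_weak_L2_derivative u g" and v: "has_weak_L2_derivative v h"
  shows "has_weak_L2_derivative (\<lambda>x. u x + v x) (\<lambda>x. g x + h x)"
proof -
  have L: "u \<in> L2" "g \<in> L2" "v \<in> L2" "h \<in> L2" using u v by (auto simp: has_weak_L2_derivative_def)
  have int: "integrable lborel (\<lambda>x. \<phi> x *\<^sub>R f x)" if "\<phi> \<in> test_functions" "f \<in> L2" for \<phi> and f :: "real \<Rightarrow> complex"
    using that by (intro test_function_integrable L2_locally_integrable)
  show ?thesis
    using u v by (auto simp: has_weak_L2_derivative_def scaleR_add_right int L test_function_deriv intro: L2_add)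
qed

text \<open>For the absolutely continuous representatives, the product and its derivative are
  integrable, being built from products of \<open>L2\<close> functions, so no boundary terms
  survive.\<close>

theorem weak_integration_by_parts:
  assumes u: "has_weak_L2_derivative u p" and v: "has_weak_L2_derivative v q"
  shows "(LINT x|lborel. p x * v x + u x * q x) = 0"
proof -
  have L: "u \<in> L2" "p \<in> L2" "v \<in> L2" "q \<in> L2" using u v by (auto simp: has_weak_L2_derivative_def)
  note [measurable] = L[THEN L2_measurable]
  obtain U where U: "primitive_of U p" "AE x in lborel. u x = U x"
    using u weakly_diff_representative by (metis has_weak_L2_derivative_iff)
  obtain V where V: "primitive_of V q" "AE x in lborel. v x = V x"
    using v weakly_diff_representative by (metis has_weak_L2_derivative_iff)
  note [measurable] = U(1)[THEN primitive_of_measurable] V(1)[THEN primitive_of_measurable]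
  have "integrable lborel (\<lambda>x. u x * v x)" by (intro L2_mult_integrable L)
  then have i1: "integrable lborel (\<lambda>x. U x * V x)"
    by (rule integrable_cong_AE_imp) (use U(2) V(2) in \<open>measurable, auto\<close>)
  have ae: "AE x in lborel. p x * V x + U x * q x = p x * v x + u x * q x"
    using U(2) V(2) by eventually_elim simp
  have "integrable lborel (\<lambda>x. p x * v x + u x * q x)"
    by (intro Bochner_Integration.integrable_add L2_mult_integrable L)
  then have i2: "integrable lborel (\<lambda>x. p x * V x + U x * q x)"
    by (rule integrable_cong_AE_imp) (use ae in \<open>measurable, auto\<close>)
  have "(LINT x|lborel. p x * v x + u x * q x) = (LINT x|lborel. p x * V x + U x * q x)"
    by (rule integral_cong_AE) (use ae in \<open>measurable, auto\<close>)
  then show ?thesis using integral_derivative_zero[OF primitive_of_mult[OF U(1) V(1)] i1 i2] by simp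
qed

lemma weighted_L2_iff:
  assumes "u \<in> L2" shows "u \<in> weighted_L2 \<longleftrightarrow> (\<lambda>x. of_real x * u x) \<in> L2"
proof -
  note [measurable] = L2_measurable[OF assms]
  have "(norm (of_real x * u x))\<^sup>2 = (norm (u x))\<^sup>2 * x\<^sup>2" for x
    by (simp add: norm_mult power_mult_distrib)
  then show ?thesis unfolding weighted_L2_def L2_def by simp
qed

text \<open>The derivative of \<open>x * u * v\<close> integrates to zero, the factor
  \<open>x\<close> being absorbed into one of the \<open>L2\<close> factors. This evaluates the
  commutator of differentiation with multiplication by \<open>x\<close>.\<close>

theorem weak_integration_by_parts_weighted:
  assumes u: "has_weak_L2_derivative u p" and xu: "(\<lambda>x. of_real x * u x) \<in> L2"
    and v: "has_weak_L2_derivative v q" and xv: "(\<lambda>x. of_real x * v x) \<in> L2"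
  shows "(LINT x|lborel. u x * v x + of_real x * (p x * v x + u x * q x)) = 0"
proof -
  have L: "u \<in> L2" "p \<in> L2" "v \<in> L2" "q \<in> L2" using u v by (auto simp: has_weak_L2_derivative_def)
  note [measurable] = L[THEN L2_measurable]
  obtain U where U: "primitive_of U p" "AE x in lborel. u x = U x"
    using u weakly_diff_representative by (metis has_weak_L2_derivative_iff)
  obtain V where V: "primitive_of V q" "AE x in lborel. v x = V x"
    using v weakly_diff_representative by (metis has_weak_L2_derivative_iff)
  note [measurable] = U(1)[THEN primitive_of_measurable] V(1)[THEN primitive_of_measurable]
  have X: "primitive_of (\<lambda>x. of_real x) (\<lambda>x. 1)"
    by (rule primitive_of_C1) (auto intro!: derivative_eq_intros)
  have P: "primitive_of (\<lambda>x. of_real x * (U x * V x)) (\<lambda>x. 1 * (U x * V x) + of_real x * (p x * V x + U x * q x))"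
    by (rule primitive_of_mult[OF X primitive_of_mult[OF U(1) V(1)]])
  have "integrable lborel (\<lambda>x. (of_real x * u x) * v x)" by (intro L2_mult_integrable L xu)
  then have i1: "integrable lborel (\<lambda>x. of_real x * (U x * V x))"
    by (rule integrable_cong_AE_imp) (use U(2) V(2) in \<open>measurable, auto\<close>)
  have ae: "AE x in lborel. 1 * (U x * V x) + of_real x * (p x * V x + U x * q x) = u x * v x + of_real x * (p x * v x + u x * q x)"
    using U(2) V(2) by eventually_elim simp
  have "integrable lborel (\<lambda>x. u x * v x + (p x * (of_real x * v x) + (of_real x * u x) * q x))"
    by (intro Bochner_Integration.integrable_add L2_mult_integrable L xu xv)
  moreover have "u x * v x + (p x * (of_real x * v x) + (of_real x * u x) * q x) =
      u x * v x + of_real x * (p x * v x + u x * q x)" for x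
    by (simp add: algebra_simps)
  ultimately have "integrable lborel (\<lambda>x. u x * v x + of_real x * (p x * v x + u x * q x))" by simp
  then have i2: "integrable lborel (\<lambda>x. 1 * (U x * V x) + of_real x * (p x * V x + U x * q x))"
    by (rule integrable_cong_AE_imp) (use ae in \<open>measurable, auto\<close>)
  have "(LINT x|lborel. u x * v x + of_real x * (p x * v x + u x * q x)) =
      (LINT x|lborel. 1 * (U x * V x) + of_real x * (p x * V x + U x * q x))"
    by (rule integral_cong_AE) (use ae in \<open>measurable, auto\<close>)
  then show ?thesis using integral_derivative_zero[OF P i1 i2] by simp
qed

lemma test_function_L2_continuous:
  fixes F :: "nat \<Rightarrow> real \<Rightarrow> complex"
  assumes \<phi>: "\<phi> \<in> test_functions" and f: "\<And>n. F n \<in> L2" "f \<in> L2"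
    and lim: "(\<lambda>n. L2_norm (\<lambda>x. F n x - f x)) \<longlonglongrightarrow> 0"
  shows "(\<lambda>n. LINT x|lborel. \<phi> x *\<^sub>R F n x) \<longlonglongrightarrow> (LINT x|lborel. \<phi> x *\<^sub>R (f x :: complex))"
proof -
  have int: "integrable lborel (\<lambda>x. \<phi> x *\<^sub>R g x)" if "g \<in> L2" for g :: "real \<Rightarrow> complex"
    using that by (intro test_function_integrable L2_locally_integrable \<phi>)
  have bound: "norm ((LINT x|lborel. \<phi> x *\<^sub>R F n x) - (LINT x|lborel. \<phi> x *\<^sub>R f x)) \<le> L2_norm \<phi> * L2_norm (\<lambda>x. F n x - f x)" for n
  proof -
    have d: "(\<lambda>x. norm (F n x - f x)) \<in> L2"
      by (rule L2_bound1I[OF L2_diff[OF f(1)[of n] f(2)], where K=1])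
         (use L2_measurable[OF f(1)[of n]] L2_measurable[OF f(2)] in auto)
    have a: "(\<lambda>x. \<bar>\<phi> x\<bar>) \<in> L2"
      by (rule L2_bound1I[OF test_function_L2[OF \<phi>], where K=1]) (use test_function_measurable[OF \<phi>] in auto)
    have "(LINT x|lborel. \<phi> x *\<^sub>R F n x) - (LINT x|lborel. \<phi> x *\<^sub>R f x) = (LINT x|lborel. \<phi> x *\<^sub>R (F n x - f x))"
      by (simp add: scaleR_diff_right int f)
    also have "norm \<dots> \<le> (LINT x|lborel. norm (\<phi> x *\<^sub>R (F n x - f x)))" by (rule integral_norm_bound)
    also have "\<dots> = (LINT x|lborel. inner \<bar>\<phi> x\<bar> (norm (F n x - f x)))" by simp
    also have "\<dots> \<le> L2_norm (\<lambda>x. \<bar>\<phi> x\<bar>) * L2_norm (\<lambda>x. norm (F n x - f x))"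
      using L2_Cauchy_Schwarz[OF a d] by linarith
    finally show ?thesis by (simp add: L2_norm_def)
  qed
  have "(\<lambda>n. (LINT x|lborel. \<phi> x *\<^sub>R F n x) - (LINT x|lborel. \<phi> x *\<^sub>R f x)) \<longlonglongrightarrow> 0"
  proof (rule Lim_null_comparison)
    show "eventually (\<lambda>n. norm ((LINT x|lborel. \<phi> x *\<^sub>R F n x) - (LINT x|lborel. \<phi> x *\<^sub>R f x)) \<le> L2_norm \<phi> * L2_norm (\<lambda>x. F n x - f x)) sequentially"
      using bound by simp
    show "(\<lambda>n. L2_norm \<phi> * L2_norm (\<lambda>x. F n x - f x)) \<longlonglongrightarrow> 0"
      using tendsto_mult_right_zero[OF lim] by simp
  qed
  then show ?thesis by (simp add: LIM_zero_iff)
qed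

theorem has_weak_L2_derivative_closed:
  assumes F: "\<And>n. has_weak_L2_derivative (F n) (G n)" and fg: "f \<in> L2" "g \<in> L2"
    and "(\<lambda>n. L2_norm (\<lambda>x. F n x - f x)) \<longlonglongrightarrow> 0" "(\<lambda>n. L2_norm (\<lambda>x. G n x - g x)) \<longlonglongrightarrow> 0"
  shows "has_weak_L2_derivative f g"
  unfolding has_weak_L2_derivative_def
proof (intro conjI ballI fg)
  fix \<phi> assume \<phi>: "\<phi> \<in> test_functions"
  have L: "F n \<in> L2" "G n \<in> L2" for n using F by (auto simp: has_weak_L2_derivative_def)
  have "(\<lambda>n. LINT x|lborel. deriv \<phi> x *\<^sub>R F n x) \<longlonglongrightarrow> (LINT x|lborel. deriv \<phi> x *\<^sub>R f x)"
    by (intro test_function_L2_continuous test_function_deriv \<phi> L fg assms)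
  moreover have "(\<lambda>n. - (LINT x|lborel. \<phi> x *\<^sub>R G n x)) \<longlonglongrightarrow> - (LINT x|lborel. \<phi> x *\<^sub>R g x)"
    by (intro tendsto_minus test_function_L2_continuous \<phi> L fg assms)
  moreover have "(LINT x|lborel. deriv \<phi> x *\<^sub>R F n x) = - (LINT x|lborel. \<phi> x *\<^sub>R G n x)" for n
    using F[of n] \<phi> by (simp add: has_weak_L2_derivative_def)
  ultimately show "(LINT x|lborel. deriv \<phi> x *\<^sub>R f x) = - (LINT x|lborel. \<phi> x *\<^sub>R g x)"
    using LIMSEQ_unique by force
qed

text \<open>A cut-off turns a local weak derivative into a global one: only the product of
  \<open>\<eta>\<close> and \<open>g\<close> has to be square integrable, not \<open>g\<close>
  itself.\<close>

lemma weakly_diff_cutoff: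
  assumes w: "weakly_diff w g" "w \<in> L2" and \<eta>: "\<eta> \<in> test_functions"
    and L: "(\<lambda>x. \<eta> x *\<^sub>R g x) \<in> L2"
  shows "has_weak_L2_derivative (\<lambda>x. \<eta> x *\<^sub>R w x) (\<lambda>x. deriv \<eta> x *\<^sub>R w x + \<eta> x *\<^sub>R g x)"
proof -
  have mult_L2: "(\<lambda>x. \<psi> x *\<^sub>R w x) \<in> L2" if "\<psi> \<in> test_functions" for \<psi>
  proof -
    from test_function_bounded[OF that] obtain B where B: "\<And>x. \<bar>\<psi> x\<bar> \<le> B" by blast
    show ?thesis
      by (rule L2_bound1I[OF w(2), of _ B])
         (use B test_function_measurable[OF that] L2_measurable[OF w(2)] in \<open>auto intro!: mult_right_mono\<close>)
  qed
  note \<eta>' = test_function_deriv[OF \<eta>]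
  have lw: "locally_integrable w" and lg: "locally_integrable g" using w by (auto simp: weakly_diff_def)
  have "(LINT x|lborel. deriv \<phi> x *\<^sub>R (\<eta> x *\<^sub>R w x)) = - (LINT x|lborel. \<phi> x *\<^sub>R (deriv \<eta> x *\<^sub>R w x + \<eta> x *\<^sub>R g x))"
    if \<phi>: "\<phi> \<in> test_functions" for \<phi>
  proof -
    note \<phi>' = test_function_deriv[OF \<phi>]
    have t: "(\<lambda>x. \<phi> x * \<eta> x) \<in> test_functions" by (rule test_function_mult[OF \<phi> \<eta>])
    have d: "deriv (\<lambda>x. \<phi> x * \<eta> x) x = deriv \<phi> x * \<eta> x + deriv \<eta> x * \<phi> x" for x
      by (intro DERIV_imp_deriv DERIV_mult test_function_DERIV \<phi> \<eta>)
    have i: "integrable lborel (\<lambda>x. (deriv \<phi> x * \<eta> x) *\<^sub>R w x)" "integrable lborel (\<lambda>x. (deriv \<eta> x * \<phi> x) *\<^sub>R w x)"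
      "integrable lborel (\<lambda>x. (\<phi> x * \<eta> x) *\<^sub>R g x)"
      by (intro test_function_integrable test_function_mult \<phi> \<phi>' \<eta> \<eta>' lw lg)+
    have "(LINT x|lborel. (deriv \<phi> x * \<eta> x + deriv \<eta> x * \<phi> x) *\<^sub>R w x) = - (LINT x|lborel. (\<phi> x * \<eta> x) *\<^sub>R g x)"
      using w(1) t unfolding weakly_diff_def d[symmetric] by blast
    then have "(LINT x|lborel. (deriv \<phi> x * \<eta> x) *\<^sub>R w x) + (LINT x|lborel. (deriv \<eta> x * \<phi> x) *\<^sub>R w x) =
        - (LINT x|lborel. (\<phi> x * \<eta> x) *\<^sub>R g x)"
      by (simp only: scaleR_add_left Bochner_Integration.integral_add[OF i(1,2)])
    moreover have "(LINT x|lborel. \<phi> x *\<^sub>R (deriv \<eta> x *\<^sub>R w x + \<eta> x *\<^sub>R g x)) =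
        (LINT x|lborel. (deriv \<eta> x * \<phi> x) *\<^sub>R w x) + (LINT x|lborel. (\<phi> x * \<eta> x) *\<^sub>R g x)"
      by (subst Bochner_Integration.integral_add[OF i(2,3), symmetric])
         (simp add: scaleR_add_right mult.commute)
    moreover have "a = - (b + c)" if "a + b = - c" for a b c :: complex
      using that by (metis add.commute add_diff_cancel_right' minus_add_distrib uminus_add_conv_diff)
    ultimately show ?thesis by simp
  qed
  then show ?thesis using mult_L2[OF \<eta>] mult_L2[OF \<eta>'] L
    by (simp add: has_weak_L2_derivative_def L2_add)
qed

section \<open>The a priori estimate\<close>

text \<open>The worst case of the comparison with \<open>\<theta> = 0\<close>, scaled to \<open>cos (\<theta> / 2) = 1\<close>. The two
  bounds on \<open>\<eta>\<close> do not suffice here; the spectral gap \<open>sqrt 2\<close> of the oscillator (\<open>gap\<close>) is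
  needed. The hypotheses force \<open>x - m > 1 / 2\<close> and \<open>q < 1 / 20\<close>, which is incompatible with \<open>gap\<close>.\<close>

lemma residual_region_contradiction:
  fixes x m q a \<alpha> \<beta> \<eta> :: real
  assumes "0 < x" "0 \<le> m" "0 \<le> q" "0 \<le> \<alpha>" "0 \<le> \<beta>" "\<alpha>\<^sup>2 + \<beta>\<^sup>2 = 1" "\<eta> = \<alpha>\<^sup>2 - \<beta>\<^sup>2"
    and eta: "m\<^sup>2 + m * x + 3 * q * m + 2 * q * x < \<eta>" "x * \<eta> \<le> m + q"
    and gap: "sqrt 2 * \<beta> \<le> (x - m) * \<alpha> + q"
    and x2: "2 / 3 < x\<^sup>2" and R: "2 < (x - m) * (3 * x + m)"
  shows False
proof -
  define a where "a = x - m"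
  have a0: "0 < a" using R assms(1,2) by (simp add: a_def zero_less_mult_iff) (smt (verit) zero_less_mult_iff)
  \<comment> \<open>The first bound on \<open>\<eta>\<close>, multiplied by \<open>x\<close>, is
    chained with the second, which eliminates \<open>\<eta>\<close>.\<close>
  have iv: "q * (2 * x\<^sup>2 - 1 + 3 * m * x) < m * (1 - x\<^sup>2 - x * m)"
  proof -
    have "x * (m\<^sup>2 + m * x + 3 * q * m + 2 * q * x) < x * \<eta>" using eta(1) \<open>0 < x\<close> by simp
    also have "\<dots> \<le> m + q" by (rule eta(2))
    finally show ?thesis by (simp add: algebra_simps power2_eq_square)
  qed
  have "0 \<le> q * (2 * x\<^sup>2 - 1 + 3 * m * x)" using assms(1-3) x2 by (intro mult_nonneg_nonneg add_nonneg_nonneg) auto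
  with iv have "0 < m * (1 - x\<^sup>2 - x * m)" by linarith
  then have xm: "x\<^sup>2 + x * m < 1" and m0: "0 < m" using \<open>0 \<le> m\<close> by (auto simp: zero_less_mult_iff)
  have "0 < x * m" using m0 \<open>0 < x\<close> by simp
  then have "x\<^sup>2 < 1" using xm by linarith
  then have x1: "x < 1" using \<open>0 < x\<close> by (simp add: power2_eq_square) (smt (verit) mult_le_cancel_left1)
  have x8: "4 / 5 < x"
  proof (rule ccontr)
    assume "\<not> 4 / 5 < x"
    then have "x\<^sup>2 \<le> (4 / 5)\<^sup>2" using \<open>0 < x\<close> by (intro power_mono) auto
    then show False using x2 by (simp add: power2_eq_square)
  qed
  have ax: "a < x" using m0 by (simp add: a_def)
  have "3 * x + m < 4" using a0 x1 m0 by (simp add: a_def)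
  then have "a * (3 * x + m) \<le> a * 4" using a0 by simp
  then have a5: "1 / 2 < a" using R by (simp add: a_def)
  have q5: "q < 1 / 20"
  proof -
    define e where "e = x * m"
    have "e > 0" using \<open>0 < x * m\<close> by (simp add: e_def)
    have "x * (q * (2 * x\<^sup>2 - 1 + 3 * m * x)) < x * (m * (1 - x\<^sup>2 - x * m))" using iv \<open>0 < x\<close> by simp
    moreover have "x * (m * (1 - x\<^sup>2 - x * m)) \<le> e * (1 / 3 - e)"
    proof -
      have "x * (m * (1 - x\<^sup>2 - x * m)) = e * (1 - x\<^sup>2 - e)" by (simp add: e_def)
      also have "\<dots> \<le> e * (1 / 3 - e)" using x2 \<open>e > 0\<close> by (intro mult_left_mono) auto
      finally show ?thesis .
    qed
    moreover have "(x * q) * (1 / 3 + 3 * e) \<le> x * (q * (2 * x\<^sup>2 - 1 + 3 * m * x))"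
    proof -
      have "(x * q) * (1 / 3 + 3 * e) \<le> (x * q) * (2 * x\<^sup>2 - 1 + 3 * e)"
        using x2 \<open>0 < x\<close> \<open>0 \<le> q\<close> by (intro mult_left_mono) auto
      then show ?thesis by (simp add: e_def algebra_simps)
    qed
    \<comment> \<open>The quotient \<open>e * (1 / 3 - e) / (1 / 3 + 3 * e)\<close> has the maximum
      \<open>1 / 27\<close>; the rounder bound \<open>1 / 25\<close> leads to a parabola with vertex
      at \<open>8 / 75\<close>.\<close>
    moreover have "e * (1 / 3 - e) \<le> (1 / 25) * (1 / 3 + 3 * e)"
    proof -
      have "0 \<le> (e - 8 / 75)\<^sup>2" by simp
      then show ?thesis by (simp add: power2_eq_square algebra_simps)
    qed
    ultimately have "(x * q) * (1 / 3 + 3 * e) < (1 / 25) * (1 / 3 + 3 * e)" by linarith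
    then have "x * q < 1 / 25" using \<open>e > 0\<close> by (simp add: mult_less_cancel_right)
    moreover have "4 / 5 * q \<le> x * q" using x8 \<open>0 \<le> q\<close> by (intro mult_right_mono) auto
    ultimately show ?thesis by simp
  qed
  have al1: "\<alpha> \<le> 1" using assms(6) by (simp add: power2_eq_square) (smt (verit) mult_less_cancel_right1 zero_le_mult_iff assms(4))
  have "2 * \<beta>\<^sup>2 \<le> (a * \<alpha> + q)\<^sup>2"
  proof -
    have "(sqrt 2 * \<beta>)\<^sup>2 \<le> (a * \<alpha> + q)\<^sup>2" using gap assms(5) by (intro power_mono) (auto simp: a_def)
    then show ?thesis by (simp add: power_mult_distrib)
  qed
  also have "\<dots> = a\<^sup>2 * \<alpha>\<^sup>2 + 2 * (a * q) * \<alpha> + q\<^sup>2" by (simp add: power2_sum power_mult_distrib)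
  also have "2 * (a * q) * \<alpha> \<le> 2 * (a * q) * 1" using al1 a0 \<open>0 \<le> q\<close> by (intro mult_left_mono) auto
  finally have 1: "2 * \<beta>\<^sup>2 \<le> a\<^sup>2 * \<alpha>\<^sup>2 + 2 * (a * q) + q\<^sup>2" by simp
  have al: "\<alpha>\<^sup>2 = (1 + \<eta>) / 2" and be: "\<beta>\<^sup>2 = (1 - \<eta>) / 2" using assms(6,7) by auto
  have "1 - \<eta> \<le> a\<^sup>2 * (1 + \<eta>) / 2 + 2 * (a * q) + q\<^sup>2" using 1 unfolding al be by simp
  then have "x * (1 - \<eta>) \<le> x * (a\<^sup>2 * (1 + \<eta>) / 2 + 2 * (a * q) + q\<^sup>2)" using \<open>0 < x\<close> by simp
  then have "2 * x \<le> a\<^sup>2 * (x + x * \<eta>) + 2 * (x * \<eta>) + 4 * x * a * q + 2 * x * q\<^sup>2" by (simp add: field_simps)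
  also have "\<dots> \<le> a\<^sup>2 * (x + (m + q)) + 2 * (m + q) + 4 * x * a * q + 2 * x * q\<^sup>2"
    using mult_left_mono[OF eta(2), of "a\<^sup>2"] eta(2) by (simp add: algebra_simps)
  finally have 2: "2 * a \<le> a\<^sup>2 * (x + m) + a\<^sup>2 * q + 2 * q + 4 * x * a * q + 2 * x * q\<^sup>2"
    by (simp add: a_def algebra_simps)
  have "a\<^sup>2 * (x + m) \<le> a"
  proof -
    have "a * (x + m) = x\<^sup>2 - m\<^sup>2" by (simp add: a_def algebra_simps power2_eq_square)
    also have "\<dots> \<le> 1" using \<open>x\<^sup>2 < 1\<close> by (simp add: power2_eq_square) (smt (verit) zero_le_square)
    finally have "a * (a * (x + m)) \<le> a * 1" using a0 by (intro mult_left_mono) auto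
    then show ?thesis by (simp add: power2_eq_square)
  qed
  moreover have "a\<^sup>2 * q \<le> 1 * q" using ax x1 a0 \<open>0 \<le> q\<close> by (intro mult_right_mono) (auto simp: power2_eq_square intro: mult_le_one)
  moreover have "x * a * q \<le> 1 * q" using ax x1 a0 \<open>0 < x\<close> \<open>0 \<le> q\<close> by (intro mult_right_mono mult_le_one) auto
  moreover have "x * q\<^sup>2 \<le> 1 * q"
  proof -
    have "x * q \<le> 1" using x1 q5 \<open>0 < x\<close> \<open>0 \<le> q\<close> by (intro mult_le_one) auto
    then have "x * q * q \<le> 1 * q" using \<open>0 \<le> q\<close> by (intro mult_right_mono) auto
    then show ?thesis by (simp add: power2_eq_square)
  qed
  \<comment> \<open>The four remaining terms contribute one, two, four and two copies of
    \<open>q\<close>; the contradiction is \<open>9 / 20 < 1 / 2\<close>.\<close>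
  ultimately have "a \<le> q * 9" using 2 by linarith
  then show False using a5 q5 by linarith
qed

text \<open>For normalised spinors, \<open>\<alpha>\<close> and \<open>\<beta>\<close> are the norms
  of the components, \<open>q\<close> that of the residual of the self-adjoint model at
  \<open>x = Re z\<close>, and \<open>E\<close> the squared norm of the model with mass. If the
  bound failed, the chirality \<open>\<eta>\<close> would be large, while \<open>anti\<close> pins
  \<open>x * \<eta>\<close> to \<open>m\<close> up to \<open>q\<close>. The hypothesis
  \<open>neg\<close> describes the range not treated by completing squares; it keeps
  \<open>x\<close> away from \<open>m\<close>, and the two demands become incompatible.\<close>

lemma perturbation_bound_or_square_bound:
  fixes x m y q \<alpha> \<beta> \<eta> C E c :: real
  assumes m: "0 \<le> m" and y: "0 < y" and q: "0 \<le> q" and ab: "0 \<le> \<alpha>" "0 \<le> \<beta>" "\<alpha>\<^sup>2 + \<beta>\<^sup>2 = 1"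
    and eta: "\<eta> = \<alpha>\<^sup>2 - \<beta>\<^sup>2" and C: "0 < C" "C \<le> 1" and c: "0 < c" "c\<^sup>2 = (1 + C) / 2"
    and E: "E \<le> (q + \<bar>x\<bar>)\<^sup>2" and anti: "\<bar>x * \<eta> - m\<bar> \<le> q"
    and gap: "sqrt 2 * c * \<beta> \<le> \<bar>x - m\<bar> * \<alpha> + q"
    and neg: "2 + (m - x) * (m * (2 - C) + x * (2 + C)) < 0"
  shows "E - m\<^sup>2 + 2 * c\<^sup>2 * \<eta> \<le> ((y + \<bar>x\<bar> + m) / y)\<^sup>2 * (q\<^sup>2 + y\<^sup>2)"
proof (rule ccontr)
  assume not: "\<not> ?thesis"
  define X where "X = \<bar>x\<bar> + m"
  have X0: "0 \<le> X" using m by (simp add: X_def)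
  \<comment> \<open>Replaces a minimisation over \<open>y\<close>: the right-hand side is
    nonnegative, and \<open>y\<close> does not occur in what follows.\<close>
  have "((y + X) / y)\<^sup>2 * (q\<^sup>2 + y\<^sup>2) - ((q + X)\<^sup>2 + 4 * q * X) = (y - X * q / y)\<^sup>2 + 2 * X / y * (q - y)\<^sup>2"
    using y by (simp add: field_simps power2_eq_square)
  then have "(q + X)\<^sup>2 + 4 * q * X \<le> ((y + X) / y)\<^sup>2 * (q\<^sup>2 + y\<^sup>2)"
    using X0 y by (smt (verit) zero_le_power2 mult_nonneg_nonneg divide_nonneg_pos)
  with not have "(q + X)\<^sup>2 + 4 * q * X < E - m\<^sup>2 + 2 * c\<^sup>2 * \<eta>" by (simp add: X_def add.assoc)
  with E have "(q + X)\<^sup>2 + 4 * q * X - (q + \<bar>x\<bar>)\<^sup>2 + m\<^sup>2 < 2 * c\<^sup>2 * \<eta>" by linarith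
  then have eta1: "m\<^sup>2 + m * \<bar>x\<bar> + 3 * q * m + 2 * q * \<bar>x\<bar> < c\<^sup>2 * \<eta>"
    by (simp add: X_def power2_eq_square algebra_simps)
  have c1: "c\<^sup>2 \<le> 1" using C c by simp
  have "0 < c\<^sup>2" using c by simp
  consider "x < 0" | "x = 0" | "0 < x" by linarith
  then show False
  proof cases
    case 1
    define w where "w = - x"
    have w: "0 < w" "\<bar>x\<bar> = w" using 1 by (auto simp: w_def)
    have "2 < (w + m) * (w * (2 + C) - m * (2 - C))" using neg by (simp add: w_def algebra_simps)
    \<comment> \<open>The factor \<open>2 - C\<close> turns the product into a difference of two
      squares.\<close>
    then have "(2 - C) * 2 < (2 - C) * ((w + m) * (w * (2 + C) - m * (2 - C)))"
      using C by (intro mult_strict_left_mono) auto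
    also have "\<dots> = 4 * w\<^sup>2 - ((2 - C) * m - C * w)\<^sup>2" by (simp add: algebra_simps power2_eq_square)
    also have "\<dots> \<le> 4 * w\<^sup>2" by simp
    finally have "2 - C < 2 * w\<^sup>2" by simp
    then have cw: "c\<^sup>2 \<le> 2 * w\<^sup>2" using c C by simp
    have "w * (m\<^sup>2 + m * w + 3 * q * m + 2 * q * w) < w * (c\<^sup>2 * \<eta>)" using eta1 w by simp
    moreover have "w * (c\<^sup>2 * \<eta>) \<le> c\<^sup>2 * q"
    proof -
      have "w * \<eta> \<le> q" using anti m by (simp add: w_def abs_le_iff)
      then have "c\<^sup>2 * (w * \<eta>) \<le> c\<^sup>2 * q" by (intro mult_left_mono) auto
      then show ?thesis by (simp add: algebra_simps)
    qed
    moreover have "c\<^sup>2 * q \<le> 2 * w\<^sup>2 * q" using cw q by (intro mult_right_mono)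
    moreover have "0 \<le> w * m\<^sup>2" "0 \<le> m * w * w" "0 \<le> w * q * m" using w m q by auto
    ultimately show False by (simp add: algebra_simps power2_eq_square)
  next
    case 2
    then have "2 + m * m * (2 - C) < 0" using neg by simp
    moreover have "0 \<le> m * m * (2 - C)" using C by simp
    ultimately show False by linarith
  next
    case 3
    have prod: "2 < (x - m) * (m * (2 - C) + x * (2 + C))" using neg by (simp add: algebra_simps)
    have "0 < m * (2 - C) + x * (2 + C)" using 3 m C by (intro add_nonneg_pos) auto
    with prod have xm: "m < x" by (smt (verit) mult_nonpos_nonneg)
    have R: "2 * c\<^sup>2 < (x - m) * (3 * x + m)"
    proof -
      have "c\<^sup>2 * 2 < c\<^sup>2 * ((x - m) * (m * (2 - C) + x * (2 + C)))" using prod \<open>0 < c\<^sup>2\<close> by (intro mult_strict_left_mono)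
      also have "\<dots> = (x - m) * ((1 + C) / 2 * (m * (2 - C) + x * (2 + C)))" by (simp add: c(2))
      also have "\<dots> \<le> (x - m) * (3 * x + m)"
      proof (intro mult_left_mono)
        have "C * m \<le> (4 + C) * x" using xm C m 3 by (intro mult_mono) auto
        then have "(1 - C) * (C * m) \<le> (1 - C) * ((4 + C) * x)" using C by (intro mult_left_mono) auto
        then show "(1 + C) / 2 * (m * (2 - C) + x * (2 + C)) \<le> 3 * x + m" by (simp add: field_simps)
      qed (use xm in simp)
      finally show ?thesis by simp
    qed
    have x2: "2 / 3 * c\<^sup>2 < x\<^sup>2"
    proof -
      have "(x - m) * (3 * x + m) = 3 * x\<^sup>2 - 2 * x * m - m\<^sup>2" by (simp add: algebra_simps power2_eq_square)
      moreover have "0 \<le> x * m" using 3 m by simp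
      moreover have "0 \<le> m\<^sup>2" by simp
      ultimately show ?thesis using R by linarith
    qed
    \<comment> \<open>All inequalities are homogeneous under this scaling, which reduces to
      \<open>c = 1\<close>.\<close>
    define x' m' q' where "x' = x / c" "m' = m / c" "q' = q / c"
    have eq: "x = c * x'" "m = c * m'" "q = c * q'" using c by (auto simp: x'_m'_q'_def)
    show False
    proof (rule residual_region_contradiction[of x' m' q' \<alpha> \<beta> \<eta>])
      show "0 < x'" "0 \<le> m'" "0 \<le> q'" using 3 m q c by (auto simp: x'_m'_q'_def)
      have "c\<^sup>2 * (m'\<^sup>2 + m' * x' + 3 * q' * m' + 2 * q' * x') < c\<^sup>2 * \<eta>"
      proof -
        have "m\<^sup>2 + m * x + 3 * q * m + 2 * q * x < c\<^sup>2 * \<eta>" using eta1 3 by simp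
        then show ?thesis unfolding eq by (simp add: power2_eq_square algebra_simps)
      qed
      then show "m'\<^sup>2 + m' * x' + 3 * q' * m' + 2 * q' * x' < \<eta>" using \<open>0 < c\<^sup>2\<close> by simp
      have "c * (x' * \<eta>) \<le> c * (m' + q')" using anti unfolding eq by (simp add: algebra_simps)
      then show "x' * \<eta> \<le> m' + q'" using c by simp
      have "c * (sqrt 2 * \<beta>) \<le> c * ((x' - m') * \<alpha> + q')" using gap xm unfolding eq using c by (simp add: algebra_simps)
      then show "sqrt 2 * \<beta> \<le> (x' - m') * \<alpha> + q'" using c by simp
      have "c\<^sup>2 * (2 / 3) < c\<^sup>2 * x'\<^sup>2" using x2 unfolding eq by (simp add: power_mult_distrib)
      then show "2 / 3 < x'\<^sup>2" using \<open>0 < c\<^sup>2\<close> by (simp only: mult_less_cancel_left_pos)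
      have "c\<^sup>2 * 2 < c\<^sup>2 * ((x' - m') * (3 * x' + m'))" using R unfolding eq by (simp add: algebra_simps power2_eq_square)
      then show "2 < (x' - m') * (3 * x' + m')" using \<open>0 < c\<^sup>2\<close> by (simp only: mult_less_cancel_left_pos)
    qed (use ab eta in auto)
  qed
qed

text \<open>\<open>A\<^sup>+\<close> equals \<open>C\<close> times the formal adjoint of
  \<open>A\<close> minus \<open>\<i> * S\<close> times the formal adjoint of
  \<open>A\<^sup>+\<close>, and replacing \<open>A\<^sup>+\<close> by its adjoint under the norm
  costs the commutator \<open>2 * C\<close>. Shifting the first part of the mixed term from
  \<open>u2\<close> to \<open>u1\<close> allows both rows to be completed to squares. The last two
  lines are derivatives that integrate to zero; the remainder is diagonal in \<open>u1\<close> and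
  \<open>u2\<close>.\<close>

lemma sum_of_squares_identity:
  fixes u1 u2 p1 p2 z E :: complex and x m C S :: real
  assumes E: "cmod E = 1" and CS: "E\<^sup>2 = Complex C S"
  defines "\<omega> \<equiv> \<i> * S * (m - z)" and "\<omega>' \<equiv> C * (m - cnj z) - (m + z)"
  shows "(cmod ((- \<i> * cnj E) * p2 + (\<i> * E) * (x * u2) + (m - z) * u1))\<^sup>2 +
      (cmod ((- \<i> * cnj E) * p1 - (\<i> * E) * (x * u1) - (m + z) * u2))\<^sup>2 =
      (cmod ((- \<i> * E) * p2 - (\<i> * cnj E) * (x * u2) + \<omega> * u1))\<^sup>2 +
      (cmod ((- \<i> * cnj E) * p1 - (\<i> * E) * (x * u1) + \<omega>' * u2))\<^sup>2 +
      C\<^sup>2 * (cmod (m - z))\<^sup>2 * (cmod u1)\<^sup>2 +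
      ((cmod (m + z))\<^sup>2 + 2 * C - (cmod \<omega>')\<^sup>2) * (cmod u2)\<^sup>2 -
      2 * C * ((cmod u2)\<^sup>2 + 2 * x * Re (cnj u2 * p2)) +
      Re (2 * (m - cnj z) * C * (- \<i> * E) * (cnj p1 * u2 + cnj u1 * p2))"
proof -
  have nsq: "(cmod (v + w))\<^sup>2 = (cmod v)\<^sup>2 + (cmod w)\<^sup>2 + 2 * Re (cnj v * w)" for v w
    unfolding cmod_power2 by (simp add: power2_eq_square algebra_simps)
  have nsq': "(cmod (v - w))\<^sup>2 = (cmod v)\<^sup>2 + (cmod w)\<^sup>2 - 2 * Re (cnj v * w)" for v w
    unfolding cmod_power2 by (simp add: power2_eq_square algebra_simps)
  define a where "a = Re E"
  define b where "b = Im E"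
  have ab: "a\<^sup>2 + b\<^sup>2 = 1" using E by (simp add: a_def b_def cmod_def)
  have Eab: "E = Complex a b" by (simp add: a_def b_def)
  have C: "C = a\<^sup>2 - b\<^sup>2" and S: "S = 2 * a * b"
    using CS by (simp_all add: Eab complex_eq_iff power2_eq_square)
  have CS1: "C\<^sup>2 + S\<^sup>2 = 1"
  proof -
    have "C\<^sup>2 + S\<^sup>2 = (a\<^sup>2 + b\<^sup>2)\<^sup>2" by (simp add: C S power2_eq_square algebra_simps)
    then show ?thesis by (simp add: ab)
  qed
  define Ap where "Ap = (- \<i> * cnj E) * p2 + (\<i> * E) * (x * u2)"
  \<comment> \<open>\<open>At\<close> and \<open>As\<close> apply to \<open>u2\<close> the formal
    adjoints of the operators occurring in \<open>Ap\<close> and \<open>Am\<close>.\<close>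
  define At where "At = (- \<i> * E) * p2 - (\<i> * cnj E) * (x * u2)"
  define Am where "Am = (- \<i> * cnj E) * p1 - (\<i> * E) * (x * u1)"
  define As where "As = (- \<i> * E) * p2 + (\<i> * cnj E) * (x * u2)"
  define d where "d = cnj p1 * u2 + cnj u1 * p2"
  have E2: "E * E = Complex C S" using CS by (simp add: power2_eq_square)
  have Ecnj: "E * cnj E = 1" using E by (metis complex_norm_square of_real_1 one_power2)
  have Ap: "Ap = C * As - \<i> * S * At"
  proof -
    have 1: "(C - \<i> * S) * E = cnj E"
    proof -
      have "C - \<i> * S = cnj (E * E)" by (simp add: E2 complex_eq_iff)
      then show ?thesis using Ecnj by (simp add: mult.assoc) (simp add: mult.commute)
    qed
    have 2: "(C + \<i> * S) * cnj E = E"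
    proof -
      have "C + \<i> * S = E * E" by (simp add: E2 complex_eq_iff)
      then show ?thesis using Ecnj by (simp add: mult.assoc)
    qed
    have "C * As - \<i> * S * At = (- \<i> * ((C - \<i> * S) * E)) * p2 + (\<i> * ((C + \<i> * S) * cnj E)) * (x * u2)"
      by (simp add: As_def At_def algebra_simps)
    then show ?thesis unfolding 1 2 Ap_def by simp
  qed
  have n1: "(cmod Ap)\<^sup>2 = (cmod At)\<^sup>2 + 2 * C * (cmod u2)\<^sup>2 - 2 * C * ((cmod u2)\<^sup>2 + 2 * x * Re (cnj u2 * p2))"
    unfolding Ap_def At_def Eab C cmod_power2 by (simp add: power2_eq_square algebra_simps)
  have adj: "cnj u1 * As = cnj (cnj u2 * Am) + (- \<i> * E) * d"
    by (simp add: As_def Am_def d_def algebra_simps)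
  have "cnj ((m - z) * u1) * Ap = (m - cnj z) * C * (cnj u1 * As) + cnj (\<omega> * u1) * At"
    by (simp add: Ap \<omega>_def algebra_simps)
  then have "Re (cnj ((m - z) * u1) * Ap) = Re ((m - cnj z) * C * cnj (cnj u2 * Am)) +
      Re ((m - cnj z) * C * (- \<i> * E) * d) + Re (cnj (\<omega> * u1) * At)"
    by (simp only: adj distrib_left mult.assoc plus_complex.simps)
  moreover have "Re ((m - cnj z) * C * cnj (cnj u2 * Am)) = Re (cnj (C * (m - cnj z) * u2) * Am)"
    by (simp add: algebra_simps)
  ultimately have cross: "Re (cnj Ap * ((m - z) * u1)) - Re (cnj Am * ((m + z) * u2)) =
      Re (cnj At * (\<omega> * u1)) + Re (cnj Am * (\<omega>' * u2)) + Re ((m - cnj z) * C * (- \<i> * E) * d)"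
  proof -
    assume 1: "Re (cnj ((m - z) * u1) * Ap) = Re ((m - cnj z) * C * cnj (cnj u2 * Am)) +
      Re ((m - cnj z) * C * (- \<i> * E) * d) + Re (cnj (\<omega> * u1) * At)"
      and 2: "Re ((m - cnj z) * C * cnj (cnj u2 * Am)) = Re (cnj (C * (m - cnj z) * u2) * Am)"
    have sym: "Re (cnj v * w) = Re (cnj w * v)" for v w by (simp add: algebra_simps)
    have 3: "Re (cnj Am * (\<omega>' * u2)) = Re (cnj Am * (C * (m - cnj z) * u2)) - Re (cnj Am * ((m + z) * u2))"
      by (simp add: \<omega>'_def algebra_simps)
    show ?thesis unfolding 3 using 1 2 sym[of Ap "(m - z) * u1"] sym[of At "\<omega> * u1"]
        sym[of Am "C * (m - cnj z) * u2"] by linarith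
  qed
  have \<omega>2: "(cmod (\<omega> * u1))\<^sup>2 = S\<^sup>2 * (cmod (m - z))\<^sup>2 * (cmod u1)\<^sup>2"
    by (simp add: \<omega>_def norm_mult power_mult_distrib)
  have "(cmod (Ap + (m - z) * u1))\<^sup>2 + (cmod (Am - (m + z) * u2))\<^sup>2 =
      (cmod (At + \<omega> * u1))\<^sup>2 + (cmod (Am + \<omega>' * u2))\<^sup>2 +
      C\<^sup>2 * (cmod (m - z))\<^sup>2 * (cmod u1)\<^sup>2 +
      ((cmod (m + z))\<^sup>2 + 2 * C - (cmod \<omega>')\<^sup>2) * (cmod u2)\<^sup>2 -
      2 * C * ((cmod u2)\<^sup>2 + 2 * x * Re (cnj u2 * p2)) +
      2 * Re ((m - cnj z) * C * (- \<i> * E) * d)"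
  proof -
    have C2: "C\<^sup>2 = 1 - S\<^sup>2" using CS1 by simp
    have e1: "(cmod ((m - z) * u1))\<^sup>2 = (cmod (m - z))\<^sup>2 * (cmod u1)\<^sup>2"
      and e2: "(cmod ((m + z) * u2))\<^sup>2 = (cmod (m + z))\<^sup>2 * (cmod u2)\<^sup>2"
      and e3: "(cmod (\<omega>' * u2))\<^sup>2 = (cmod \<omega>')\<^sup>2 * (cmod u2)\<^sup>2"
      by (simp_all only: norm_mult power_mult_distrib)
    have e4: "C\<^sup>2 * (cmod (m - z))\<^sup>2 * (cmod u1)\<^sup>2 =
        (cmod (m - z))\<^sup>2 * (cmod u1)\<^sup>2 - S\<^sup>2 * (cmod (m - z))\<^sup>2 * (cmod u1)\<^sup>2"
      by (simp only: C2 left_diff_distrib mult_1_left)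
    have e5: "((cmod (m + z))\<^sup>2 + 2 * C - (cmod \<omega>')\<^sup>2) * (cmod u2)\<^sup>2 =
        (cmod (m + z))\<^sup>2 * (cmod u2)\<^sup>2 + 2 * C * (cmod u2)\<^sup>2 - (cmod \<omega>')\<^sup>2 * (cmod u2)\<^sup>2"
      by (simp only: left_diff_distrib distrib_right)
    show ?thesis
      using nsq[of Ap "(m - z) * u1"] nsq'[of Am "(m + z) * u2"] nsq[of At "\<omega> * u1"]
        nsq[of Am "\<omega>' * u2"] n1 \<omega>2 e1 e2 e3 e4 e5 cross
      by linarith
  qed
  moreover have "Re (2 * (m - cnj z) * C * (- \<i> * E) * d) = 2 * Re ((m - cnj z) * C * (- \<i> * E) * d)"
    by (simp only: mult.assoc) simp
  ultimately show ?thesis by (simp only: Ap_def At_def Am_def d_def)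
qed

section \<open>Integral identities for a pair of components\<close>

lemma L2_Pair:
  fixes f :: "real \<Rightarrow> 'a::euclidean_space" and g :: "real \<Rightarrow> 'b::euclidean_space"
  assumes "f \<in> L2" "g \<in> L2" shows "(\<lambda>x. (f x, g x)) \<in> L2"
  by (rule L2_boundI[OF assms, where K=1 and M=1])
     (use L2_measurable[OF assms(1)] L2_measurable[OF assms(2)] norm_Pair_le in auto)

lemma L2_norm_Pair:
  assumes "f \<in> L2" "g \<in> L2" shows "(L2_norm (\<lambda>x. (f x, g x)))\<^sup>2 = (L2_norm f)\<^sup>2 + (L2_norm g)\<^sup>2"
  using assms by (simp add: L2_norm_power2 norm_Pair L2_integrable)

text \<open>The derivatives are parameters of their own, so that sums and differences can be formed
  without returning to the choice made by \<open>weak_deriv\<close>.\<close>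

locale weak_pair =
  fixes u1 u2 p1 p2 :: "real \<Rightarrow> complex"
  assumes weak: "has_weak_L2_derivative u1 p1" "has_weak_L2_derivative u2 p2"
    and weighted: "(\<lambda>x. of_real x * u1 x) \<in> L2" "(\<lambda>x. of_real x * u2 x) \<in> L2"
begin

lemma L2_members: "u1 \<in> L2" "u2 \<in> L2" "p1 \<in> L2" "p2 \<in> L2"
  using weak by (auto simp: has_weak_L2_derivative_def)

lemmas L2_intros = L2_add L2_diff L2_mult_const L2_members weighted L2_Pair

text \<open>The derivative of \<open>cnj u1 * u2\<close>; likewise \<open>self_term\<close> is the
  derivative of \<open>x * (cmod u)\<^sup>2\<close>.\<close>

definition cross_term :: "real \<Rightarrow> complex" where
  "cross_term x = cnj (p1 x) * u2 x + cnj (u1 x) * p2 x"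

definition self_term :: "(real \<Rightarrow> complex) \<Rightarrow> (real \<Rightarrow> complex) \<Rightarrow> real \<Rightarrow> real" where
  "self_term u p x = (cmod (u x))\<^sup>2 + 2 * x * Re (cnj (u x) * p x)"

lemma cross_term: "integrable lborel cross_term" "(LINT x|lborel. cross_term x) = 0"
proof -
  show "integrable lborel cross_term"
    unfolding cross_term_def[abs_def] by (intro Bochner_Integration.integrable_add L2_mult_integrable L2_cnj L2_members)
  show "(LINT x|lborel. cross_term x) = 0"
    unfolding cross_term_def
    by (rule weak_integration_by_parts[OF has_weak_L2_derivative_linear[OF weak(1) bounded_linear_cnj] weak(2)])
qed

lemma integral_cross_term:
  "integrable lborel (\<lambda>x. Re (k * cross_term x))" "(LINT x|lborel. Re (k * cross_term x)) = 0"
proof -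
  have i: "integrable lborel (\<lambda>x. k * cross_term x)" using cross_term(1) by simp
  then show "integrable lborel (\<lambda>x. Re (k * cross_term x))" by (rule integrable_bounded_linear[OF bounded_linear_Re])
  show "(LINT x|lborel. Re (k * cross_term x)) = 0"
    using integral_bounded_linear[OF bounded_linear_Re i] cross_term(2) by (simp del: times_complex.sel)
qed

lemma self_term_general:
  assumes w: "has_weak_L2_derivative u p" and x: "(\<lambda>x. of_real x * u x) \<in> L2"
  shows "integrable lborel (self_term u p)" "(LINT x|lborel. self_term u p x) = 0"
proof -
  have L: "u \<in> L2" "p \<in> L2" using w by (auto simp: has_weak_L2_derivative_def)
  have xc: "(\<lambda>x. of_real x * cnj (u x)) \<in> L2" using L2_cnj[OF x] by simp
  define h where "h x = cnj (u x) * u x + of_real x * (cnj (p x) * u x + cnj (u x) * p x)" for x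
  have "integrable lborel (\<lambda>x. cnj (u x) * u x + (cnj (p x) * (of_real x * u x) + (of_real x * cnj (u x)) * p x))"
    by (intro Bochner_Integration.integrable_add L2_mult_integrable L2_cnj L x xc)
  then have ih: "integrable lborel h" by (simp add: h_def[abs_def] algebra_simps)
  have eq: "self_term u p x = Re (h x)" for x
    unfolding self_term_def h_def cmod_power2 by (simp add: power2_eq_square algebra_simps)
  show "integrable lborel (self_term u p)" unfolding eq[abs_def] by (rule integrable_bounded_linear[OF bounded_linear_Re ih])
  have "(LINT x|lborel. h x) = 0"
    unfolding h_def
    by (rule weak_integration_by_parts_weighted[OF has_weak_L2_derivative_linear[OF w bounded_linear_cnj] xc w x])
  then show "(LINT x|lborel. self_term u p x) = 0"
    unfolding eq using integral_bounded_linear[OF bounded_linear_Re ih] by simp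
qed

lemmas self_term1 = self_term_general[OF weak(1) weighted(1)]
lemmas self_term2 = self_term_general[OF weak(2) weighted(2)]

end

text \<open>Here \<open>p\<close> stands for the derivative of \<open>u\<close>. Writing \<open>A\<^sup>+\<close> and \<open>A\<close> for the two operators and
  \<open>T\<close> for the matrix with rows \<open>(m, A\<^sup>+)\<close> and \<open>(A, - m)\<close>, the Dirac operator exchanges the two halves of
  a spinor and applies \<open>T\<close> to them, so it acts as \<open>T\<close> on the spinors \<open>(v, v)\<close> and as \<open>- T\<close> on \<open>(v, - v)\<close>.\<close>

definition raise_op :: "real \<Rightarrow> (real \<Rightarrow> complex) \<Rightarrow> (real \<Rightarrow> complex) \<Rightarrow> real \<Rightarrow> complex" where
  "raise_op \<theta> u p x = (- \<i> * cnj (cis (\<theta> / 2))) * p x + (\<i> * cis (\<theta> / 2)) * (of_real x * u x)"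

definition lower_op :: "real \<Rightarrow> (real \<Rightarrow> complex) \<Rightarrow> (real \<Rightarrow> complex) \<Rightarrow> real \<Rightarrow> complex" where
  "lower_op \<theta> u p x = (- \<i> * cnj (cis (\<theta> / 2))) * p x - (\<i> * cis (\<theta> / 2)) * (of_real x * u x)"

lemma L2_norm_mult_const: "L2_norm (\<lambda>x. (k::complex) * f x) = cmod k * L2_norm f"
  by (simp add: L2_norm_def norm_mult power_mult_distrib real_sqrt_mult)

context weak_pair
begin

lemma L2_sum_power2:
  fixes f g :: "real \<Rightarrow> complex"
  assumes "f \<in> L2" "g \<in> L2"
  shows "(L2_norm f)\<^sup>2 + (L2_norm g)\<^sup>2 = (LINT x|lborel. (cmod (f x))\<^sup>2 + (cmod (g x))\<^sup>2)"
  using assms by (simp add: L2_norm_power2 L2_integrable)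

text \<open>Integrate \<open>sum_of_squares_identity\<close> and discard the two completed squares:
  the hypotheses say that the remaining coefficients of both components are at least
  \<open>\<kappa>\<^sup>2\<close>.\<close>

lemma square_bound:
  fixes m \<theta> \<kappa> :: real and z :: complex
  assumes 1: "\<kappa>\<^sup>2 \<le> (cos \<theta>)\<^sup>2 * (cmod (m - z))\<^sup>2"
    and 2: "\<kappa>\<^sup>2 \<le> (cmod (m + z))\<^sup>2 + 2 * cos \<theta> - (cmod (cos \<theta> * (m - cnj z) - (m + z)))\<^sup>2"
  shows "\<kappa>\<^sup>2 * ((L2_norm u1)\<^sup>2 + (L2_norm u2)\<^sup>2) \<le>
    (L2_norm (\<lambda>x. raise_op \<theta> u2 p2 x + (m - z) * u1 x))\<^sup>2 + (L2_norm (\<lambda>x. lower_op \<theta> u1 p1 x - (m + z) * u2 x))\<^sup>2"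
proof -
  define E where "E = cis (\<theta> / 2)"
  have E: "cmod E = 1" "E\<^sup>2 = Complex (cos \<theta>) (sin \<theta>)"
    by (simp_all add: E_def power2_eq_square cis_mult complex_eq_iff)
  have fL: "(\<lambda>x. raise_op \<theta> u2 p2 x + (m - z) * u1 x) \<in> L2" "(\<lambda>x. lower_op \<theta> u1 p1 x - (m + z) * u2 x) \<in> L2"
    unfolding raise_op_def lower_op_def by (intro L2_intros)+
  define k where "k = 2 * (m - cnj z) * cos \<theta> * (- \<i> * E)"
  define g where "g x = \<kappa>\<^sup>2 * ((cmod (u1 x))\<^sup>2 + (cmod (u2 x))\<^sup>2) - 2 * cos \<theta> * self_term u2 p2 x + Re (k * cross_term x)" for x
  have gi: "integrable lborel g" "(LINT x|lborel. g x) = \<kappa>\<^sup>2 * ((L2_norm u1)\<^sup>2 + (L2_norm u2)\<^sup>2)"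
  proof -
    have i: "integrable lborel (\<lambda>x. \<kappa>\<^sup>2 * ((cmod (u1 x))\<^sup>2 + (cmod (u2 x))\<^sup>2))"
      "integrable lborel (\<lambda>x. 2 * cos \<theta> * self_term u2 p2 x)"
      using L2_members self_term2 by (auto simp: L2_integrable)
    show "integrable lborel g"
      unfolding g_def[abs_def]
      by (intro Bochner_Integration.integrable_add Bochner_Integration.integrable_diff i integral_cross_term)
    show "(LINT x|lborel. g x) = \<kappa>\<^sup>2 * ((L2_norm u1)\<^sup>2 + (L2_norm u2)\<^sup>2)"
      unfolding g_def L2_sum_power2[OF L2_members(1,2)]
      by (subst Bochner_Integration.integral_add Bochner_Integration.integral_diff,
          (intro Bochner_Integration.integrable_diff i integral_cross_term)+)+
         (simp add: integral_cross_term self_term2 del: times_complex.sel)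
  qed
  have "(LINT x|lborel. g x) \<le> (LINT x|lborel. (cmod (raise_op \<theta> u2 p2 x + (m - z) * u1 x))\<^sup>2 + (cmod (lower_op \<theta> u1 p1 x - (m + z) * u2 x))\<^sup>2)"
  proof (rule integral_mono[OF gi(1)])
    show "integrable lborel (\<lambda>x. (cmod (raise_op \<theta> u2 p2 x + (m - z) * u1 x))\<^sup>2 + (cmod (lower_op \<theta> u1 p1 x - (m + z) * u2 x))\<^sup>2)"
      using fL by (intro Bochner_Integration.integrable_add L2_integrable)
    fix x
    note id = sum_of_squares_identity[OF E, of "p2 x" x "u2 x" m z "u1 x" "p1 x"]
    have "\<kappa>\<^sup>2 * (cmod (u1 x))\<^sup>2 \<le> (cos \<theta>)\<^sup>2 * (cmod (m - z))\<^sup>2 * (cmod (u1 x))\<^sup>2"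
      by (intro mult_right_mono 1) auto
    moreover have "\<kappa>\<^sup>2 * (cmod (u2 x))\<^sup>2 \<le>
        ((cmod (m + z))\<^sup>2 + 2 * cos \<theta> - (cmod (cos \<theta> * (m - cnj z) - (m + z)))\<^sup>2) * (cmod (u2 x))\<^sup>2"
      by (intro mult_right_mono 2) auto
    ultimately show "g x \<le> (cmod (raise_op \<theta> u2 p2 x + (m - z) * u1 x))\<^sup>2 + (cmod (lower_op \<theta> u1 p1 x - (m + z) * u2 x))\<^sup>2"
      unfolding raise_op_def lower_op_def E_def[symmetric] id g_def self_term_def cross_term_def k_def distrib_left
      by (smt (verit) zero_le_power2)
  qed
  then show ?thesis unfolding gi(2) L2_sum_power2[OF fL] .
qed

text \<open>\<open>K1\<close>, \<open>K2\<close> are the ladder operators of the self-adjoint case \<open>\<theta> = 0\<close>; the operator for general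
  \<open>\<theta>\<close> is \<open>cos (\<theta> / 2)\<close> times this one minus \<open>\<i> sin (\<theta> / 2)\<close> times the one built from \<open>M1\<close>, \<open>M2\<close>.\<close>

definition K1 where "K1 x = (- \<i>) * p2 x + \<i> * (of_real x * u2 x)"
definition K2 where "K2 x = (- \<i>) * p1 x - \<i> * (of_real x * u1 x)"
definition M1 where "M1 x = (- \<i>) * p2 x - \<i> * (of_real x * u2 x)"
definition M2 where "M2 x = (- \<i>) * p1 x + \<i> * (of_real x * u1 x)"

lemma KM_L2: "K1 \<in> L2" "K2 \<in> L2" "M1 \<in> L2" "M2 \<in> L2"
  unfolding K1_def[abs_def] K2_def[abs_def] M1_def[abs_def] M2_def[abs_def] by (intro L2_intros)+

text \<open>The model operator is symmetric, and the imaginary part of \<open>z\<close> adds a skew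
  multiple of the identity, so the mixed term is a derivative.\<close>

lemma shifted_norm:
  fixes c m :: real and z :: complex
  shows "(L2_norm (\<lambda>x. c * K1 x + (m - z) * u1 x))\<^sup>2 + (L2_norm (\<lambda>x. c * K2 x - (m + z) * u2 x))\<^sup>2 =
    (L2_norm (\<lambda>x. c * K1 x + (m - Re z) * u1 x))\<^sup>2 + (L2_norm (\<lambda>x. c * K2 x - (m + Re z) * u2 x))\<^sup>2 +
    (Im z)\<^sup>2 * ((L2_norm u1)\<^sup>2 + (L2_norm u2)\<^sup>2)" (is "?l = ?r1 + ?r2")
proof -
  have L: "(\<lambda>x. c * K1 x + w * u1 x) \<in> L2" "(\<lambda>x. c * K2 x - w * u2 x) \<in> L2" for w :: complex
    by (intro L2_intros KM_L2)+
  have "(cmod (c * K1 x + (m - z) * u1 x))\<^sup>2 + (cmod (c * K2 x - (m + z) * u2 x))\<^sup>2 =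
      ((cmod (c * K1 x + (m - Re z) * u1 x))\<^sup>2 + (cmod (c * K2 x - (m + Re z) * u2 x))\<^sup>2) +
      (Im z)\<^sup>2 * ((cmod (u1 x))\<^sup>2 + (cmod (u2 x))\<^sup>2) + Re (of_real (2 * Im z * c) * cross_term x)" for x
    unfolding K1_def K2_def cross_term_def cmod_power2 by (simp add: power2_eq_square algebra_simps)
  then have "?l = (LINT x|lborel. ((cmod (c * K1 x + (m - Re z) * u1 x))\<^sup>2 + (cmod (c * K2 x - (m + Re z) * u2 x))\<^sup>2) +
      (Im z)\<^sup>2 * ((cmod (u1 x))\<^sup>2 + (cmod (u2 x))\<^sup>2) + Re (of_real (2 * Im z * c) * cross_term x))"
    by (simp only: L2_sum_power2[OF L(1)[of "m - z"] L(2)[of "m + z"]])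
  also have "\<dots> = (LINT x|lborel. ((cmod (c * K1 x + (m - Re z) * u1 x))\<^sup>2 + (cmod (c * K2 x - (m + Re z) * u2 x))\<^sup>2) +
      (Im z)\<^sup>2 * ((cmod (u1 x))\<^sup>2 + (cmod (u2 x))\<^sup>2)) + 0"
    unfolding integral_cross_term(2)[of "of_real (2 * Im z * c)", symmetric]
    using L2_integrable[OF L(1)[of "m - Re z"]] L2_integrable[OF L(2)[of "m + Re z"]] L2_members(1,2)[THEN L2_integrable]
    by (intro Bochner_Integration.integral_add integral_cross_term) simp
  also have "\<dots> = ?r1 + ?r2"
    using L2_integrable[OF L(1)[of "m - Re z"]] L2_integrable[OF L(2)[of "m + Re z"]] L2_members(1,2)[THEN L2_integrable]
    by (simp add: L2_norm_power2)
  finally show ?thesis .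
qed

text \<open>The mass term anticommutes with the model operator, so the mixed term integrates to
  zero.\<close>

lemma massive_norm:
  fixes c m :: real
  shows "(L2_norm (\<lambda>x. c * K1 x + m * u1 x))\<^sup>2 + (L2_norm (\<lambda>x. c * K2 x - m * u2 x))\<^sup>2 =
    c\<^sup>2 * ((L2_norm K1)\<^sup>2 + (L2_norm K2)\<^sup>2) + m\<^sup>2 * ((L2_norm u1)\<^sup>2 + (L2_norm u2)\<^sup>2)" (is "?l = ?r1 + ?r2")
proof -
  have L: "(\<lambda>x. c * K1 x + m * u1 x) \<in> L2" "(\<lambda>x. c * K2 x - m * u2 x) \<in> L2"
    by (intro L2_intros KM_L2)+
  have "(cmod (c * K1 x + m * u1 x))\<^sup>2 + (cmod (c * K2 x - m * u2 x))\<^sup>2 =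
      c\<^sup>2 * ((cmod (K1 x))\<^sup>2 + (cmod (K2 x))\<^sup>2) + m\<^sup>2 * ((cmod (u1 x))\<^sup>2 + (cmod (u2 x))\<^sup>2) +
      Re ((- 2 * \<i> * c * m) * cross_term x)" for x
    unfolding K1_def K2_def cross_term_def cmod_power2 by (simp add: power2_eq_square algebra_simps)
  then have "?l = (LINT x|lborel. c\<^sup>2 * ((cmod (K1 x))\<^sup>2 + (cmod (K2 x))\<^sup>2) + m\<^sup>2 * ((cmod (u1 x))\<^sup>2 + (cmod (u2 x))\<^sup>2) +
      Re ((- 2 * \<i> * c * m) * cross_term x))"
    by (simp only: L2_sum_power2[OF L])
  also have "\<dots> = (LINT x|lborel. c\<^sup>2 * ((cmod (K1 x))\<^sup>2 + (cmod (K2 x))\<^sup>2) + m\<^sup>2 * ((cmod (u1 x))\<^sup>2 + (cmod (u2 x))\<^sup>2)) + 0"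
    unfolding integral_cross_term(2)[of "- 2 * \<i> * c * m", symmetric]
    using L2_members(1,2)[THEN L2_integrable] KM_L2[THEN L2_integrable]
    by (intro Bochner_Integration.integral_add integral_cross_term) simp
  also have "\<dots> = ?r1 + ?r2"
    using L2_members(1,2)[THEN L2_integrable] KM_L2[THEN L2_integrable] by (simp add: L2_norm_power2)
  finally show ?thesis .
qed

text \<open>\<open>M1\<close> and \<open>M2\<close> are the formal adjoints of \<open>K1\<close> and
  \<open>K2\<close> applied to the same components, so the squared norms differ by the commutator of
  differentiation and multiplication by \<open>x\<close>, with opposite signs on the two
  components.\<close>

lemma commutator_norm:
  "(L2_norm M1)\<^sup>2 + (L2_norm M2)\<^sup>2 = (L2_norm K1)\<^sup>2 + (L2_norm K2)\<^sup>2 + 2 * ((L2_norm u1)\<^sup>2 - (L2_norm u2)\<^sup>2)"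
proof -
  have "(cmod (M1 x))\<^sup>2 + (cmod (M2 x))\<^sup>2 = (cmod (K1 x))\<^sup>2 + (cmod (K2 x))\<^sup>2 +
      2 * ((cmod (u1 x))\<^sup>2 - (cmod (u2 x))\<^sup>2) + (2 * self_term u2 p2 x - 2 * self_term u1 p1 x)" for x
    unfolding K1_def K2_def M1_def M2_def self_term_def cmod_power2 by (simp add: power2_eq_square algebra_simps)
  then show ?thesis
    unfolding L2_sum_power2[OF KM_L2(3,4)]
    using L2_members(1,2)[THEN L2_integrable] KM_L2[THEN L2_integrable] self_term1 self_term2
    by (simp add: L2_norm_power2)
qed

text \<open>The residual is paired with \<open>(u1, - u2)\<close>. The model operator anticommutes
  with this change of sign and drops out, which leaves mass and chirality; Cauchy-Schwarz does the
  rest.\<close>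

lemma chirality_identity:
  fixes c m \<xi> :: real
  shows "\<bar>\<xi> * ((L2_norm u1)\<^sup>2 - (L2_norm u2)\<^sup>2) - m * ((L2_norm u1)\<^sup>2 + (L2_norm u2)\<^sup>2)\<bar> \<le>
    L2_norm (\<lambda>x. (u1 x, u2 x)) * L2_norm (\<lambda>x. (c * K1 x + (m - \<xi>) * u1 x, c * K2 x - (m + \<xi>) * u2 x))"
proof -
  have L: "(\<lambda>x. (u1 x, - u2 x)) \<in> L2" "(\<lambda>x. (c * K1 x + (m - \<xi>) * u1 x, c * K2 x - (m + \<xi>) * u2 x)) \<in> L2"
    by (intro L2_intros KM_L2 L2_minus)+
  have "inner (u1 x, - u2 x) (c * K1 x + (m - \<xi>) * u1 x, c * K2 x - (m + \<xi>) * u2 x) =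
      m * ((cmod (u1 x))\<^sup>2 + (cmod (u2 x))\<^sup>2) - \<xi> * ((cmod (u1 x))\<^sup>2 - (cmod (u2 x))\<^sup>2) + Re ((- \<i> * c) * cross_term x)" for x
    unfolding K1_def K2_def cross_term_def cmod_power2 inner_Pair inner_complex_def by (simp add: power2_eq_square algebra_simps)
  then have "(LINT x|lborel. inner (u1 x, - u2 x) (c * K1 x + (m - \<xi>) * u1 x, c * K2 x - (m + \<xi>) * u2 x)) =
     (LINT x|lborel. m * ((cmod (u1 x))\<^sup>2 + (cmod (u2 x))\<^sup>2) - \<xi> * ((cmod (u1 x))\<^sup>2 - (cmod (u2 x))\<^sup>2) + Re ((- \<i> * c) * cross_term x))"
    by (simp only:)
  also have "\<dots> = (LINT x|lborel. m * ((cmod (u1 x))\<^sup>2 + (cmod (u2 x))\<^sup>2) - \<xi> * ((cmod (u1 x))\<^sup>2 - (cmod (u2 x))\<^sup>2)) + 0"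
    unfolding integral_cross_term(2)[of "- \<i> * c", symmetric]
    using L2_members(1,2)[THEN L2_integrable]
    by (intro Bochner_Integration.integral_add integral_cross_term) simp
  also have "\<dots> = m * ((L2_norm u1)\<^sup>2 + (L2_norm u2)\<^sup>2) - \<xi> * ((L2_norm u1)\<^sup>2 - (L2_norm u2)\<^sup>2)"
    using L2_members(1,2)[THEN L2_integrable] by (simp add: L2_norm_power2)
  finally have "\<bar>m * ((L2_norm u1)\<^sup>2 + (L2_norm u2)\<^sup>2) - \<xi> * ((L2_norm u1)\<^sup>2 - (L2_norm u2)\<^sup>2)\<bar> \<le>
     L2_norm (\<lambda>x. (u1 x, - u2 x)) * L2_norm (\<lambda>x. (c * K1 x + (m - \<xi>) * u1 x, c * K2 x - (m + \<xi>) * u2 x))"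
    using L2_Cauchy_Schwarz[OF L] by simp
  moreover have "L2_norm (\<lambda>x. (u1 x, - u2 x)) = L2_norm (\<lambda>x. (u1 x, u2 x))"
    by (simp add: L2_norm_def norm_Pair)
  ultimately show ?thesis by (simp add: abs_minus_commute)
qed

text \<open>\<open>K1\<close> and \<open>M1\<close> come from mutually adjoint ladder operators
  whose commutator contributes the \<open>2\<close>; the square of \<open>M1\<close> is
  discarded.\<close>

lemma spectral_gap: "sqrt 2 * L2_norm u2 \<le> L2_norm K1"
proof -
  have "(LINT x|lborel. 2 * (cmod (u2 x))\<^sup>2 - 2 * self_term u2 p2 x) \<le> (LINT x|lborel. (cmod (K1 x))\<^sup>2)"
  proof (rule integral_mono)
    show "2 * (cmod (u2 x))\<^sup>2 - 2 * self_term u2 p2 x \<le> (cmod (K1 x))\<^sup>2" for x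
    proof -
      have "(cmod (K1 x))\<^sup>2 = (cmod (M1 x))\<^sup>2 + (2 * (cmod (u2 x))\<^sup>2 - 2 * self_term u2 p2 x)"
        unfolding K1_def M1_def self_term_def cmod_power2 by (simp add: power2_eq_square algebra_simps)
      then show ?thesis by simp
    qed
  qed (use L2_members(1,2)[THEN L2_integrable] KM_L2[THEN L2_integrable] self_term2 in auto)
  then have "2 * (L2_norm u2)\<^sup>2 \<le> (L2_norm K1)\<^sup>2"
    using L2_members(1,2)[THEN L2_integrable] self_term2 by (simp add: L2_norm_power2)
  then have "(sqrt 2 * L2_norm u2)\<^sup>2 \<le> (L2_norm K1)\<^sup>2" by (simp add: power_mult_distrib)
  then show ?thesis by (rule power2_le_imp_le) simp
qed

text \<open>Write the image as \<open>P - s * M\<close>, where \<open>P\<close> belongs to the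
  self-adjoint model, so that its norm is at least \<open>\<bar>Im z\<bar>\<close> times that of
  \<open>u\<close>. If \<open>c * norm M\<close> is at most
  \<open>(\<bar>Im z\<bar> + \<bar>Re z\<bar> + m) / \<bar>Im z\<bar>\<close> times the norm of
  \<open>P\<close>, then \<open>\<bar>s\<bar> = t * c\<close> and the triangle inequality yield
  exactly \<open>\<kappa>\<close>. The ground state of the model shows that this relative bound
  fails in general, which is why there are two cases.\<close>

theorem pair_estimate:
  fixes m \<theta> \<kappa> :: real and z :: complex
  assumes \<theta>: "- (pi / 2) < \<theta>" "\<theta> < pi / 2" and m: "0 \<le> m"
    and \<kappa>: "\<kappa> = (1 - \<bar>tan (\<theta> / 2)\<bar>) * \<bar>Im z\<bar> - (\<bar>Re z\<bar> + m) * \<bar>tan (\<theta> / 2)\<bar>" and pos: "0 < \<kappa>"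
  shows "\<kappa>\<^sup>2 * ((L2_norm u1)\<^sup>2 + (L2_norm u2)\<^sup>2) \<le>
    (L2_norm (\<lambda>x. raise_op \<theta> u2 p2 x + (m - z) * u1 x))\<^sup>2 + (L2_norm (\<lambda>x. lower_op \<theta> u1 p1 x - (m + z) * u2 x))\<^sup>2"
proof -
  define c s t C \<xi> y where "c = cos (\<theta> / 2)" and "s = sin (\<theta> / 2)" and "t = \<bar>tan (\<theta> / 2)\<bar>"
    and "C = cos \<theta>" and "\<xi> = Re z" and "y = \<bar>Im z\<bar>"
  note defs = this
  have c0: "0 < c" unfolding c_def using \<theta> by (intro cos_gt_zero_pi) auto
  have C0: "0 < C" unfolding C_def using \<theta> by (intro cos_gt_zero_pi) auto
  have cs: "c\<^sup>2 + s\<^sup>2 = 1" by (simp add: c_def s_def)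
  have C: "C = c\<^sup>2 - s\<^sup>2" using cos_double[of "\<theta> / 2"] by (simp add: C_def c_def s_def)
  have t: "t = \<bar>s\<bar> / c" using c0 by (simp add: t_def tan_def s_def c_def[symmetric] abs_divide)
  have t0: "0 \<le> t" by (simp add: t_def)
  have st: "s\<^sup>2 = c\<^sup>2 * t\<^sup>2" using c0 by (simp add: t power_divide)
  have Ct: "C = c\<^sup>2 * (1 - t\<^sup>2)" and ct: "c\<^sup>2 * (1 + t\<^sup>2) = 1" using cs by (simp_all add: C st algebra_simps)
  have t1: "t < 1"
  proof (rule ccontr)
    assume "\<not> t < 1"
    then have "1 \<le> t\<^sup>2" by simp
    then have "c\<^sup>2 * (1 - t\<^sup>2) \<le> 0" by (intro mult_nonneg_nonpos) auto
    then show False using C0 Ct by simp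
  qed
  \<comment> \<open>Since \<open>C = (1 - t\<^sup>2) / (1 + t\<^sup>2)\<close>, it is enough that
    \<open>t\<^sup>2 \<le> t\<close>. The consequence is
    \<open>\<kappa> \<le> C * y\<close>.\<close>
  have C1: "1 - t \<le> C"
  proof -
    have "t\<^sup>2 \<le> t" using t0 t1 by (simp add: power2_eq_square mult_left_le_one_le)
    then have "c\<^sup>2 * (1 + t\<^sup>2) \<le> c\<^sup>2 * (1 + t)" by (intro mult_left_mono) auto
    then have "1 \<le> c\<^sup>2 * (1 + t)" by (simp only: ct)
    then have "(1 - t) * 1 \<le> (1 - t) * (c\<^sup>2 * (1 + t))" using t1 by (intro mult_left_mono) auto
    then show ?thesis by (simp add: Ct power2_eq_square algebra_simps)
  qed
  have Cle: "C \<le> 1" by (simp add: C_def)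
  have cC: "c\<^sup>2 = (1 + C) / 2" using cs C by simp
  have \<kappa>': "\<kappa> = (1 - t) * y - (\<bar>\<xi>\<bar> + m) * t" by (simp add: \<kappa> t_def y_def \<xi>_def)
  have X0: "0 \<le> (\<bar>\<xi>\<bar> + m) * t" using m t0 by simp
  have y0: "0 < y"
  proof (rule ccontr)
    assume "\<not> 0 < y"
    then have "(1 - t) * y \<le> 0" using t1 by (simp add: mult_nonneg_nonpos)
    then show False using pos X0 \<kappa>' by linarith
  qed
  have \<kappa>y: "\<kappa> \<le> C * y"
  proof -
    have "(1 - t) * y \<le> C * y" using C1 y0 by (intro mult_right_mono) auto
    then show ?thesis using \<kappa>' X0 by linarith
  qed
  show ?thesis
  proof (cases "0 \<le> 2 + (m - \<xi>) * (m * (2 - C) + \<xi> * (2 + C))")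
    case True
    txt \<open>In this range the sum of squares of \<open>sum_of_squares_identity\<close> has large enough coefficients.\<close>
    show ?thesis
    proof (rule square_bound)
      have "y \<le> cmod (m - z)" using abs_Im_le_cmod[of "m - z"] by (simp add: y_def)
      then have "C * y \<le> C * cmod (m - z)" using C0 by simp
      with \<kappa>y have "\<kappa>\<^sup>2 \<le> (C * cmod (m - z))\<^sup>2" using pos by (intro power_mono) auto
      then show "\<kappa>\<^sup>2 \<le> (cos \<theta>)\<^sup>2 * (cmod (m - z))\<^sup>2" by (simp add: power_mult_distrib C_def)
      have "\<kappa>\<^sup>2 \<le> (C * y)\<^sup>2" using \<kappa>y pos by (intro power_mono) auto
      also have "\<dots> = C * C * y\<^sup>2" by (simp add: power2_eq_square)
      \<comment> \<open>Enlarging one factor \<open>C\<close> to \<open>2 - C\<close> matches the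
        coefficient of \<open>y\<^sup>2\<close> in the expanded right-hand side; the terms without
        \<open>y\<close> are then supplied by the case assumption.\<close>
      also have "\<dots> \<le> C * (2 - C) * y\<^sup>2" using C0 Cle by (intro mult_right_mono mult_left_mono) auto
      also have "\<dots> \<le> C * (2 - C) * y\<^sup>2 + C * (2 + (m - \<xi>) * (m * (2 - C) + \<xi> * (2 + C)))"
        using True C0 by simp
      also have "\<dots> = ((m + \<xi>)\<^sup>2 + y\<^sup>2) + 2 * C - ((C * (m - \<xi>) - (m + \<xi>))\<^sup>2 + (C * Im z - Im z)\<^sup>2)"
        by (simp add: y_def power2_eq_square algebra_simps)
      also have "\<dots> = (cmod (m + z))\<^sup>2 + 2 * C - (cmod (C * (m - cnj z) - (m + z)))\<^sup>2"
        by (simp add: cmod_power2 y_def \<xi>_def)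
      finally show "\<kappa>\<^sup>2 \<le> (cmod (m + z))\<^sup>2 + 2 * cos \<theta> - (cmod (cos \<theta> * (m - cnj z) - (m + z)))\<^sup>2"
        by (simp add: C_def)
    qed
  next
    case False
    txt \<open>Otherwise the operator is compared with the self-adjoint one; \<open>perturbation_bound_or_square_bound\<close>
      controls the relative size of the skew part.\<close>
    define N where "N = L2_norm (\<lambda>x. (u1 x, u2 x))"
    have N2: "N\<^sup>2 = (L2_norm u1)\<^sup>2 + (L2_norm u2)\<^sup>2" unfolding N_def by (rule L2_norm_Pair[OF L2_members(1,2)])
    define F where "F = (\<lambda>x. (raise_op \<theta> u2 p2 x + (m - z) * u1 x, lower_op \<theta> u1 p1 x - (m + z) * u2 x))"
    define P where "P = (\<lambda>x. (c * K1 x + (m - z) * u1 x, c * K2 x - (m + z) * u2 x))"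
    define G where "G = (\<lambda>x. (c * K1 x + (m - \<xi>) * u1 x, c * K2 x - (m + \<xi>) * u2 x))"
    define T where "T = (\<lambda>x. (c * K1 x + m * u1 x, c * K2 x - m * u2 x))"
    define M where "M = (\<lambda>x. (\<i> * M1 x, \<i> * M2 x))"
    have comp: "(\<lambda>x. raise_op \<theta> u2 p2 x + (m - z) * u1 x) \<in> L2" "(\<lambda>x. lower_op \<theta> u1 p1 x - (m + z) * u2 x) \<in> L2"
      "(\<lambda>x. c * K1 x + w * u1 x) \<in> L2" "(\<lambda>x. c * K2 x - w * u2 x) \<in> L2" for w
      unfolding raise_op_def lower_op_def by (intro L2_intros KM_L2)+
    have L: "F \<in> L2" "P \<in> L2" "G \<in> L2" "T \<in> L2" "M \<in> L2"
      unfolding F_def P_def G_def T_def M_def by (intro L2_Pair comp L2_mult_const KM_L2)+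
    have sqF: "(L2_norm F)\<^sup>2 = (L2_norm (\<lambda>x. raise_op \<theta> u2 p2 x + (m - z) * u1 x))\<^sup>2 + (L2_norm (\<lambda>x. lower_op \<theta> u1 p1 x - (m + z) * u2 x))\<^sup>2"
      unfolding F_def by (rule L2_norm_Pair[OF comp(1,2)])
    have sqP: "(L2_norm P)\<^sup>2 = (L2_norm G)\<^sup>2 + y\<^sup>2 * N\<^sup>2"
      unfolding P_def G_def L2_norm_Pair[OF comp(3,4)] N2 using shifted_norm[of c m z]
      by (simp add: y_def \<xi>_def)
    have sqM: "(L2_norm M)\<^sup>2 = (L2_norm K1)\<^sup>2 + (L2_norm K2)\<^sup>2 + 2 * ((L2_norm u1)\<^sup>2 - (L2_norm u2)\<^sup>2)"
      unfolding M_def L2_norm_Pair[OF L2_mult_const[OF KM_L2(3)] L2_mult_const[OF KM_L2(4)]]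
      using commutator_norm by (simp add: L2_norm_mult_const)
    have sqT: "(L2_norm T)\<^sup>2 = c\<^sup>2 * ((L2_norm K1)\<^sup>2 + (L2_norm K2)\<^sup>2) + m\<^sup>2 * N\<^sup>2"
      unfolding T_def L2_norm_Pair[OF comp(3,4)] N2 by (rule massive_norm)
    have FPM: "F x = P x - s *\<^sub>R M x" for x
      unfolding F_def P_def M_def raise_op_def lower_op_def K1_def K2_def M1_def M2_def
      by (simp add: cis.ctr c_def s_def complex_eq_iff algebra_simps)
    have FP: "L2_norm P \<le> L2_norm F + \<bar>s\<bar> * L2_norm M"
    proof -
      have "P = (\<lambda>x. F x + s *\<^sub>R M x)" by (simp add: FPM)
      then show ?thesis using L2_norm_triangle[OF L(1) L2_scaleR[OF L(5)], of s] by (simp add: L2_norm_scaleR)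
    qed
    have TG: "L2_norm T \<le> L2_norm G + \<bar>\<xi>\<bar> * N"
    proof -
      have uL: "(\<lambda>x. (u1 x, u2 x)) \<in> L2" by (intro L2_Pair L2_members)
      have "T = (\<lambda>x. G x + \<xi> *\<^sub>R (u1 x, u2 x))" by (simp add: T_def G_def algebra_simps scaleR_conv_of_real)
      then show ?thesis using L2_norm_triangle[OF L(3) L2_scaleR[OF uL], of \<xi>] by (simp only: L2_norm_scaleR N_def)
    qed
    have anti: "\<bar>\<xi> * ((L2_norm u1)\<^sup>2 - (L2_norm u2)\<^sup>2) - m * N\<^sup>2\<bar> \<le> N * L2_norm G"
      unfolding N2 unfolding N_def G_def by (rule chirality_identity)
    have gap: "sqrt 2 * c * L2_norm u2 \<le> \<bar>\<xi> - m\<bar> * L2_norm u1 + L2_norm G"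
    proof -
      have "c * (sqrt 2 * L2_norm u2) \<le> c * L2_norm K1" using spectral_gap c0 by simp
      also have "\<dots> = L2_norm (\<lambda>x. c * K1 x)" using c0 by (simp add: L2_norm_mult_const)
      also have "(\<lambda>x. c * K1 x) = (\<lambda>x. (c * K1 x + (m - \<xi>) * u1 x) + of_real (\<xi> - m) * u1 x)"
        by (simp add: algebra_simps)
      also have "L2_norm \<dots> \<le> L2_norm (\<lambda>x. c * K1 x + (m - \<xi>) * u1 x) + L2_norm (\<lambda>x. of_real (\<xi> - m) * u1 x)"
        using comp(3)[of "m - \<xi>"] by (intro L2_norm_triangle L2_mult_const L2_members) simp
      also have "L2_norm (\<lambda>x. of_real (\<xi> - m) * u1 x) = \<bar>\<xi> - m\<bar> * L2_norm u1"
        by (simp only: L2_norm_mult_const norm_of_real)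
      also have "L2_norm (\<lambda>x. c * K1 x + (m - \<xi>) * u1 x) \<le> L2_norm G"
        by (rule L2_norm_mono[OF L(3)]) (use comp(3)[of "m - \<xi>"] norm_fst_le in \<open>auto simp: G_def intro!: AE_I2\<close>)
      finally show ?thesis by (simp add: mult_ac add.commute)
    qed
    have main: "c\<^sup>2 * (L2_norm M)\<^sup>2 \<le> ((y + \<bar>\<xi>\<bar> + m) / y)\<^sup>2 * (L2_norm P)\<^sup>2"
    proof (cases "N = 0")
      case True
      then have "(L2_norm u1)\<^sup>2 + (L2_norm u2)\<^sup>2 = 0" using N2 by simp
      then have 0: "L2_norm u1 = 0" "L2_norm u2 = 0" by (auto simp: sum_power2_eq_zero_iff)
      have "c\<^sup>2 * (L2_norm M)\<^sup>2 = (L2_norm T)\<^sup>2" using sqT sqM True 0 by simp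
      also have "\<dots> \<le> (L2_norm G)\<^sup>2" using TG True by (intro power_mono) auto
      also have "\<dots> = 1\<^sup>2 * (L2_norm P)\<^sup>2" using sqP True by simp
      also have "\<dots> \<le> ((y + \<bar>\<xi>\<bar> + m) / y)\<^sup>2 * (L2_norm P)\<^sup>2"
        using y0 m by (intro mult_right_mono power_mono) (auto simp: field_simps)
      finally show ?thesis .
    next
      case N0: False
      then have Np: "0 < N" by (simp add: N_def less_le)
      define \<alpha> \<beta> q E where "\<alpha> = L2_norm u1 / N" and "\<beta> = L2_norm u2 / N" and "q = L2_norm G / N"
        and "E = (L2_norm T / N)\<^sup>2"
      have "E - m\<^sup>2 + 2 * c\<^sup>2 * (\<alpha>\<^sup>2 - \<beta>\<^sup>2) \<le> ((y + \<bar>\<xi>\<bar> + m) / y)\<^sup>2 * (q\<^sup>2 + y\<^sup>2)"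
      proof (rule perturbation_bound_or_square_bound[OF m y0 _ _ _ _ refl C0 Cle c0 cC])
        show "0 \<le> q" "0 \<le> \<alpha>" "0 \<le> \<beta>" using Np by (auto simp: q_def \<alpha>_def \<beta>_def)
        have "\<alpha>\<^sup>2 + \<beta>\<^sup>2 = ((L2_norm u1)\<^sup>2 + (L2_norm u2)\<^sup>2) / N\<^sup>2"
          by (simp add: \<alpha>_def \<beta>_def power_divide add_divide_distrib)
        then show "\<alpha>\<^sup>2 + \<beta>\<^sup>2 = 1" unfolding N2[symmetric] using Np by simp
        show "E \<le> (q + \<bar>\<xi>\<bar>)\<^sup>2"
          unfolding E_def q_def using TG Np by (intro power_mono) (auto simp: field_simps)
        show "\<bar>\<xi> * (\<alpha>\<^sup>2 - \<beta>\<^sup>2) - m\<bar> \<le> q"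
        proof -
          have "\<xi> * (\<alpha>\<^sup>2 - \<beta>\<^sup>2) - m = (\<xi> * ((L2_norm u1)\<^sup>2 - (L2_norm u2)\<^sup>2) - m * N\<^sup>2) / N\<^sup>2"
            using Np by (simp add: \<alpha>_def \<beta>_def field_simps)
          then have "\<bar>\<xi> * (\<alpha>\<^sup>2 - \<beta>\<^sup>2) - m\<bar> = \<bar>\<xi> * ((L2_norm u1)\<^sup>2 - (L2_norm u2)\<^sup>2) - m * N\<^sup>2\<bar> / N\<^sup>2"
            by (simp add: abs_divide)
          also have "\<dots> \<le> (N * L2_norm G) / N\<^sup>2" using anti by (intro divide_right_mono) auto
          also have "\<dots> = q" using Np by (simp add: q_def power2_eq_square)
          finally show ?thesis .
        qed
        show "sqrt 2 * c * \<beta> \<le> \<bar>\<xi> - m\<bar> * \<alpha> + q"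
          using divide_right_mono[OF gap, of N] Np by (simp add: \<alpha>_def \<beta>_def q_def add_divide_distrib)
        show "2 + (m - \<xi>) * (m * (2 - C) + \<xi> * (2 + C)) < 0" using False by simp
      qed
      from mult_right_mono[OF this, of "N\<^sup>2"]
      have le: "(E - m\<^sup>2 + 2 * c\<^sup>2 * (\<alpha>\<^sup>2 - \<beta>\<^sup>2)) * N\<^sup>2 \<le> ((y + \<bar>\<xi>\<bar> + m) / y)\<^sup>2 * ((q\<^sup>2 + y\<^sup>2) * N\<^sup>2)"
        by (simp add: mult.assoc)
      have eq1: "(E - m\<^sup>2 + 2 * c\<^sup>2 * (\<alpha>\<^sup>2 - \<beta>\<^sup>2)) * N\<^sup>2 = (L2_norm T)\<^sup>2 - m\<^sup>2 * N\<^sup>2 + 2 * c\<^sup>2 * ((L2_norm u1)\<^sup>2 - (L2_norm u2)\<^sup>2)"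
        using Np by (simp add: E_def \<alpha>_def \<beta>_def field_simps)
      have eq2: "(q\<^sup>2 + y\<^sup>2) * N\<^sup>2 = (L2_norm P)\<^sup>2" using Np by (simp add: sqP q_def field_simps)
      have "c\<^sup>2 * (L2_norm M)\<^sup>2 = (L2_norm T)\<^sup>2 - m\<^sup>2 * N\<^sup>2 + 2 * c\<^sup>2 * ((L2_norm u1)\<^sup>2 - (L2_norm u2)\<^sup>2)"
        by (simp add: sqM sqT algebra_simps)
      then show ?thesis using le unfolding eq1 eq2 by simp
    qed
    \<comment> \<open>The relative size of the skew part; expanding \<open>(1 - \<rho>) * y\<close>
      gives \<open>\<kappa>\<close>.\<close>
    define \<rho> where "\<rho> = t * ((y + \<bar>\<xi>\<bar> + m) / y)"
    have sM: "\<bar>s\<bar> * L2_norm M \<le> \<rho> * L2_norm P"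
    proof -
      have "(c * L2_norm M)\<^sup>2 \<le> (((y + \<bar>\<xi>\<bar> + m) / y) * L2_norm P)\<^sup>2" using main by (simp only: power_mult_distrib)
      then have "c * L2_norm M \<le> ((y + \<bar>\<xi>\<bar> + m) / y) * L2_norm P"
        by (rule power2_le_imp_le) (use y0 m in auto)
      then have "t * (c * L2_norm M) \<le> t * (((y + \<bar>\<xi>\<bar> + m) / y) * L2_norm P)" using t0 by (rule mult_left_mono)
      moreover have "t * c = \<bar>s\<bar>" using c0 by (simp add: t)
      ultimately show ?thesis by (simp add: \<rho>_def mult.assoc[symmetric])
    qed
    have \<rho>y: "(1 - \<rho>) * y = \<kappa>" using y0 by (simp add: \<rho>_def \<kappa>' field_simps)
    then have \<rho>1: "0 < 1 - \<rho>" using pos y0 by (metis zero_less_mult_pos2)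
    have "(y * N)\<^sup>2 \<le> (L2_norm P)\<^sup>2" by (simp add: sqP power_mult_distrib)
    then have "y * N \<le> L2_norm P" by (rule power2_le_imp_le) simp
    then have "(1 - \<rho>) * (y * N) \<le> (1 - \<rho>) * L2_norm P" using \<rho>1 by simp
    also have "\<dots> \<le> L2_norm F" using FP sM by (simp add: algebra_simps)
    finally have "\<kappa> * N \<le> L2_norm F" by (simp only: mult.assoc[symmetric] \<rho>y)
    then have "(\<kappa> * N)\<^sup>2 \<le> (L2_norm F)\<^sup>2" using pos by (intro power_mono) (auto simp: N_def)
    then show ?thesis by (simp add: power_mult_distrib N2 sqF)
  qed
qed

end

section \<open>The Dirac system\<close>

lemma norm_vec_power2: "(norm (v :: complex ^ 'n))\<^sup>2 = (\<Sum>k\<in>UNIV. (cmod (v $ k))\<^sup>2)"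
  by (simp add: norm_vec_def L2_set_def sum_nonneg)

lemma L2_nth: "f \<in> L2 \<Longrightarrow> (\<lambda>x. (f x :: complex ^ 'n) $ k) \<in> L2"
  by (rule L2_linear[OF bounded_linear_vec_nth])

lemma L2_axis:
  assumes "f \<in> L2" shows "(\<lambda>x. axis k (f x :: complex) :: complex ^ 'n) \<in> L2"
proof (rule L2_linear[OF _ assms])
  have "linear (axis k :: complex \<Rightarrow> complex ^ 'n)"
    by (rule linearI) (auto simp: vec_eq_iff axis_def)
  then show "bounded_linear (axis k :: complex \<Rightarrow> complex ^ 'n)" by (simp add: linear_conv_bounded_linear)
qed

lemma L2_vecI:
  assumes "\<And>k. (\<lambda>x. (f x :: complex ^ 'n) $ k) \<in> L2" shows "f \<in> L2"
proof -
  have "(\<lambda>x. \<Sum>k\<in>UNIV. axis k (f x $ k)) \<in> L2" by (intro L2_sum L2_axis assms)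
  moreover have "(\<Sum>k\<in>UNIV. axis k (v $ k)) = v" for v :: "complex ^ 'n"
    by (simp add: vec_eq_iff axis_def if_distrib cong: if_cong)
  ultimately show ?thesis by simp
qed

lemma L2_norm_vec: "f \<in> L2 \<Longrightarrow> (L2_norm f)\<^sup>2 = (\<Sum>k\<in>UNIV. (L2_norm (\<lambda>x. (f x :: complex ^ 'n) $ k))\<^sup>2)"
  by (simp add: L2_norm_power2 norm_vec_power2 L2_integrable L2_nth)

lemma L2_norm_nth_le: "f \<in> L2 \<Longrightarrow> L2_norm (\<lambda>x. (f x :: complex ^ 'n) $ k) \<le> L2_norm f"
  by (rule L2_norm_mono) (auto simp: L2_nth Finite_Cartesian_Product.norm_nth_le)

lemma vector_4:
  "(vector [w, x, y, z] :: 'a::zero ^ 4) $ 1 = w"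
  "(vector [w, x, y, z] :: 'a::zero ^ 4) $ 2 = x"
  "(vector [w, x, y, z] :: 'a::zero ^ 4) $ 3 = y"
  "(vector [w, x, y, z] :: 'a::zero ^ 4) $ 4 = z"
  unfolding vector_def by simp_all

text \<open>The action of \<open>H - z\<close> with \<open>p\<close> in place of the derivative of \<open>u\<close>.\<close>

definition dirac_sym ::
  "real \<Rightarrow> real \<Rightarrow> (real \<Rightarrow> complex ^ 4) \<Rightarrow> (real \<Rightarrow> complex ^ 4) \<Rightarrow> complex \<Rightarrow> real \<Rightarrow> complex ^ 4" where
  "dirac_sym m \<theta> u p z x = vector
    [raise_op \<theta> (\<lambda>x. u x $ 4) (\<lambda>x. p x $ 4) x + m * u x $ 3 - z * u x $ 1,
     lower_op \<theta> (\<lambda>x. u x $ 3) (\<lambda>x. p x $ 3) x - m * u x $ 4 - z * u x $ 2,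
     raise_op \<theta> (\<lambda>x. u x $ 2) (\<lambda>x. p x $ 2) x + m * u x $ 1 - z * u x $ 3,
     lower_op \<theta> (\<lambda>x. u x $ 1) (\<lambda>x. p x $ 1) x - m * u x $ 2 - z * u x $ 4]"

lemma dirac_sym_nth:
  "dirac_sym m \<theta> u p z x $ 1 = raise_op \<theta> (\<lambda>x. u x $ 4) (\<lambda>x. p x $ 4) x + m * u x $ 3 - z * u x $ 1"
  "dirac_sym m \<theta> u p z x $ 2 = lower_op \<theta> (\<lambda>x. u x $ 3) (\<lambda>x. p x $ 3) x - m * u x $ 4 - z * u x $ 2"
  "dirac_sym m \<theta> u p z x $ 3 = raise_op \<theta> (\<lambda>x. u x $ 2) (\<lambda>x. p x $ 2) x + m * u x $ 1 - z * u x $ 3"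
  "dirac_sym m \<theta> u p z x $ 4 = lower_op \<theta> (\<lambda>x. u x $ 1) (\<lambda>x. p x $ 1) x - m * u x $ 2 - z * u x $ 4"
  by (simp_all add: dirac_sym_def vector_4)

lemma shift_H_op:
  "shift_op (H_op m \<theta>) z u = dirac_sym m \<theta> u (\<lambda>x. \<chi> k. weak_deriv (\<lambda>y. u y $ k) x) z"
proof -
  have 1: "exp (- \<i> * complex_of_real \<theta> / 2) = cnj (cis (\<theta> / 2))"
    by (simp add: cis_conv_exp cis_cnj exp_cnj)
  have 2: "exp (\<i> * complex_of_real \<theta> / 2) = cis (\<theta> / 2)" by (simp add: cis_conv_exp)
  show ?thesis
    unfolding shift_op_def H_op_def 1 2 fun_eq_iff vec_eq_iff forall_4 dirac_sym_nth
    by (simp add: raise_op_def lower_op_def dirac1_def dirac2_def dirac3_def off_diagonal_block_def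
        pauli1_def pauli2_def pauli3_def matrix_vector_mult_def sum_4 vector_4 vector_2 algebra_simps)
qed

text \<open>Domain membership together with an explicit derivative. The choice behind
  \<open>weak_deriv\<close> respects linear combinations only almost everywhere, whereas the pairs
  \<open>(u, p)\<close> form a linear space exactly.\<close>

definition in_dirac_domain :: "(real \<Rightarrow> complex ^ 4) \<Rightarrow> (real \<Rightarrow> complex ^ 4) \<Rightarrow> bool" where
  "in_dirac_domain u p \<longleftrightarrow> (\<forall>k. has_weak_L2_derivative (\<lambda>x. u x $ k) (\<lambda>x. p x $ k) \<and>
     (\<lambda>x. of_real x * u x $ k) \<in> L2)"

lemma in_dirac_domain_H_dom: "in_dirac_domain u p \<Longrightarrow> u \<in> H_dom"
  by (auto simp: in_dirac_domain_def H_dom_def H1_def weighted_L2_iff has_weak_L2_derivative_def)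

lemma H_dom_in_dirac_domain: "u \<in> H_dom \<Longrightarrow> in_dirac_domain u (\<lambda>x. \<chi> k. weak_deriv (\<lambda>y. u y $ k) x)"
  unfolding in_dirac_domain_def H_dom_def
  using weak_deriv_weak weighted_L2_iff by (auto simp: has_weak_L2_derivative_def)

lemma shift_H_op_AE:
  assumes "in_dirac_domain u p" shows "L2_eq (shift_op (H_op m \<theta>) z u) (dirac_sym m \<theta> u p z)"
proof -
  have "AE x in lborel. weak_deriv (\<lambda>y. u y $ k) x = p x $ k" for k
    using assms by (intro weak_deriv_eq) (simp add: in_dirac_domain_def)
  then have "AE x in lborel. \<forall>k. weak_deriv (\<lambda>y. u y $ k) x = p x $ k" by (simp add: AE_all_countable)
  then show ?thesis unfolding L2_eq_def shift_H_op
    by eventually_elim (simp add: vec_eq_iff forall_4 dirac_sym_nth raise_op_def lower_op_def)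
qed

lemma in_dirac_domain_L2:
  assumes "in_dirac_domain u p"
  shows "u \<in> L2" "p \<in> L2" "(\<lambda>x. u x $ k) \<in> L2" "(\<lambda>x. p x $ k) \<in> L2" "(\<lambda>x. of_real x * u x $ k) \<in> L2"
  using assms by (auto simp: in_dirac_domain_def has_weak_L2_derivative_def intro!: L2_vecI)

lemma raise_lower_L2:
  assumes "u \<in> L2" "p \<in> L2" "(\<lambda>x. of_real x * u x) \<in> L2"
  shows "raise_op \<theta> u p \<in> L2" "lower_op \<theta> u p \<in> L2"
  unfolding raise_op_def[abs_def] lower_op_def[abs_def] by (intro L2_add L2_diff L2_mult_const assms)+

lemma dirac_sym_L2:
  assumes "in_dirac_domain u p" shows "dirac_sym m \<theta> u p z \<in> L2"
proof (rule L2_vecI)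
  have "\<forall>k. (\<lambda>x. dirac_sym m \<theta> u p z x $ k) \<in> L2"
    unfolding forall_4 dirac_sym_nth
    by (intro conjI L2_add L2_diff L2_mult_const raise_lower_L2 in_dirac_domain_L2[OF assms])
  then show "(\<lambda>x. dirac_sym m \<theta> u p z x $ k) \<in> L2" for k by blast
qed

lemma in_dirac_domain_lincomb:
  assumes u: "in_dirac_domain u p" and v: "in_dirac_domain v q"
  shows "in_dirac_domain (\<lambda>x. u x + c *\<^sub>R v x) (\<lambda>x. p x + c *\<^sub>R q x)"
  unfolding in_dirac_domain_def
proof (intro allI conjI)
  fix k
  have "has_weak_L2_derivative (\<lambda>x. u x $ k + c *\<^sub>R v x $ k) (\<lambda>x. p x $ k + c *\<^sub>R q x $ k)"
    using u v by (intro has_weak_L2_derivative_add has_weak_L2_derivative_linear[OF _ bounded_linear_scaleR_right])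
      (auto simp: in_dirac_domain_def)
  then show "has_weak_L2_derivative (\<lambda>x. (u x + c *\<^sub>R v x) $ k) (\<lambda>x. (p x + c *\<^sub>R q x) $ k)" by simp
  have "(\<lambda>x. of_real x * u x $ k + c *\<^sub>R (of_real x * v x $ k)) \<in> L2"
    by (intro L2_add L2_scaleR in_dirac_domain_L2(5)[OF u] in_dirac_domain_L2(5)[OF v])
  then show "(\<lambda>x. of_real x * (u x + c *\<^sub>R v x) $ k) \<in> L2" by (simp add: algebra_simps)
qed

lemma dirac_sym_lincomb:
  "dirac_sym m \<theta> (\<lambda>x. u x + c *\<^sub>R v x) (\<lambda>x. p x + c *\<^sub>R q x) z x =
   dirac_sym m \<theta> u p z x + c *\<^sub>R dirac_sym m \<theta> v q z x"
  by (simp add: vec_eq_iff forall_4 dirac_sym_nth raise_op_def lower_op_def algebra_simps)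

text \<open>The difference of the two halves satisfies the pair equation with \<open>- z\<close>, up
  to sign, which is harmless because \<open>\<kappa>\<close> depends only on
  \<open>\<bar>Re z\<bar>\<close> and \<open>\<bar>Im z\<bar>\<close>. The parallelogram law,
  applied to \<open>u\<close> and to its image, recombines the two estimates without loss.\<close>

theorem dirac_lower_bound:
  fixes m \<theta> \<kappa> :: real and z :: complex
  assumes \<theta>: "- (pi / 2) < \<theta>" "\<theta> < pi / 2" and m: "0 \<le> m"
    and \<kappa>: "\<kappa> = (1 - \<bar>tan (\<theta> / 2)\<bar>) * \<bar>Im z\<bar> - (\<bar>Re z\<bar> + m) * \<bar>tan (\<theta> / 2)\<bar>" and pos: "0 < \<kappa>"
    and u: "in_dirac_domain u p"
  shows "\<kappa> * L2_norm u \<le> L2_norm (dirac_sym m \<theta> u p z)"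
proof -
  define v where "v k x = u x $ k" for k x
  define q where "q k x = p x $ k" for k x
  define f where "f k x = dirac_sym m \<theta> u p z x $ k" for k x
  have w: "has_weak_L2_derivative (v k) (q k)" and xw: "(\<lambda>x. of_real x * v k x) \<in> L2" for k
    using u by (auto simp: in_dirac_domain_def v_def[abs_def] q_def[abs_def])
  have fL: "f k \<in> L2" for k unfolding f_def by (rule L2_nth[OF dirac_sym_L2[OF u]])
  have vL: "v k \<in> L2" for k unfolding v_def by (rule in_dirac_domain_L2(3)[OF u])
  have minus: "has_weak_L2_derivative (\<lambda>x. - v k x) (\<lambda>x. - q k x)" for k
    by (rule has_weak_L2_derivative_linear[OF w bounded_linear_minus[OF bounded_linear_ident]])
  interpret S: weak_pair "\<lambda>x. v 1 x + v 3 x" "\<lambda>x. v 2 x + v 4 x" "\<lambda>x. q 1 x + q 3 x" "\<lambda>x. q 2 x + q 4 x"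
  proof
    show "(\<lambda>x. of_real x * (v 1 x + v 3 x)) \<in> L2" "(\<lambda>x. of_real x * (v 2 x + v 4 x)) \<in> L2"
      unfolding distrib_left by (intro L2_add xw)+
  qed (intro has_weak_L2_derivative_add w)+
  interpret D: weak_pair "\<lambda>x. v 1 x + - v 3 x" "\<lambda>x. v 2 x + - v 4 x" "\<lambda>x. q 1 x + - q 3 x" "\<lambda>x. q 2 x + - q 4 x"
  proof
    show "(\<lambda>x. of_real x * (v 1 x + - v 3 x)) \<in> L2" "(\<lambda>x. of_real x * (v 2 x + - v 4 x)) \<in> L2"
      unfolding distrib_left mult_minus_right by (intro L2_add L2_minus xw)+
  qed (intro has_weak_L2_derivative_add w minus)+
  have "\<kappa>\<^sup>2 * ((L2_norm (\<lambda>x. v 1 x + v 3 x))\<^sup>2 + (L2_norm (\<lambda>x. v 2 x + v 4 x))\<^sup>2) \<le>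
      (L2_norm (\<lambda>x. f 1 x + f 3 x))\<^sup>2 + (L2_norm (\<lambda>x. f 2 x + f 4 x))\<^sup>2"
  proof -
    have "(\<lambda>x. raise_op \<theta> (\<lambda>x. v 2 x + v 4 x) (\<lambda>x. q 2 x + q 4 x) x + (m - z) * (v 1 x + v 3 x)) = (\<lambda>x. f 1 x + f 3 x)"
      "(\<lambda>x. lower_op \<theta> (\<lambda>x. v 1 x + v 3 x) (\<lambda>x. q 1 x + q 3 x) x - (m + z) * (v 2 x + v 4 x)) = (\<lambda>x. f 2 x + f 4 x)"
      by (simp_all add: f_def dirac_sym_nth raise_op_def lower_op_def v_def q_def algebra_simps)
    then show ?thesis using S.pair_estimate[OF \<theta> m \<kappa> pos] by simp
  qed
  moreover have "\<kappa>\<^sup>2 * ((L2_norm (\<lambda>x. v 1 x - v 3 x))\<^sup>2 + (L2_norm (\<lambda>x. v 2 x - v 4 x))\<^sup>2) \<le>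
      (L2_norm (\<lambda>x. f 1 x - f 3 x))\<^sup>2 + (L2_norm (\<lambda>x. f 2 x - f 4 x))\<^sup>2"
  proof -
    have "(\<lambda>x. raise_op \<theta> (\<lambda>x. v 2 x + - v 4 x) (\<lambda>x. q 2 x + - q 4 x) x + (m - - z) * (v 1 x + - v 3 x)) = (\<lambda>x. - (f 1 x - f 3 x))"
      "(\<lambda>x. lower_op \<theta> (\<lambda>x. v 1 x + - v 3 x) (\<lambda>x. q 1 x + - q 3 x) x - (m + - z) * (v 2 x + - v 4 x)) = (\<lambda>x. - (f 2 x - f 4 x))"
      by (simp_all add: f_def dirac_sym_nth raise_op_def lower_op_def v_def q_def algebra_simps)
    moreover have "\<kappa> = (1 - \<bar>tan (\<theta> / 2)\<bar>) * \<bar>Im (- z)\<bar> - (\<bar>Re (- z)\<bar> + m) * \<bar>tan (\<theta> / 2)\<bar>" using \<kappa> by simp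
    ultimately show ?thesis using D.pair_estimate[OF \<theta> m _ pos, of "- z"] L2_norm_minus[of "\<lambda>x. f 1 x - f 3 x"]
        L2_norm_minus[of "\<lambda>x. f 2 x - f 4 x"] by simp
  qed
  ultimately have "\<kappa>\<^sup>2 * (\<Sum>k\<in>UNIV. (L2_norm (v k))\<^sup>2) \<le> (\<Sum>k\<in>UNIV. (L2_norm (f k))\<^sup>2)"
    using arg_cong[OF L2_parallelogram[OF vL[of 1] vL[of 3]], of "(*) (\<kappa>\<^sup>2)"]
      arg_cong[OF L2_parallelogram[OF vL[of 2] vL[of 4]], of "(*) (\<kappa>\<^sup>2)"]
      L2_parallelogram[OF fL[of 1] fL[of 3]] L2_parallelogram[OF fL[of 2] fL[of 4]]
    unfolding sum_4 by (simp add: distrib_left mult.left_commute)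
  then have "(\<kappa> * L2_norm u)\<^sup>2 \<le> (L2_norm (dirac_sym m \<theta> u p z))\<^sup>2"
    unfolding power_mult_distrib L2_norm_vec[OF in_dirac_domain_L2(1)[OF u]] L2_norm_vec[OF dirac_sym_L2[OF u]]
      v_def f_def .
  then show ?thesis by (rule power2_le_imp_le) simp
qed

text \<open>Up to a unimodular factor the operator is \<open>p\<close> plus or minus
  \<open>cis \<theta> * x * u\<close>. In the mixed term, the part with \<open>cos \<theta>\<close>
  is a derivative minus \<open>(cmod u)\<^sup>2\<close> and costs at most the squared norm of
  \<open>u\<close>; the part with \<open>sin \<theta>\<close> uses up a fraction
  \<open>\<bar>sin \<theta>\<bar>\<close> of the two squares. Hence the graph norm controls
  derivative and weight separately.\<close>

lemma raise_lower_graph_bound: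
  assumes \<theta>: "- (pi / 2) < \<theta>" "\<theta> < pi / 2"
    and w: "has_weak_L2_derivative u p" and x: "(\<lambda>x. of_real x * u x) \<in> L2"
    and T: "T = raise_op \<theta> \<or> T = lower_op \<theta>"
  shows "(1 - \<bar>sin \<theta>\<bar>) * ((L2_norm p)\<^sup>2 + (L2_norm (\<lambda>x. of_real x * u x))\<^sup>2) \<le> (L2_norm (T u p))\<^sup>2 + (L2_norm u)\<^sup>2"
proof -
  interpret weak_pair u u p p using w x by unfold_locales
  have L: "u \<in> L2" "p \<in> L2" using w by (auto simp: has_weak_L2_derivative_def)
  \<comment> \<open>The relative sign of the two terms, so that both operators are treated at
    once.\<close>
  define \<sigma> :: real where "\<sigma> = (if T = raise_op \<theta> then -1 else 1)"
  have \<sigma>: "\<sigma> = 1 \<or> \<sigma> = -1" by (simp add: \<sigma>_def)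
  have Tx: "T u p x = (- \<i> * cnj (cis (\<theta> / 2))) * p x - \<sigma> * ((\<i> * cis (\<theta> / 2)) * (of_real x * u x))" for x
    using T by (auto simp: \<sigma>_def raise_op_def lower_op_def)
  have TL: "T u p \<in> L2" using T raise_lower_L2[OF L x] by auto
  have cis2: "cis (\<theta> / 2) * cis (\<theta> / 2) = cis \<theta>" by (simp add: cis_mult)
  have Tn: "cmod (T u p x) = cmod (p x + \<sigma> * cis \<theta> * (of_real x * u x))" for x
  proof -
    have c1: "cnj (cis (\<theta> / 2)) * cis (\<theta> / 2) = 1" by (simp add: cis_cnj cis_mult)
    have "T u p x = (- \<i> * cnj (cis (\<theta> / 2))) * (p x + \<sigma> * (cis (\<theta> / 2) * cis (\<theta> / 2)) * (of_real x * u x))"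
      using c1 by (simp add: Tx algebra_simps)
    then show ?thesis by (simp add: cis2 norm_mult)
  qed
  have pt: "(1 - \<bar>sin \<theta>\<bar>) * ((cmod (p x))\<^sup>2 + (cmod (of_real x * u x))\<^sup>2) + \<sigma> * cos \<theta> * (self_term u p x - (cmod (u x))\<^sup>2)
      \<le> (cmod (T u p x))\<^sup>2" for x
  proof -
    define a where "a = p x"
    define b where "b = complex_of_real x * u x"
    have st: "self_term u p x - (cmod (u x))\<^sup>2 = 2 * Re (cnj b * a)" by (simp add: self_term_def a_def b_def algebra_simps)
    have "(cmod (T u p x))\<^sup>2 = (cmod a)\<^sup>2 + (cmod b)\<^sup>2 + 2 * Re (cnj a * (\<sigma> * cis \<theta> * b))"
    proof -
      have "(cmod (\<sigma> * cis \<theta> * b))\<^sup>2 = (cmod b)\<^sup>2" using \<sigma> by (auto simp: norm_mult)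
      moreover have "(cmod (a + w))\<^sup>2 = (cmod a)\<^sup>2 + (cmod w)\<^sup>2 + 2 * Re (cnj a * w)" for w
        unfolding cmod_power2 by (simp add: power2_eq_square algebra_simps)
      ultimately show ?thesis by (simp only: Tn a_def b_def)
    qed
    also have "Re (cnj a * (\<sigma> * cis \<theta> * b)) = \<sigma> * (cos \<theta> * Re (cnj b * a)) + \<sigma> * (sin \<theta> * Im (cnj b * a))"
      by (simp add: cis.ctr algebra_simps)
    finally have eq: "(cmod (T u p x))\<^sup>2 = (cmod a)\<^sup>2 + (cmod b)\<^sup>2 + 2 * \<sigma> * cos \<theta> * Re (cnj b * a) + 2 * (\<sigma> * sin \<theta> * Im (cnj b * a))"
      by (simp add: algebra_simps)
    have "\<bar>\<sigma> * sin \<theta> * Im (cnj b * a)\<bar> \<le> \<bar>sin \<theta>\<bar> * (cmod b * cmod a)"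
    proof -
      have "\<bar>Im (cnj b * a)\<bar> \<le> cmod b * cmod a" using abs_Im_le_cmod[of "cnj b * a"] by (simp only: norm_mult complex_mod_cnj)
      then have "\<bar>sin \<theta>\<bar> * \<bar>Im (cnj b * a)\<bar> \<le> \<bar>sin \<theta>\<bar> * (cmod b * cmod a)" by (intro mult_left_mono) auto
      then show ?thesis using \<sigma> by (auto simp only: abs_mult abs_minus abs_one mult_1_left)
    qed
    moreover have "2 * (\<bar>sin \<theta>\<bar> * (cmod b * cmod a)) \<le> \<bar>sin \<theta>\<bar> * ((cmod a)\<^sup>2 + (cmod b)\<^sup>2)"
    proof -
      have "2 * (cmod b * cmod a) \<le> (cmod a)\<^sup>2 + (cmod b)\<^sup>2" using sum_squares_bound[of "cmod a" "cmod b"] by (simp add: mult_ac)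
      then have "\<bar>sin \<theta>\<bar> * (2 * (cmod b * cmod a)) \<le> \<bar>sin \<theta>\<bar> * ((cmod a)\<^sup>2 + (cmod b)\<^sup>2)" by (intro mult_left_mono) auto
      then show ?thesis by simp
    qed
    ultimately have "- (\<bar>sin \<theta>\<bar> * ((cmod a)\<^sup>2 + (cmod b)\<^sup>2)) \<le> 2 * (\<sigma> * sin \<theta> * Im (cnj b * a))" by linarith
    then show ?thesis unfolding eq st by (simp add: a_def[symmetric] b_def[symmetric] algebra_simps)
  qed
  have i: "integrable lborel (self_term u p)" "(LINT x|lborel. self_term u p x) = 0" by (rule self_term1)+
  have "(LINT x|lborel. (1 - \<bar>sin \<theta>\<bar>) * ((cmod (p x))\<^sup>2 + (cmod (of_real x * u x))\<^sup>2) + \<sigma> * cos \<theta> * (self_term u p x - (cmod (u x))\<^sup>2))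
      \<le> (LINT x|lborel. (cmod (T u p x))\<^sup>2)"
    using L2_integrable[OF L(1)] L2_integrable[OF L(2)] L2_integrable[OF x] i(1) L2_integrable[OF TL]
    by (intro integral_mono pt) (auto simp del: norm_mult)
  also have "(LINT x|lborel. (1 - \<bar>sin \<theta>\<bar>) * ((cmod (p x))\<^sup>2 + (cmod (of_real x * u x))\<^sup>2) + \<sigma> * cos \<theta> * (self_term u p x - (cmod (u x))\<^sup>2))
      = (1 - \<bar>sin \<theta>\<bar>) * ((L2_norm p)\<^sup>2 + (L2_norm (\<lambda>x. of_real x * u x))\<^sup>2) - \<sigma> * cos \<theta> * (L2_norm u)\<^sup>2"
    using L2_integrable[OF L(1)] L2_integrable[OF L(2)] L2_integrable[OF x] i
    by (simp add: L2_norm_power2 del: norm_mult)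
  also have "(LINT x|lborel. (cmod (T u p x))\<^sup>2) = (L2_norm (T u p))\<^sup>2" by (simp add: L2_norm_power2)
  finally have "(1 - \<bar>sin \<theta>\<bar>) * ((L2_norm p)\<^sup>2 + (L2_norm (\<lambda>x. of_real x * u x))\<^sup>2) - \<sigma> * cos \<theta> * (L2_norm u)\<^sup>2 \<le> (L2_norm (T u p))\<^sup>2" .
  moreover have "\<sigma> * cos \<theta> * (L2_norm u)\<^sup>2 \<le> 1 * (L2_norm u)\<^sup>2"
  proof (intro mult_right_mono)
    have "\<bar>\<sigma> * cos \<theta>\<bar> \<le> 1" using \<sigma> abs_cos_le_one[of \<theta>] by auto
    then show "\<sigma> * cos \<theta> \<le> 1" by linarith
  qed simp
  ultimately show ?thesis by linarith
qed

section \<open>Closed range and trivial cokernel\<close>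

definition L2_tendsto :: "(nat \<Rightarrow> real \<Rightarrow> 'a::euclidean_space) \<Rightarrow> (real \<Rightarrow> 'a) \<Rightarrow> bool" where
  "L2_tendsto F f \<longleftrightarrow> (\<forall>n. F n \<in> L2) \<and> f \<in> L2 \<and> (\<lambda>n. L2_norm (\<lambda>x. F n x - f x)) \<longlonglongrightarrow> 0"

lemma L2_tendsto_add:
  assumes F: "L2_tendsto F f" and G: "L2_tendsto G g" shows "L2_tendsto (\<lambda>n x. F n x + G n x) (\<lambda>x. f x + g x)"
  unfolding L2_tendsto_def
proof (intro conjI allI)
  have L: "F n \<in> L2" "G n \<in> L2" "f \<in> L2" "g \<in> L2" for n using F G by (auto simp: L2_tendsto_def)
  show "(\<lambda>x. F n x + G n x) \<in> L2" "(\<lambda>x. f x + g x) \<in> L2" for n by (intro L2_add L)+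
  have lim: "(\<lambda>n. L2_norm (\<lambda>x. F n x - f x) + L2_norm (\<lambda>x. G n x - g x)) \<longlonglongrightarrow> 0"
    using F G unfolding L2_tendsto_def by (intro tendsto_add_zero) auto
  show "(\<lambda>n. L2_norm (\<lambda>x. (F n x + G n x) - (f x + g x))) \<longlonglongrightarrow> 0"
  proof (rule Lim_null_comparison[OF _ lim], intro always_eventually allI)
    fix n
    have "(\<lambda>x. (F n x + G n x) - (f x + g x)) = (\<lambda>x. (F n x - f x) + (G n x - g x))" by auto
    then show "norm (L2_norm (\<lambda>x. (F n x + G n x) - (f x + g x))) \<le> L2_norm (\<lambda>x. F n x - f x) + L2_norm (\<lambda>x. G n x - g x)"
      using L2_norm_triangle[OF L2_diff[OF L(1) L(3)] L2_diff[OF L(2) L(4)], of n n] by simp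
  qed
qed

lemma L2_tendsto_mult_const:
  assumes "L2_tendsto F f" shows "L2_tendsto (\<lambda>n x. (k::complex) * F n x) (\<lambda>x. k * f x)"
proof -
  have "(\<lambda>n. cmod k * L2_norm (\<lambda>x. F n x - f x)) \<longlonglongrightarrow> 0"
    using assms unfolding L2_tendsto_def by (intro tendsto_mult_right_zero) auto
  moreover have "L2_norm (\<lambda>x. k * F n x - k * f x) = cmod k * L2_norm (\<lambda>x. F n x - f x)" for n
    by (simp only: right_diff_distrib[symmetric] L2_norm_mult_const)
  ultimately show ?thesis using assms by (simp add: L2_tendsto_def L2_mult_const)
qed

lemma L2_tendsto_diff:
  fixes F G :: "nat \<Rightarrow> real \<Rightarrow> complex"
  assumes "L2_tendsto F f" "L2_tendsto G g" shows "L2_tendsto (\<lambda>n x. F n x - G n x) (\<lambda>x. f x - g x)"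
  using L2_tendsto_add[OF assms(1) L2_tendsto_mult_const[OF assms(2), of "-1"]] by simp

lemma L2_tendsto_nth:
  assumes "L2_tendsto F f" shows "L2_tendsto (\<lambda>n x. F n x $ k) (\<lambda>x. (f x :: complex ^ 'n) $ k)"
proof -
  have L: "F n \<in> L2" "f \<in> L2" for n using assms by (auto simp: L2_tendsto_def)
  have "(\<lambda>n. L2_norm (\<lambda>x. (F n x - f x) $ k)) \<longlonglongrightarrow> 0"
  proof (rule Lim_null_comparison)
    show "(\<lambda>n. L2_norm (\<lambda>x. F n x - f x)) \<longlonglongrightarrow> 0" using assms by (simp add: L2_tendsto_def)
    show "eventually (\<lambda>n. norm (L2_norm (\<lambda>x. (F n x - f x) $ k)) \<le> L2_norm (\<lambda>x. F n x - f x)) sequentially"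
      using L2_norm_nth_le[OF L2_diff[OF L]] by simp
  qed
  then show ?thesis using L2_nth[OF L(1)] L2_nth[OF L(2)] by (simp add: L2_tendsto_def)
qed

lemma L2_tendsto_unique:
  assumes "L2_tendsto F f" "L2_tendsto F g" shows "AE x in lborel. f x = g x"
proof -
  have L: "F n \<in> L2" "f \<in> L2" "g \<in> L2" for n using assms by (auto simp: L2_tendsto_def)
  have "(\<lambda>n. L2_norm (\<lambda>x. F n x - f x) + L2_norm (\<lambda>x. F n x - g x)) \<longlonglongrightarrow> 0 + 0"
    using assms unfolding L2_tendsto_def by (intro tendsto_add) auto
  moreover have "L2_norm (\<lambda>x. f x - g x) \<le> L2_norm (\<lambda>x. F n x - f x) + L2_norm (\<lambda>x. F n x - g x)" for n
    using L2_norm_triangle_diff[OF L(2) L(1) L(3), of n] L2_norm_minus_commute[of f "F n"] by simp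
  ultimately have "L2_norm (\<lambda>x. f x - g x) \<le> 0" by (intro LIMSEQ_le_const) auto
  then have "L2_norm (\<lambda>x. f x - g x) = 0" using L2_norm_nonneg[of "\<lambda>x. f x - g x"] by linarith
  then have "AE x in lborel. f x - g x = 0" using L2_norm_eq_0_iff[OF L2_diff[OF L(2,3)]] by simp
  then show ?thesis by eventually_elim simp
qed

lemma L2_cong_AE:
  fixes f g :: "real \<Rightarrow> 'a::euclidean_space"
  assumes "f \<in> L2" "AE x in lborel. f x = g x" "g \<in> borel_measurable borel" shows "g \<in> L2"
proof -
  note [measurable] = assms(3) L2_measurable[OF assms(1)]
  have "integrable lborel (\<lambda>x. (norm (g x))\<^sup>2)"
    using L2_integrable[OF assms(1)] by (rule integrable_cong_AE_imp) (use assms(2) in \<open>measurable, auto\<close>)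
  then show ?thesis using assms(3) by (simp add: L2_def)
qed

lemma L2_tendsto_CauchyE:
  fixes F :: "nat \<Rightarrow> real \<Rightarrow> 'a::euclidean_space" and G :: "nat \<Rightarrow> real \<Rightarrow> 'b::euclidean_space"
  assumes G: "L2_tendsto G g" and F: "\<And>n. F n \<in> L2"
    and le: "\<And>m n. L2_norm (\<lambda>x. F m x - F n x) \<le> K * L2_norm (\<lambda>x. G m x - G n x)" and K: "0 < K"
  obtains f where "L2_tendsto F f"
proof -
  have L: "G n \<in> L2" "g \<in> L2" for n using G by (auto simp: L2_tendsto_def)
  have "L2_Cauchy F"
    unfolding L2_Cauchy_def
  proof (intro allI impI)
    fix e :: real assume "0 < e"
    then have "0 < e / (2 * K)" using K by simp
    then obtain N where N: "\<And>n. n \<ge> N \<Longrightarrow> L2_norm (\<lambda>x. G n x - g x) < e / (2 * K)"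
      using G unfolding L2_tendsto_def LIMSEQ_def dist_real_def by (metis L2_norm_nonneg abs_of_nonneg diff_zero)
    show "\<exists>N. \<forall>m\<ge>N. \<forall>n\<ge>N. L2_norm (\<lambda>x. F m x - F n x) < e"
    proof (intro exI allI impI)
      fix m n assume mn: "N \<le> m" "N \<le> n"
      have "L2_norm (\<lambda>x. G m x - G n x) < e / (2 * K) + e / (2 * K)"
        using L2_norm_triangle_diff[OF L(1) L(2) L(1), of m n] N[OF mn(1)] N[OF mn(2)] L2_norm_minus_commute[of g "G n"]
        by linarith
      then have "K * L2_norm (\<lambda>x. G m x - G n x) < K * (e / (2 * K) + e / (2 * K))"
        using K by (rule mult_strict_left_mono)
      also have "\<dots> = e" using K by (simp add: field_simps)
      finally show "L2_norm (\<lambda>x. F m x - F n x) < e" using le[of m n] by linarith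
    qed
  qed
  from L2_complete[OF F this] obtain f where "f \<in> L2" "(\<lambda>n. L2_norm (\<lambda>x. F n x - f x)) \<longlonglongrightarrow> 0" by blast
  then show ?thesis by (intro that[of f]) (simp add: L2_tendsto_def F)
qed

text \<open>Multiplication by \<open>x\<close> is bounded on each window \<open>{- R..R}\<close>, so
  both limits agree there, and countably many windows exhaust the line.\<close>

lemma L2_tendsto_weighted:
  assumes u: "L2_tendsto u U" and X: "L2_tendsto (\<lambda>n x. of_real x * u n x) X"
  shows "AE x in lborel. X x = of_real x * (U x :: complex)"
proof -
  have L: "u n \<in> L2" "U \<in> L2" "(\<lambda>x. of_real x * u n x) \<in> L2" "X \<in> L2" for n
    using u X by (auto simp: L2_tendsto_def)
  note [measurable] = L2_measurable[OF L(1)] L2_measurable[OF L(2)] L2_measurable[OF L(4)]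
  define c where "c R h x = indicator {- R..R} x *\<^sub>R (h x :: complex)" for R h and x :: real
  have cut: "c R h \<in> L2 \<and> L2_norm (c R h) \<le> L2_norm h" if "h \<in> L2" for R h
  proof -
    note [measurable] = L2_measurable[OF that]
    have le: "norm (c R h x) \<le> norm (h x)" for x by (simp add: c_def indicator_def)
    have "c R h \<in> L2" by (rule L2_bound1I[OF that, of _ 1]) (use le in \<open>auto simp: c_def[abs_def]\<close>)
    then show ?thesis using L2_norm_mono[OF that, of "c R h"] le by simp
  qed
  have cutX: "L2_tendsto (\<lambda>n. c R (\<lambda>x. of_real x * u n x)) (c R X)" for R
    unfolding L2_tendsto_def
  proof (intro conjI allI)
    show "(\<lambda>n. L2_norm (\<lambda>x. c R (\<lambda>x. of_real x * u n x) x - c R X x)) \<longlonglongrightarrow> 0"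
    proof (rule Lim_null_comparison)
      show "(\<lambda>n. L2_norm (\<lambda>x. of_real x * u n x - X x)) \<longlonglongrightarrow> 0" using X by (simp add: L2_tendsto_def)
      show "eventually (\<lambda>n. norm (L2_norm (\<lambda>x. c R (\<lambda>x. of_real x * u n x) x - c R X x)) \<le> L2_norm (\<lambda>x. of_real x * u n x - X x)) sequentially"
      proof (intro always_eventually allI)
        fix n
        have "(\<lambda>x. c R (\<lambda>x. of_real x * u n x) x - c R X x) = c R (\<lambda>x. of_real x * u n x - X x)"
          by (auto simp: c_def scaleR_diff_right)
        then show "norm (L2_norm (\<lambda>x. c R (\<lambda>x. of_real x * u n x) x - c R X x)) \<le> L2_norm (\<lambda>x. of_real x * u n x - X x)"
          using cut[OF L2_diff[OF L(3,4)], of R n] by simp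
      qed
    qed
  qed (use cut L in auto)
  have cutU: "L2_tendsto (\<lambda>n. c R (\<lambda>x. of_real x * u n x)) (c R (\<lambda>x. of_real x * U x))" if R: "0 \<le> R" for R
  proof -
    have bound: "norm (c R (\<lambda>x. of_real x * h x) x) \<le> norm (R *\<^sub>R h x)" for h x
      using R by (auto simp: c_def indicator_def norm_mult intro!: mult_right_mono)
    have cR: "c R (\<lambda>x. of_real x * h x) \<in> L2 \<and> L2_norm (c R (\<lambda>x. of_real x * h x)) \<le> R * L2_norm h" if "h \<in> L2" for h
    proof -
      note [measurable] = L2_measurable[OF that]
      have "c R (\<lambda>x. of_real x * h x) \<in> L2"
        by (rule L2_bound1I[OF L2_scaleR[OF that, of R], of _ 1]) (use bound[of h] in \<open>auto simp: c_def[abs_def]\<close>)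
      then show ?thesis using L2_norm_mono[OF L2_scaleR[OF that, of R], of "c R (\<lambda>x. of_real x * h x)"] bound[of h] R
        by (simp add: L2_norm_scaleR)
    qed
    show ?thesis
      unfolding L2_tendsto_def
    proof (intro conjI allI)
      show "(\<lambda>n. L2_norm (\<lambda>x. c R (\<lambda>x. of_real x * u n x) x - c R (\<lambda>x. of_real x * U x) x)) \<longlonglongrightarrow> 0"
      proof (rule Lim_null_comparison)
        show "(\<lambda>n. R * L2_norm (\<lambda>x. u n x - U x)) \<longlonglongrightarrow> 0" using u by (auto simp: L2_tendsto_def intro: tendsto_mult_right_zero)
        show "eventually (\<lambda>n. norm (L2_norm (\<lambda>x. c R (\<lambda>x. of_real x * u n x) x - c R (\<lambda>x. of_real x * U x) x)) \<le> R * L2_norm (\<lambda>x. u n x - U x)) sequentially"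
        proof (intro always_eventually allI)
          fix n
          have "(\<lambda>x. c R (\<lambda>x. of_real x * u n x) x - c R (\<lambda>x. of_real x * U x) x) = c R (\<lambda>x. of_real x * (u n x - U x))"
            by (auto simp: c_def scaleR_diff_right right_diff_distrib)
          then show "norm (L2_norm (\<lambda>x. c R (\<lambda>x. of_real x * u n x) x - c R (\<lambda>x. of_real x * U x) x)) \<le> R * L2_norm (\<lambda>x. u n x - U x)"
            using cR[OF L2_diff[OF L(1,2)], of n] by simp
        qed
      qed
    qed (use cR L in auto)
  qed
  have "AE x in lborel. \<forall>n::nat. c (real n) X x = c (real n) (\<lambda>x. of_real x * U x) x"
    unfolding AE_all_countable using L2_tendsto_unique[OF cutX cutU] by simp
  then show ?thesis
  proof eventually_elim
    case (elim x)
    obtain n :: nat where "\<bar>x\<bar> \<le> real n" using real_arch_simple by blast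
    then show ?case using elim[rule_format, of n] by (simp add: c_def indicator_def abs_le_iff)
  qed
qed

section \<open>Graph-norm control and closed range\<close>

definition dirac_gap :: "real \<Rightarrow> real \<Rightarrow> complex \<Rightarrow> real" where
  "dirac_gap m \<theta> z = (1 - \<bar>tan (\<theta> / 2)\<bar>) * \<bar>Im z\<bar> - (\<bar>Re z\<bar> + m) * \<bar>tan (\<theta> / 2)\<bar>"

locale dirac_resolvent_region =
  fixes m \<theta> :: real and z :: complex
  assumes \<theta>: "- (pi / 2) < \<theta>" "\<theta> < pi / 2" and m: "0 \<le> m" and gap: "0 < dirac_gap m \<theta> z"
begin

lemma lower_bound: "in_dirac_domain u p \<Longrightarrow> dirac_gap m \<theta> z * L2_norm u \<le> L2_norm (dirac_sym m \<theta> u p z)"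
  using dirac_lower_bound[OF \<theta> m dirac_gap_def gap] .

text \<open>Each component is differentiated in exactly one row of \<open>H - z\<close>. The
  remaining terms of that row, apart from the weight, are already controlled by
  \<open>lower_bound\<close>, and \<open>raise_lower_graph_bound\<close> separates the derivative
  from the weight.\<close>

lemma graph_bound:
  "\<exists>K>0. \<forall>u p k. in_dirac_domain u p \<longrightarrow>
     L2_norm (\<lambda>x. u x $ k) \<le> K * L2_norm (dirac_sym m \<theta> u p z) \<and>
     L2_norm (\<lambda>x. p x $ k) \<le> K * L2_norm (dirac_sym m \<theta> u p z) \<and>
     L2_norm (\<lambda>x. of_real x * u x $ k) \<le> K * L2_norm (dirac_sym m \<theta> u p z)"
proof -
  define \<kappa> where "\<kappa> = dirac_gap m \<theta> z"
  have \<kappa>: "0 < \<kappa>" using gap by (simp add: \<kappa>_def)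
  have "0 < cos \<theta>" using \<theta> by (intro cos_gt_zero_pi) auto
  then have "(sin \<theta>)\<^sup>2 < 1" using sin_cos_squared_add[of \<theta>] by (smt (verit) zero_less_power)
  then have S: "0 < 1 - \<bar>sin \<theta>\<bar>" by (simp add: abs_square_less_1)
  \<comment> \<open>\<open>A\<close> collects one row: the image itself, then the mass and the
    spectral term, both estimated through \<open>1 / \<kappa>\<close>. \<open>B\<close> is what
    \<open>raise_lower_graph_bound\<close> makes of it.\<close>
  define A where "A = 1 + (m + cmod z) / \<kappa>"
  define B where "B = sqrt ((A\<^sup>2 + (1 / \<kappa>)\<^sup>2) / (1 - \<bar>sin \<theta>\<bar>))"
  define K where "K = 1 / \<kappa> + B"
  have B0: "0 \<le> B" unfolding B_def using S by simp
  have K0: "0 < K" using \<kappa> B0 by (simp add: K_def add_pos_nonneg)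
  have main: "L2_norm (\<lambda>x. u x $ k) \<le> K * L2_norm (dirac_sym m \<theta> u p z) \<and>
      L2_norm (\<lambda>x. p x $ k) \<le> K * L2_norm (dirac_sym m \<theta> u p z) \<and>
      L2_norm (\<lambda>x. of_real x * u x $ k) \<le> K * L2_norm (dirac_sym m \<theta> u p z)"
    if u: "in_dirac_domain u p" for u p k
  proof -
    define d where "d = L2_norm (dirac_sym m \<theta> u p z)"
    note uL = in_dirac_domain_L2[OF u] and DL = dirac_sym_L2[OF u, of m \<theta> z]
    have Nd: "L2_norm u \<le> d / \<kappa>" using lower_bound[OF u] \<kappa> by (simp add: d_def \<kappa>_def field_simps)
    have comp: "L2_norm (\<lambda>x. u x $ j) \<le> d / \<kappa>" for j using L2_norm_nth_le[OF uL(1), of j] Nd by linarith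
    have Tk: "L2_norm (T (\<lambda>x. u x $ k) (\<lambda>x. p x $ k)) \<le> A * d"
      if T: "T (\<lambda>x. u x $ k) (\<lambda>x. p x $ k) = (\<lambda>x. (dirac_sym m \<theta> u p z x $ i + w * u x $ j) + z * u x $ i)"
        and w: "cmod w = m" for T i j w
    proof -
      have a: "(\<lambda>x. dirac_sym m \<theta> u p z x $ i) \<in> L2" by (rule L2_nth[OF DL])
      have b: "(\<lambda>x. w * u x $ j) \<in> L2" "(\<lambda>x. z * u x $ i) \<in> L2" by (intro L2_mult_const uL)+
      have "L2_norm (T (\<lambda>x. u x $ k) (\<lambda>x. p x $ k)) \<le>
          L2_norm (\<lambda>x. dirac_sym m \<theta> u p z x $ i + w * u x $ j) + L2_norm (\<lambda>x. z * u x $ i)"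
        unfolding T by (rule L2_norm_triangle[OF L2_add[OF a b(1)] b(2)])
      also have "L2_norm (\<lambda>x. dirac_sym m \<theta> u p z x $ i + w * u x $ j) \<le> L2_norm (\<lambda>x. dirac_sym m \<theta> u p z x $ i) + L2_norm (\<lambda>x. w * u x $ j)"
        by (rule L2_norm_triangle[OF a b(1)])
      also have "L2_norm (\<lambda>x. dirac_sym m \<theta> u p z x $ i) \<le> d" unfolding d_def by (rule L2_norm_nth_le[OF DL])
      also have "L2_norm (\<lambda>x. w * u x $ j) \<le> m * (d / \<kappa>)"
        unfolding L2_norm_mult_const w using comp m by (intro mult_left_mono) auto
      also have "L2_norm (\<lambda>x. z * u x $ i) \<le> cmod z * (d / \<kappa>)"
        unfolding L2_norm_mult_const using comp by (intro mult_left_mono) auto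
      finally show ?thesis by (simp add: A_def algebra_simps add_divide_distrib)
    qed
    have w: "has_weak_L2_derivative (\<lambda>x. u x $ k) (\<lambda>x. p x $ k)" using u by (simp add: in_dirac_domain_def)
    have "k = 1 \<or> k = 2 \<or> k = 3 \<or> k = 4" by (rule exhaust_4)
    then obtain T where T: "T = raise_op \<theta> \<or> T = lower_op \<theta>" "L2_norm (T (\<lambda>x. u x $ k) (\<lambda>x. p x $ k)) \<le> A * d"
    \<comment> \<open>Component \<open>k\<close> is differentiated in row \<open>5 - k\<close>;
      \<open>w\<close> and \<open>j\<close> describe the mass term of that row.\<close>
    proof (elim disjE)
      assume k: "k = 1"
      show ?thesis by (rule that[of "lower_op \<theta>"], simp, rule Tk[where i=4 and j=2 and w=m])
        (use m in \<open>auto simp: k dirac_sym_nth fun_eq_iff\<close>)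
    next
      assume k: "k = 2"
      show ?thesis by (rule that[of "raise_op \<theta>"], simp, rule Tk[where i=3 and j=1 and w="-m"])
        (use m in \<open>auto simp: k dirac_sym_nth fun_eq_iff\<close>)
    next
      assume k: "k = 3"
      show ?thesis by (rule that[of "lower_op \<theta>"], simp, rule Tk[where i=2 and j=4 and w=m])
        (use m in \<open>auto simp: k dirac_sym_nth fun_eq_iff\<close>)
    next
      assume k: "k = 4"
      show ?thesis by (rule that[of "raise_op \<theta>"], simp, rule Tk[where i=1 and j=3 and w="-m"])
        (use m in \<open>auto simp: k dirac_sym_nth fun_eq_iff\<close>)
    qed
    have d0: "0 \<le> d" by (simp add: d_def)
    have "(1 - \<bar>sin \<theta>\<bar>) * ((L2_norm (\<lambda>x. p x $ k))\<^sup>2 + (L2_norm (\<lambda>x. of_real x * u x $ k))\<^sup>2) \<le>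
        (L2_norm (T (\<lambda>x. u x $ k) (\<lambda>x. p x $ k)))\<^sup>2 + (L2_norm (\<lambda>x. u x $ k))\<^sup>2"
      by (rule raise_lower_graph_bound[OF \<theta> w uL(5) T(1)])
    also have "\<dots> \<le> (A * d)\<^sup>2 + (d / \<kappa>)\<^sup>2" using T(2) comp[of k] by (intro add_mono power_mono) auto
    also have "\<dots> = (A\<^sup>2 + (1 / \<kappa>)\<^sup>2) * d\<^sup>2" by (simp add: power_mult_distrib power_divide algebra_simps)
    finally have "(L2_norm (\<lambda>x. p x $ k))\<^sup>2 + (L2_norm (\<lambda>x. of_real x * u x $ k))\<^sup>2 \<le> (A\<^sup>2 + (1 / \<kappa>)\<^sup>2) / (1 - \<bar>sin \<theta>\<bar>) * d\<^sup>2"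
      using S by (simp add: field_simps)
    also have "\<dots> = (B * d)\<^sup>2" using S by (simp add: B_def power_mult_distrib)
    finally have sq: "(L2_norm (\<lambda>x. p x $ k))\<^sup>2 + (L2_norm (\<lambda>x. of_real x * u x $ k))\<^sup>2 \<le> (B * d)\<^sup>2" .
    have "(L2_norm (\<lambda>x. p x $ k))\<^sup>2 \<le> (B * d)\<^sup>2" "(L2_norm (\<lambda>x. of_real x * u x $ k))\<^sup>2 \<le> (B * d)\<^sup>2"
      using sq zero_le_power2[of "L2_norm (\<lambda>x. p x $ k)"] zero_le_power2[of "L2_norm (\<lambda>x. of_real x * u x $ k)"] by linarith+
    then have "L2_norm (\<lambda>x. p x $ k) \<le> B * d" "L2_norm (\<lambda>x. of_real x * u x $ k) \<le> B * d"
      using B0 d0 by (auto intro: power2_le_imp_le)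
    moreover have "B * d \<le> K * d" using \<kappa> d0 by (intro mult_right_mono) (auto simp: K_def)
    moreover have "d / \<kappa> \<le> K * d" using B0 d0 by (simp add: K_def algebra_simps)
    ultimately show ?thesis using comp[of k] by (auto simp: d_def[symmetric])
  qed
  show ?thesis using K0 main by blast
qed

definition range_set :: "(real \<Rightarrow> complex ^ 4) set" where
  "range_set = {g \<in> L2. \<exists>u p. in_dirac_domain u p \<and> (AE x in lborel. dirac_sym m \<theta> u p z x = g x)}"

text \<open>\<open>graph_bound\<close> makes the preimages, their derivatives and their products
  with \<open>x\<close> Cauchy together; the limits belong to one domain element because weak
  differentiation and multiplication by \<open>x\<close> are closed operations.\<close>

lemma range_set_closed:
  assumes F: "\<And>n. F n \<in> range_set" and g: "g \<in> L2" and lim: "(\<lambda>n. L2_norm (\<lambda>x. F n x - g x)) \<longlonglongrightarrow> 0"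
  shows "g \<in> range_set"
proof -
  obtain u p where up: "\<And>n. in_dirac_domain (u n) (p n)" and eq: "\<And>n. AE x in lborel. dirac_sym m \<theta> (u n) (p n) z x = F n x"
    using F unfolding range_set_def mem_Collect_eq by metis
  define D where "D n = dirac_sym m \<theta> (u n) (p n) z" for n
  have DL: "D n \<in> L2" for n unfolding D_def by (rule dirac_sym_L2[OF up])
  have FL: "F n \<in> L2" for n using F by (simp add: range_set_def)
  have "L2_norm (\<lambda>x. D n x - g x) = L2_norm (\<lambda>x. F n x - g x)" for n
  proof (rule L2_norm_cong_AE)
    show "AE x in lborel. D n x - g x = F n x - g x" using eq[of n] by eventually_elim (simp add: D_def)
  qed (use L2_measurable[OF DL] L2_measurable[OF FL] L2_measurable[OF g] in auto)
  then have D: "L2_tendsto D g" using DL g lim by (simp add: L2_tendsto_def)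
  obtain K where K0: "0 < K" and Kall: "\<forall>u p k. in_dirac_domain u p \<longrightarrow>
     L2_norm (\<lambda>x. u x $ k) \<le> K * L2_norm (dirac_sym m \<theta> u p z) \<and>
     L2_norm (\<lambda>x. p x $ k) \<le> K * L2_norm (dirac_sym m \<theta> u p z) \<and>
     L2_norm (\<lambda>x. of_real x * u x $ k) \<le> K * L2_norm (dirac_sym m \<theta> u p z)"
    using graph_bound by blast
  have K: "0 < K"
    "in_dirac_domain u p \<Longrightarrow> L2_norm (\<lambda>x. u x $ k) \<le> K * L2_norm (dirac_sym m \<theta> u p z)"
    "in_dirac_domain u p \<Longrightarrow> L2_norm (\<lambda>x. p x $ k) \<le> K * L2_norm (dirac_sym m \<theta> u p z)"
    "in_dirac_domain u p \<Longrightarrow> L2_norm (\<lambda>x. of_real x * u x $ k) \<le> K * L2_norm (dirac_sym m \<theta> u p z)" for u p k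
    using K0 Kall by blast+
  have dd: "in_dirac_domain (\<lambda>x. u i x - u j x) (\<lambda>x. p i x - p j x)" for i j
    using in_dirac_domain_lincomb[OF up up, of i "-1" j] by simp
  have dD: "dirac_sym m \<theta> (\<lambda>x. u i x - u j x) (\<lambda>x. p i x - p j x) z = (\<lambda>x. D i x - D j x)" for i j
    using dirac_sym_lincomb[of m \<theta> "u i" "-1" "u j" "p i" "p j" z] by (simp add: D_def fun_eq_iff)
  note upL = in_dirac_domain_L2[OF up]
  have "\<exists>U. L2_tendsto (\<lambda>n x. u n x $ k) U" for k
  proof -
    have "L2_norm (\<lambda>x. u i x $ k - u j x $ k) \<le> K * L2_norm (\<lambda>x. D i x - D j x)" for i j
      using K(2)[OF dd[of i j], where k=k] unfolding dD by simp
    from L2_tendsto_CauchyE[where F="\<lambda>n x. u n x $ k", OF D upL(3) this K(1)] show ?thesis by blast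
  qed
  then obtain U where U: "\<And>k. L2_tendsto (\<lambda>n x. u n x $ k) (U k)" by metis
  have "\<exists>P. L2_tendsto (\<lambda>n x. p n x $ k) P" for k
  proof -
    have "L2_norm (\<lambda>x. p i x $ k - p j x $ k) \<le> K * L2_norm (\<lambda>x. D i x - D j x)" for i j
      using K(3)[OF dd[of i j], where k=k] unfolding dD by simp
    from L2_tendsto_CauchyE[where F="\<lambda>n x. p n x $ k", OF D upL(4) this K(1)] show ?thesis by blast
  qed
  then obtain P where P: "\<And>k. L2_tendsto (\<lambda>n x. p n x $ k) (P k)" by metis
  have "\<exists>X. L2_tendsto (\<lambda>n x. of_real x * u n x $ k) X" for k
  proof -
    have "L2_norm (\<lambda>x. of_real x * u i x $ k - of_real x * u j x $ k) \<le> K * L2_norm (\<lambda>x. D i x - D j x)" for i j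
      using K(4)[OF dd[of i j], where k=k] unfolding dD by (simp add: right_diff_distrib)
    from L2_tendsto_CauchyE[where F="\<lambda>n x. of_real x * u n x $ k", OF D upL(5) this K(1)] show ?thesis by blast
  qed
  then obtain X where X: "\<And>k. L2_tendsto (\<lambda>n x. of_real x * u n x $ k) (X k)" by metis
  have XU: "AE x in lborel. X k x = of_real x * U k x" for k by (rule L2_tendsto_weighted[OF U X])
  have ULk: "U k \<in> L2" "P k \<in> L2" "X k \<in> L2" for k using U[of k] P[of k] X[of k] by (auto simp: L2_tendsto_def)
  have xU: "(\<lambda>x. of_real x * U k x) \<in> L2" for k
    by (rule L2_cong_AE[OF ULk(3)[of k] XU]) (use L2_measurable[OF ULk(1)[of k]] in simp)
  have X': "L2_tendsto (\<lambda>n x. of_real x * u n x $ k) (\<lambda>x. of_real x * U k x)" for k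
  proof -
    have "L2_norm (\<lambda>x. of_real x * u n x $ k - of_real x * U k x) = L2_norm (\<lambda>x. of_real x * u n x $ k - X k x)" for n
      by (rule L2_norm_cong_AE) (use XU[of k] L2_measurable[OF upL(5)[of n k]] L2_measurable[OF xU[of k]] L2_measurable[OF ULk(3)[of k]] in auto)
    then show ?thesis using X[of k] xU by (simp add: L2_tendsto_def)
  qed
  define Uv where "Uv x = (\<chi> k. U k x)" for x
  define Pv where "Pv x = (\<chi> k. P k x)" for x
  have dom: "in_dirac_domain Uv Pv"
    unfolding in_dirac_domain_def Uv_def Pv_def
  proof (intro allI conjI)
    fix k
    have "has_weak_L2_derivative (U k) (P k)"
    proof (rule has_weak_L2_derivative_closed)
      show "has_weak_L2_derivative (\<lambda>x. u n x $ k) (\<lambda>x. p n x $ k)" for n using up[of n] by (simp add: in_dirac_domain_def)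
    qed (use U[of k] P[of k] in \<open>auto simp: L2_tendsto_def\<close>)
    then show "has_weak_L2_derivative (\<lambda>x. (\<chi> k. U k x) $ k) (\<lambda>x. (\<chi> k. P k x) $ k)" by simp
    show "(\<lambda>x. of_real x * (\<chi> k. U k x) $ k) \<in> L2" using xU by simp
  qed
  have "\<forall>k. L2_tendsto (\<lambda>n x. D n x $ k) (\<lambda>x. dirac_sym m \<theta> Uv Pv z x $ k)"
    unfolding D_def forall_4 dirac_sym_nth raise_op_def lower_op_def Uv_def Pv_def vec_lambda_beta
    by (intro conjI L2_tendsto_add L2_tendsto_diff L2_tendsto_mult_const U P X')
  then have "AE x in lborel. dirac_sym m \<theta> Uv Pv z x $ k = g x $ k" for k
    using L2_tendsto_unique L2_tendsto_nth[OF D] by blast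
  then have "AE x in lborel. \<forall>k. dirac_sym m \<theta> Uv Pv z x $ k = g x $ k" by (simp add: AE_all_countable)
  then have "AE x in lborel. dirac_sym m \<theta> Uv Pv z x = g x" by eventually_elim (simp add: vec_eq_iff)
  then show ?thesis using dom g unfolding range_set_def by blast
qed

end

section \<open>Cut-offs and weak solutions of the adjoint equation\<close>

lemma test_function_dilate:
  assumes \<phi>: "\<phi> \<in> test_functions" and R: "0 < R"
  shows "(\<lambda>x. \<phi> (x / R)) \<in> test_functions" "deriv (\<lambda>x. \<phi> (x / R)) x = deriv \<phi> (x / R) / R"
proof -
  obtain M where M: "0 < M" "\<And>x. M \<le> \<bar>x\<bar> \<Longrightarrow> \<phi> x = 0" using test_function_support[OF \<phi>] by blast
  show "(\<lambda>x. \<phi> (x / R)) \<in> test_functions"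
  proof (rule test_functionI[of _ "- (M * R)" "M * R"])
    have "diff_times n \<phi>" for n using \<phi> by (simp add: test_functions_iff)
    from diff_times_affine[OF this, of _ "1 / R" 0] show "diff_times n (\<lambda>x. \<phi> (x / R))" for n by simp
    show "- (M * R) \<le> x \<and> x \<le> M * R" if "\<phi> (x / R) \<noteq> 0" for x
    proof -
      have "\<not> M \<le> \<bar>x / R\<bar>" using that M(2) by blast
      then have "\<bar>x\<bar> < M * R" using R by (simp add: abs_divide field_simps)
      then show ?thesis by auto
    qed
  qed
  show "deriv (\<lambda>x. \<phi> (x / R)) x = deriv \<phi> (x / R) / R"
  proof (rule DERIV_imp_deriv)
    have "((\<lambda>x. x / R) has_real_derivative 1 / R) (at x)" using R by (auto intro!: derivative_eq_intros)
    from DERIV_chain2[OF test_function_DERIV[OF \<phi>] this]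
    show "DERIV (\<lambda>x. \<phi> (x / R)) x :> deriv \<phi> (x / R) / R" by simp
  qed
qed

lemma test_function_mult_L2:
  fixes h :: "real \<Rightarrow> complex"
  assumes \<phi>: "\<phi> \<in> test_functions" and h: "h \<in> L2"
  shows "(\<lambda>x. \<phi> x *\<^sub>R h x) \<in> L2" "(\<lambda>x. \<phi> x *\<^sub>R (of_real x * h x)) \<in> L2"
proof -
  note [measurable] = test_function_measurable[OF \<phi>] L2_measurable[OF h]
  obtain M where M: "0 < M" "\<And>x. M \<le> \<bar>x\<bar> \<Longrightarrow> \<phi> x = 0" using test_function_support[OF \<phi>] by blast
  obtain B where B: "0 < B" "\<And>x. \<bar>\<phi> x\<bar> \<le> B" using test_function_bounded[OF \<phi>] by blast
  show "(\<lambda>x. \<phi> x *\<^sub>R h x) \<in> L2"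
    by (rule L2_bound1I[OF h, of _ B]) (use B in \<open>auto intro!: mult_right_mono\<close>)
  have "\<bar>\<phi> x\<bar> * \<bar>x\<bar> \<le> B * M" for x
  proof (cases "M \<le> \<bar>x\<bar>")
    case False
    then show ?thesis using B by (intro mult_mono) auto
  qed (use M B in simp)
  then have "norm (\<phi> x *\<^sub>R (of_real x * h x)) \<le> (B * M) * norm (h x)" for x
    using mult_right_mono[of "\<bar>\<phi> x\<bar> * \<bar>x\<bar>" "B * M" "norm (h x)"] by (simp add: norm_mult mult.assoc)
  then show "(\<lambda>x. \<phi> x *\<^sub>R (of_real x * h x)) \<in> L2" by (intro L2_bound1I[OF h, of _ "B * M"]) auto
qed

text \<open>The integral identity is the weak form of the equation that \<open>a\<close> times the
  derivative of \<open>\<omega>\<close> equals \<open>\<rho>\<close>, and \<open>b\<close> is the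
  inverse of \<open>a\<close>.\<close>

lemma weakly_diff_of_orthogonality:
  fixes \<omega> \<rho> :: "real \<Rightarrow> complex"
  assumes \<omega>: "\<omega> \<in> L2" and \<rho>: "locally_integrable \<rho>" and a: "a * b = (1 :: complex)"
    and orth: "\<And>\<phi>. \<phi> \<in> test_functions \<Longrightarrow> (LINT x|lborel. a * (deriv \<phi> x *\<^sub>R \<omega> x) + \<phi> x *\<^sub>R \<rho> x) = 0"
  shows "weakly_diff \<omega> (\<lambda>x. b * \<rho> x)"
  unfolding weakly_diff_def
proof (intro conjI ballI)
  show lw: "locally_integrable \<omega>" by (rule L2_locally_integrable[OF \<omega>])
  show "locally_integrable (\<lambda>x. b * \<rho> x)"
    using locally_integrable_mult_continuous[OF \<rho>, of "\<lambda>_. b"] by (simp add: mult.commute)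
  fix \<phi> assume \<phi>: "\<phi> \<in> test_functions"
  have i: "integrable lborel (\<lambda>x. deriv \<phi> x *\<^sub>R \<omega> x)" "integrable lborel (\<lambda>x. \<phi> x *\<^sub>R \<rho> x)"
    by (intro test_function_integrable test_function_deriv \<phi> lw \<rho>)+
  have "a * (LINT x|lborel. deriv \<phi> x *\<^sub>R \<omega> x) + (LINT x|lborel. \<phi> x *\<^sub>R \<rho> x) = 0"
    using orth[OF \<phi>]
    unfolding Bochner_Integration.integral_add[OF integrable_mult_right[OF i(1)] i(2)] integral_mult_right_zero .
  then have "b * (a * (LINT x|lborel. deriv \<phi> x *\<^sub>R \<omega> x)) = - (b * (LINT x|lborel. \<phi> x *\<^sub>R \<rho> x))"
    by (metis add_eq_0_iff minus_minus mult_minus_right)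
  moreover have "b * (a * I) = I" for I using a by (metis mult.assoc mult.commute mult_1)
  moreover have "(LINT x|lborel. \<phi> x *\<^sub>R (b * \<rho> x)) = b * (LINT x|lborel. \<phi> x *\<^sub>R \<rho> x)"
    by (subst integral_mult_right_zero[symmetric]) (simp add: mult_scaleR_right)
  ultimately show "(LINT x|lborel. deriv \<phi> x *\<^sub>R \<omega> x) = - (LINT x|lborel. \<phi> x *\<^sub>R (b * \<rho> x))" by simp
qed

lemma test_vector_in_domain:
  fixes a :: complex and k :: 4
  assumes \<phi>: "\<phi> \<in> test_functions"
  shows "in_dirac_domain (\<lambda>x. axis k (a * of_real (\<phi> x))) (\<lambda>x. axis k (a * of_real (deriv \<phi> x)))"
  unfolding in_dirac_domain_def
proof (intro allI conjI)
  fix j :: 4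
  have L: "(\<lambda>x. complex_of_real (\<psi> x)) \<in> L2" if "\<psi> \<in> test_functions" for \<psi>
    by (rule L2_linear[OF bounded_linear_of_real test_function_L2[OF that]])
  have w: "has_weak_L2_derivative (\<lambda>x. a * of_real (\<phi> x)) (\<lambda>x. a * of_real (deriv \<phi> x))"
  proof (rule has_weak_L2_derivative_linear[OF _ bounded_linear_mult_right], rule has_weak_L2_derivative_C1)
    show "((\<lambda>x. complex_of_real (\<phi> x)) has_vector_derivative of_real (deriv \<phi> x)) (at x)" for x
      using test_function_DERIV[OF \<phi>]
      by (intro has_vector_derivative_of_real) (simp add: has_real_derivative_iff_has_vector_derivative)
    show "continuous_on UNIV (\<lambda>x. complex_of_real (deriv \<phi> x))"
      by (intro continuous_intros test_function_continuous test_function_deriv \<phi>)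
  qed (intro L \<phi> test_function_deriv)+
  have zero: "has_weak_L2_derivative (\<lambda>x. 0) (\<lambda>x. 0)" by (simp add: has_weak_L2_derivative_def)
  show "has_weak_L2_derivative (\<lambda>x. axis k (a * of_real (\<phi> x)) $ j) (\<lambda>x. axis k (a * of_real (deriv \<phi> x)) $ j)"
    using w zero by (cases "j = k") (simp_all add: axis_def)
  have "(\<lambda>x. \<phi> x *\<^sub>R (complex_of_real x * 1)) \<in> L2"
  proof -
    obtain M where M: "0 < M" "\<And>x. M \<le> \<bar>x\<bar> \<Longrightarrow> \<phi> x = 0" using test_function_support[OF \<phi>] by blast
    have "\<bar>\<phi> x\<bar> * \<bar>x\<bar> \<le> M * \<bar>\<phi> x\<bar>" for x
      using M(2)[of x] by (cases "M \<le> \<bar>x\<bar>") (auto simp: mult.commute intro!: mult_right_mono)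
    then show ?thesis
      by (intro L2_bound1I[OF test_function_L2[OF \<phi>], of _ M]) (use test_function_measurable[OF \<phi>] in \<open>auto simp: norm_mult\<close>)
  qed
  then have "(\<lambda>x. a * (\<phi> x *\<^sub>R (of_real x * 1))) \<in> L2" by (rule L2_mult_const)
  then have "(\<lambda>x. of_real x * (a * of_real (\<phi> x))) \<in> L2" by (simp add: scaleR_conv_of_real mult_ac)
  then show "(\<lambda>x. of_real x * axis k (a * of_real (\<phi> x)) $ j) \<in> L2"
    by (cases "j = k") (simp_all add: axis_def)
qed

context dirac_resolvent_region
begin

lemma range_set_member: "in_dirac_domain u p \<Longrightarrow> dirac_sym m \<theta> u p z \<in> range_set"
  unfolding range_set_def using dirac_sym_L2 by auto

lemma range_set_add_scale:
  assumes "f \<in> range_set" "g \<in> range_set" shows "(\<lambda>x. f x + c *\<^sub>R g x) \<in> range_set"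
proof -
  obtain u p v q where u: "in_dirac_domain u p" "AE x in lborel. dirac_sym m \<theta> u p z x = f x"
    and v: "in_dirac_domain v q" "AE x in lborel. dirac_sym m \<theta> v q z x = g x"
    using assms by (auto simp: range_set_def)
  have "AE x in lborel. dirac_sym m \<theta> (\<lambda>x. u x + c *\<^sub>R v x) (\<lambda>x. p x + c *\<^sub>R q x) z x = f x + c *\<^sub>R g x"
    using u(2) v(2) by eventually_elim (simp add: dirac_sym_lincomb)
  moreover have "(\<lambda>x. f x + c *\<^sub>R g x) \<in> L2" using assms by (intro L2_add L2_scaleR) (auto simp: range_set_def)
  ultimately show ?thesis using in_dirac_domain_lincomb[OF u(1) v(1)] unfolding range_set_def by blast
qed

lemma range_set_zero: "(\<lambda>x. 0) \<in> range_set"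
proof -
  have "in_dirac_domain (\<lambda>x. 0) (\<lambda>x. 0)" by (simp add: in_dirac_domain_def has_weak_L2_derivative_def)
  moreover have "dirac_sym m \<theta> (\<lambda>x. 0) (\<lambda>x. 0) z x = 0" for x
    by (simp add: vec_eq_iff forall_4 dirac_sym_nth raise_op_def lower_op_def)
  ultimately show ?thesis unfolding range_set_def by auto
qed

text \<open>Conjugation together with a sign change in the even components turns the adjoint equation into the
  original one. Cut-offs of the resulting solution lie in the domain, and their image under \<open>H - z\<close> is
  small because only the derivative of the cut-off survives; the a priori bound then makes it vanish.\<close>

lemma orthogonal_complement_trivial:
  assumes w: "w \<in> L2" and orth: "\<And>v. v \<in> range_set \<Longrightarrow> (LINT x|lborel. inner (w x) (v x)) = 0"
  shows "L2_norm w = 0"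
proof -
  define E where "E = cis (\<theta> / 2)"
  define a where "a = - \<i> * cnj E"
  define b where "b = \<i> * E"
  have EE: "cnj E * E = 1" by (simp add: E_def cis_cnj cis_mult)
  have ab: "a * b = 1" using EE by (simp add: a_def b_def algebra_simps)
  define \<omega> where "\<omega> k x = cnj (w x $ k)" for k x
  have \<omega>L: "\<omega> k \<in> L2" for k unfolding \<omega>_def by (intro L2_cnj L2_nth w)
  have lx: "locally_integrable (\<lambda>x. of_real x * \<omega> k x)" for k
    using locally_integrable_mult_continuous[OF L2_locally_integrable[OF \<omega>L], of "\<lambda>x. of_real x" k]
    by (simp add: mult.commute)
  have li: "locally_integrable (\<lambda>x. c1 * (of_real x * \<omega> k x) + c2 * \<omega> i x + c3 * \<omega> j x)" for c1 c2 c3 k i j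
  proof -
    have mult: "locally_integrable (\<lambda>x. c * f x)" if "locally_integrable f" for c and f :: "real \<Rightarrow> complex"
      using locally_integrable_mult_continuous[OF that, of "\<lambda>_. c"] by (simp add: mult.commute)
    show ?thesis by (intro locally_integrable_add mult lx L2_locally_integrable \<omega>L)
  qed
  have pairing: "(LINT x|lborel. (\<Sum>j\<in>UNIV. \<omega> j x * dirac_sym m \<theta> (\<lambda>x. axis k (of_real (\<phi> x))) (\<lambda>x. axis k (of_real (deriv \<phi> x))) z x $ j)) = 0"
    if \<phi>: "\<phi> \<in> test_functions" for \<phi> and k :: 4
  proof -
    define D where "D c = dirac_sym m \<theta> (\<lambda>x. axis k (c * of_real (\<phi> x))) (\<lambda>x. axis k (c * of_real (deriv \<phi> x))) z" for c
    define I where "I x = (\<Sum>j\<in>UNIV. \<omega> j x * D 1 x $ j)" for x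
    have DL: "D c \<in> L2" for c unfolding D_def by (intro dirac_sym_L2 test_vector_in_domain \<phi>)
    have Iint: "integrable lborel I"
      unfolding I_def[abs_def] by (intro Bochner_Integration.integrable_sum L2_mult_integrable \<omega>L L2_nth DL)
    have Dc: "D c x $ j = c * D 1 x $ j" for c x j
    proof -
      have "\<forall>j. D c x $ j = c * D 1 x $ j"
        unfolding D_def forall_4 dirac_sym_nth raise_op_def lower_op_def axis_def by (simp add: algebra_simps)
      then show ?thesis by blast
    qed
    \<comment> \<open>Orthogonality is only real; the freedom in the scalar, used with
      \<open>1\<close> and \<open>- \<i>\<close>, recovers the vanishing of the complex
      integral.\<close>
    have "Re (c * (LINT x|lborel. I x)) = 0" for c
    proof -
      have "0 = (LINT x|lborel. inner (w x) (D c x))"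
        using orth[OF range_set_member[OF test_vector_in_domain[OF \<phi>]], of k c] by (simp add: D_def)
      also have "\<dots> = (LINT x|lborel. Re (c * I x))"
      proof (intro Bochner_Integration.integral_cong refl)
        fix x
        have "inner (w x) (D c x) = (\<Sum>j\<in>UNIV. Re (\<omega> j x * D c x $ j))"
          by (simp add: inner_vec_def inner_complex_def \<omega>_def)
        also have "\<dots> = Re (c * I x)" by (simp only: Dc[of c] I_def sum_distrib_left Re_sum mult.left_commute)
        finally show "inner (w x) (D c x) = Re (c * I x)" .
      qed
      also have "\<dots> = Re (LINT x|lborel. c * I x)"
        using integral_bounded_linear[OF bounded_linear_Re, of lborel "\<lambda>x. c * I x"] Iint by simp
      finally show ?thesis by (simp del: times_complex.sel)
    qed
    from this[of 1] this[of "- \<i>"] have "(LINT x|lborel. I x) = 0" by (simp add: complex_eq_iff)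
    then show ?thesis by (simp add: I_def D_def)
  qed
  define \<nu> :: "4 \<Rightarrow> real \<Rightarrow> complex" where "\<nu> k x = (if k = 1 \<or> k = 3 then \<omega> k x else - \<omega> k x)" for k x
  have \<nu>: "\<nu> 1 = \<omega> 1" "\<nu> 2 = (\<lambda>x. - \<omega> 2 x)" "\<nu> 3 = \<omega> 3" "\<nu> 4 = (\<lambda>x. - \<omega> 4 x)"
    by (auto simp: \<nu>_def fun_eq_iff)
  have \<nu>L: "\<nu> k \<in> L2" for k using \<omega>L L2_minus[OF \<omega>L] by (cases "k = 1 \<or> k = 3") (simp_all add: \<nu>_def[abs_def])
  \<comment> \<open>The rows of \<open>(H - z) \<nu> = 0\<close>, each solved for \<open>a\<close>
    times the derivative of its component.\<close>
  define \<rho> :: "4 \<Rightarrow> real \<Rightarrow> complex" where "\<rho> k x =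
     (if k = 1 then b * (of_real x * \<nu> 1 x) + m * \<nu> 2 x + z * \<nu> 4 x
      else if k = 2 then (- b) * (of_real x * \<nu> 2 x) + (- m) * \<nu> 1 x + z * \<nu> 3 x
      else if k = 3 then b * (of_real x * \<nu> 3 x) + z * \<nu> 2 x + m * \<nu> 4 x
      else (- b) * (of_real x * \<nu> 4 x) + (- m) * \<nu> 3 x + z * \<nu> 1 x)" for k x
  have wd: "weakly_diff (\<nu> k) (\<lambda>x. b * \<rho> k x)" for k
  proof (rule weakly_diff_of_orthogonality[OF \<nu>L _ ab])
    have "\<forall>k. locally_integrable (\<rho> k)"
      unfolding forall_4
    proof (intro conjI)
      show "locally_integrable (\<rho> 1)" using li[of b 1 "- m" 2 "- z" 4] by (simp add: \<rho>_def[abs_def] \<nu>)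
      show "locally_integrable (\<rho> 2)" using li[of b 2 "- m" 1 z 3] by (simp add: \<rho>_def[abs_def] \<nu>)
      show "locally_integrable (\<rho> 3)" using li[of b 3 "- z" 2 "- m" 4] by (simp add: \<rho>_def[abs_def] \<nu>)
      show "locally_integrable (\<rho> 4)" using li[of b 4 "- m" 3 z 1] by (simp add: \<rho>_def[abs_def] \<nu>)
    qed
    then show "locally_integrable (\<rho> k)" by blast
    fix \<phi> assume \<phi>: "\<phi> \<in> test_functions"
    note D = dirac_sym_nth raise_op_def lower_op_def axis_def sum_4 a_def b_def E_def[symmetric]
    have "\<forall>k. (LINT x|lborel. a * (deriv \<phi> x *\<^sub>R \<nu> k x) + \<phi> x *\<^sub>R \<rho> k x) = 0"
      unfolding forall_4
    proof (intro conjI)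
      \<comment> \<open>The equation for component \<open>k\<close> comes from testing with a vector
        supported in component \<open>5 - k\<close>.\<close>
      have "a * (deriv \<phi> x *\<^sub>R \<nu> 1 x) + \<phi> x *\<^sub>R \<rho> 1 x =
          (\<Sum>j\<in>UNIV. \<omega> j x * dirac_sym m \<theta> (\<lambda>x. axis 4 (of_real (\<phi> x))) (\<lambda>x. axis 4 (of_real (deriv \<phi> x))) z x $ j)" for x
        by (simp add: D \<rho>_def \<nu> scaleR_conv_of_real algebra_simps)
      then show "(LINT x|lborel. a * (deriv \<phi> x *\<^sub>R \<nu> 1 x) + \<phi> x *\<^sub>R \<rho> 1 x) = 0" using pairing[OF \<phi>, of 4] by simp
      have "a * (deriv \<phi> x *\<^sub>R \<nu> 2 x) + \<phi> x *\<^sub>R \<rho> 2 x =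
          - (\<Sum>j\<in>UNIV. \<omega> j x * dirac_sym m \<theta> (\<lambda>x. axis 3 (of_real (\<phi> x))) (\<lambda>x. axis 3 (of_real (deriv \<phi> x))) z x $ j)" for x
        by (simp add: D \<rho>_def \<nu> scaleR_conv_of_real algebra_simps)
      then show "(LINT x|lborel. a * (deriv \<phi> x *\<^sub>R \<nu> 2 x) + \<phi> x *\<^sub>R \<rho> 2 x) = 0" using pairing[OF \<phi>, of 3] by simp
      have "a * (deriv \<phi> x *\<^sub>R \<nu> 3 x) + \<phi> x *\<^sub>R \<rho> 3 x =
          (\<Sum>j\<in>UNIV. \<omega> j x * dirac_sym m \<theta> (\<lambda>x. axis 2 (of_real (\<phi> x))) (\<lambda>x. axis 2 (of_real (deriv \<phi> x))) z x $ j)" for x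
        by (simp add: D \<rho>_def \<nu> scaleR_conv_of_real algebra_simps)
      then show "(LINT x|lborel. a * (deriv \<phi> x *\<^sub>R \<nu> 3 x) + \<phi> x *\<^sub>R \<rho> 3 x) = 0" using pairing[OF \<phi>, of 2] by simp
      have "a * (deriv \<phi> x *\<^sub>R \<nu> 4 x) + \<phi> x *\<^sub>R \<rho> 4 x =
          - (\<Sum>j\<in>UNIV. \<omega> j x * dirac_sym m \<theta> (\<lambda>x. axis 1 (of_real (\<phi> x))) (\<lambda>x. axis 1 (of_real (deriv \<phi> x))) z x $ j)" for x
        by (simp add: D \<rho>_def \<nu> scaleR_conv_of_real algebra_simps)
      then show "(LINT x|lborel. a * (deriv \<phi> x *\<^sub>R \<nu> 4 x) + \<phi> x *\<^sub>R \<rho> 4 x) = 0" using pairing[OF \<phi>, of 1] by simp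
    qed
    then show "(LINT x|lborel. a * (deriv \<phi> x *\<^sub>R \<nu> k x) + \<phi> x *\<^sub>R \<rho> k x) = 0" by blast
  qed
  define \<beta> where "\<beta> = interval_bump 1 (-1) 1"
  have \<beta>: "\<beta> \<in> test_functions" unfolding \<beta>_def by (rule interval_bump_test) simp
  have \<beta>0: "0 < \<beta> 0" by (simp add: \<beta>_def interval_bump_def bump_range)
  obtain B where B: "0 < B" "\<And>x. \<bar>deriv \<beta> x\<bar> \<le> B" using test_function_bounded[OF test_function_deriv[OF \<beta>]] by blast
  \<comment> \<open>As \<open>R\<close> grows, the right-hand side tends to zero, whereas the norm
    on the left tends to \<open>\<beta> 0\<close> times that of \<open>w\<close>.\<close>
  have bound: "dirac_gap m \<theta> z * L2_norm (\<lambda>x. \<beta> (x / R) *\<^sub>R w x) \<le> (B / R) * L2_norm w" if R: "0 < R" for R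
  proof -
    define \<psi> where "\<psi> x = \<beta> (x / R)" for x
    have \<psi>: "\<psi> \<in> test_functions" and d\<psi>: "deriv \<psi> x = deriv \<beta> (x / R) / R" for x
      unfolding \<psi>_def by (rule test_function_dilate[OF \<beta> R])+
    have \<psi>\<rho>: "(\<lambda>x. \<psi> x *\<^sub>R (b * \<rho> k x)) \<in> L2" for k
    proof -
      have gen: "(\<lambda>x. \<psi> x *\<^sub>R (b * (c1 * (of_real x * \<nu> k x) + c2 * \<nu> i x + c3 * \<nu> j x))) \<in> L2" for c1 c2 c3 k i j
      proof -
        have "(\<lambda>x. (b * c1) * (\<psi> x *\<^sub>R (of_real x * \<nu> k x)) + (b * c2) * (\<psi> x *\<^sub>R \<nu> i x) + (b * c3) * (\<psi> x *\<^sub>R \<nu> j x)) \<in> L2"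
          by (intro L2_add L2_mult_const test_function_mult_L2 \<psi> \<nu>L)
        then show ?thesis by (simp add: scaleR_conv_of_real algebra_simps)
      qed
      have "\<forall>k. (\<lambda>x. \<psi> x *\<^sub>R (b * \<rho> k x)) \<in> L2"
        unfolding forall_4 \<rho>_def
        using gen[of b 1 m 2 z 4] gen[of "- b" 2 "- m" 1 z 3] gen[of b 3 z 2 m 4] gen[of "- b" 4 "- m" 3 z 1] by simp
      then show ?thesis by blast
    qed
    define v where "v x = (\<chi> k. \<psi> x *\<^sub>R \<nu> k x)" for x
    define p where "p x = (\<chi> k. deriv \<psi> x *\<^sub>R \<nu> k x + \<psi> x *\<^sub>R (b * \<rho> k x))" for x
    have dom: "in_dirac_domain v p"
      unfolding in_dirac_domain_def v_def p_def vec_lambda_beta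
    proof (intro allI conjI)
      fix k
      show "has_weak_L2_derivative (\<lambda>x. \<psi> x *\<^sub>R \<nu> k x) (\<lambda>x. deriv \<psi> x *\<^sub>R \<nu> k x + \<psi> x *\<^sub>R (b * \<rho> k x))"
        by (rule weakly_diff_cutoff[OF wd \<nu>L \<psi> \<psi>\<rho>])
      show "(\<lambda>x. of_real x * (\<psi> x *\<^sub>R \<nu> k x)) \<in> L2"
        using test_function_mult_L2(2)[OF \<psi> \<nu>L[of k]] by simp
    qed
    have Ds: "dirac_sym m \<theta> v p z x = vector [a * (deriv \<psi> x *\<^sub>R \<nu> 4 x), a * (deriv \<psi> x *\<^sub>R \<nu> 3 x), a * (deriv \<psi> x *\<^sub>R \<nu> 2 x), a * (deriv \<psi> x *\<^sub>R \<nu> 1 x)]" for x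
    proof -
      have abr: "a * (y + \<psi> x *\<^sub>R (b * r)) = a * y + \<psi> x *\<^sub>R r" for y r
      proof -
        have "a * (y + \<psi> x *\<^sub>R (b * r)) = a * y + \<psi> x *\<^sub>R ((a * b) * r)" by (simp add: algebra_simps)
        then show ?thesis by (simp add: ab)
      qed
      show ?thesis
        unfolding vec_eq_iff forall_4 dirac_sym_nth vector_4 raise_op_def lower_op_def v_def p_def vec_lambda_beta
          E_def[symmetric] a_def[symmetric] b_def[symmetric] abr
        by (simp add: \<rho>_def scaleR_conv_of_real algebra_simps)
    qed
    have nv: "norm (v x) = norm (\<psi> x *\<^sub>R w x)" for x
    proof -
      have "(norm (v x))\<^sup>2 = (norm (\<psi> x *\<^sub>R w x))\<^sup>2"
        unfolding norm_vec_power2 sum_4 v_def by (simp add: \<nu> \<omega>_def power_mult_distrib norm_mult)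
      then show ?thesis by simp
    qed
    have nD: "norm (dirac_sym m \<theta> v p z x) \<le> norm ((B / R) *\<^sub>R w x)" for x
    proof -
      have "(norm (dirac_sym m \<theta> v p z x))\<^sup>2 = (deriv \<psi> x)\<^sup>2 * (norm (w x))\<^sup>2"
        unfolding norm_vec_power2 sum_4 Ds vector_4
        by (simp add: \<nu> \<omega>_def power_mult_distrib norm_mult a_def E_def algebra_simps)
      also have "\<dots> \<le> (B / R)\<^sup>2 * (norm (w x))\<^sup>2"
      proof (intro mult_right_mono)
        have "\<bar>deriv \<psi> x\<bar> \<le> B / R" using B(2)[of "x / R"] R by (simp add: d\<psi> abs_divide divide_right_mono)
        then have "\<bar>deriv \<psi> x\<bar>\<^sup>2 \<le> (B / R)\<^sup>2" by (intro power_mono) auto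
        then show "(deriv \<psi> x)\<^sup>2 \<le> (B / R)\<^sup>2" by simp
      qed simp
      also have "\<dots> = (norm ((B / R) *\<^sub>R w x))\<^sup>2" by (simp only: norm_scaleR power_mult_distrib power2_abs)
      finally show ?thesis by (rule power2_le_imp_le) simp
    qed
    have "dirac_gap m \<theta> z * L2_norm v \<le> L2_norm (dirac_sym m \<theta> v p z)" by (rule lower_bound[OF dom])
    also have "\<dots> \<le> L2_norm (\<lambda>x. (B / R) *\<^sub>R w x)"
      using nD by (intro L2_norm_mono L2_scaleR w dirac_sym_L2 dom) auto
    also have "\<dots> = (B / R) * L2_norm w" using B R by (simp add: L2_norm_scaleR)
    also have "L2_norm v = L2_norm (\<lambda>x. \<beta> (x / R) *\<^sub>R w x)" using nv by (simp add: L2_norm_def \<psi>_def)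
    finally show ?thesis .
  qed
  note [measurable] = test_function_measurable[OF \<beta>] L2_measurable[OF w]
  have "(\<lambda>n. LINT x|lborel. (norm (\<beta> (x / real (Suc n)) *\<^sub>R w x))\<^sup>2) \<longlonglongrightarrow> (LINT x|lborel. (norm (\<beta> 0 *\<^sub>R w x))\<^sup>2)"
  proof (rule integral_dominated_convergence[where w="\<lambda>x. (norm (w x))\<^sup>2"])
    show "AE x in lborel. (\<lambda>n. (norm (\<beta> (x / real (Suc n)) *\<^sub>R w x))\<^sup>2) \<longlonglongrightarrow> (norm (\<beta> 0 *\<^sub>R w x))\<^sup>2"
    proof (intro AE_I2 tendsto_power tendsto_norm tendsto_scaleR tendsto_const)
      fix x
      have "(\<lambda>n. x / real (Suc n)) \<longlonglongrightarrow> 0" by (rule LIMSEQ_Suc[OF lim_const_over_n])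
      moreover have "isCont \<beta> 0" using test_function_DERIV[OF \<beta>] DERIV_isCont by blast
      ultimately show "(\<lambda>n. \<beta> (x / real (Suc n))) \<longlonglongrightarrow> \<beta> 0" by (rule isCont_tendsto_compose[rotated])
    qed
    show "AE x in lborel. norm ((norm (\<beta> (x / real (Suc n)) *\<^sub>R w x))\<^sup>2) \<le> (norm (w x))\<^sup>2" for n
    proof (intro AE_I2)
      fix x
      have "\<bar>\<beta> (x / real (Suc n))\<bar> \<le> 1" using interval_bump_range unfolding \<beta>_def by (simp add: abs_le_iff)
      then have "norm (\<beta> (x / real (Suc n)) *\<^sub>R w x) \<le> norm (w x)" by (simp add: mult_left_le_one_le)
      then have "(norm (\<beta> (x / real (Suc n)) *\<^sub>R w x))\<^sup>2 \<le> (norm (w x))\<^sup>2" by (intro power_mono) auto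
      then show "norm ((norm (\<beta> (x / real (Suc n)) *\<^sub>R w x))\<^sup>2) \<le> (norm (w x))\<^sup>2" by simp
    qed
  qed (use L2_integrable[OF w] in auto)
  then have "(\<lambda>n. L2_norm (\<lambda>x. \<beta> (x / real (Suc n)) *\<^sub>R w x)) \<longlonglongrightarrow> L2_norm (\<lambda>x. \<beta> 0 *\<^sub>R w x)"
    unfolding L2_norm_def by (rule tendsto_real_sqrt)
  then have lim: "(\<lambda>n. dirac_gap m \<theta> z * L2_norm (\<lambda>x. \<beta> (x / real (Suc n)) *\<^sub>R w x)) \<longlonglongrightarrow> dirac_gap m \<theta> z * (\<beta> 0 * L2_norm w)"
    using \<beta>0 by (intro tendsto_mult tendsto_const) (simp add: L2_norm_scaleR)
  have "(\<lambda>n. (B / real (Suc n)) * L2_norm w) \<longlonglongrightarrow> 0"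
    by (intro tendsto_mult_left_zero LIMSEQ_Suc[OF lim_const_over_n])
  from LIMSEQ_le[OF lim this] bound have "dirac_gap m \<theta> z * (\<beta> 0 * L2_norm w) \<le> 0"
    by (metis of_nat_0_less_iff zero_less_Suc)
  then have "L2_norm w \<le> 0" using gap \<beta>0 by (simp add: mult_le_0_iff)
  then show ?thesis using L2_norm_nonneg[of w] by linarith
qed

end

section \<open>Resolvent set and resolvent norm\<close>

lemma resolvent_spec:
  assumes "z \<in> resolvent_set D T" "f \<in> L2"
  shows "resolvent D T z f \<in> D" "L2_eq (shift_op T z (resolvent D T z f)) f"
proof -
  have "\<exists>u. u \<in> D \<and> L2_eq (shift_op T z u) f" using assms unfolding resolvent_set_def by blast
  from someI_ex[OF this] show "resolvent D T z f \<in> D" "L2_eq (shift_op T z (resolvent D T z f)) f"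
    by (simp_all add: resolvent_def)
qed

context dirac_resolvent_region
begin

lemma range_set_eq_L2:
  assumes f: "f \<in> L2" shows "f \<in> range_set"
proof -
  have sub: "range_set \<subseteq> L2" by (auto simp: range_set_def)
  have scale: "(\<lambda>x. c *\<^sub>R u x) \<in> range_set" if "u \<in> range_set" for c u
    using range_set_add_scale[OF range_set_zero that, of c] by simp
  have add: "(\<lambda>x. u x + v x) \<in> range_set" if "u \<in> range_set" "v \<in> range_set" for u v
    using range_set_add_scale[OF that, of 1] by simp
  obtain h where h: "h \<in> range_set" and orth: "\<And>v. v \<in> range_set \<Longrightarrow> (LINT x|lborel. inner (f x - h x) (v x)) = 0"
    by (rule L2_projection[OF sub _ add scale range_set_closed f]) (use range_set_zero in auto)
  have hL: "h \<in> L2" using h sub by auto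
  have "L2_norm (\<lambda>x. f x - h x) = 0" by (rule orthogonal_complement_trivial[OF L2_diff[OF f hL] orth])
  then have ae: "AE x in lborel. f x - h x = 0" using L2_norm_eq_0_iff[OF L2_diff[OF f hL]] by simp
  obtain u p where "in_dirac_domain u p" "AE x in lborel. dirac_sym m \<theta> u p z x = h x"
    using h by (auto simp: range_set_def)
  moreover from this(2) ae have "AE x in lborel. dirac_sym m \<theta> u p z x = f x" by eventually_elim simp
  ultimately show ?thesis using f unfolding range_set_def by blast
qed

lemma shift_bound:
  assumes u: "u \<in> H_dom" and f: "f \<in> L2" and eq: "L2_eq (shift_op (H_op m \<theta>) z u) f"
  shows "dirac_gap m \<theta> z * L2_norm u \<le> L2_norm f"
proof -
  note dom = H_dom_in_dirac_domain[OF u]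
  note DL = dirac_sym_L2[OF dom, of m \<theta> z]
  have "L2_norm (dirac_sym m \<theta> u (\<lambda>x. \<chi> k. weak_deriv (\<lambda>y. u y $ k) x) z) = L2_norm f"
    using eq unfolding shift_H_op L2_eq_def
    by (rule L2_norm_cong_AE) (use L2_measurable[OF DL] L2_measurable[OF f] in auto)
  then show ?thesis using lower_bound[OF dom] by simp
qed

lemma in_resolvent_set: "z \<in> resolvent_set H_dom (H_op m \<theta>)"
  unfolding resolvent_set_def mem_Collect_eq
proof (intro conjI ballI impI)
  have ex: "\<exists>u\<in>H_dom. L2_eq (shift_op (H_op m \<theta>) z u) f" if fL: "f \<in> L2" for f
  proof -
    obtain u p where dom: "in_dirac_domain u p" and ae: "AE x in lborel. dirac_sym m \<theta> u p z x = f x"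
      using range_set_eq_L2[OF fL] by (auto simp: range_set_def)
    have "AE x in lborel. shift_op (H_op m \<theta>) z u x = f x"
      using shift_H_op_AE[OF dom, of m \<theta> z] ae unfolding L2_eq_def by eventually_elim simp
    then show ?thesis using in_dirac_domain_H_dom[OF dom] unfolding L2_eq_def by blast
  qed
  then show "\<exists>u\<in>H_dom. L2_eq (shift_op (H_op m \<theta>) z u) f" if "f \<in> L2" for f using that .
  show "L2_eq u v" if u: "u \<in> H_dom" and v: "v \<in> H_dom"
    and eq: "L2_eq (shift_op (H_op m \<theta>) z u) (shift_op (H_op m \<theta>) z v)" for u v
  proof -
    define p q where "p x = (\<chi> k. weak_deriv (\<lambda>y. u y $ k) x)" and "q x = (\<chi> k. weak_deriv (\<lambda>y. v y $ k) x)" for x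
    have up: "in_dirac_domain u p" and vq: "in_dirac_domain v q"
      unfolding p_def q_def by (intro H_dom_in_dirac_domain u v)+
    have dom: "in_dirac_domain (\<lambda>x. u x - v x) (\<lambda>x. p x - q x)" using in_dirac_domain_lincomb[OF up vq, of "-1"] by simp
    have "AE x in lborel. dirac_sym m \<theta> (\<lambda>x. u x - v x) (\<lambda>x. p x - q x) z x = 0"
      using eq unfolding shift_H_op L2_eq_def p_def[symmetric] q_def[symmetric]
    proof eventually_elim
      case (elim x)
      then show ?case using dirac_sym_lincomb[of m \<theta> u "-1" v p q z x] by simp
    qed
    then have "L2_norm (dirac_sym m \<theta> (\<lambda>x. u x - v x) (\<lambda>x. p x - q x) z) = 0"
      using L2_norm_eq_0_iff[OF dirac_sym_L2[OF dom]] by simp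
    then have "L2_norm (\<lambda>x. u x - v x) \<le> 0" using lower_bound[OF dom] gap by (simp add: mult_le_0_iff)
    then have "L2_norm (\<lambda>x. u x - v x) = 0" using L2_norm_nonneg[of "\<lambda>x. u x - v x"] by linarith
    then have "AE x in lborel. u x - v x = 0" using L2_norm_eq_0_iff[OF in_dirac_domain_L2(1)[OF dom]] by simp
    then show ?thesis unfolding L2_eq_def by eventually_elim simp
  qed
  show "\<exists>C. \<forall>f\<in>L2. L2_norm (resolvent H_dom (H_op m \<theta>) z f) \<le> C * L2_norm f"
  proof (intro exI ballI)
    fix f :: "real \<Rightarrow> complex ^ 4" assume f: "f \<in> L2"
    have "\<exists>u. u \<in> H_dom \<and> L2_eq (shift_op (H_op m \<theta>) z u) f" using ex[OF f] by blast
    from someI_ex[OF this] have "dirac_gap m \<theta> z * L2_norm (resolvent H_dom (H_op m \<theta>) z f) \<le> L2_norm f"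
      unfolding resolvent_def using shift_bound[OF _ f] by blast
    then show "L2_norm (resolvent H_dom (H_op m \<theta>) z f) \<le> (1 / dirac_gap m \<theta> z) * L2_norm f"
      using gap by (simp add: field_simps)
  qed
qed

lemma resolvent_norm_le: "resolvent_norm H_dom (H_op m \<theta>) z \<le> 1 / dirac_gap m \<theta> z"
  unfolding resolvent_norm_def
proof (rule cSUP_least)
  show "{f \<in> L2. L2_norm (f :: real \<Rightarrow> complex ^ 4) \<le> 1} \<noteq> {}"
    using L2_zero by (auto intro!: exI[of _ "\<lambda>_. 0"])
  fix f :: "real \<Rightarrow> complex ^ 4" assume "f \<in> {f \<in> L2. L2_norm f \<le> 1}"
  then have f: "f \<in> L2" "L2_norm f \<le> 1" by auto
  have "dirac_gap m \<theta> z * L2_norm (resolvent H_dom (H_op m \<theta>) z f) \<le> 1"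
    using shift_bound[OF resolvent_spec(1)[OF in_resolvent_set f(1)] f(1) resolvent_spec(2)[OF in_resolvent_set f(1)]] f(2)
    by linarith
  then show "L2_norm (resolvent H_dom (H_op m \<theta>) z f) \<le> 1 / dirac_gap m \<theta> z" using gap by (simp add: field_simps)
qed

end

text \<open>Outside the region the gap exceeds \<open>\<epsilon>\<close>, so \<open>z\<close> is in
  the resolvent set and the norm of the resolvent is at most the reciprocal of the gap.\<close>

theorem pseudospectrum_outer_bound:
  assumes "0 \<le> m" "- (pi / 2) < \<theta>" "\<theta> < pi / 2" "0 < \<epsilon>"
  shows "pseudospectrum H_dom (H_op m \<theta>) \<epsilon>
       \<subseteq> {z. (1 - \<bar>tan (\<theta> / 2)\<bar>) * \<bar>Im z\<bar> \<le> (\<bar>Re z\<bar> + m) * \<bar>tan (\<theta> / 2)\<bar> + \<epsilon>}"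
proof (intro subsetI CollectI, rule ccontr)
  fix z assume z: "z \<in> pseudospectrum H_dom (H_op m \<theta>) \<epsilon>"
    and "\<not> (1 - \<bar>tan (\<theta> / 2)\<bar>) * \<bar>Im z\<bar> \<le> (\<bar>Re z\<bar> + m) * \<bar>tan (\<theta> / 2)\<bar> + \<epsilon>"
  then have \<epsilon>: "\<epsilon> < dirac_gap m \<theta> z" by (simp add: dirac_gap_def)
  interpret dirac_resolvent_region m \<theta> z
    using assms \<epsilon> by unfold_locales auto
  have 1: "1 / \<epsilon> < resolvent_norm H_dom (H_op m \<theta>) z"
    using z in_resolvent_set by (auto simp: pseudospectrum_def spectrum_def)
  have "1 / dirac_gap m \<theta> z < 1 / \<epsilon>" using \<epsilon> assms(4) by (intro divide_strict_left_mono mult_pos_pos) auto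
  then show False using 1 resolvent_norm_le by linarith
qed

section \<open>Pseudomodes from Gaussian packets\<close>

text \<open>\<open>resolvent\<close> picks some preimage; injectivity identifies it with
  \<open>u\<close> almost everywhere, which is enough for the norm.\<close>

lemma resolvent_dirac_sym_norm:
  assumes z: "z \<in> resolvent_set H_dom (H_op m \<theta>)" and u: "in_dirac_domain u p"
  shows "L2_norm (resolvent H_dom (H_op m \<theta>) z (dirac_sym m \<theta> u p z)) = L2_norm u"
proof -
  define r where "r = resolvent H_dom (H_op m \<theta>) z (dirac_sym m \<theta> u p z)"
  have r: "r \<in> H_dom" "L2_eq (shift_op (H_op m \<theta>) z r) (dirac_sym m \<theta> u p z)"
    unfolding r_def by (rule resolvent_spec[OF z dirac_sym_L2[OF u]])+
  have "L2_eq (shift_op (H_op m \<theta>) z r) (shift_op (H_op m \<theta>) z u)"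
    using r(2) shift_H_op_AE[OF u, of m \<theta> z] unfolding L2_eq_def by eventually_elim simp
  moreover have "\<forall>u\<in>H_dom. \<forall>v\<in>H_dom. L2_eq (shift_op (H_op m \<theta>) z u) (shift_op (H_op m \<theta>) z v) \<longrightarrow> L2_eq u v"
    using z unfolding resolvent_set_def mem_Collect_eq by (rule conjunct1)
  ultimately have ae: "AE x in lborel. r x = u x"
    using r(1) in_dirac_domain_H_dom[OF u] unfolding L2_eq_def[of r u, symmetric] by blast
  have "r \<in> L2" using in_dirac_domain_L2(1)[OF H_dom_in_dirac_domain[OF r(1)]] .
  then show ?thesis
    unfolding r_def[symmetric] using ae in_dirac_domain_L2(1)[OF u] by (intro L2_norm_cong_AE L2_measurable)
qed

text \<open>Scaling the residual to norm one makes it admissible in the supremum, and its preimage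
  then has norm above \<open>1 / \<epsilon>\<close>.\<close>

theorem pseudomode_criterion:
  assumes u: "in_dirac_domain u p" and small: "L2_norm (dirac_sym m \<theta> u p z) < \<epsilon> * L2_norm u" and \<epsilon>: "0 < \<epsilon>"
  shows "z \<in> pseudospectrum H_dom (H_op m \<theta>) \<epsilon>"
proof (cases "z \<in> resolvent_set H_dom (H_op m \<theta>)")
  case False
  then show ?thesis by (simp add: pseudospectrum_def spectrum_def)
next
  case True
  obtain K where K: "\<And>f. f \<in> L2 \<Longrightarrow> L2_norm (resolvent H_dom (H_op m \<theta>) z f) \<le> K * L2_norm f"
    using True unfolding resolvent_set_def by blast
  define d where "d = L2_norm (dirac_sym m \<theta> u p z)"
  \<comment> \<open>A vanishing residual would force \<open>u\<close> to vanish, by boundedness of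
    the resolvent, and then the strict inequality \<open>small\<close> is impossible.\<close>
  have "d \<noteq> 0"
  proof
    assume "d = 0"
    then have "L2_norm u \<le> 0"
      using K[OF dirac_sym_L2[OF u, of m \<theta> z]] resolvent_dirac_sym_norm[OF True u] by (simp add: d_def)
    then show False using small \<epsilon> \<open>d = 0\<close> by (simp add: d_def mult_pos_pos zero_less_mult_iff)
  qed
  then have d: "0 < d" using L2_norm_nonneg[of "dirac_sym m \<theta> u p z"] by (simp add: d_def less_le)
  have zero: "in_dirac_domain (\<lambda>x. 0) (\<lambda>x. 0)" by (simp add: in_dirac_domain_def has_weak_L2_derivative_def)
  have zs: "dirac_sym m \<theta> (\<lambda>x. 0) (\<lambda>x. 0) z x = 0" for x
    by (simp add: vec_eq_iff forall_4 dirac_sym_nth raise_op_def lower_op_def)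
  define U where "U x = (1 / d) *\<^sub>R u x" for x
  define P where "P x = (1 / d) *\<^sub>R p x" for x
  have dom: "in_dirac_domain U P"
    using in_dirac_domain_lincomb[OF zero u, of "1 / d"] by (simp add: U_def[abs_def] P_def[abs_def])
  have DU: "dirac_sym m \<theta> U P z = (\<lambda>x. (1 / d) *\<^sub>R dirac_sym m \<theta> u p z x)"
    using dirac_sym_lincomb[of m \<theta> "\<lambda>x. 0" "1 / d" u "\<lambda>x. 0" p z] zs by (simp add: U_def[abs_def] P_def[abs_def] fun_eq_iff)
  have n1: "L2_norm (dirac_sym m \<theta> U P z) = 1" unfolding DU L2_norm_scaleR using d by (simp add: d_def[symmetric])
  have "1 / \<epsilon> < L2_norm u / d" using small d \<epsilon> by (simp add: d_def field_simps)
  also have "\<dots> = L2_norm U" using d by (simp add: U_def[abs_def] L2_norm_scaleR)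
  also have "\<dots> = L2_norm (resolvent H_dom (H_op m \<theta>) z (dirac_sym m \<theta> U P z))"
    by (rule resolvent_dirac_sym_norm[OF True dom, symmetric])
  also have "\<dots> \<le> resolvent_norm H_dom (H_op m \<theta>) z"
    unfolding resolvent_norm_def
  proof (rule cSUP_upper)
    show "dirac_sym m \<theta> U P z \<in> {f \<in> L2. L2_norm f \<le> 1}" using dirac_sym_L2[OF dom] n1 by simp
    show "bdd_above ((\<lambda>f. L2_norm (resolvent H_dom (H_op m \<theta>) z f)) ` {f \<in> L2. L2_norm f \<le> 1})"
    proof (rule bdd_aboveI2)
      fix f :: "real \<Rightarrow> complex ^ 4" assume "f \<in> {f \<in> L2. L2_norm f \<le> 1}"
      then have f: "f \<in> L2" "L2_norm f \<le> 1" by auto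
      have "K * L2_norm f \<le> \<bar>K\<bar> * 1" using f(2) by (intro mult_mono) auto
      then show "L2_norm (resolvent H_dom (H_op m \<theta>) z f) \<le> \<bar>K\<bar>" using K[OF f(1)] by simp
    qed
  qed
  finally show ?thesis using True by (simp add: pseudospectrum_def spectrum_def)
qed

section \<open>Gaussian integrals and decay\<close>

lemma gaussian_integral:
  fixes \<beta> :: complex
  assumes C: "0 < (C::real)"
  shows "integrable lborel (\<lambda>x. exp (- of_real (C * x\<^sup>2) + 2 * \<beta> * of_real x))" (is "integrable lborel ?f")
    and "(LINT x|lborel. exp (- of_real (C * x\<^sup>2) + 2 * \<beta> * of_real x)) = of_real (sqrt (pi / C)) * exp (\<beta>\<^sup>2 / of_real C)"
proof -
  \<comment> \<open>The substitution \<open>x = t + c * y\<close> centres the real part of the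
    exponent and normalises its variance. What remains is the characteristic function of the
    standard normal law at the frequency \<open>\<tau>\<close>, so no contour has to be
    shifted.\<close>
  define b1 b2 c t \<tau> where "b1 = Re \<beta>" and "b2 = Im \<beta>" and "c = 1 / sqrt (2 * C)" and "t = b1 / C" and "\<tau> = 2 * b2 * c"
  have c: "0 < c" "c\<^sup>2 = 1 / (2 * C)" using C by (auto simp: c_def power_divide)
  have \<beta>: "\<beta> = of_real b1 + \<i> * of_real b2" by (simp add: b1_def b2_def complex_eq_iff)
  define k where "k = of_real (sqrt (2 * pi)) * exp (complex_of_real (b1\<^sup>2 / C) + \<i> * of_real (2 * b1 * b2 / C))"
  have eq: "?f (t + c * y) = k * (std_normal_density y *\<^sub>R iexp (\<tau> * y))" for y
  proof -
    have Cc: "C * c\<^sup>2 = 1 / 2" using C c by simp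
    have Ct: "C * t = b1" using C by (simp add: t_def)
    have 1: "- (C * (t + c * y)\<^sup>2) + 2 * b1 * (t + c * y) = b1\<^sup>2 / C - y\<^sup>2 / 2"
    proof -
      have "- (C * (t + c * y)\<^sup>2) + 2 * b1 * (t + c * y) = - (C * t) * t - (C * c\<^sup>2) * y\<^sup>2 - 2 * (C * t) * c * y + 2 * b1 * t + 2 * b1 * c * y"
        by (simp add: power2_eq_square algebra_simps)
      also have "\<dots> = b1 * t - y\<^sup>2 / 2" unfolding Cc Ct by (simp add: algebra_simps)
      finally show ?thesis by (simp add: t_def power2_eq_square)
    qed
    have 2: "2 * b2 * (t + c * y) = 2 * b1 * b2 / C + \<tau> * y" by (simp add: t_def \<tau>_def algebra_simps)
    have "- of_real (C * (t + c * y)\<^sup>2) + 2 * \<beta> * of_real (t + c * y) =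
        of_real (- (C * (t + c * y)\<^sup>2) + 2 * b1 * (t + c * y)) + \<i> * of_real (2 * b2 * (t + c * y))"
      by (simp add: \<beta> algebra_simps)
    also have "\<dots> = (of_real (b1\<^sup>2 / C) + \<i> * of_real (2 * b1 * b2 / C)) + (of_real (- y\<^sup>2 / 2) + \<i> * of_real (\<tau> * y))"
      unfolding 1 2 by (simp add: algebra_simps)
    finally have eq1: "- of_real (C * (t + c * y)\<^sup>2) + 2 * \<beta> * of_real (t + c * y) =
        (of_real (b1\<^sup>2 / C) + \<i> * of_real (2 * b1 * b2 / C)) + (of_real (- y\<^sup>2 / 2) + \<i> * of_real (\<tau> * y))" .
    have "?f (t + c * y) = exp (of_real (b1\<^sup>2 / C) + \<i> * of_real (2 * b1 * b2 / C)) * (of_real (exp (- y\<^sup>2 / 2)) * iexp (\<tau> * y))"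
      unfolding eq1 exp_add exp_of_real by simp
    then show ?thesis by (simp add: k_def normal_density_def scaleR_conv_of_real)
  qed
  have ci: "integrable lborel (\<lambda>y. std_normal_density y *\<^sub>R iexp (\<tau> * y))"
  proof (rule Bochner_Integration.integrable_bound[OF integrable_std_normal_moment[of 0]])
    show "AE y in lborel. norm (std_normal_density y *\<^sub>R iexp (\<tau> * y)) \<le> norm (std_normal_density y * y ^ 0)"
      by (simp add: norm_exp_i_times)
  qed measurable
  have "char std_normal_distribution \<tau> = (LINT y|lborel. std_normal_density y *\<^sub>R iexp (\<tau> * y))"
    unfolding char_def by (subst integral_density) (auto simp: normal_density_nonneg)
  then have ch: "(LINT y|lborel. std_normal_density y *\<^sub>R iexp (\<tau> * y)) = of_real (exp (- (\<tau>\<^sup>2) / 2))"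
    by (simp add: char_std_normal_distribution)
  have fi: "integrable lborel (\<lambda>y. ?f (t + c * y))" unfolding eq by (rule integrable_mult_right) (rule ci)
  show "integrable lborel ?f"
    using lborel_integrable_real_affine[OF fi, of "1 / c" "- t / c"] c by (simp add: field_simps)
  have "(LINT x|lborel. ?f x) = \<bar>c\<bar> *\<^sub>R (LINT y|lborel. ?f (t + c * y))"
    by (rule lborel_integral_real_affine) (use c in simp)
  also have "\<dots> = of_real c * (k * of_real (exp (- (\<tau>\<^sup>2) / 2)))"
    unfolding eq integral_mult_right_zero ch using c by (simp add: scaleR_conv_of_real)
  also have "\<dots> = of_real (c * sqrt (2 * pi)) * exp (of_real (b1\<^sup>2 / C) + \<i> * of_real (2 * b1 * b2 / C) + of_real (- (\<tau>\<^sup>2) / 2))"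
    by (simp only: k_def exp_add exp_of_real of_real_mult mult.assoc)
  also have "c * sqrt (2 * pi) = sqrt (pi / C)"
    using C by (simp add: c_def real_sqrt_divide real_sqrt_mult)
  also have "of_real (b1\<^sup>2 / C) + \<i> * of_real (2 * b1 * b2 / C) + of_real (- (\<tau>\<^sup>2) / 2) = \<beta>\<^sup>2 / of_real C"
  proof -
    have "\<tau>\<^sup>2 / 2 = b2\<^sup>2 / C" using C by (simp add: \<tau>_def power_mult_distrib c(2))
    then have "- (\<tau>\<^sup>2) / 2 = - b2\<^sup>2 / C" by simp
    then show ?thesis using C by (simp add: \<beta> complex_eq_iff power2_eq_square field_simps)
  qed
  finally show "(LINT x|lborel. ?f x) = of_real (sqrt (pi / C)) * exp (\<beta>\<^sup>2 / of_real C)" .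
qed

lemma gaussian_decay_L2:
  fixes h :: "real \<Rightarrow> complex"
  assumes h: "continuous_on UNIV h" and c: "0 < c" and le: "\<And>x. cmod (h x) \<le> K * exp (- c * x\<^sup>2)"
  shows "h \<in> L2" "(\<lambda>x. of_real x * h x) \<in> L2"
proof -
  have [measurable]: "h \<in> borel_measurable borel" using h by (rule borel_measurable_continuous_onI)
  have base: "(\<lambda>x. exp (- a * x\<^sup>2)) \<in> L2" if "0 < a" for a :: real
  proof -
    have "integrable lborel (\<lambda>x. exp (- complex_of_real (2 * a * x\<^sup>2) + 2 * 0 * of_real x))"
      by (rule gaussian_integral(1)) (use that in simp)
    then have "integrable lborel (\<lambda>x. cmod (exp (- complex_of_real (2 * a * x\<^sup>2))))"
      by (intro integrable_norm) simp
    moreover have "cmod (exp (- complex_of_real (2 * a * x\<^sup>2))) = (norm (exp (- a * x\<^sup>2)))\<^sup>2" for x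
      by (simp add: norm_exp_eq_Re power2_eq_square exp_add[symmetric])
    ultimately show ?thesis by (simp add: L2_def)
  qed
  show "h \<in> L2" by (rule L2_bound1I[OF base[OF c], of _ K]) (use le in auto)
  have "0 \<le> K" using le[of 0] by (simp add: order_trans[OF norm_ge_zero])
  \<comment> \<open>Half of the Gaussian decay is given up to absorb the factor
    \<open>x\<close>.\<close>
  have x_le: "\<bar>x\<bar> * exp (- c * x\<^sup>2) \<le> (1 + 2 / c) * exp (- (c / 2) * x\<^sup>2)" for x
  proof -
    have "\<bar>x\<bar> \<le> 1 + x\<^sup>2"
    proof -
      have "0 \<le> (\<bar>x\<bar> - 1)\<^sup>2" by simp
      then show ?thesis by (simp add: power2_eq_square algebra_simps)
    qed
    also have "x\<^sup>2 \<le> (2 / c) * exp ((c / 2) * x\<^sup>2)"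
      using exp_ge_add_one_self[of "(c / 2) * x\<^sup>2"] c by (simp add: field_simps)
    also have "1 \<le> exp ((c / 2) * x\<^sup>2)" using c by simp
    finally have "\<bar>x\<bar> \<le> (1 + 2 / c) * exp ((c / 2) * x\<^sup>2)" by (simp add: distrib_right)
    then have "\<bar>x\<bar> * exp (- c * x\<^sup>2) \<le> (1 + 2 / c) * exp ((c / 2) * x\<^sup>2) * exp (- c * x\<^sup>2)" by (intro mult_right_mono) auto
    also have "\<dots> = (1 + 2 / c) * exp (- (c / 2) * x\<^sup>2)"
      by (simp add: mult.assoc exp_add[symmetric] algebra_simps)
    finally show ?thesis .
  qed
  have "cmod (of_real x * h x) \<le> (K * (1 + 2 / c)) * norm (exp (- (c / 2) * x\<^sup>2))" for x
  proof -
    have "cmod (of_real x * h x) \<le> \<bar>x\<bar> * (K * exp (- c * x\<^sup>2))" using le[of x] by (simp add: norm_mult mult_left_mono)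
    also have "\<dots> = K * (\<bar>x\<bar> * exp (- c * x\<^sup>2))" by simp
    also have "\<dots> \<le> K * ((1 + 2 / c) * exp (- (c / 2) * x\<^sup>2))" using x_le \<open>0 \<le> K\<close> by (intro mult_left_mono)
    finally show ?thesis by simp
  qed
  then show "(\<lambda>x. of_real x * h x) \<in> L2"
    using c by (intro L2_bound1I[OF base[of "c / 2"]]) auto
qed

lemma L2_complex_Cauchy_Schwarz:
  fixes f g :: "real \<Rightarrow> complex"
  assumes f: "f \<in> L2" and g: "g \<in> L2"
  shows "cmod (LINT x|lborel. cnj (f x) * g x) \<le> L2_norm f * L2_norm g"
proof -
  have n: "(\<lambda>x. cmod (h x)) \<in> L2" if "h \<in> L2" for h :: "real \<Rightarrow> complex"
    using L2_measurable[OF that] by (intro L2_bound1I[OF that, of _ 1]) auto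
  have "cmod (LINT x|lborel. cnj (f x) * g x) \<le> (LINT x|lborel. cmod (cnj (f x) * g x))"
    by (rule integral_norm_bound)
  also have "\<dots> = (LINT x|lborel. inner (cmod (f x)) (cmod (g x)))" by (simp add: norm_mult)
  also have "\<dots> \<le> L2_norm (\<lambda>x. cmod (f x)) * L2_norm (\<lambda>x. cmod (g x))"
    using L2_Cauchy_Schwarz[OF n[OF f] n[OF g]] by linarith
  finally show ?thesis by (simp add: L2_norm_def)
qed

section \<open>Second-order expansions of the packet exponents and Laplace's method\<close>

lemma exp_quadratic_remainder:
  fixes y :: complex
  assumes "cmod y \<le> 1"
  shows "cmod (exp y - 1 - y - y\<^sup>2 / 2) \<le> 3 / 2 * cmod y ^ 3"
proof -
  have "cmod (exp y - (\<Sum>k\<le>2. y ^ k / fact k)) \<le> exp \<bar>Re y\<bar> * cmod y ^ Suc 2 / fact 2" by (rule Taylor_exp)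
  also have "(\<Sum>k\<le>2. y ^ k / fact k) = 1 + y + y\<^sup>2 / 2" by (simp add: numeral_2_eq_2)
  finally have "cmod (exp y - 1 - y - y\<^sup>2 / 2) \<le> exp \<bar>Re y\<bar> * cmod y ^ 3 / 2"
    by (simp add: algebra_simps numeral_3_eq_3)
  also have "exp \<bar>Re y\<bar> \<le> exp 1" using abs_Re_le_cmod[of y] assms by simp
  also have "exp 1 \<le> (3 :: real)" by (rule exp_le)
  finally show ?thesis by (simp add: mult_right_mono)
qed

text \<open>With \<open>y = \<eta> s\<close>, \<open>packet_phase Z y\<close> governs the overlap of the packets at \<open>0\<close> and \<open>s\<close> and
  \<open>packet_growth Z y\<close> the norm of the packet at \<open>s\<close>; \<open>\<eta>\<close> points in the direction of steepest
  descent of the former.\<close>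

definition packet_phase :: "complex \<Rightarrow> complex \<Rightarrow> complex" where
  "packet_phase Z y = Z * (exp (2 * y) - 1 - 2 * y) + 2 * (exp y - 1 - y)"

definition packet_growth :: "complex \<Rightarrow> complex \<Rightarrow> real" where
  "packet_growth Z y = Re (Z * (exp (2 * y) - 1 - 2 * y)) + (exp (2 * Re y) - 1 - 2 * Re y)"

text \<open>The quadratic terms are \<open>Z * (2 * y)\<^sup>2 / 2\<close> and
  \<open>2 * y\<^sup>2 / 2\<close>. The cubic constant is \<open>12\<close> from the remainder at
  \<open>2 * y\<close>, which is why \<open>y\<close> is bounded by \<open>1 / 2\<close>, plus
  \<open>3\<close> from the remainder at \<open>y\<close>.\<close>

lemma packet_phase_expansion:
  assumes Z: "cmod Z \<le> 1" and y: "cmod y \<le> 1 / 2"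
  shows "cmod (packet_phase Z y - (2 * Z + 1) * y\<^sup>2) \<le> 15 * cmod y ^ 3"
proof -
  define R where "R y = exp y - 1 - y - y\<^sup>2 / 2" for y :: complex
  have "packet_phase Z y - (2 * Z + 1) * y\<^sup>2 = Z * R (2 * y) + 2 * R y"
    by (simp add: packet_phase_def R_def power_mult_distrib algebra_simps)
  then have "cmod (packet_phase Z y - (2 * Z + 1) * y\<^sup>2) \<le> cmod Z * cmod (R (2 * y)) + 2 * cmod (R y)"
    using norm_triangle_ineq[of "Z * R (2 * y)" "2 * R y"] by (simp add: norm_mult)
  also have "\<dots> \<le> 1 * (3 / 2 * cmod (2 * y) ^ 3) + 2 * (3 / 2 * cmod y ^ 3)"
    unfolding R_def using y by (intro add_mono mult_mono Z exp_quadratic_remainder) (auto simp: norm_mult)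
  finally show ?thesis by (simp add: norm_mult power_mult_distrib)
qed

text \<open>Compared with the phase there is an additional \<open>(cmod y)\<^sup>2\<close>, because
  \<open>2 * (Re y)\<^sup>2 = Re (y\<^sup>2) + (cmod y)\<^sup>2\<close>. This is why the descent
  rate \<open>h\<close> has to exceed \<open>1\<close> for the end packets to be small.\<close>

lemma packet_growth_expansion:
  assumes Z: "cmod Z \<le> 1" and y: "cmod y \<le> 1 / 2"
  shows "packet_growth Z y \<le> Re ((2 * Z + 1) * y\<^sup>2) + (cmod y)\<^sup>2 + 24 * cmod y ^ 3"
proof -
  define R where "R y = exp y - 1 - y - y\<^sup>2 / 2" for y :: complex
  define a where "a = complex_of_real (Re y)"
  have R: "cmod (R (2 * y)) \<le> 12 * cmod y ^ 3" if "cmod y \<le> 1 / 2" for y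
    using exp_quadratic_remainder[of "2 * y"] that by (simp add: R_def norm_mult power_mult_distrib)
  have a: "cmod a \<le> cmod y" by (simp add: a_def abs_Re_le_cmod)
  have "Re (exp (2 * a)) = exp (2 * Re y)" by (simp add: a_def Re_exp)
  moreover have "2 * (Re y)\<^sup>2 = Re (y\<^sup>2) + (cmod y)\<^sup>2" unfolding cmod_power2 by (simp add: power2_eq_square)
  ultimately have "packet_growth Z y = Re ((2 * Z + 1) * y\<^sup>2) + (cmod y)\<^sup>2 + Re (Z * R (2 * y)) + Re (R (2 * a))"
    by (simp add: packet_growth_def R_def a_def power_mult_distrib algebra_simps)
  also have "Re (Z * R (2 * y)) \<le> 1 * (12 * cmod y ^ 3)"
  proof -
    have "Re (Z * R (2 * y)) \<le> cmod Z * cmod (R (2 * y))" unfolding norm_mult[symmetric] by (rule complex_Re_le_cmod)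
    also have "\<dots> \<le> 1 * (12 * cmod y ^ 3)" using Z y by (intro mult_mono R) auto
    finally show ?thesis .
  qed
  also have "Re (R (2 * a)) \<le> 12 * cmod y ^ 3"
  proof -
    have "Re (R (2 * a)) \<le> 12 * cmod a ^ 3" using R[of a] a y complex_Re_le_cmod[of "R (2 * a)"] by linarith
    also have "\<dots> \<le> 12 * cmod y ^ 3" using a by (simp add: power_mono)
    finally show ?thesis .
  qed
  finally show ?thesis by simp
qed

text \<open>The real part of the integrand is at least \<open>exp (- 4) / 2\<close> for \<open>\<bar>s\<bar> \<le> 1 / sqrt n\<close> and nonnegative as
  long as \<open>\<bar>s\<bar> \<le> n powr (- 1 / 3) / 3\<close>, where the cubic error contributes at most \<open>1\<close> to the exponent;
  beyond that its modulus is exponentially small.\<close>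

lemma laplace_lower_bound:
  fixes G :: "real \<Rightarrow> complex"
  assumes cont: "continuous_on {-r..r} G" and r: "r \<le> 1 / 40" "1 / sqrt n \<le> r"
    and h: "1 \<le> h" "h \<le> 3" and n: "729 \<le> n"
    and G: "\<And>s. \<bar>s\<bar> \<le> r \<Longrightarrow> cmod (G s + of_real (h * s\<^sup>2)) \<le> 15 * \<bar>s\<bar> ^ 3"
  shows "exp (- 4) / sqrt n - exp (- (n powr (1 / 3)) / 24) \<le> cmod (integral {-r..r} (\<lambda>s. exp (of_real n * G s)))"
proof -
  define q where "q = 1 / sqrt n"
  define p where "p = n powr (1 / 3)"
  define e where "e = exp (- p / 24)"
  have p: "p ^ 3 = n" using n by (simp add: p_def powr_power)
  \<comment> \<open>The constant \<open>729\<close> is \<open>9 ^ 3\<close>: then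
    \<open>(3 * p)\<^sup>2 \<le> p ^ 3 = n\<close>, so the inner window of radius \<open>q\<close>
    lies within the one of radius \<open>1 / (3 * p)\<close>.\<close>
  have p9: "9 \<le> p"
  proof (rule ccontr)
    assume "\<not> 9 \<le> p"
    then have "p ^ 3 < 9 ^ 3" by (intro power_strict_mono) (auto simp: p_def)
    then show False using n p by simp
  qed
  have q0: "0 < q" and qr: "q \<le> r" using n r by (auto simp: q_def)
  have q2: "n * q\<^sup>2 = 1" using n by (simp add: q_def power_divide)
  have r0: "0 < r" using q0 qr by simp
  have qp: "q \<le> 1 / (3 * p)"
  proof -
    have "(3 * p)\<^sup>2 \<le> n" using p9 unfolding p[symmetric] by (simp add: power2_eq_square power3_eq_cube mult_right_mono)
    then have "3 * p \<le> sqrt n" using real_le_rsqrt by blast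
    then show ?thesis using p9 n unfolding q_def by (intro divide_left_mono) auto
  qed
  \<comment> \<open>A step function below the real part of the integrand. The tail bound
    \<open>e\<close> is subtracted everywhere, which costs little and leaves a single comparison
    under the integral.\<close>
  define b where "b s = (if s \<in> {-q..q} then exp (- 4) / 2 else 0) - e" for s :: real
  have le: "b s \<le> Re (exp (of_real n * G s))" if s: "s \<in> {-r..r}" for s
  proof -
    have sr: "\<bar>s\<bar> \<le> r" using s by auto
    define R where "R = G s + of_real (h * s\<^sup>2)"
    have R: "cmod R \<le> 15 * \<bar>s\<bar> ^ 3" using G[OF sr] by (simp add: R_def)
    have ex: "of_real n * G s = of_real (- n * h * s\<^sup>2) + of_real n * R" by (simp add: R_def algebra_simps)
    show ?thesis
    proof (cases "\<bar>s\<bar> \<le> 1 / (3 * p)")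
      case True
      have "15 * n * \<bar>s\<bar> ^ 3 \<le> 15 * n * (1 / (3 * p)) ^ 3" using True n by (intro mult_left_mono power_mono) auto
      also have "\<dots> = 15 / 27" unfolding p[symmetric] using p9 by (simp add: power_divide power_mult_distrib)
      finally have "n * (15 * \<bar>s\<bar> ^ 3) \<le> 1" by simp
      moreover have "n * cmod R \<le> n * (15 * \<bar>s\<bar> ^ 3)" using R n by (intro mult_left_mono) auto
      moreover have "cmod (of_real n * R) = n * cmod R" using n by (simp add: norm_mult)
      ultimately have nR: "cmod (of_real n * R) \<le> 1" by linarith
      have "\<bar>Im (of_real n * R)\<bar> \<le> 1" using abs_Im_le_cmod[of "of_real n * R"] nR by linarith
      \<comment> \<open>A phase of modulus at most \<open>1\<close> keeps the cosine above
        \<open>1 / 2\<close>.\<close>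
      moreover have "1 \<le> pi / 3" using pi_gt3 by simp
      ultimately have "cos (pi / 3) \<le> cos \<bar>Im (of_real n * R)\<bar>" by (intro cos_monotone_0_pi_le) auto
      then have c: "1 / 2 \<le> cos (Im (of_real n * R))" by (simp add: cos_60)
      have Re: "Re (exp (of_real n * G s)) = exp (- n * h * s\<^sup>2 + Re (of_real n * R)) * cos (Im (of_real n * R))"
        unfolding ex by (simp add: Re_exp)
      show ?thesis
      proof (cases "s \<in> {-q..q}")
        case True
        have "s\<^sup>2 \<le> q\<^sup>2" using True by (intro abs_le_square_iff[THEN iffD1]) auto
        then have "n * s\<^sup>2 \<le> 1" using q2 n mult_left_mono[of "s\<^sup>2" "q\<^sup>2" n] by simp
        then have "h * (n * s\<^sup>2) \<le> 3 * 1" using h n by (intro mult_mono) auto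
        moreover have "- 1 \<le> Re (of_real n * R)" using abs_Re_le_cmod[of "of_real n * R"] nR by linarith
        ultimately have "- 4 \<le> - n * h * s\<^sup>2 + Re (of_real n * R)" by (simp add: algebra_simps)
        then have "exp (- 4) * (1 / 2) \<le> Re (exp (of_real n * G s))" unfolding Re using c by (intro mult_mono) auto
        moreover have "0 < e" by (simp add: e_def)
        ultimately show ?thesis using True unfolding b_def if_P[OF True] by linarith
      next
        case False
        then have "b s \<le> 0" unfolding b_def if_not_P[OF False] by (simp add: e_def)
        also have "0 \<le> Re (exp (of_real n * G s))" unfolding Re using c by simp
        finally show ?thesis .
      qed
    next
      case False
      then have nq: "s \<notin> {-q..q}" using qp by auto
      \<comment> \<open>The bound \<open>r \<le> 1 / 40\<close> makes
        \<open>15 * \<bar>s\<bar>\<close> at most \<open>3 / 8\<close>, so the cubic error cannot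
        outweigh a descent of rate at least \<open>1\<close>. The rate \<open>3 / 8\<close> kept
        below gives the exponent \<open>p / 24\<close> at
        \<open>\<bar>s\<bar> = 1 / (3 * p)\<close>.\<close>
      have "cmod R \<le> 3 / 8 * s\<^sup>2"
      proof -
        have "15 * \<bar>s\<bar> ^ 3 = 15 * \<bar>s\<bar> * s\<^sup>2" by (simp add: power3_eq_cube power2_eq_square)
        also have "\<dots> \<le> 3 / 8 * s\<^sup>2" using sr r by (intro mult_right_mono) auto
        finally show ?thesis using R by simp
      qed
      then have "Re R \<le> 3 / 8 * s\<^sup>2" using complex_Re_le_cmod[of R] by linarith
      moreover have "1 * s\<^sup>2 \<le> h * s\<^sup>2" using h by (intro mult_right_mono) auto
      moreover have "Re R = Re (G s) + h * s\<^sup>2" unfolding R_def by simp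
      ultimately have "Re (G s) \<le> - (3 / 8) * s\<^sup>2" using zero_le_power2[of s] by linarith
      moreover have "(1 / (3 * p))\<^sup>2 \<le> s\<^sup>2" using False p9 by (intro abs_le_square_iff[THEN iffD1]) auto
      ultimately have "Re (G s) \<le> - (3 / 8) * (1 / (3 * p))\<^sup>2" by simp
      then have "n * Re (G s) \<le> n * (- (3 / 8) * (1 / (3 * p))\<^sup>2)" using n by (intro mult_left_mono) auto
      also have "\<dots> = - p / 24" unfolding p[symmetric] using p9 by (simp add: power2_eq_square power3_eq_cube)
      finally have "cmod (exp (of_real n * G s)) \<le> e" by (simp add: e_def)
      then show ?thesis using abs_Re_le_cmod[of "exp (of_real n * G s)"] unfolding b_def if_not_P[OF nq] by linarith
    qed
  qed
  have bi: "(b has_integral (2 * q * (exp (- 4) / 2) - 2 * r * e)) {-r..r}"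
    unfolding b_def
  proof (rule has_integral_diff)
    have "((\<lambda>s. exp (- 4) / 2) has_integral 2 * q * (exp (- 4) / 2)) {-q..q}"
      using has_integral_const_real[of "exp (- 4) / 2 :: real" "-q" q] q0 by simp
    then show "((\<lambda>s. if s \<in> {-q..q} then exp (- 4) / 2 else 0) has_integral 2 * q * (exp (- 4) / 2)) {-r..r}"
      using qr by (subst has_integral_restrict) auto
    show "((\<lambda>s. e) has_integral 2 * r * e) {-r..r}"
      using has_integral_const_real[of e "-r" r] r0 by simp
  qed
  have I: "(\<lambda>s. exp (of_real n * G s)) integrable_on {-r..r}"
    using cont by (intro integrable_continuous_real continuous_intros)
  have "2 * q * (exp (- 4) / 2) - 2 * r * e = integral {-r..r} b" using bi by (rule integral_unique[symmetric])
  also have "\<dots> \<le> integral {-r..r} (\<lambda>s. Re (exp (of_real n * G s)))"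
    using bi I le integrable_linear[OF I bounded_linear_Re] by (intro integral_le) (auto simp: has_integral_integrable o_def)
  also have "\<dots> = Re (integral {-r..r} (\<lambda>s. exp (of_real n * G s)))" using integral_linear[OF I bounded_linear_Re] by (simp add: o_def)
  also have "\<dots> \<le> cmod (integral {-r..r} (\<lambda>s. exp (of_real n * G s)))" by (rule complex_Re_le_cmod)
  finally have "q * exp (- 4) - 2 * r * e \<le> cmod (integral {-r..r} (\<lambda>s. exp (of_real n * G s)))" by simp
  moreover have "2 * r * e \<le> 1 * e" using r by (intro mult_right_mono) (auto simp: e_def)
  ultimately have "q * exp (- 4) - e \<le> cmod (integral {-r..r} (\<lambda>s. exp (of_real n * G s)))" by linarith
  then show ?thesis by (simp add: q_def e_def p_def)
qed

text \<open>The scale \<open>n\<close> is fixed by requiring \<open>cmod Z = sin \<theta>\<close>, which makes the two conditions on \<open>w\<close>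
  compatible; \<open>l = cmod \<Lambda> / (4 * n)\<close> is the larger root of \<open>l\<^sup>2 - 2 * l * cos \<beta> + (cos \<theta>)\<^sup>2\<close>.\<close>

lemma beam_parameters:
  assumes \<theta>: "0 < \<theta>" "\<theta> < pi / 2" and \<alpha>: "0 \<le> \<alpha>" "\<alpha> < \<theta>" and \<Lambda>: "\<Lambda> \<noteq> 0" "\<bar>Arg \<Lambda>\<bar> \<le> \<alpha>"
  defines "\<mu> \<equiv> (cos \<alpha>)\<^sup>2 - (cos \<theta>)\<^sup>2"
  obtains n Z w \<eta> h where "cmod \<Lambda> / 8 \<le> n" "0 < n" "\<Lambda> = 4 * of_real n * (1 + Z)" "cmod Z \<le> 1"
    "\<i> * of_real (sin \<theta>) * w\<^sup>2 = Z * of_real (n * cos \<theta>)" "(cmod w)\<^sup>2 = n * cos \<theta>"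
    "cmod \<eta> = 1" "(2 * Z + 1) * \<eta>\<^sup>2 = - of_real h" "1 + \<mu> \<le> h" "h \<le> 3"
proof -
  define \<beta> where "\<beta> = Arg \<Lambda>"
  define C where "C = cos \<theta>"
  define S where "S = sin \<theta>"
  have C: "0 < C" and S: "0 < S" and CS: "C\<^sup>2 + S\<^sup>2 = 1"
    using \<theta> by (auto simp: C_def S_def cos_gt_zero_pi sin_gt_zero)
  have cb: "cos \<alpha> \<le> cos \<beta>"
    using cos_monotone_0_pi_le[of "\<bar>\<beta>\<bar>" \<alpha>] \<alpha> \<theta> \<Lambda> by (simp add: \<beta>_def)
  have ca: "C < cos \<alpha>" unfolding C_def using \<alpha> \<theta> by (intro cos_monotone_0_pi) auto
  have cb2: "(cos \<alpha>)\<^sup>2 \<le> (cos \<beta>)\<^sup>2" using cb ca C by (intro power_mono) auto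
  have "C\<^sup>2 < (cos \<alpha>)\<^sup>2" using ca C by (intro power_strict_mono) auto
  then have \<mu>: "0 < \<mu>" by (simp add: \<mu>_def C_def)
  have \<mu>1: "\<mu> \<le> 1" using zero_le_power2[of "cos \<theta>"] cos_squared_eq[of \<alpha>] zero_le_power2[of "sin \<alpha>"] by (simp add: \<mu>_def)
  \<comment> \<open>Half the square root of the discriminant; it is real because
    \<open>\<bar>\<beta>\<bar> \<le> \<alpha> < \<theta>\<close>.\<close>
  define d where "d = sqrt ((cos \<beta>)\<^sup>2 - C\<^sup>2)"
  have d2: "d\<^sup>2 = (cos \<beta>)\<^sup>2 - C\<^sup>2" and d0: "0 \<le> d" using cb2 \<open>C\<^sup>2 < (cos \<alpha>)\<^sup>2\<close> by (auto simp: d_def)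
  define l where "l = cos \<beta> + d"
  have l0: "0 < l" using cb ca C d0 by (simp add: l_def)
  have "d \<le> 1"
  proof -
    have "d\<^sup>2 \<le> 1\<^sup>2" using d2 cos_squared_eq[of \<beta>] by (simp add: add_increasing)
    then show ?thesis using power2_le_imp_le[of d 1] by simp
  qed
  then have l2: "l \<le> 2" using cos_le_one[of \<beta>] unfolding l_def by linarith
  have lq: "l\<^sup>2 - 2 * l * cos \<beta> + C\<^sup>2 = 0"
  proof -
    have "l\<^sup>2 - 2 * l * cos \<beta> + C\<^sup>2 = d\<^sup>2 - (cos \<beta>)\<^sup>2 + C\<^sup>2" by (simp add: l_def power2_eq_square algebra_simps)
    then show ?thesis using d2 by simp
  qed
  \<comment> \<open>The relation of \<open>\<Lambda>\<close> to \<open>n\<close> and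
    \<open>Z\<close> dictates this value; the quadratic equation for \<open>l\<close> says precisely
    that its modulus is \<open>S\<close>.\<close>
  define Z where "Z = of_real l * cis \<beta> - 1"
  have Z2: "(cmod Z)\<^sup>2 = S\<^sup>2"
  proof -
    have "(cmod Z)\<^sup>2 = (l * cos \<beta> - 1)\<^sup>2 + (l * sin \<beta>)\<^sup>2" unfolding cmod_power2 by (simp add: Z_def)
    also have "\<dots> = l\<^sup>2 * ((cos \<beta>)\<^sup>2 + (sin \<beta>)\<^sup>2) - 2 * l * cos \<beta> + 1" by (simp only: power2_eq_square algebra_simps)
    also have "\<dots> = S\<^sup>2" using lq CS by simp
    finally show ?thesis .
  qed
  then have ZS: "cmod Z = S" using S by (simp add: power2_eq_iff_nonneg)
  define n where "n = cmod \<Lambda> / (4 * l)"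
  have n0: "0 < n" using \<Lambda> l0 by (simp add: n_def)
  have "cmod \<Lambda> / 8 \<le> n" using l0 l2 \<Lambda> unfolding n_def by (intro divide_left_mono) auto
  have "\<Lambda> = 4 * of_real n * (1 + Z)"
    using l0 \<Lambda> rcis_cmod_Arg[of \<Lambda>] by (simp add: n_def Z_def \<beta>_def rcis_def)
  have "cmod Z \<le> 1" using ZS by (simp add: S_def)
  define w where "w = csqrt (Z * of_real (n * C) / (\<i> * of_real S))"
  have w: "w\<^sup>2 = Z * of_real (n * C) / (\<i> * of_real S)" by (simp add: w_def)
  then have "\<i> * of_real (sin \<theta>) * w\<^sup>2 = Z * of_real (n * cos \<theta>)" using S by (simp add: S_def C_def)
  have "(cmod w)\<^sup>2 = n * cos \<theta>"
    unfolding norm_power[symmetric] w using S n0 C by (simp add: norm_divide norm_mult ZS S_def C_def)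
  define h where "h = cmod (2 * Z + 1)"
  have h2: "h\<^sup>2 = 1 + 4 * (Re Z + S\<^sup>2)"
  proof -
    have "h\<^sup>2 = 4 * (cmod Z)\<^sup>2 + 4 * Re Z + 1" unfolding h_def cmod_power2 by (simp add: power2_eq_square algebra_simps)
    then show ?thesis using Z2 by simp
  qed
  \<comment> \<open>As \<open>l\<close> is at least \<open>cos \<beta>\<close>, this is at least
    \<open>(cos \<beta>)\<^sup>2 - C\<^sup>2\<close>, hence at least \<open>\<mu>\<close>: here the
    angular condition becomes a margin of the descent rate over \<open>1\<close>.\<close>
  have "Re Z + S\<^sup>2 = l * cos \<beta> - C\<^sup>2" using CS by (simp add: Z_def)
  moreover have "(cos \<beta>)\<^sup>2 \<le> l * cos \<beta>" using d0 cb ca C by (simp add: l_def power2_eq_square distrib_right)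
  ultimately have "\<mu> \<le> Re Z + S\<^sup>2" using cb2 by (simp add: \<mu>_def C_def)
  moreover have "\<mu> * \<mu> \<le> \<mu>" using \<mu> \<mu>1 mult_left_mono[of \<mu> 1 \<mu>] by simp
  moreover have "(1 + \<mu>)\<^sup>2 = 1 + 2 * \<mu> + \<mu> * \<mu>" by (simp add: power2_eq_square algebra_simps)
  ultimately have "(1 + \<mu>)\<^sup>2 \<le> 1 + 4 * (Re Z + S\<^sup>2)" using \<mu> by (smt (verit))
  then have "(1 + \<mu>)\<^sup>2 \<le> h\<^sup>2" unfolding h2 .
  then have h1: "1 + \<mu> \<le> h" by (rule power2_le_imp_le) (simp add: h_def)
  have "h \<le> 3"
    
  proof -
    have "h \<le> 2 * S + 1" using norm_triangle_ineq[of "2 * Z" 1] by (simp add: h_def norm_mult ZS)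
    then show ?thesis using sin_le_one[of \<theta>] unfolding S_def by linarith
  qed
  define \<eta> where "\<eta> = csqrt (- of_real h / (2 * Z + 1))"
  have nz: "2 * Z + 1 \<noteq> 0" using h1 \<mu> unfolding h_def by auto
  have \<eta>: "\<eta>\<^sup>2 = - of_real h / (2 * Z + 1)" by (simp add: \<eta>_def)
  then have "(2 * Z + 1) * \<eta>\<^sup>2 = - of_real h" using nz by simp
  have "cmod \<eta> = 1"
  proof -
    have "(cmod \<eta>)\<^sup>2 = 1" unfolding norm_power[symmetric] \<eta> using nz by (simp add: norm_divide h_def)
    then show ?thesis using power2_eq_iff_nonneg[of "cmod \<eta>" 1] by simp
  qed
  show ?thesis by (rule that[of n Z w \<eta> h]) fact+
qed

text \<open>Gaussian coherent states with a complex centre \<open>w\<close>. The lowering operator maps \<open>packet \<theta> w\<close> to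
  \<open>- 2 * \<i> * w\<close> times itself.\<close>

definition packet :: "real \<Rightarrow> complex \<Rightarrow> real \<Rightarrow> complex" where
  "packet \<theta> w x = exp (- (cis \<theta> * of_real (x\<^sup>2) / 2) + 2 * cis (\<theta> / 2) * w * of_real x - w\<^sup>2)"

definition beam :: "real \<Rightarrow> real \<Rightarrow> (real \<Rightarrow> complex) \<Rightarrow> (real \<Rightarrow> complex) \<Rightarrow> real \<Rightarrow> complex" where
  "beam \<theta> r w a x = integral {-r..r} (\<lambda>s. a s * packet \<theta> (w s) x)"

section \<open>Coherent states and their superpositions\<close>

lemma cis_half_power2: "(cis (\<theta> / 2))\<^sup>2 = cis \<theta>"
  by (simp add: power2_eq_square cis_mult)

text \<open>Half of the decay rate \<open>cos \<theta> / 2\<close> pays for the linear term, by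
  completing a square. The majorant depends on the centre only through the bound \<open>W\<close>
  and thus serves all packets of a beam.\<close>

lemma packet_bound:
  assumes C: "0 < cos \<theta>" and w: "cmod w \<le> W"
  shows "cmod (packet \<theta> w x) \<le> exp (4 * W\<^sup>2 / cos \<theta> + W\<^sup>2) * exp (- (cos \<theta> / 4) * x\<^sup>2)"
proof -
  define C where "C = cos \<theta>"
  have C0: "0 < C" using C by (simp add: C_def)
  have W: "0 \<le> W" using w norm_ge_zero order_trans by blast
  have "Re (2 * cis (\<theta> / 2) * w * of_real x) \<le> 2 * W * \<bar>x\<bar>"
  proof -
    have "Re (2 * cis (\<theta> / 2) * w * of_real x) \<le> cmod (2 * cis (\<theta> / 2) * w * of_real x)" by (rule complex_Re_le_cmod)
    also have "\<dots> = 2 * cmod w * \<bar>x\<bar>" by (simp add: norm_mult)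
    finally show ?thesis using mult_right_mono[OF w, of "\<bar>x\<bar>"] by simp
  qed
  moreover have "- Re (w\<^sup>2) \<le> W\<^sup>2"
  proof -
    have "- Re (w\<^sup>2) \<le> (cmod w)\<^sup>2" using abs_Re_le_cmod[of "w\<^sup>2"] by (simp add: norm_power)
    then show ?thesis using power_mono[OF w norm_ge_zero, of 2] by linarith
  qed
  moreover have "2 * W * \<bar>x\<bar> \<le> C / 4 * x\<^sup>2 + 4 * W\<^sup>2 / C"
  proof -
    have "0 \<le> (C * \<bar>x\<bar> / 2 - 2 * W)\<^sup>2 / C" using C0 by simp
    also have "\<dots> = C / 4 * x\<^sup>2 + 4 * W\<^sup>2 / C - 2 * W * \<bar>x\<bar>"
      using C0 by (simp add: power2_diff power_mult_distrib power_divide field_simps) (simp add: power2_eq_square)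
    finally show ?thesis by simp
  qed
  moreover have "Re (- (cis \<theta> * of_real (x\<^sup>2) / 2) + 2 * cis (\<theta> / 2) * w * of_real x - w\<^sup>2) =
      - (C * x\<^sup>2 / 2) + Re (2 * cis (\<theta> / 2) * w * of_real x) - Re (w\<^sup>2)"
    by (simp add: C_def)
  ultimately have "Re (- (cis \<theta> * of_real (x\<^sup>2) / 2) + 2 * cis (\<theta> / 2) * w * of_real x - w\<^sup>2) \<le>
      (4 * W\<^sup>2 / C + W\<^sup>2) + (- (C / 4) * x\<^sup>2)" by linarith
  then show ?thesis unfolding packet_def norm_exp_eq_Re C_def exp_add[symmetric] by simp
qed

lemma continuous_packet: "continuous_on UNIV (packet \<theta> w)"
  unfolding packet_def[abs_def] by (intro continuous_intros) auto

lemma packet_L2: "0 < cos \<theta> \<Longrightarrow> packet \<theta> w \<in> L2"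
  by (rule gaussian_decay_L2(1)[OF continuous_packet _ packet_bound[OF _ order_refl]]) auto

text \<open>The Gaussian integral puts \<open>cis \<theta> / cos \<theta>\<close> in front of
  \<open>w\<^sup>2\<close>, and the factor \<open>exp (- w\<^sup>2)\<close> of the packet subtracts
  \<open>1\<close>, which leaves \<open>\<i> * tan \<theta>\<close>. For \<open>\<theta> = 0\<close>
  this is, up to a constant, the reproducing kernel \<open>exp (2 * cnj v * w)\<close>.\<close>

lemma packet_pairing:
  assumes C: "0 < cos \<theta>"
  shows "(LINT x|lborel. cnj (packet \<theta> v x) * packet \<theta> w x) =
    of_real (sqrt (pi / cos \<theta>)) *
    exp ((cnj (\<i> * of_real (sin \<theta>) * v\<^sup>2) + \<i> * of_real (sin \<theta>) * w\<^sup>2 + 2 * (cnj v * w)) / of_real (cos \<theta>))"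
proof -
  define E where "E = cis (\<theta> / 2)"
  have E2: "E\<^sup>2 = of_real (cos \<theta>) + \<i> * of_real (sin \<theta>)" by (simp add: E_def cis_half_power2 complex_eq_iff)
  have EE: "cnj E * E = 1" by (simp add: E_def cis_cnj cis_mult)
  define b where "b = cnj (E * v) + E * w"
  have "cnj (packet \<theta> v x) * packet \<theta> w x =
      exp (- of_real (cos \<theta> * x\<^sup>2) + 2 * b * of_real x) * exp (- cnj (v\<^sup>2) - w\<^sup>2)" for x
  proof -
    have c: "cnj (cis \<theta>) + cis \<theta> = 2 * of_real (cos \<theta>)" by (simp add: complex_eq_iff)
    have "cnj (- (cis \<theta> * of_real (x\<^sup>2) / 2) + 2 * cis (\<theta> / 2) * v * of_real x - v\<^sup>2) +
        (- (cis \<theta> * of_real (x\<^sup>2) / 2) + 2 * cis (\<theta> / 2) * w * of_real x - w\<^sup>2) =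
        - ((cnj (cis \<theta>) + cis \<theta>) * of_real (x\<^sup>2) / 2) + 2 * b * of_real x + (- cnj (v\<^sup>2) - w\<^sup>2)"
      by (simp add: b_def E_def algebra_simps add_divide_distrib)
    also have "\<dots> = - of_real (cos \<theta> * x\<^sup>2) + 2 * b * of_real x + (- cnj (v\<^sup>2) - w\<^sup>2)" unfolding c by simp
    finally show ?thesis unfolding packet_def exp_cnj exp_add[symmetric] by (rule arg_cong[where f = exp])
  qed
  then have "(LINT x|lborel. cnj (packet \<theta> v x) * packet \<theta> w x) =
      of_real (sqrt (pi / cos \<theta>)) * exp (b\<^sup>2 / of_real (cos \<theta>)) * exp (- cnj (v\<^sup>2) - w\<^sup>2)"
    by (simp only: gaussian_integral(2)[OF C] integral_mult_left_zero)
  also have "\<dots> = of_real (sqrt (pi / cos \<theta>)) * exp (b\<^sup>2 / of_real (cos \<theta>) + (- cnj (v\<^sup>2) - w\<^sup>2))"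
    by (simp add: exp_add[symmetric] exp_diff[symmetric] mult.assoc)
  also have "b\<^sup>2 / of_real (cos \<theta>) + (- cnj (v\<^sup>2) - w\<^sup>2) =
      (cnj (\<i> * of_real (sin \<theta>) * v\<^sup>2) + \<i> * of_real (sin \<theta>) * w\<^sup>2 + 2 * (cnj v * w)) / of_real (cos \<theta>)"
  proof -
    have "b\<^sup>2 = cnj (E\<^sup>2) * cnj (v\<^sup>2) + E\<^sup>2 * w\<^sup>2 + 2 * (cnj E * E) * (cnj v * w)"
      by (simp add: b_def power2_eq_square algebra_simps)
    then show ?thesis unfolding EE E2 using C by (simp add: field_simps)
  qed
  finally show ?thesis .
qed

locale gaussian_beam =
  fixes \<theta> r :: real and w :: "real \<Rightarrow> complex"
  assumes cos_pos: "0 < cos \<theta>" and r_pos: "0 < r" and w_cont: "continuous_on UNIV w"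
begin

lemma packet_integrand_cont:
  assumes "continuous_on UNIV a"
  shows "continuous_on S (\<lambda>s. a s * packet \<theta> (w s) x)"
  unfolding packet_def
  by (intro continuous_intros continuous_on_subset[OF w_cont] continuous_on_subset[OF assms]) auto

lemma width_bound: obtains W where "\<And>s. s \<in> {-r..r} \<Longrightarrow> cmod (w s) \<le> W"
proof -
  have "bounded (w ` {-r..r})"
    by (intro compact_imp_bounded compact_continuous_image continuous_on_subset[OF w_cont]) auto
  then obtain W where "\<forall>s\<in>{-r..r}. cmod (w s) \<le> W" unfolding bounded_iff by auto
  then show ?thesis using that by blast
qed

lemma packet_uniform_bound:
  obtains K where "0 \<le> K" "\<And>s x. s \<in> {-r..r} \<Longrightarrow> cmod (packet \<theta> (w s) x) \<le> K * exp (- (cos \<theta> / 4) * x\<^sup>2)"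
proof -
  obtain W where W: "\<And>s. s \<in> {-r..r} \<Longrightarrow> cmod (w s) \<le> W" using width_bound by blast
  show ?thesis
    by (rule that[of "exp (4 * W\<^sup>2 / cos \<theta> + W\<^sup>2)"]) (simp, rule packet_bound[OF cos_pos W])
qed

lemma beam_vector_derivative:
  assumes a: "continuous_on UNIV a"
  shows "(beam \<theta> r w a has_vector_derivative
    (- (cis \<theta> * of_real x) * beam \<theta> r w a x + 2 * cis (\<theta> / 2) * beam \<theta> r w (\<lambda>s. a s * w s) x)) (at x)"
proof -
  define g where "g x s = (- (cis \<theta> * of_real x) + 2 * cis (\<theta> / 2) * w s) * (a s * packet \<theta> (w s) x)" for x s
  have d: "((\<lambda>x. a s * packet \<theta> (w s) x) has_vector_derivative g x s) (at x within UNIV)" for x s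
  proof -
    \<comment> \<open>Differentiate in a complex variable first, then restrict to the real
      line.\<close>
    have "((\<lambda>x. - (cis \<theta> * (x * x) / 2) + 2 * cis (\<theta> / 2) * w s * x - (w s)\<^sup>2) has_field_derivative
        - (cis \<theta> * of_real x) + 2 * cis (\<theta> / 2) * w s) (at (of_real x))"
      by (auto intro!: derivative_eq_intros simp: field_simps)
    then have "((\<lambda>x. exp (- (cis \<theta> * (x * x) / 2) + 2 * cis (\<theta> / 2) * w s * x - (w s)\<^sup>2)) has_field_derivative
        packet \<theta> (w s) x * (- (cis \<theta> * of_real x) + 2 * cis (\<theta> / 2) * w s)) (at (of_real x))"
      by (rule DERIV_cong[OF DERIV_fun_exp]) (simp add: packet_def power2_eq_square)
    from DERIV_cmult[OF this, of "a s"]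
    have "((\<lambda>x. a s * exp (- (cis \<theta> * (x * x) / 2) + 2 * cis (\<theta> / 2) * w s * x - (w s)\<^sup>2)) has_field_derivative g x s) (at (of_real x))"
      by (simp add: g_def algebra_simps)
    from has_vector_derivative_real_field[OF this, of UNIV] show ?thesis
      by (simp add: packet_def power2_eq_square)
  qed
  have gc: "continuous_on (UNIV \<times> cbox (-r) r) (\<lambda>(x, s). g x s)"
    unfolding g_def packet_def split_beta
    by (intro continuous_intros continuous_on_compose2[OF w_cont] continuous_on_compose2[OF a]) auto
  have "((\<lambda>x. integral (cbox (-r) r) (\<lambda>s. a s * packet \<theta> (w s) x)) has_vector_derivative integral (cbox (-r) r) (g x))
      (at x within UNIV)"
    by (rule leibniz_rule_vector_derivative[OF d _ gc]) (auto intro!: integrable_continuous_real packet_integrand_cont a)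
  moreover have "integral (cbox (-r) r) (g x) =
      - (cis \<theta> * of_real x) * beam \<theta> r w a x + 2 * cis (\<theta> / 2) * beam \<theta> r w (\<lambda>s. a s * w s) x"
  proof -
    have i: "(\<lambda>s. b s * packet \<theta> (w s) x) integrable_on {-r..r}" if "continuous_on UNIV b" for b
      by (intro integrable_continuous_real packet_integrand_cont that)
    have "g x = (\<lambda>s. (- (cis \<theta> * of_real x)) * (a s * packet \<theta> (w s) x) + (2 * cis (\<theta> / 2)) * ((a s * w s) * packet \<theta> (w s) x))"
      by (simp add: g_def algebra_simps fun_eq_iff)
    then show ?thesis unfolding beam_def cbox_interval
      using i[OF a] i[OF continuous_on_mult[OF a w_cont]]
      by (simp only: integral_add integrable_on_mult_right integral_mult_right)
  qed
  ultimately show ?thesis by (simp add: beam_def[abs_def])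
qed

lemma beam_continuous: "continuous_on UNIV a \<Longrightarrow> continuous_on UNIV (beam \<theta> r w a)"
  using has_vector_derivative_continuous[OF beam_vector_derivative] by (simp add: continuous_at_imp_continuous_on)

lemma beam_bound:
  assumes a: "continuous_on UNIV a"
  obtains K where "\<And>x. cmod (beam \<theta> r w a x) \<le> K * exp (- (cos \<theta> / 4) * x\<^sup>2)"
proof -
  obtain K where K: "0 \<le> K" "\<And>s x. s \<in> {-r..r} \<Longrightarrow> cmod (packet \<theta> (w s) x) \<le> K * exp (- (cos \<theta> / 4) * x\<^sup>2)"
    using packet_uniform_bound by blast
  have "bounded (a ` {-r..r})"
    by (intro compact_imp_bounded compact_continuous_image continuous_on_subset[OF a]) auto
  then obtain A where "\<forall>s\<in>{-r..r}. cmod (a s) \<le> A" unfolding bounded_iff by auto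
  then have A: "\<And>s. s \<in> {-r..r} \<Longrightarrow> cmod (a s) \<le> A" by blast
  have "cmod (beam \<theta> r w a x) \<le> (A * (K * exp (- (cos \<theta> / 4) * x\<^sup>2))) * (r - - r)" for x
    unfolding beam_def
  proof (rule integral_bound)
    show "cmod (a s * packet \<theta> (w s) x) \<le> A * (K * exp (- (cos \<theta> / 4) * x\<^sup>2))" if "s \<in> {-r..r}" for s
      unfolding norm_mult using A[OF that] by (intro mult_mono K(2) that) (auto intro: order_trans[OF norm_ge_zero])
  qed (use r_pos a packet_integrand_cont in auto)
  then show ?thesis by (intro that[of "A * K * (2 * r)"]) (simp add: mult_ac)
qed

lemma beam_L2:
  assumes a: "continuous_on UNIV a"
  shows "beam \<theta> r w a \<in> L2" "(\<lambda>x. of_real x * beam \<theta> r w a x) \<in> L2"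
proof -
  obtain K where K: "\<And>x. cmod (beam \<theta> r w a x) \<le> K * exp (- (cos \<theta> / 4) * x\<^sup>2)" using beam_bound[OF a] by blast
  show "beam \<theta> r w a \<in> L2" "(\<lambda>x. of_real x * beam \<theta> r w a x) \<in> L2"
    using gaussian_decay_L2[OF beam_continuous[OF a] _ K] cos_pos by auto
qed

lemma beam_weak_derivative:
  assumes a: "continuous_on UNIV a"
  shows "has_weak_L2_derivative (beam \<theta> r w a)
    (\<lambda>x. - (cis \<theta> * of_real x) * beam \<theta> r w a x + 2 * cis (\<theta> / 2) * beam \<theta> r w (\<lambda>s. a s * w s) x)"
proof (rule has_weak_L2_derivative_C1[OF beam_vector_derivative[OF a]])
  have aw: "continuous_on UNIV (\<lambda>s. a s * w s)" by (intro continuous_intros a w_cont)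
  show "continuous_on UNIV (\<lambda>x. - (cis \<theta> * of_real x) * beam \<theta> r w a x + 2 * cis (\<theta> / 2) * beam \<theta> r w (\<lambda>s. a s * w s) x)"
    by (intro continuous_intros beam_continuous a aw)
  show "beam \<theta> r w a \<in> L2" by (rule beam_L2[OF a])
  show "(\<lambda>x. - (cis \<theta> * of_real x) * beam \<theta> r w a x + 2 * cis (\<theta> / 2) * beam \<theta> r w (\<lambda>s. a s * w s) x) \<in> L2"
    using L2_add[OF L2_mult_const[OF beam_L2(2)[OF a], of "- cis \<theta>"] L2_mult_const[OF beam_L2(1)[OF aw], of "2 * cis (\<theta> / 2)"]]
    by (simp add: mult.assoc)
qed

text \<open>Fubini, with the uniform Gaussian majorant of the packets in the dominating product.
  Overlaps with a beam thereby reduce to the explicit overlaps of packets.\<close>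

lemma beam_pairing:
  assumes a: "continuous_on UNIV a"
  shows "(LINT x|lborel. cnj (packet \<theta> v x) * beam \<theta> r w a x) =
    integral {-r..r} (\<lambda>s. a s * (LINT x|lborel. cnj (packet \<theta> v x) * packet \<theta> (w s) x))"
proof -
  define k where "k s x = indicator {-r..r} s *\<^sub>R (a s * (cnj (packet \<theta> v x) * packet \<theta> (w s) x))" for s x
  note [measurable] = borel_measurable_continuous_onI[OF w_cont] borel_measurable_continuous_onI[OF a]
  have [measurable]: "(exp :: complex \<Rightarrow> complex) \<in> borel_measurable borel" "cnj \<in> borel_measurable borel"
    by (intro borel_measurable_continuous_onI continuous_intros)+
  obtain K where K: "0 \<le> K" "\<And>s x. s \<in> {-r..r} \<Longrightarrow> cmod (packet \<theta> (w s) x) \<le> K * exp (- (cos \<theta> / 4) * x\<^sup>2)"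
    using packet_uniform_bound by blast
  have ki: "integrable (lborel \<Otimes>\<^sub>M lborel) (\<lambda>(s, x). k s x)"
  proof (rule Bochner_Integration.integrable_bound)
    have "(\<lambda>x. complex_of_real (K * exp (- (cos \<theta> / 4) * x\<^sup>2))) \<in> L2"
      by (rule gaussian_decay_L2(1)[where c = "cos \<theta> / 4" and K = K]) (use cos_pos K(1) in \<open>auto intro!: continuous_intros simp: norm_mult\<close>)
    from L2_mult_integrable[OF packet_L2[OF cos_pos] this, of v]
    have 1: "integrable lborel (\<lambda>x. packet \<theta> v x * of_real (K * exp (- (cos \<theta> / 4) * x\<^sup>2)))" .
    have "integrable lborel (\<lambda>s. indicator {-r..r} s *\<^sub>R a s)"
      using borel_integrable_atLeastAtMost'[OF continuous_on_subset[OF a], of "-r" r] by (simp add: set_integrable_def)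
    from integrable_lborel_mult_pair[OF this 1]
    show "integrable (lborel \<Otimes>\<^sub>M lborel) (\<lambda>(s, x). (indicator {-r..r} s *\<^sub>R a s) * (packet \<theta> v x * of_real (K * exp (- (cos \<theta> / 4) * x\<^sup>2))))" .
    show "(\<lambda>(s, x). k s x) \<in> borel_measurable (lborel \<Otimes>\<^sub>M lborel)"
      unfolding k_def packet_def by measurable
    show "AE p in lborel \<Otimes>\<^sub>M lborel. cmod (case p of (s, x) \<Rightarrow> k s x) \<le>
        cmod (case p of (s, x) \<Rightarrow> (indicator {-r..r} s *\<^sub>R a s) * (packet \<theta> v x * of_real (K * exp (- (cos \<theta> / 4) * x\<^sup>2))))"
    proof (rule AE_I2, clarify)
      fix s x
      show "cmod (k s x) \<le> cmod ((indicator {-r..r} s *\<^sub>R a s) * (packet \<theta> v x * of_real (K * exp (- (cos \<theta> / 4) * x\<^sup>2))))"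
      proof (cases "s \<in> {-r..r}")
        case True
        have "cmod (a s) * (cmod (packet \<theta> v x) * cmod (packet \<theta> (w s) x)) \<le>
            cmod (a s) * (cmod (packet \<theta> v x) * (K * exp (- (cos \<theta> / 4) * x\<^sup>2)))"
          by (intro mult_left_mono K(2) True) auto
        then show ?thesis using True K(1) by (simp add: k_def norm_mult)
      qed (simp add: k_def)
    qed
  qed
  have pp: "integrable lborel (\<lambda>x. cnj (packet \<theta> v x) * packet \<theta> w' x)" for w'
    by (intro L2_mult_integrable L2_cnj packet_L2 cos_pos)
  have "(LINT x|lborel. cnj (packet \<theta> v x) * beam \<theta> r w a x) = (LINT x|lborel. LINT s|lborel. k s x)"
  proof (intro Bochner_Integration.integral_cong refl)
    fix x
    have "set_integrable lborel {-r..r} (\<lambda>s. cnj (packet \<theta> v x) * (a s * packet \<theta> (w s) x))"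
      by (intro borel_integrable_atLeastAtMost' continuous_intros packet_integrand_cont a)
    from set_borel_integral_eq_integral(2)[OF this]
    have "(LINT s|lborel. k s x) = integral {-r..r} (\<lambda>s. cnj (packet \<theta> v x) * (a s * packet \<theta> (w s) x))"
      by (simp add: set_lebesgue_integral_def k_def mult_ac)
    then show "cnj (packet \<theta> v x) * beam \<theta> r w a x = (LINT s|lborel. k s x)" by (simp add: beam_def)
  qed
  also have "\<dots> = (LINT s|lborel. LINT x|lborel. k s x)" using lborel_pair.Fubini_integral[OF ki] by simp
  also have "\<dots> = (LINT s:{-r..r}|lborel. a s * (LINT x|lborel. cnj (packet \<theta> v x) * packet \<theta> (w s) x))"
    using pp by (simp add: set_lebesgue_integral_def k_def)
  also have "\<dots> = integral {-r..r} (\<lambda>s. a s * (LINT x|lborel. cnj (packet \<theta> v x) * packet \<theta> (w s) x))"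
    unfolding packet_pairing[OF cos_pos]
    by (intro set_borel_integral_eq_integral borel_integrable_atLeastAtMost' continuous_intros
        continuous_on_subset[OF a] continuous_on_subset[OF w_cont]) (use cos_pos in auto)
  finally show ?thesis .
qed

end

context gaussian_beam
begin

text \<open>Take \<open>u = (g, k, g, k)\<close> with \<open>g\<close> equal to \<open>m + z\<close>
  times the beam and \<open>k\<close> equal to \<open>A\<close> applied to the beam. Then the even
  rows of \<open>(H - z) u\<close> vanish identically, and the odd rows carry
  \<open>A\<^sup>+ A - (z\<^sup>2 - m\<^sup>2)\<close> applied to the beam.\<close>

lemma beam_pseudomode:
  fixes z :: complex and m :: real
  assumes a: "continuous_on UNIV a" and \<epsilon>: "0 < \<epsilon>"
    and small: "L2_norm (\<lambda>x. 4 * cis (\<theta> / 2) * of_real x * beam \<theta> r w (\<lambda>s. a s * w s) x - 4 * beam \<theta> r w (\<lambda>s. a s * w s * w s) x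
      - (z\<^sup>2 - (of_real m)\<^sup>2) * beam \<theta> r w a x) < \<epsilon> * (cmod (of_real m + z) * L2_norm (beam \<theta> r w a))" (is "L2_norm ?f < _")
  shows "z \<in> pseudospectrum H_dom (H_op m \<theta>) \<epsilon>"
proof -
  define D where "D b x = - (cis \<theta> * of_real x) * beam \<theta> r w b x + 2 * cis (\<theta> / 2) * beam \<theta> r w (\<lambda>s. b s * w s) x" for b x
  have aw: "continuous_on UNIV (\<lambda>s. a s * w s)" by (intro continuous_intros a w_cont)
  define g where "g = (\<lambda>x. (of_real m + z) * beam \<theta> r w a x)"
  define k where "k = (\<lambda>x. - 2 * \<i> * beam \<theta> r w (\<lambda>s. a s * w s) x)"
  define g' where "g' = (\<lambda>x. (of_real m + z) * D a x)"
  define k' where "k' = (\<lambda>x. - 2 * \<i> * D (\<lambda>s. a s * w s) x)"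
  define u p :: "real \<Rightarrow> complex ^ 4" where "u x = vector [g x, k x, g x, k x]" and "p x = vector [g' x, k' x, g' x, k' x]" for x
  have un: "u x $ 1 = g x" "u x $ 2 = k x" "u x $ 3 = g x" "u x $ 4 = k x"
    and pn: "p x $ 1 = g' x" "p x $ 2 = k' x" "p x $ 3 = g' x" "p x $ 4 = k' x" for x
    by (simp_all add: u_def p_def vector_4)
  have wd: "has_weak_L2_derivative g g'" "has_weak_L2_derivative k k'"
    unfolding g_def g'_def k_def k'_def D_def
    by (rule has_weak_L2_derivative_linear[OF beam_weak_derivative[OF a] bounded_linear_mult_right],
        rule has_weak_L2_derivative_linear[OF beam_weak_derivative[OF aw] bounded_linear_mult_right])
  have wx: "(\<lambda>x. of_real x * g x) \<in> L2" "(\<lambda>x. of_real x * k x) \<in> L2"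
    using L2_mult_const[OF beam_L2(2)[OF a], of "of_real m + z"] L2_mult_const[OF beam_L2(2)[OF aw], of "- 2 * \<i>"]
    by (simp_all add: g_def k_def mult_ac)
  have dom: "in_dirac_domain u p"
    unfolding in_dirac_domain_def forall_4 un pn using wd wx by simp
  have Ec: "cnj (cis (\<theta> / 2)) * cis \<theta> = cis (\<theta> / 2)" "cnj (cis (\<theta> / 2)) * cis (\<theta> / 2) = 1"
    by (simp_all add: cis_cnj cis_mult)
  have low: "lower_op \<theta> g g' x = (of_real m + z) * k x" for x
  proof -
    have "lower_op \<theta> g g' x = (of_real m + z) *
        (\<i> * (cnj (cis (\<theta> / 2)) * cis \<theta>) * of_real x * beam \<theta> r w a x
         - 2 * \<i> * (cnj (cis (\<theta> / 2)) * cis (\<theta> / 2)) * beam \<theta> r w (\<lambda>s. a s * w s) x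
         - \<i> * cis (\<theta> / 2) * of_real x * beam \<theta> r w a x)"
      unfolding lower_op_def g_def g'_def D_def by (simp add: algebra_simps)
    then show ?thesis unfolding Ec by (simp add: k_def)
  qed
  have high: "raise_op \<theta> k k' x = 4 * cis (\<theta> / 2) * of_real x * beam \<theta> r w (\<lambda>s. a s * w s) x
      - 4 * beam \<theta> r w (\<lambda>s. a s * w s * w s) x" for x
  proof -
    have "raise_op \<theta> k k' x =
         2 * (cnj (cis (\<theta> / 2)) * cis \<theta>) * of_real x * beam \<theta> r w (\<lambda>s. a s * w s) x
         - 4 * (cnj (cis (\<theta> / 2)) * cis (\<theta> / 2)) * beam \<theta> r w (\<lambda>s. a s * w s * w s) x
         + 2 * cis (\<theta> / 2) * of_real x * beam \<theta> r w (\<lambda>s. a s * w s) x"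
      unfolding raise_op_def k_def k'_def D_def by (simp add: algebra_simps)
    then show ?thesis unfolding Ec by (simp add: algebra_simps)
  qed
  have d1: "dirac_sym m \<theta> u p z x $ 1 = ?f x" "dirac_sym m \<theta> u p z x $ 3 = ?f x" for x
    unfolding dirac_sym_nth un pn high by (simp_all add: g_def power2_eq_square algebra_simps)
  have d2: "dirac_sym m \<theta> u p z x $ 2 = 0" "dirac_sym m \<theta> u p z x $ 4 = 0" for x
    unfolding dirac_sym_nth un pn low by (simp_all add: algebra_simps)
  have z0: "L2_norm (\<lambda>x. 0 :: complex) = 0" by (simp add: L2_norm_def)
  have ng: "L2_norm g = cmod (of_real m + z) * L2_norm (beam \<theta> r w a)" by (simp add: g_def L2_norm_mult_const)
  have "(L2_norm (dirac_sym m \<theta> u p z))\<^sup>2 = 2 * (L2_norm ?f)\<^sup>2"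
    by (simp add: L2_norm_vec[OF dirac_sym_L2[OF dom]] sum_4 d1 d2 z0)
  also have "\<dots> < 2 * (\<epsilon> * L2_norm g)\<^sup>2"
    using small unfolding ng by (simp add: power_strict_mono)
  \<comment> \<open>The components \<open>k\<close> can only enlarge the norm of
    \<open>u\<close>.\<close>
  also have "\<dots> \<le> \<epsilon>\<^sup>2 * (2 * (L2_norm g)\<^sup>2 + 2 * (L2_norm k)\<^sup>2)" by (simp add: power_mult_distrib algebra_simps)
  also have "\<dots> = (\<epsilon> * L2_norm u)\<^sup>2"
    by (simp add: power_mult_distrib L2_norm_vec[OF in_dirac_domain_L2(1)[OF dom]] sum_4 un)
  finally have "L2_norm (dirac_sym m \<theta> u p z) < \<epsilon> * L2_norm u" by (rule power2_less_imp_less) (use \<epsilon> in simp)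
  then show ?thesis by (rule pseudomode_criterion[OF dom _ \<epsilon>])
qed

end

text \<open>The integrand of the superposition below is an exact \<open>s\<close>-derivative.\<close>

lemma beam_telescope:
  fixes L \<eta> w0 :: complex
  assumes "0 < r" and \<eta>: "\<eta> \<noteq> 0"
  defines "w \<equiv> \<lambda>s. w0 * exp (\<eta> * of_real s)" and "a \<equiv> \<lambda>s. exp (- (L / 2) * (\<eta> * of_real s))"
  shows "4 * cis (\<theta> / 2) * of_real x * beam \<theta> r w (\<lambda>s. a s * w s) x - 4 * beam \<theta> r w (\<lambda>s. a s * w s * w s) x - L * beam \<theta> r w a x
    = 2 / \<eta> * (a r * packet \<theta> (w r) x - a (- r) * packet \<theta> (w (- r)) x)"
proof -
  define E where "E = cis (\<theta> / 2)"
  \<comment> \<open>On packets \<open>A\<^sup>+ A\<close> acts as \<open>2 * w\<close> times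
    differentiation in \<open>w\<close>, which along \<open>w0 * exp (\<eta> * s)\<close> is
    \<open>2 / \<eta>\<close> times differentiation in \<open>s\<close>; the weight accounts for
    \<open>- L\<close>. The variable \<open>y\<close> is complex so that \<open>F\<close> can be
    differentiated holomorphically.\<close>
  define F where "F y = 2 / \<eta> * exp (- (L / 2) * (\<eta> * y) + (- (cis \<theta> * of_real (x\<^sup>2) / 2)
      + 2 * E * (w0 * exp (\<eta> * y)) * of_real x - (w0 * exp (\<eta> * y))\<^sup>2))" for y
  have Fs: "F (of_real s) = 2 / \<eta> * (a s * packet \<theta> (w s) x)" for s
    by (simp only: F_def a_def w_def packet_def E_def exp_add)
  define f where "f s = (4 * E * of_real x) * (a s * w s * packet \<theta> (w s) x) - 4 * (a s * w s * w s * packet \<theta> (w s) x)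
      - L * (a s * packet \<theta> (w s) x)" for s
  have "(F has_field_derivative f s) (at (of_real s))" for s
  proof -
    have "(F has_field_derivative 2 / \<eta> * (exp (- (L / 2) * (\<eta> * of_real s) + (- (cis \<theta> * of_real (x\<^sup>2) / 2)
          + 2 * E * (w0 * exp (\<eta> * of_real s)) * of_real x - (w0 * exp (\<eta> * of_real s))\<^sup>2)) *
        (- (L / 2) * \<eta> + (2 * E * (w0 * (exp (\<eta> * of_real s) * \<eta>)) * of_real x
          - 2 * (w0 * exp (\<eta> * of_real s)) * (w0 * (exp (\<eta> * of_real s) * \<eta>)))))) (at (of_real s))"
      unfolding F_def using \<eta> by (auto intro!: derivative_eq_intros)
    also have "2 / \<eta> * (exp (- (L / 2) * (\<eta> * of_real s) + (- (cis \<theta> * of_real (x\<^sup>2) / 2)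
          + 2 * E * (w0 * exp (\<eta> * of_real s)) * of_real x - (w0 * exp (\<eta> * of_real s))\<^sup>2)) *
        (- (L / 2) * \<eta> + (2 * E * (w0 * (exp (\<eta> * of_real s) * \<eta>)) * of_real x
          - 2 * (w0 * exp (\<eta> * of_real s)) * (w0 * (exp (\<eta> * of_real s) * \<eta>))))) =
        2 / \<eta> * ((a s * packet \<theta> (w s) x) * (- (L / 2) * \<eta> + (2 * E * (w s * \<eta>) * of_real x - 2 * w s * (w s * \<eta>))))"
      by (simp only: a_def w_def packet_def E_def exp_add mult.assoc)
    also have "\<dots> = f s" using \<eta> by (simp add: f_def field_simps)
    finally show ?thesis .
  qed
  from has_vector_derivative_real_field[OF this]
  have "((\<lambda>s. F (of_real s)) has_vector_derivative f s) (at s within {-r..r})" for s .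
  then have "(f has_integral F (of_real r) - F (of_real (- r))) {-r..r}"
    by (intro fundamental_theorem_of_calculus) (use \<open>0 < r\<close> in auto)
  then have I: "integral {-r..r} f = F (of_real r) - F (of_real (- r))" by (rule integral_unique)
  have i: "(\<lambda>s. b s * packet \<theta> (w s) x) integrable_on {-r..r}" if "continuous_on {-r..r} b" for b
    unfolding packet_def w_def by (intro integrable_continuous_real continuous_intros that) auto
  have c: "continuous_on {-r..r} a" "continuous_on {-r..r} (\<lambda>s. a s * w s)" "continuous_on {-r..r} (\<lambda>s. a s * w s * w s)"
    unfolding a_def w_def by (intro continuous_intros)+
  have "integral {-r..r} f = 4 * E * of_real x * beam \<theta> r w (\<lambda>s. a s * w s) x - 4 * beam \<theta> r w (\<lambda>s. a s * w s * w s) x - L * beam \<theta> r w a x"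
    using i[OF c(1)] i[OF c(2)] i[OF c(3)] unfolding f_def[abs_def] beam_def
    by (simp only: integral_diff integrable_diff integrable_on_mult_right integral_mult_right)
  then show ?thesis using I by (simp add: Fs[of r] Fs[of "- r", simplified] E_def right_diff_distrib)
qed

section \<open>Comparison of the end packets with the overlap\<close>

lemma L2_norm_power2_complex: "of_real ((L2_norm f)\<^sup>2) = (LINT x|lborel. cnj (f x) * (f x :: complex))"
  unfolding L2_norm_power2 integral_complex_of_real[symmetric] complex_norm_square by (simp add: mult.commute)

text \<open>The two conditions on \<open>w\<close> turn the exponent into \<open>n\<close> times an
  expression free of \<open>n\<close> and \<open>w\<close>, as Laplace's method requires.\<close>

lemma packet_pairing_scaled:
  assumes C: "0 < cos \<theta>" and w: "\<i> * of_real (sin \<theta>) * w\<^sup>2 = Z * of_real (n * cos \<theta>)" "(cmod w)\<^sup>2 = n * cos \<theta>"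
  shows "(LINT x|lborel. cnj (packet \<theta> (w * X) x) * packet \<theta> (w * Y) x) =
    of_real (sqrt (pi / cos \<theta>)) * exp (of_real n * (cnj (Z * X\<^sup>2) + Z * Y\<^sup>2 + 2 * (cnj X * Y)))"
proof -
  have 1: "\<i> * of_real (sin \<theta>) * (w * X)\<^sup>2 = Z * of_real (n * cos \<theta>) * X\<^sup>2" for X
    unfolding w(1)[symmetric] by (simp add: power_mult_distrib)
  have "cnj (w * X) * (w * Y) = (cnj w * w) * (cnj X * Y)" by simp
  also have "cnj w * w = of_real (n * cos \<theta>)" using w(2) complex_norm_square[of w] by (simp add: mult.commute)
  finally have 2: "cnj (w * X) * (w * Y) = of_real (n * cos \<theta>) * (cnj X * Y)" .
  have "(cnj (Z * of_real (n * cos \<theta>) * X\<^sup>2) + Z * of_real (n * cos \<theta>) * Y\<^sup>2 + 2 * (of_real (n * cos \<theta>) * (cnj X * Y))) / of_real (cos \<theta>)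
      = of_real n * (cnj (Z * X\<^sup>2) + Z * Y\<^sup>2 + 2 * (cnj X * Y))"
    using C by (simp add: field_simps)
  then show ?thesis unfolding packet_pairing[OF C] 1 2 by (simp only:)
qed

text \<open>Everything is measured against the norm \<open>N\<close> of the central packet. Testing
  the beam with that packet bounds its norm below by \<open>N\<close> times a Laplace integral,
  while the residual consists of two end packets of relative size
  \<open>exp (n * packet_growth Z y)\<close>; the factor \<open>4\<close> comes from
  \<open>2 / \<eta>\<close> and the two ends.\<close>

lemma beam_in_pseudospectrum:
  fixes z \<eta> Z w :: complex and m n h \<mu> r :: real
  assumes C: "0 < cos \<theta>" and \<epsilon>: "0 < \<epsilon>"
    and L: "z\<^sup>2 - (of_real m)\<^sup>2 = 4 * of_real n * (1 + Z)" and Z: "cmod Z \<le> 1"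
    and w: "\<i> * of_real (sin \<theta>) * w\<^sup>2 = Z * of_real (n * cos \<theta>)" "(cmod w)\<^sup>2 = n * cos \<theta>"
    and \<eta>: "cmod \<eta> = 1" "(2 * Z + 1) * \<eta>\<^sup>2 = - of_real h" and h: "1 + \<mu> \<le> h" "h \<le> 3"
    and \<mu>: "0 < \<mu>" "\<mu> \<le> 1" and r: "r = \<mu> / 48" and n: "729 \<le> n" "1 / sqrt n \<le> r"
    and small: "4 * exp (- (n * (\<mu> * r\<^sup>2 / 2))) <
      \<epsilon> * (cmod (of_real m + z) * (exp (- 4) / sqrt n - exp (- (n powr (1 / 3)) / 24)))"
  shows "z \<in> pseudospectrum H_dom (H_op m \<theta>) \<epsilon>"
proof -
  define v where "v = (\<lambda>s. w * exp (\<eta> * complex_of_real s))"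
  define a where "a = (\<lambda>s. exp (- ((z\<^sup>2 - (of_real m)\<^sup>2) / 2) * (\<eta> * complex_of_real s)))"
  define P where "P = sqrt (pi / cos \<theta>)"
  define N where "N = L2_norm (packet \<theta> w)"
  have r0: "0 < r" "r \<le> 1 / 48" using \<mu> r by auto
  have ca: "continuous_on UNIV a" and cv: "continuous_on UNIV v" unfolding a_def v_def by (intro continuous_intros)+
  interpret gaussian_beam \<theta> r v by unfold_locales (use C r0 cv in auto)
  have as: "a s = exp (of_real n * (- 2 * (1 + Z) * (\<eta> * of_real s)))" for s unfolding a_def L by (rule arg_cong[where f = exp]) (simp add: field_simps)
  have N2: "of_real (N\<^sup>2) = of_real P * exp (of_real n * (cnj Z + Z + 2))"
    using packet_pairing_scaled[OF C w, of 1 1] unfolding N_def L2_norm_power2_complex P_def by simp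
  have N0: "0 < N"
  proof -
    have "of_real (N\<^sup>2) \<noteq> (0 :: complex)" unfolding N2 using C by (simp add: P_def)
    then show ?thesis by (simp add: N_def less_le)
  qed
  have norm_s: "L2_norm (\<lambda>x. a s * packet \<theta> (v s) x) = N * exp (n * packet_growth Z (\<eta> * of_real s))" for s
  proof -
    define y where "y = \<eta> * complex_of_real s"
    define X where "X = exp y"
    have X2: "exp (2 * y) = X\<^sup>2" by (simp add: X_def exp_double)
    have "complex_of_real (2 * Re y) = cnj y + y" by (simp add: complex_eq_iff)
    then have Xr: "complex_of_real (exp (2 * Re y)) = cnj X * X"
      unfolding X_def exp_cnj exp_add[symmetric] by (simp only: exp_of_real[symmetric])
    have "of_real ((L2_norm (\<lambda>x. a s * packet \<theta> (v s) x))\<^sup>2) =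
        cnj (a s) * a s * (LINT x|lborel. cnj (packet \<theta> (v s) x) * packet \<theta> (v s) x)"
      unfolding L2_norm_power2_complex by (simp add: mult_ac flip: integral_mult_right_zero)
    also have "\<dots> = cnj (a s) * a s * (of_real P * exp (of_real n * (cnj (Z * X\<^sup>2) + Z * X\<^sup>2 + 2 * (cnj X * X))))"
      unfolding v_def y_def[symmetric] X_def[symmetric] packet_pairing_scaled[OF C w] P_def ..
    also have "\<dots> = of_real P * exp (of_real n * (cnj (- 2 * (1 + Z) * y) + (- 2 * (1 + Z) * y) + (cnj (Z * X\<^sup>2) + Z * X\<^sup>2 + 2 * (cnj X * X))))"
      unfolding as y_def[symmetric] by (simp add: exp_cnj exp_add[symmetric] algebra_simps)
    also have "cnj (- 2 * (1 + Z) * y) + (- 2 * (1 + Z) * y) + (cnj (Z * X\<^sup>2) + Z * X\<^sup>2 + 2 * (cnj X * X)) =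
        (cnj Z + Z + 2) + of_real (2 * packet_growth Z y)"
    proof -
      have re: "complex_of_real (2 * Re q) = q + cnj q" for q by (simp add: complex_eq_iff)
      have "complex_of_real (2 * packet_growth Z y) = of_real (2 * Re (Z * (X\<^sup>2 - 1 - 2 * y))) + 2 * (of_real (exp (2 * Re y)) - 1) - 2 * of_real (2 * Re y)"
        unfolding packet_growth_def X2 by (simp add: algebra_simps)
      then show ?thesis unfolding re Xr by (simp add: algebra_simps)
    qed
    also have "of_real P * exp (of_real n * ((cnj Z + Z + 2) + of_real (2 * packet_growth Z y))) =
        of_real (N\<^sup>2) * exp (of_real (2 * (n * packet_growth Z y)))"
      unfolding N2 by (simp add: exp_add distrib_left mult_ac)
    also have "\<dots> = of_real ((N * exp (n * packet_growth Z y))\<^sup>2)"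
      unfolding exp_of_real by (simp add: power_mult_distrib exp_double)
    finally have "(L2_norm (\<lambda>x. a s * packet \<theta> (v s) x))\<^sup>2 = (N * exp (n * packet_growth Z y))\<^sup>2" by (simp only: of_real_eq_iff)
    then show ?thesis unfolding y_def[symmetric] using N0 by (simp add: power2_eq_iff_nonneg)
  qed
  have y: "cmod (\<eta> * of_real s) = \<bar>s\<bar>" for s using \<eta>(1) by (simp add: norm_mult)
  have quad: "(2 * Z + 1) * (\<eta> * of_real s)\<^sup>2 = - of_real (h * s\<^sup>2)" for s
    using \<eta>(2) by (simp add: power_mult_distrib mult.assoc[symmetric])
  have end_le: "L2_norm (\<lambda>x. a s * packet \<theta> (v s) x) \<le> N * exp (- (n * (\<mu> * r\<^sup>2 / 2)))" if s: "\<bar>s\<bar> = r" for s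
  proof -
    have s2: "s\<^sup>2 = r\<^sup>2" using s by (metis power2_abs)
    have "packet_growth Z (\<eta> * of_real s) \<le> - h * r\<^sup>2 + r\<^sup>2 + 24 * r ^ 3"
      using packet_growth_expansion[OF Z, of "\<eta> * of_real s"] r0 s unfolding quad y by (simp add: s2)
    \<comment> \<open>The choice \<open>r = \<mu> / 48\<close> lets the cubic error use up exactly
      half of the guaranteed margin \<open>\<mu>\<close> of \<open>h\<close> over
      \<open>1\<close>.\<close>
    also have "24 * r ^ 3 = \<mu> * r\<^sup>2 / 2" by (simp add: r power2_eq_square power3_eq_cube)
    also have "- h * r\<^sup>2 + r\<^sup>2 + \<mu> * r\<^sup>2 / 2 \<le> - (\<mu> * r\<^sup>2 / 2)"
      using mult_right_mono[OF h(1), of "r\<^sup>2"] by (simp add: algebra_simps)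
    finally have "n * packet_growth Z (\<eta> * of_real s) \<le> - (n * (\<mu> * r\<^sup>2 / 2))" using n mult_left_mono[of _ "- (\<mu> * r\<^sup>2 / 2)" n] by simp
    then show ?thesis unfolding norm_s using N0 by simp
  qed
  define f where "f x = 4 * cis (\<theta> / 2) * of_real x * beam \<theta> r v (\<lambda>s. a s * v s) x - 4 * beam \<theta> r v (\<lambda>s. a s * v s * v s) x
      - (z\<^sup>2 - (of_real m)\<^sup>2) * beam \<theta> r v a x" for x
  have \<eta>0: "\<eta> \<noteq> 0" using \<eta>(1) by auto
  have f: "f x = 2 / \<eta> * (a r * packet \<theta> (v r) x + - (a (- r) * packet \<theta> (v (- r)) x))" for x
    unfolding f_def v_def a_def beam_telescope[OF r0(1) \<eta>0] by simp
  have L2s: "(\<lambda>x. a s * packet \<theta> (v s) x) \<in> L2" for s by (intro L2_mult_const packet_L2 C)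
  have "L2_norm f \<le> 2 * (L2_norm (\<lambda>x. a r * packet \<theta> (v r) x) + L2_norm (\<lambda>x. a (- r) * packet \<theta> (v (- r)) x))"
    using L2_norm_triangle[OF L2s[of r] L2_minus[OF L2s[of "- r"]]] \<eta>(1)
    unfolding f[abs_def] L2_norm_mult_const L2_norm_minus by (simp add: norm_divide)
  also have "\<dots> \<le> 2 * (N * exp (- (n * (\<mu> * r\<^sup>2 / 2))) + N * exp (- (n * (\<mu> * r\<^sup>2 / 2))))"
    using r0 by (intro mult_left_mono add_mono end_le) auto
  finally have f_le: "L2_norm f \<le> N * (4 * exp (- (n * (\<mu> * r\<^sup>2 / 2))))" by simp
  define G where "G s = packet_phase Z (\<eta> * complex_of_real s)" for s
  define den where "den = exp (- 4) / sqrt n - exp (- (n powr (1 / 3)) / 24)"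
  have "den \<le> cmod (integral {-r..r} (\<lambda>s. exp (of_real n * G s)))"
    unfolding den_def
  proof (rule laplace_lower_bound[where h = h])
    show "continuous_on {-r..r} G" unfolding G_def packet_phase_def by (intro continuous_intros)
    show "cmod (G s + of_real (h * s\<^sup>2)) \<le> 15 * \<bar>s\<bar> ^ 3" if "\<bar>s\<bar> \<le> r" for s
      using packet_phase_expansion[OF Z, of "\<eta> * of_real s"] that r0 unfolding quad y G_def by simp
  qed (use h \<mu> n r0 in auto)
  moreover have "(LINT x|lborel. cnj (packet \<theta> w x) * beam \<theta> r v a x) = of_real (N\<^sup>2) * integral {-r..r} (\<lambda>s. exp (of_real n * G s))"
  proof -
    \<comment> \<open>The exponent splits into that of \<open>N\<^sup>2\<close> and
      \<open>packet_phase\<close>, whose linear terms come from the weight \<open>a\<close>.\<close>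
    have "a s * (LINT x|lborel. cnj (packet \<theta> w x) * packet \<theta> (v s) x) = of_real (N\<^sup>2) * exp (of_real n * G s)" for s
    proof -
      define y where "y = \<eta> * complex_of_real s"
      have "a s * (LINT x|lborel. cnj (packet \<theta> w x) * packet \<theta> (v s) x) =
          of_real P * exp (of_real n * (- 2 * (1 + Z) * y) + of_real n * (cnj Z + Z * (exp y)\<^sup>2 + 2 * exp y))"
        using packet_pairing_scaled[OF C w, of 1 "exp y"] unfolding as v_def y_def[symmetric] P_def by (simp add: exp_add)
      also have "of_real n * (- 2 * (1 + Z) * y) + of_real n * (cnj Z + Z * (exp y)\<^sup>2 + 2 * exp y) =
          of_real n * (cnj Z + Z + 2) + of_real n * G s"
        unfolding G_def packet_phase_def y_def[symmetric] exp_double by (simp add: algebra_simps)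
      finally show ?thesis unfolding N2 by (simp add: exp_add)
    qed
    then show ?thesis unfolding beam_pairing[OF ca] by simp
  qed
  moreover have "cmod (LINT x|lborel. cnj (packet \<theta> w x) * beam \<theta> r v a x) \<le> N * L2_norm (beam \<theta> r v a)"
    unfolding N_def by (rule L2_complex_Cauchy_Schwarz[OF packet_L2[OF C] beam_L2(1)[OF ca]])
  ultimately have "N\<^sup>2 * den \<le> N * L2_norm (beam \<theta> r v a)"
    using mult_left_mono[of den "cmod (integral {-r..r} (\<lambda>s. exp (of_real n * G s)))" "N\<^sup>2"] by (simp add: norm_mult norm_power)
  then have "N * den \<le> L2_norm (beam \<theta> r v a)" using N0 by (simp add: power2_eq_square)
  then have "cmod (of_real m + z) * (N * den) \<le> cmod (of_real m + z) * L2_norm (beam \<theta> r v a)" by (intro mult_left_mono) auto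
  then have "\<epsilon> * (cmod (of_real m + z) * (N * den)) \<le> \<epsilon> * (cmod (of_real m + z) * L2_norm (beam \<theta> r v a))" by (rule mult_left_mono) (use \<epsilon> in simp)
  moreover have "N * (4 * exp (- (n * (\<mu> * r\<^sup>2 / 2)))) < N * (\<epsilon> * (cmod (of_real m + z) * den))"
    using small N0 unfolding den_def by (intro mult_strict_left_mono)
  ultimately have "L2_norm f < \<epsilon> * (cmod (of_real m + z) * L2_norm (beam \<theta> r v a))"
    using f_le by (simp add: mult_ac)
  then show ?thesis unfolding f_def[abs_def] by (rule beam_pseudomode[OF ca \<epsilon>])
qed

theorem pseudospectrum_inner_bound:
  fixes m \<theta> \<delta> :: real
  assumes m: "0 \<le> m" and \<theta>: "\<theta> < pi / 2" and \<delta>: "0 < \<delta>"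
  shows "\<exists>C1>0. \<exists>C2>0. \<forall>\<epsilon>>0. \<forall>z. cmod (z\<^sup>2 - (of_real m)\<^sup>2) \<ge> C1 \<longrightarrow> \<bar>Arg (z\<^sup>2 - (of_real m)\<^sup>2)\<bar> \<le> \<theta> - \<delta> \<longrightarrow>
    cmod (z\<^sup>2 - (of_real m)\<^sup>2) > C2 * ln (1 / \<epsilon>\<^sup>2) \<longrightarrow> z \<in> pseudospectrum H_dom (H_op m \<theta>) \<epsilon>"
proof (cases "\<theta> < \<delta>")
  \<comment> \<open>A negative bound on the modulus of the argument is never met, so any constants
    do. This also settles \<open>\<theta> \<le> 0\<close>.\<close>
  case True
  then show ?thesis by (intro exI[of _ "1::real"] conjI allI impI) auto
next
  case False
  define \<alpha> where "\<alpha> = \<theta> - \<delta>"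
  have \<alpha>: "0 \<le> \<alpha>" "\<alpha> < \<theta>" using False \<delta> by (auto simp: \<alpha>_def)
  have \<theta>0: "0 < \<theta>" using \<alpha> by simp
  have C: "0 < cos \<theta>" using \<theta> \<theta>0 by (simp add: cos_gt_zero_pi)
  define \<mu> where "\<mu> = (cos \<alpha>)\<^sup>2 - (cos \<theta>)\<^sup>2"
  have \<mu>: "0 < \<mu>" "\<mu> \<le> 1"
  proof -
    have "cos \<theta> < cos \<alpha>" using \<alpha> \<theta> by (intro cos_monotone_0_pi) auto
    then have "(cos \<theta>)\<^sup>2 < (cos \<alpha>)\<^sup>2" using C by (intro power_strict_mono) auto
    then show "0 < \<mu>" by (simp add: \<mu>_def)
    show "\<mu> \<le> 1" using zero_le_power2[of "cos \<theta>"] cos_squared_eq[of \<alpha>] zero_le_power2[of "sin \<alpha>"] by (simp add: \<mu>_def)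
  qed
  define r where "r = \<mu> / 48"
  define \<kappa> where "\<kappa> = \<mu> * r\<^sup>2 / 2"
  have r: "0 < r" and \<kappa>: "0 < \<kappa>" using \<mu> by (auto simp: r_def \<kappa>_def)
  \<comment> \<open>Half of the exponential rate pays for the constant and for the algebraic loss
    \<open>1 / sqrt n\<close> of the Laplace bound; the other half is compared with
    \<open>\<epsilon>\<close>.\<close>
  have "eventually (\<lambda>n. 4 * exp (- (n * \<kappa>)) < exp (- (n * \<kappa> / 2)) * (exp (- 4) / sqrt n - exp (- (n powr (1 / 3)) / 24))) at_top"
    using \<kappa> by real_asymp
  moreover have "eventually (\<lambda>n. 1 / sqrt n \<le> r) at_top" using r by real_asymp
  ultimately obtain n0 where n0: "\<And>n. n0 \<le> n \<Longrightarrow> 4 * exp (- (n * \<kappa>)) < exp (- (n * \<kappa> / 2)) * (exp (- 4) / sqrt n - exp (- (n powr (1 / 3)) / 24))"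
      "\<And>n. n0 \<le> n \<Longrightarrow> 1 / sqrt n \<le> r"
    by (metis (no_types, lifting) eventually_at_top_linorder eventually_conj)
  \<comment> \<open>As \<open>n\<close> is at least an eighth of the modulus, the first entry forces
    \<open>n \<ge> n0\<close> and \<open>n \<ge> 729\<close>; the second keeps \<open>m + z\<close>
    away from zero.\<close>
  define C1 where "C1 = max (8 * max n0 729) (1 + 2 * m)"
  have C1: "0 < C1" by (simp add: C1_def)
  show ?thesis
  \<comment> \<open>With \<open>ln (1 / \<epsilon>\<^sup>2) = - 2 * ln \<epsilon>\<close> and
    \<open>n\<close> at least an eighth of the modulus, the constant \<open>8 / \<kappa>\<close> is
    what makes the logarithmic hypothesis imply
    \<open>n * \<kappa> / 2 > - ln \<epsilon>\<close>.\<close>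
  proof (rule exI[of _ C1], rule conjI[OF C1], rule exI[of _ "8 / \<kappa>"], intro conjI allI impI)
    show "0 < 8 / \<kappa>" using \<kappa> by simp
    fix \<epsilon> z assume \<epsilon>: "(0::real) < \<epsilon>" and big: "C1 \<le> cmod (z\<^sup>2 - (of_real m)\<^sup>2)"
      and Arg: "\<bar>Arg (z\<^sup>2 - (of_real m)\<^sup>2)\<bar> \<le> \<theta> - \<delta>" and log: "8 / \<kappa> * ln (1 / \<epsilon>\<^sup>2) < cmod (z\<^sup>2 - (of_real m)\<^sup>2)"
    have nz: "z\<^sup>2 - (of_real m)\<^sup>2 \<noteq> 0" using big C1 by auto
    obtain n Z w \<eta> h where p: "cmod (z\<^sup>2 - (of_real m)\<^sup>2) / 8 \<le> n" "0 < n" "z\<^sup>2 - (of_real m)\<^sup>2 = 4 * of_real n * (1 + Z)" "cmod Z \<le> 1"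
        "\<i> * of_real (sin \<theta>) * w\<^sup>2 = Z * of_real (n * cos \<theta>)" "(cmod w)\<^sup>2 = n * cos \<theta>"
        "cmod \<eta> = 1" "(2 * Z + 1) * \<eta>\<^sup>2 = - of_real h" "1 + \<mu> \<le> h" "h \<le> 3"
      using beam_parameters[OF \<theta>0 \<theta> \<alpha> nz Arg[folded \<alpha>_def]] unfolding \<mu>_def[symmetric] by metis
    have n: "n0 \<le> n" "729 \<le> n" using p(1) big by (auto simp: C1_def)
    \<comment> \<open>If \<open>m + z\<close> had modulus below \<open>1\<close>, the factorisation
      \<open>(z - m) * (m + z)\<close> would keep the modulus below
      \<open>1 + 2 * m\<close>.\<close>
    have mz: "1 \<le> cmod (of_real m + z)"
    proof (rule ccontr)
      assume *: "\<not> 1 \<le> cmod (of_real m + z)"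
      have "z\<^sup>2 - (of_real m)\<^sup>2 = (z - of_real m) * (of_real m + z)" by (simp add: power2_eq_square algebra_simps)
      then have "cmod (z\<^sup>2 - (of_real m)\<^sup>2) = cmod (z - of_real m) * cmod (of_real m + z)" by (simp add: norm_mult)
      also have "\<dots> \<le> cmod (z - of_real m) * 1" using * by (intro mult_left_mono) auto
      also have "cmod (z - of_real m) \<le> cmod (of_real m + z) + 2 * m"
        using norm_triangle_ineq4[of "of_real m + z" "of_real (2 * m)"] m by (simp add: algebra_simps)
      finally show False using big * by (simp add: C1_def)
    qed
    have "exp (- (n * \<kappa> / 2)) < \<epsilon>"
    proof -
      have "ln (1 / \<epsilon>\<^sup>2) = - 2 * ln \<epsilon>" using \<epsilon> by (simp add: ln_div ln_realpow)
      then have "- 16 * ln \<epsilon> < \<kappa> * cmod (z\<^sup>2 - (of_real m)\<^sup>2)" using log \<kappa> by (simp add: field_simps)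
      also have "\<dots> \<le> \<kappa> * (8 * n)" using p(1) \<kappa> by (intro mult_left_mono) auto
      finally have "- (n * \<kappa> / 2) < ln \<epsilon>" by (simp add: algebra_simps)
      then show ?thesis using \<epsilon> by (metis exp_less_mono exp_ln)
    qed
    define den where "den = exp (- 4) / sqrt n - exp (- (n powr (1 / 3)) / 24)"
    have b: "4 * exp (- (n * \<kappa>)) < exp (- (n * \<kappa> / 2)) * den" unfolding den_def by (rule n0(1)[OF n(1)])
    moreover have "0 < exp (- (n * \<kappa> / 2)) * den" using b by (rule le_less_trans[rotated]) simp
    then have "0 < den" by (simp add: zero_less_mult_iff)
    moreover have "exp (- (n * \<kappa> / 2)) * den \<le> \<epsilon> * (cmod (of_real m + z) * den)"
    proof (rule mult_mono)
      show "den \<le> cmod (of_real m + z) * den" using mult_right_mono[OF mz, of den] \<open>0 < den\<close> by simp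
    qed (use \<open>exp (- (n * \<kappa> / 2)) < \<epsilon>\<close> \<epsilon> \<open>0 < den\<close> in auto)
    ultimately have "4 * exp (- (n * (\<mu> * r\<^sup>2 / 2))) < \<epsilon> * (cmod (of_real m + z) * den)" unfolding \<kappa>_def by linarith
    then show "z \<in> pseudospectrum H_dom (H_op m \<theta>) \<epsilon>"
      unfolding den_def
      by (intro beam_in_pseudospectrum[OF C \<epsilon> p(3-10) \<mu> r_def n(2) n0(2)[OF n(1)]])
  qed
qed

theorem theorem1p2:
  fixes m \<theta> \<delta> :: real
  assumes "0 \<le> m" and "- (pi / 2) < \<theta>" and "\<theta> < pi / 2" and "0 < \<delta>"
  shows "\<exists>C1>0. \<exists>C2>0. \<forall>\<epsilon>>0.
     {z :: complex. cmod (z\<^sup>2 - (of_real m)\<^sup>2) \<ge> C1 \<and>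
                    \<bar>Arg (z\<^sup>2 - (of_real m)\<^sup>2)\<bar> \<le> \<theta> - \<delta> \<and>
                    cmod (z\<^sup>2 - (of_real m)\<^sup>2) > C2 * ln (1 / \<epsilon>\<^sup>2)}
       \<subseteq> pseudospectrum H_dom (H_op m \<theta>) \<epsilon> \<and>
     pseudospectrum H_dom (H_op m \<theta>) \<epsilon>
       \<subseteq> {z. (1 - \<bar>tan (\<theta> / 2)\<bar>) * \<bar>Im z\<bar> \<le> (\<bar>Re z\<bar> + m) * \<bar>tan (\<theta> / 2)\<bar> + \<epsilon>}"
proof -
  obtain C1 C2 where C: "0 < C1" "0 < C2" "\<And>\<epsilon> z. 0 < \<epsilon> \<Longrightarrow> cmod (z\<^sup>2 - (of_real m)\<^sup>2) \<ge> C1 \<Longrightarrow>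
      \<bar>Arg (z\<^sup>2 - (of_real m)\<^sup>2)\<bar> \<le> \<theta> - \<delta> \<Longrightarrow> cmod (z\<^sup>2 - (of_real m)\<^sup>2) > C2 * ln (1 / \<epsilon>\<^sup>2) \<Longrightarrow>
      z \<in> pseudospectrum H_dom (H_op m \<theta>) \<epsilon>"
    using pseudospectrum_inner_bound[OF assms(1,3,4)] by metis
  show ?thesis
    by (rule exI[of _ C1], rule conjI[OF C(1)], rule exI[of _ C2], rule conjI[OF C(2)])
      (use C(3) pseudospectrum_outer_bound[OF assms(1-3)] in blast)
qed

end
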